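(* Let $P=D_1\times\cdots\times D_n$ and $Q=G_1\times\cdots\times G_n$ be two bounded product domains in $\mathbb{C}^n$ such that $Q\subset\subset P\subset\subset\mathbb{C}^n$. Let $1\le q\le n$, $1\le p\le\infty$ and $s=(s_1,\dots,s_n)\in\mathbb{R}^n$. Consider one of the following two cases: (1) $c=k(p,s)=(k(p,s_1),\dots,k(p,s_n))$ is the $\overline{\partial}$-weight of $(p,s)$ and $s^+:=(s_1,\dots,s_{n-1},s_n+1-\epsilon)$ for an arbitrary $\epsilon>0$; (2) $c=\widetilde{k}(p,s)=(\widetilde{k}(p,s_1),\dots,\widetilde{k}(p,s_n))$ is the modified $\overline{\partial}$-weight of $(p,s)$ and $s^+:=s$. Then there exists a linear mapping $\mathbf{J}=\mathbf{J}^{Q,P}_{p,s^+,q}$ which defines a bounded linear operator $$\mathbf{J}:\ |z|^sL^p_{0,q}(P)\cap\ker\overline{\partial}_c\rightarrow|z|^{s^+}L^p_{0,q-1}(P)$$ such that, for every $\omega\in|z|^sL^p_{0,q}(P)\cap\ker\overline{\partial}_c$, $$\overline{\partial}_c\,\mathbf{J}\omega=\overline{\partial}_{\widetilde{k}}\,\mathbf{J}\omega=\omega$$ in the sense of distributions on $Q$, where $\widetilde{k}=\widetilde{k}(p,s)$.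
   Context: All $\overline{\partial}$ are in the sense of distributions. Multi-index notation: $|z|^{s}=|z_1|^{s_1}\cdots|z_n|^{s_n}$, $z^c=z_1^{c_1}\cdots z_n^{c_n}$. A product domain is a product $D_1\times\cdots\times D_n$ of domains $D_j\subset\mathbb{C}$. For open $D\subset\mathbb{C}^n$, $|z|^sL^p_{0,q}(D)$ is the Banach space of measurable $(0,q)$-forms $f$ on $D$ with $|z|^{-s}f\in L^p_{0,q}(D)$, with norm $\||z|^{-s}f\|_{L^p_{0,q}(D)}$; $|z|^sL^p_{loc}$ is defined analogously. For $c\in\mathbb{Z}^n$ and a measurable $(0,q)$-form $f$ on $D$ with $z^{-c}f\in L^1_{(0,q),loc}(D)$ and $\overline{\partial}(z^{-c}f)\in L^1_{(0,q+1),loc}(D)$, set $\overline{\partial}_cf:=z^c\,\overline{\partial}(z^{-c}f)$. For $\sigma\in\mathbb{R}$ and $1\le p\le\infty$: the $\overline{\partial}$-weight is $k(p,\sigma):=\max\{m\in\mathbb{Z}:|z|^{\sigma}L^p_{loc}(\mathbb{C})\subset|z|^mL^1_{loc}(\mathbb{C})\}$, and the modified $\overline{\partial}$-weight is $\widetilde{k}(p,\sigma):=\min\{m\in\mathbb{Z}:\mathcal{I}^m\mathcal{O}_{\mathbb{C}}\subset|z|^{\sigma}L^p_{loc}(\mathbb{C})\}$, where $\mathcal{I}^m\mathcal{O}_{\mathbb{C}}$ consists of the meromorphic functions $f$ (on open subsets of $\mathbb{C}$) with $z^{-m}f$ holomorphic. Explicitly, $\widetilde{k}(p,\sigma)=\min\{m\in\mathbb{Z}:(\sigma-m)p<2\}$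 if $p<\infty$ and $\widetilde{k}(\infty,\sigma)=\min\{m\in\mathbb{Z}:\sigma-m\le0\}$. *)

theory Defs
  imports
    "HOL-Analysis.Analysis"
    "HOL-Probability.Essential_Supremum"
    "HOL-Complex_Analysis.Meromorphic"
begin

section \<open>Lebesgue spaces\<close>

definition Lp_norm :: "ennreal \<Rightarrow> 'a measure \<Rightarrow> ('a \<Rightarrow> 'b::real_normed_vector) \<Rightarrow> ennreal" where
  "Lp_norm p M f =
     (if p = \<infinity> then esssup M (\<lambda>x. ennreal (norm (f x)))
      else let I = (\<integral>\<^sup>+x. ennreal (norm (f x) powr enn2real p) \<partial>M)
           in if I = \<infinity> then \<infinity> else ennreal (enn2real I powr (1 / enn2real p)))"

definition Lp_loc :: "ennreal \<Rightarrow> 'a::euclidean_space set \<Rightarrow> ('a \<Rightarrow> complex) set" where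
  "Lp_loc p D = {f. f \<in> borel_measurable (lebesgue_on D) \<and>
     (\<forall>K. compact K \<and> K \<subseteq> D \<longrightarrow> Lp_norm p (lebesgue_on K) f < \<infinity>)}"

section \<open>The weights in one variable\<close>

text \<open>The space \<open>|z|\<^sup>\<sigma> L\<^sup>p\<^sub>l\<^sub>o\<^sub>c(U)\<close> for \<open>U\<close> in the complex plane. Note that \<open>0 powr a = 0\<close>; this
  concerns only a null set.\<close>

definition wLp_loc :: "ennreal \<Rightarrow> real \<Rightarrow> complex set \<Rightarrow> (complex \<Rightarrow> complex) set" where
  "wLp_loc p \<sigma> U = {f. f \<in> borel_measurable (lebesgue_on U) \<and>
     (\<lambda>z. of_real (cmod z powr (-\<sigma>)) * f z) \<in> Lp_loc p U}"

text \<open>Sections over \<open>U\<close> of the sheaf of meromorphic functions \<open>f\<close> with \<open>z\<^sup>-\<^sup>m f\<close> holomorphic,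
  i.e. extending holomorphically across the origin if \<open>0 \<in> U\<close>.\<close>

definition ideal_sections :: "int \<Rightarrow> complex set \<Rightarrow> (complex \<Rightarrow> complex) set" where
  "ideal_sections m U = {f. f meromorphic_on U \<and>
     (\<exists>h. h holomorphic_on U \<and> (\<forall>z\<in>U - {0}. z powi (-m) * f z = h z))}"

definition dbar_weight :: "ennreal \<Rightarrow> real \<Rightarrow> int" where
  "dbar_weight p \<sigma> = (GREATEST m::int. wLp_loc p \<sigma> UNIV \<subseteq> wLp_loc 1 (real_of_int m) UNIV)"

definition mod_dbar_weight :: "ennreal \<Rightarrow> real \<Rightarrow> int" where
  "mod_dbar_weight p \<sigma> = (LEAST m::int. \<forall>U. open U \<longrightarrow> ideal_sections m U \<subseteq> wLp_loc p \<sigma> U)"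

section \<open>Forms of type \<open>(0,q)\<close>\<close>

text \<open>Coordinates of \<open>complex^'n\<close> are indexed by a finite linearly ordered type \<open>'n\<close>. A form
  \<open>f\<close> of type \<open>(0,q)\<close> is the family of its coefficients \<open>f I\<close>, \<open>card I = q\<close>, with respect
  to the basis of wedge products of the \<open>d\<close>z-bar\<open>\<^sub>i\<close>, \<open>i \<in> I\<close>, taken in increasing order.
  The values of \<open>f I\<close> for \<open>card I \<noteq> q\<close>, and outside the domain considered, are irrelevant.\<close>

type_synonym 'n form = "'n set \<Rightarrow> complex^'n \<Rightarrow> complex"

definition fmult :: "(complex^'n \<Rightarrow> complex) \<Rightarrow> 'n form \<Rightarrow> 'n form" where
  "fmult g f = (\<lambda>I z. g z * f I z)"

definition lincomb :: "complex \<Rightarrow> 'n form \<Rightarrow> complex \<Rightarrow> 'n form \<Rightarrow> 'n form" where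
  "lincomb a f b g = (\<lambda>I z. a * f I z + b * g I z)"

definition measurable_form :: "nat \<Rightarrow> (complex^'n::finite) set \<Rightarrow> 'n form \<Rightarrow> bool" where
  "measurable_form q D f \<longleftrightarrow> (\<forall>I. card I = q \<longrightarrow> f I \<in> borel_measurable (lebesgue_on D))"

definition form_ae_eq :: "nat \<Rightarrow> (complex^'n::finite) set \<Rightarrow> 'n form \<Rightarrow> 'n form \<Rightarrow> bool" where
  "form_ae_eq q D f g \<longleftrightarrow> (\<forall>I. card I = q \<longrightarrow> (AE z in lebesgue_on D. f I z = g I z))"

definition abs_pow :: "real^'n \<Rightarrow> complex^'n::finite \<Rightarrow> complex" where
  "abs_pow s z = of_real (\<Prod>j\<in>UNIV. cmod (z $ j) powr (s $ j))"

definition mono_pow :: "int^'n \<Rightarrow> complex^'n::finite \<Rightarrow> complex" where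
  "mono_pow c z = (\<Prod>j\<in>UNIV. (z $ j) powi (c $ j))"

text \<open>The norm and the space \<open>|z|\<^sup>s L\<^sup>p\<^sub>0\<^sub>,\<^sub>q(D)\<close>; the pointwise norm of a form is the Euclidean
  norm of its coefficient vector.\<close>

definition wform_norm ::
    "nat \<Rightarrow> ennreal \<Rightarrow> real^'n \<Rightarrow> (complex^'n::finite) set \<Rightarrow> 'n form \<Rightarrow> ennreal" where
  "wform_norm q p s D f =
     Lp_norm p (lebesgue_on D)
       (\<lambda>z. L2_set (\<lambda>I. cmod (fmult (abs_pow (-s)) f I z)) {I. card I = q})"

definition wform_Lp ::
    "nat \<Rightarrow> ennreal \<Rightarrow> real^'n \<Rightarrow> (complex^'n::finite) set \<Rightarrow> 'n form set" where
  "wform_Lp q p s D = {f. measurable_form q D f \<and>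
     measurable_form q D (fmult (abs_pow (-s)) f) \<and> wform_norm q p s D f < \<infinity>}"

definition form_L1_loc :: "nat \<Rightarrow> (complex^'n::finite) set \<Rightarrow> 'n form set" where
  "form_L1_loc q D = {f. \<forall>I. card I = q \<longrightarrow> f I \<in> Lp_loc 1 D}"

section \<open>The Cauchy-Riemann operator in the sense of distributions\<close>

fun Ck :: "nat \<Rightarrow> ('a::euclidean_space \<Rightarrow> complex) \<Rightarrow> bool" where
  "Ck 0 f \<longleftrightarrow> continuous_on UNIV f"
| "Ck (Suc k) f \<longleftrightarrow> (\<forall>x. f differentiable (at x)) \<and>
     (\<forall>v\<in>Basis. Ck k (\<lambda>x. frechet_derivative f (at x) v))"

definition test_function :: "'a::euclidean_space set \<Rightarrow> ('a \<Rightarrow> complex) \<Rightarrow> bool" where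
  "test_function D \<phi> \<longleftrightarrow> (\<forall>k. Ck k \<phi>) \<and>
     compact (closure {x. \<phi> x \<noteq> 0}) \<and> closure {x. \<phi> x \<noteq> 0} \<subseteq> D"

text \<open>The Wirtinger derivative with respect to the conjugate of \<open>z\<^sub>j\<close>.\<close>

definition wirtinger_bar :: "'n \<Rightarrow> (complex^'n::finite \<Rightarrow> complex) \<Rightarrow> complex^'n \<Rightarrow> complex" where
  "wirtinger_bar j \<phi> z =
     (frechet_derivative \<phi> (at z) (axis j 1) + \<i> * frechet_derivative \<phi> (at z) (axis j \<i>)) / 2"

text \<open>\<open>has_dbar D q f g\<close>: on the open set \<open>D\<close>, the distributional d-bar of the locally integrable
  \<open>(0,q)\<close>-form \<open>f\<close> is the locally integrable \<open>(0,q+1)\<close>-form \<open>g\<close>. The sign comes from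
  sorting \<open>d\<close>z-bar\<open>\<^sub>j\<close> into its place in the wedge product over \<open>J\<close>.\<close>

definition has_dbar ::
    "(complex^'n::{finite,linorder}) set \<Rightarrow> nat \<Rightarrow> 'n form \<Rightarrow> 'n form \<Rightarrow> bool" where
  "has_dbar D q f g \<longleftrightarrow> f \<in> form_L1_loc q D \<and> g \<in> form_L1_loc (Suc q) D \<and>
     (\<forall>J \<phi>. card J = Suc q \<and> test_function D \<phi> \<longrightarrow>
        (\<integral>z. g J z * \<phi> z \<partial>lebesgue_on D) =
        - (\<Sum>j\<in>J. (-1) ^ card {i\<in>J. i < j} *
             (\<integral>z. f (J - {j}) z * wirtinger_bar j \<phi> z \<partial>lebesgue_on D)))"

text \<open>\<open>has_dbar_c D c q f h\<close>: the form \<open>z\<^sup>c\<close> d-bar\<open>(z\<^sup>-\<^sup>c f)\<close> is defined on \<open>D\<close> and equals \<open>h\<close>.\<close>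

definition has_dbar_c ::
    "(complex^'n::{finite,linorder}) set \<Rightarrow> int^'n::{finite,linorder} \<Rightarrow> nat \<Rightarrow> 'n form \<Rightarrow> 'n form \<Rightarrow> bool" where
  "has_dbar_c D c q f h \<longleftrightarrow> measurable_form q D f \<and>
     (\<exists>g. has_dbar D q (fmult (mono_pow (-c)) f) g \<and>
          form_ae_eq (Suc q) D h (fmult (mono_pow c) g))"

definition ker_dbar_c ::
    "(complex^'n::{finite,linorder}) set \<Rightarrow> int^'n::{finite,linorder} \<Rightarrow> nat \<Rightarrow> 'n form set" where
  "ker_dbar_c D c q = {f. has_dbar_c D c q f (\<lambda>I z. 0)}"

section \<open>Product domains\<close>

definition product_set :: "('n \<Rightarrow> complex set) \<Rightarrow> (complex^'n::finite) set" where
  "product_set D = {z. \<forall>j. z $ j \<in> D j}"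

definition planar_domain :: "complex set \<Rightarrow> bool" where
  "planar_domain D \<longleftrightarrow> open D \<and> connected D \<and> D \<noteq> {}"

definition rel_compact_in :: "'a::topological_space set \<Rightarrow> 'a set \<Rightarrow> bool" where
  "rel_compact_in A B \<longleftrightarrow> compact (closure A) \<and> closure A \<subseteq> B"

end

theory Submission
  imports Defs
begin

text \<open>Multiplication by \<open>z\<^sup>-\<^sup>c\<close> turns d-bar\<open>\<^sub>c\<close> into d-bar and \<open>|z|\<^sup>s L\<^sup>p\<close> into
\<open>|z|\<^sup>\<sigma> L\<^sup>p\<close> with \<open>\<sigma> = s - c\<close>, so the task is to solve d-bar with weighted bounds for
ordinary closed forms. This is done one coordinate at a time. Let \<open>g\<close> be closed, let \<open>j\<close> be a
coordinate, let \<open>\<theta>\<close> be a cut-off function of \<open>z\<^sub>j\<close> that is 1 near the closure of \<open>G\<^sub>j\<close> and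
supported in \<open>D\<^sub>j\<close>, and let \<open>T\<close> be the Cauchy transform in the variable \<open>z\<^sub>j\<close>. Contract \<open>g\<close>
with \<open>d\<close>z-bar\<open>\<^sub>j\<close>, multiply by \<open>\<theta>\<close> and apply \<open>T\<close>: this is \<open>K g\<close>. Take the part of \<open>g\<close>
without \<open>d\<close>z-bar\<open>\<^sub>j\<close>, multiply by the z-bar-derivative of \<open>\<theta>\<close> and apply \<open>T\<close>: this is \<open>S g\<close>.
Since \<open>T\<close> inverts the z-bar-derivative in \<open>z\<^sub>j\<close> on compactly supported data, closedness of \<open>g\<close>
gives d-bar \<open>K g = g - S g\<close> where \<open>z\<^sub>j \<in> G\<^sub>j\<close>; moreover \<open>S g\<close> is closed and does not contain
\<open>d\<close>z-bar\<open>\<^sub>j\<close> (\<open>homotopy_step\<close>). A form of positive degree that has lost all the differentials is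
zero, so after finitely many steps the sum of the \<open>K\<close>-terms is a solution over \<open>Q\<close>
(\<open>solution_operator_insert\<close>, \<open>solution_operator_exists\<close>).

The estimates also concern one variable at a time, because the factors of the weight in the other
variables are constant along the fibres over which \<open>T\<close> integrates. By a weighted Schur test the
Cauchy kernel in \<open>z\<^sub>j\<close> maps \<open>|z\<^sub>j|\<^sup>\<sigma> L\<^sup>p\<close> boundedly to \<open>|z\<^sub>j|\<^sup>\<tau> L\<^sup>p\<close> over bounded sets
whenever certain linear inequalities between \<open>p\<close>, \<open>\<sigma>\<close> and \<open>\<tau>\<close> can be solved (\<open>admissible\<close>,
\<open>cauchy_majorant_bound\<close>). The extremal property that defines a weight places each \<open>\<sigma>\<^sub>j\<close> in an
interval of length one: for \<open>1 < p < \<infinity>\<close> it is \<open>(2/p - 2, 2/p - 1]\<close> for the d-bar-weight and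
\<open>[2/p - 1, 2/p)\<close> for the modified one (\<open>dbar_weight_bounds\<close>, \<open>mod_dbar_weight_bounds\<close>). On the
second interval \<open>\<tau> = \<sigma>\<close> is admissible, on the first even \<open>\<tau> = \<sigma> + 1 - \<epsilon>\<close>
(\<open>admissible_mod\<close>, \<open>admissible_dbar\<close>). Every term of the solution starts by applying \<open>K\<close> or
\<open>S\<close> in the coordinate that is treated first, so treating the last coordinate first puts the gain
\<open>1 - \<epsilon>\<close> there.

To work with distributions, \<open>T\<close> is written as an integral over the translations
\<open>u(z - w e\<^sub>j)\<close>. Fubini's theorem in \<open>(z, w)\<close> and translation invariance then give the bounds
and identify the adjoint \<open>T\<^sup>*\<close> with the same integral in the opposite direction, which maps smooth
functions with compact support to smooth functions. After multiplication by \<open>\<theta>\<close> the result is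
again a test function, on a larger product, and the identity for d-bar \<open>K g\<close> becomes the definition of
closedness tested against it. The one analytic input is the Cauchy-Pompeiu formula
(\<open>integral_dbar_cauchy\<close>).

The solution also satisfies the equation with the modified weight in place of \<open>c\<close>: the modified
weight is at most \<open>c\<close> in each coordinate, so the two equations differ by a monomial with
nonnegative exponents. Such a monomial is holomorphic, and test functions may be multiplied by it
(\<open>weak_dbar_mono_pow\<close>).\<close>

section \<open>Calculus of continuously differentiable functions\<close>

lemma Ck_SucI:
  assumes "\<And>x. (f has_derivative f' x) (at x)" and "\<And>v. v \<in> Basis \<Longrightarrow> Ck k (\<lambda>x. f' x v)"
  shows "Ck (Suc k) f"
proof -
  have "frechet_derivative f (at x) = f' x" for x
    using frechet_derivative_at[OF assms(1)] by simp
  then show ?thesis using assms by (auto simp: differentiable_def)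
qed

lemma Ck_has_derivative:
  "Ck (Suc k) f \<Longrightarrow> (f has_derivative frechet_derivative f (at x)) (at x)"
  by (simp add: frechet_derivative_works)

lemma Ck_SucD: "Ck (Suc k) f \<Longrightarrow> Ck k f"
proof (induction k arbitrary: f)
  case 0
  then show ?case
    by (simp add: continuous_at_imp_continuous_on differentiable_imp_continuous_within)
next
  case (Suc k)
  then show ?case by (metis Ck.simps(2))
qed

lemma Ck_continuous: "Ck k f \<Longrightarrow> continuous_on UNIV f"
  by (induction k) (auto dest: Ck_SucD simp del: Ck.simps(2))

lemma Ck_const: "Ck k (\<lambda>x. c)"
proof (induction k arbitrary: c)
  case (Suc k)
  then show ?case by (intro Ck_SucI[where f'="\<lambda>x v. 0"]) auto
qed simp

lemma Ck_add: "Ck k f \<Longrightarrow> Ck k g \<Longrightarrow> Ck k (\<lambda>x. f x + g x)"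
proof (induction k arbitrary: f g)
  case 0 then show ?case by (auto intro: continuous_intros)
next
  case (Suc k)
  show ?case
    by (rule Ck_SucI[where f'="\<lambda>x v. frechet_derivative f (at x) v + frechet_derivative g (at x) v"])
      (use Suc in \<open>auto intro!: has_derivative_add Ck_has_derivative simp del: Ck.simps(2)\<close>, use Suc in auto)
qed

lemma Ck_mult: "Ck k f \<Longrightarrow> Ck k g \<Longrightarrow> Ck k (\<lambda>x. f x * g x)"
proof (induction k arbitrary: f g)
  case 0 then show ?case by (auto intro: continuous_intros)
next
  case (Suc k)
  show ?case
  proof (rule Ck_SucI)
    show "((\<lambda>x. f x * g x) has_derivative
        (\<lambda>v. f x * frechet_derivative g (at x) v + frechet_derivative f (at x) v * g x)) (at x)" for x
      using Suc.prems by (intro has_derivative_mult Ck_has_derivative)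
    fix v :: 'a assume "v \<in> Basis"
    then show "Ck k (\<lambda>x. f x * frechet_derivative g (at x) v + frechet_derivative f (at x) v * g x)"
      using Suc.prems Ck_SucD[OF Suc.prems(1)] Ck_SucD[OF Suc.prems(2)] 
      by (intro Ck_add Suc.IH) auto
  qed
qed

lemma Ck_sum: "(\<And>i. i \<in> I \<Longrightarrow> Ck k (f i)) \<Longrightarrow> Ck k (\<lambda>x. \<Sum>i\<in>I. f i x)"
  by (induction I rule: infinite_finite_induct) (auto intro: Ck_const Ck_add)

lemma Ck_prod: "(\<And>i. i \<in> I \<Longrightarrow> Ck k (f i)) \<Longrightarrow> Ck k (\<lambda>x. \<Prod>i\<in>I. f i x)"
  by (induction I rule: infinite_finite_induct) (auto intro: Ck_const Ck_mult)

lemma Ck_bounded_linear: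
  assumes "bounded_linear L" shows "Ck k L"
proof (cases k)
  case 0
  then show ?thesis using assms by (simp add: linear_continuous_on)
next
  case (Suc m)
  show ?thesis unfolding Suc
    by (rule Ck_SucI[where f'="\<lambda>x. L"]) (use assms in \<open>auto intro: bounded_linear_imp_has_derivative Ck_const\<close>)
qed

lemma linear_eq_sum_Basis:
  assumes "linear f" shows "f v = (\<Sum>b\<in>Basis. (v \<bullet> b) *\<^sub>R f b)"
proof -
  have "f v = f (\<Sum>b\<in>Basis. (v \<bullet> b) *\<^sub>R b)" by (simp add: euclidean_representation)
  then show ?thesis using assms by (simp add: linear_sum linear_cmul)
qed

lemma Ck_compose_affine:
  assumes L: "bounded_linear L"
  shows "Ck k f \<Longrightarrow> Ck k (\<lambda>x. f (L x + c))"
proof (induction k arbitrary: f)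
  case 0
  have "continuous_on UNIV (\<lambda>x. L x + c)" using L by (intro continuous_intros linear_continuous_on)
  from continuous_on_compose2[OF _ this] 0 show ?case by auto
next
  case (Suc k)
  show ?case
  proof (rule Ck_SucI)
    have d: "((\<lambda>x. L x + c) has_derivative L) (at x)" for x
      using bounded_linear_imp_has_derivative[OF L] by (auto intro!: derivative_eq_intros)
    show "((\<lambda>x. f (L x + c)) has_derivative (\<lambda>v. frechet_derivative f (at (L x + c)) (L v))) (at x)" for x
      using has_derivative_compose[OF d Ck_has_derivative[OF Suc.prems]] by simp
    fix v :: 'a
    have "(\<lambda>x. frechet_derivative f (at (L x + c)) (L v)) =
      (\<lambda>x. \<Sum>b\<in>Basis. of_real (L v \<bullet> b) * frechet_derivative f (at (L x + c)) b)"
      unfolding scaleR_conv_of_real[symmetric]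
      by (rule ext, rule linear_eq_sum_Basis[OF has_derivative_linear[OF Ck_has_derivative[OF Suc.prems]]])
    moreover have "Ck k (\<lambda>x. \<Sum>b\<in>Basis. of_real (L v \<bullet> b) * frechet_derivative f (at (L x + c)) b)"
      using Suc by (intro Ck_sum Ck_mult Ck_const) auto
    ultimately show "Ck k (\<lambda>x. frechet_derivative f (at (L x + c)) (L v))" by simp
  qed
qed

section \<open>A smooth bump function\<close>

text \<open>The functions \<open>p(1/t) exp(-1/t)\<close>, extended by zero to \<open>t \<le> 0\<close>. Letting \<open>p\<close> run over all
polynomials makes the class closed under differentiation, so smoothness follows by induction on
the order with a single computation of a derivative.\<close>

definition flat :: "real poly \<Rightarrow> real \<Rightarrow> complex" where
  "flat p t = (if t > 0 then of_real (poly p (1 / t) * exp (- 1 / t)) else 0)"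

lemma poly_exp_tendsto_0: "((\<lambda>x. poly p x * exp (- x)) \<longlongrightarrow> 0) at_top" for p :: "real poly"
proof -
  have "((\<lambda>x. \<Sum>i\<le>degree p. coeff p i * (x ^ i / exp x)) \<longlongrightarrow> (\<Sum>i\<le>degree p. coeff p i * 0)) at_top"
    by (intro tendsto_intros tendsto_power_div_exp_0)
  then show ?thesis by (simp add: poly_altdef sum_distrib_right exp_minus divide_inverse mult.assoc)
qed

lemma flat_has_derivative:
  "(flat p has_derivative (\<lambda>v. of_real v * flat ([:0, 0, 1:] * (p - pderiv p)) t)) (at t)"
proof -
  let ?q = "[:0, 0, 1:] * (p - pderiv p)"
  have "(flat p has_vector_derivative flat ?q t) (at t)"
  proof (cases "t = 0")
    case False
    show ?thesis
    proof (cases "t > 0")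
      case True
      have "((\<lambda>t. poly p (1 / t) * exp (- 1 / t)) has_real_derivative
          poly ?q (1 / t) * exp (- 1 / t)) (at t)"
        using True by (auto intro!: derivative_eq_intros simp: power2_eq_square) (simp add: field_simps)
      then have "((\<lambda>t. complex_of_real (poly p (1 / t) * exp (- 1 / t))) has_vector_derivative
          of_real (poly ?q (1 / t) * exp (- 1 / t))) (at t)"
        by (intro has_vector_derivative_of_real) (simp add: has_real_derivative_iff_has_vector_derivative)
      then have "(flat p has_vector_derivative of_real (poly ?q (1 / t) * exp (- 1 / t))) (at t)"
        by (rule has_vector_derivative_transform_within_open[where S="{0<..}"]) (use True in \<open>auto simp: flat_def\<close>)
      then show ?thesis using True by (simp add: flat_def)
    next
      case F: False
      have "((\<lambda>t. 0) has_vector_derivative (0::complex)) (at t)" by simp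
      then have "(flat p has_vector_derivative 0) (at t)"
        by (rule has_vector_derivative_transform_within_open[where S="{..<0}"])
          (use False F in \<open>auto simp: flat_def\<close>)
      then show ?thesis using F by (simp add: flat_def)
    qed
  next
    case True
    have r: "((\<lambda>t. poly (pCons 0 p) (1 / t) * exp (- (1 / t))) \<longlongrightarrow> 0) (at_right (0::real))"
      using poly_exp_tendsto_0[of "pCons 0 p"]
      by (rule filterlim_compose) (use filterlim_inverse_at_top_right in \<open>simp add: inverse_eq_divide\<close>)
    have "((\<lambda>t. complex_of_real (poly (pCons 0 p) (1 / t) * exp (- (1 / t)))) \<longlongrightarrow> 0) (at_right (0::real))"
      using tendsto_of_real[OF r] by (simp del: poly_pCons)
    then have 1: "((\<lambda>t. flat p t / of_real t) \<longlongrightarrow> 0) (at_right 0)"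
      by (rule Lim_transform_eventually) (auto simp: flat_def eventually_at_filter)
    have 2: "((\<lambda>t. flat p t / of_real t) \<longlongrightarrow> 0) (at_left 0)"
      by (rule tendsto_eventually) (auto simp: flat_def eventually_at_filter)
    have "((\<lambda>t. flat p t / of_real t) \<longlongrightarrow> 0) (at 0)"
      using 1 2 by (simp add: filterlim_split_at)
    then have "((\<lambda>h. norm (flat p h) / norm h) \<longlongrightarrow> 0) (at 0)"
      using tendsto_norm_zero[of "\<lambda>t. flat p t / of_real t"] by (simp add: norm_divide)
    then show ?thesis using True
      by (simp add: has_vector_derivative_def has_derivative_at flat_def)
  qed
  then show ?thesis by (simp add: has_vector_derivative_def scaleR_conv_of_real)
qed

lemma Ck_flat: "Ck k (flat p)"
proof (induction k arbitrary: p)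
  case 0
  then show ?case
    by (auto intro!: continuous_at_imp_continuous_on has_derivative_continuous flat_has_derivative)
next
  case (Suc k)
  show ?case by (rule Ck_SucI[OF flat_has_derivative]) (use Suc in \<open>simp del: mult_pCons_left\<close>)
qed

definition bump :: "real \<Rightarrow> complex \<Rightarrow> complex" where
  "bump d w = flat 1 (d + Re w) * flat 1 (d - Re w) * flat 1 (d + Im w) * flat 1 (d - Im w)"

lemma flat_1_eq: "flat 1 t = of_real (if t > 0 then exp (- 1 / t) else 0)"
  by (simp add: flat_def)

lemma Ck_bump: "Ck k (bump d)"
proof -
  have "bounded_linear (\<lambda>x. - Re x)" "bounded_linear (\<lambda>x. - Im x)"
    using bounded_linear_minus bounded_linear_Re bounded_linear_Im by blast+
  from this[THEN Ck_compose_affine[OF _ Ck_flat, where c=d and k=k]]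
       Ck_compose_affine[OF bounded_linear_Re Ck_flat, where c=d and k=k]
       Ck_compose_affine[OF bounded_linear_Im Ck_flat, where c=d and k=k]
  show ?thesis unfolding bump_def[abs_def] by (intro Ck_mult) (simp_all add: add.commute)
qed

lemma bump_real_nonneg: "\<exists>r\<ge>0. bump d w = of_real r"
  unfolding bump_def flat_1_eq
  by (rule exI[where x="(if d + Re w > 0 then exp (- 1 / (d + Re w)) else 0) *
    (if d - Re w > 0 then exp (- 1 / (d - Re w)) else 0) *
    (if d + Im w > 0 then exp (- 1 / (d + Im w)) else 0) *
    (if d - Im w > 0 then exp (- 1 / (d - Im w)) else 0)"]) auto

lemma bump_nonzero_iff: "bump d w \<noteq> 0 \<longleftrightarrow> \<bar>Re w\<bar> < d \<and> \<bar>Im w\<bar> < d"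
  by (auto simp: bump_def flat_def)

section \<open>Differentiation under convolution integrals\<close>

lemma uniformly_continuous_compact_support:
  fixes f :: "'a::euclidean_space \<Rightarrow> 'b::metric_space"
  assumes "continuous_on UNIV f" "compact K" "\<And>x. x \<notin> K \<Longrightarrow> f x = a"
  shows "uniformly_continuous_on UNIV f"
proof -
  define K' where "K' = (\<lambda>(x, y). x + y) ` (K \<times> cball 0 1)"
  have "compact K'" unfolding K'_def
    by (intro compact_continuous_image compact_Times assms compact_cball)
       (auto simp: case_prod_unfold intro!: continuous_intros)
  then have u: "uniformly_continuous_on K' f"
    using assms(1) by (intro compact_uniformly_continuous) (auto intro: continuous_on_subset)
  have near: "x \<in> K'" if "y \<in> K" "dist x y < 1" for x y
  proof -
    have "(y, x - y) \<in> K \<times> cball 0 1" using that by (auto simp: dist_norm norm_minus_commute)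
    then have "(case (y, x - y) of (x, y) \<Rightarrow> x + y) \<in> K'" unfolding K'_def by (rule imageI)
    then show ?thesis by simp
  qed
  show ?thesis unfolding uniformly_continuous_on_def
  proof (intro allI impI)
    fix e :: real assume "e > 0"
    then obtain d where d: "d > 0" "\<And>x x'. x \<in> K' \<Longrightarrow> x' \<in> K' \<Longrightarrow> dist x' x < d \<Longrightarrow> dist (f x') (f x) < e"
      using u unfolding uniformly_continuous_on_def by metis
    have "dist (f x') (f x) < e" if "dist x' x < min d 1" for x x'
    proof (cases "x \<in> K \<or> x' \<in> K")
      case True
      then have "x \<in> K'" "x' \<in> K'"
        using near[of x x] near[of x' x'] near[of x x'] near[of x' x] that
        by (auto simp: dist_commute)
      then show ?thesis using d that by auto
    next
      case False
      then show ?thesis using assms(3) \<open>e > 0\<close> by simp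
    qed
    then show "\<exists>d>0. \<forall>x\<in>UNIV. \<forall>x'\<in>UNIV. dist x' x < d \<longrightarrow> dist (f x') (f x) < e"
      using d(1) by (intro exI[of _ "min d 1"]) auto
  qed
qed

lemma bounded_compact_support:
  fixes f :: "'a::euclidean_space \<Rightarrow> complex"
  assumes "continuous_on UNIV f" "compact K" "\<And>x. x \<notin> K \<Longrightarrow> f x = 0"
  obtains B where "B > 0" "\<And>x. norm (f x) \<le> B"
proof -
  have "bounded (f ` K)"
    using assms by (intro compact_imp_bounded compact_continuous_image) (auto intro: continuous_on_subset)
  then obtain B where "B > 0" "\<And>x. x \<in> K \<Longrightarrow> norm (f x) \<le> B"
    unfolding bounded_pos by auto
  then show ?thesis using assms(3) that[of B] by (metis less_eq_real_def norm_zero)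
qed

lemma frechet_derivative_zero_outside:
  assumes "closed K" "\<And>x. x \<notin> K \<Longrightarrow> f x = 0" "x \<notin> K"
  shows "frechet_derivative f (at x) v = 0"
proof -
  have "((\<lambda>x. 0) has_derivative (\<lambda>v. 0)) (at x)" by simp
  then have "(f has_derivative (\<lambda>v. 0)) (at x)"
    by (rule has_derivative_transform_within_open[where s="- K"]) (use assms in auto)
  then show ?thesis using frechet_derivative_at by (metis (full_types))
qed

lemma frechet_derivative_uniformly_continuous:
  fixes \<phi> :: "'a::euclidean_space \<Rightarrow> complex"
  assumes \<phi>: "Ck (Suc 0) \<phi>" and K: "compact K" "\<And>x. x \<notin> K \<Longrightarrow> \<phi> x = 0" and e: "e > 0"
  shows "\<exists>d>0. \<forall>x y h. dist x y < d \<longrightarrow>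
    norm (frechet_derivative \<phi> (at x) h - frechet_derivative \<phi> (at y) h) \<le> e * norm h"
proof -
  let ?D = "\<lambda>x. frechet_derivative \<phi> (at x)"
  let ?n = "real DIM('a)"
  have "\<exists>d>0. \<forall>x y. dist x y < d \<longrightarrow> dist (?D x b) (?D y b) < e / ?n" if b: "b \<in> Basis" for b
  proof -
    have "uniformly_continuous_on UNIV (\<lambda>x. ?D x b)"
      by (rule uniformly_continuous_compact_support[OF _ K(1), where a=0])
        (use \<phi> b frechet_derivative_zero_outside[OF compact_imp_closed[OF K(1)] K(2)] in auto)
    then show ?thesis using e unfolding uniformly_continuous_on_def
      by (metis DIM_positive UNIV_I divide_pos_pos of_nat_0_less_iff)
  qed
  then obtain d where d: "\<And>b. b \<in> Basis \<Longrightarrow> d b > 0"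
    "\<And>b x y. b \<in> Basis \<Longrightarrow> dist x y < d b \<Longrightarrow> dist (?D x b) (?D y b) < e / ?n"
    by metis
  define d0 where "d0 = Min (d ` Basis)"
  have d0: "d0 > 0" "\<And>b. b \<in> Basis \<Longrightarrow> d0 \<le> d b" unfolding d0_def using d(1) by auto
  have lin: "?D x h = (\<Sum>b\<in>Basis. (h \<bullet> b) *\<^sub>R ?D x b)" for x h
    by (rule linear_eq_sum_Basis[OF has_derivative_linear[OF Ck_has_derivative[OF \<phi>]]])
  have "norm (?D x h - ?D y h) \<le> e * norm h" if "dist x y < d0" for x y h
  proof -
    have "norm (?D x h - ?D y h) = norm (\<Sum>b\<in>Basis. (h \<bullet> b) *\<^sub>R (?D x b - ?D y b))"
      by (subst (1 2) lin) (simp add: sum_subtractf scaleR_diff_right)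
    also have "\<dots> \<le> (\<Sum>b\<in>(Basis::'a set). norm h * (e / ?n))"
    proof (rule sum_norm_le)
      fix b :: 'a assume b: "b \<in> Basis"
      have "norm (?D x b - ?D y b) \<le> e / ?n"
        using d(2)[OF b, of x y] d0(2)[OF b] that by (auto simp: dist_norm)
      then show "norm ((h \<bullet> b) *\<^sub>R (?D x b - ?D y b)) \<le> norm h * (e / ?n)"
        unfolding norm_scaleR using Basis_le_norm[OF b, of h] by (intro mult_mono) auto
    qed
    also have "\<dots> = e * norm h" by simp
    finally show ?thesis .
  qed
  with d0(1) show ?thesis by blast
qed

lemma integrable_translate_kernel:
  fixes \<phi> :: "'a::euclidean_space \<Rightarrow> complex" and L :: "'b::euclidean_space \<Rightarrow> 'a"
  assumes "continuous_on UNIV \<phi>" "compact K" "\<And>x. x \<notin> K \<Longrightarrow> \<phi> x = 0"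
    and L: "bounded_linear L" and k: "integrable lborel k"
  shows "integrable lborel (\<lambda>w. \<phi> (z + L w) * k w)"
proof -
  obtain B where B: "B > 0" "\<And>x. norm (\<phi> x) \<le> B" using bounded_compact_support assms(1-3) by blast
  have [measurable]: "\<phi> \<in> borel_measurable borel" using assms(1) by (rule borel_measurable_continuous_onI)
  have [measurable]: "L \<in> borel_measurable borel"
    using L by (intro borel_measurable_continuous_onI linear_continuous_on)
  have [measurable]: "k \<in> borel_measurable borel" using k by auto
  show ?thesis
    by (rule Bochner_Integration.integrable_bound[OF integrable_mult_right[OF k, of "of_real B"]])
       (use B in \<open>auto simp: norm_mult intro!: mult_right_mono always_eventually\<close>)
qed

text \<open>Dominated differentiation without pointwise limits: the derivative of a compactly supported
continuously differentiable function is uniformly continuous, so the remainder of the linearisation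
at \<open>z + L w\<close> is small uniformly in \<open>w\<close>, and integrating it against \<open>k\<close> costs only the
\<open>L\<^sup>1\<close> norm of \<open>k\<close>.\<close>

lemma has_derivative_integral_translate:
  fixes \<phi> :: "'a::euclidean_space \<Rightarrow> complex" and L :: "'b::euclidean_space \<Rightarrow> 'a"
  assumes L: "bounded_linear L" and \<phi>: "Ck (Suc 0) \<phi>"
    and K: "compact K" "\<And>x. x \<notin> K \<Longrightarrow> \<phi> x = 0" and k: "integrable lborel k"
  shows "((\<lambda>z. \<integral>w. \<phi> (z + L w) * k w \<partial>lborel) has_derivative
    (\<lambda>h. \<integral>w. frechet_derivative \<phi> (at (z + L w)) h * k w \<partial>lborel)) (at z)"
proof -
  let ?D = "\<lambda>x. frechet_derivative \<phi> (at x)"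
  have d\<phi>: "(\<phi> has_derivative ?D x) (at x)" for x using Ck_has_derivative[OF \<phi>] .
  have Dlin: "?D x h = (\<Sum>b\<in>Basis. (h \<bullet> b) *\<^sub>R ?D x b)" for x h
    by (rule linear_eq_sum_Basis[OF has_derivative_linear[OF d\<phi>]])
  have intD: "integrable lborel (\<lambda>w. ?D (z + L w) h * k w)" for h
  proof (rule integrable_translate_kernel[OF _ K(1) _ L k, of "\<lambda>x. ?D x h"])
    have "continuous_on UNIV (\<lambda>x. \<Sum>b\<in>Basis. (h \<bullet> b) *\<^sub>R ?D x b)"
      using \<phi> by (auto intro!: continuous_intros)
    then show "continuous_on UNIV (\<lambda>x. ?D x h)" unfolding Dlin[symmetric] .
    show "x \<notin> K \<Longrightarrow> ?D x h = 0" for x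
      by (rule frechet_derivative_zero_outside[OF compact_imp_closed[OF K(1)] K(2)])
  qed
  have int\<phi>: "integrable lborel (\<lambda>w. \<phi> (y + L w) * k w)" for y
    by (rule integrable_translate_kernel[OF Ck_continuous[OF \<phi>] K L k])
  have intk: "integrable lborel (\<lambda>w. norm (k w))" using k by simp
  define I where "I = (\<integral>w. norm (k w) \<partial>lborel)"
  have I0: "I \<ge> 0" unfolding I_def by simp
  show ?thesis
    unfolding has_derivative_at_alt
  proof (intro conjI allI impI)
    show "bounded_linear (\<lambda>h. \<integral>w. ?D (z + L w) h * k w \<partial>lborel)"
    proof (rule linear_conv_bounded_linear[THEN iffD1], rule linearI)
      show "(\<integral>w. ?D (z + L w) (a + b) * k w \<partial>lborel) =
        (\<integral>w. ?D (z + L w) a * k w \<partial>lborel) + (\<integral>w. ?D (z + L w) b * k w \<partial>lborel)" for a b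
        using linear_add[OF has_derivative_linear[OF d\<phi>]] intD
        by (subst Bochner_Integration.integral_add[symmetric]) (auto simp: algebra_simps)
      show "(\<integral>w. ?D (z + L w) (c *\<^sub>R a) * k w \<partial>lborel) = c *\<^sub>R (\<integral>w. ?D (z + L w) a * k w \<partial>lborel)" for a c
        using linear_cmul[OF has_derivative_linear[OF d\<phi>]]
        by (subst integral_scaleR_right[symmetric]) auto
    qed
    fix e :: real assume e: "e > 0"
    obtain d where d: "d > 0" "\<And>x y h. dist x y < d \<Longrightarrow> norm (?D x h - ?D y h) \<le> e / (I + 1) * norm h"
      using frechet_derivative_uniformly_continuous[OF \<phi> K, of "e / (I + 1)"] e I0 by auto
    have "norm ((\<integral>w. \<phi> (y + L w) * k w \<partial>lborel) - (\<integral>w. \<phi> (z + L w) * k w \<partial>lborel) -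
        (\<integral>w. ?D (z + L w) (y - z) * k w \<partial>lborel)) \<le> e * norm (y - z)" if y: "norm (y - z) < d" for y
    proof -
      have pt: "norm (\<phi> (y + L w) - \<phi> (z + L w) - ?D (z + L w) (y - z)) \<le> norm (y - z) * (e / (I + 1))" for w
      proof -
        have "norm (\<phi> (y + L w) - \<phi> (z + L w) - ?D (z + L w) ((y + L w) - (z + L w)))
          \<le> norm ((y + L w) - (z + L w)) * (e / (I + 1))"
        proof (rule differentiable_bound_linearization[where S="ball (z + L w) d" and f'="?D"])
          fix t :: real assume t: "t \<in> {0..1}"
          have "norm (t *\<^sub>R (y - z)) \<le> norm (y - z)" using t by (simp add: mult_left_le_one_le)
          then have "dist (z + L w) (z + L w + t *\<^sub>R ((y + L w) - (z + L w))) < d"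
            using y by (simp add: dist_norm)
          then show "z + L w + t *\<^sub>R ((y + L w) - (z + L w)) \<in> ball (z + L w) d" by simp
        next
          fix x assume x: "x \<in> ball (z + L w) d"
          show "(\<phi> has_derivative ?D x) (at x within ball (z + L w) d)"
            using d\<phi> by (rule has_derivative_at_withinI)
          show "onorm (?D x - ?D (z + L w)) \<le> e / (I + 1)"
            using d(2)[of x "z + L w"] x by (intro onorm_bound) (use e I0 in \<open>auto simp: dist_commute\<close>)
        qed (use d(1) in auto)
        then show ?thesis by simp
      qed
      have "(\<integral>w. \<phi> (y + L w) * k w \<partial>lborel) - (\<integral>w. \<phi> (z + L w) * k w \<partial>lborel) -
          (\<integral>w. ?D (z + L w) (y - z) * k w \<partial>lborel) =
          (\<integral>w. (\<phi> (y + L w) - \<phi> (z + L w) - ?D (z + L w) (y - z)) * k w \<partial>lborel)"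
        using int\<phi>[of y] int\<phi>[of z] intD[of "y - z"] by (simp add: algebra_simps)
      also have "norm \<dots> \<le> (\<integral>w. norm (y - z) * (e / (I + 1)) * norm (k w) \<partial>lborel)"
      proof (rule Bochner_Integration.integral_norm_bound_integral)
        show "integrable lborel (\<lambda>w. (\<phi> (y + L w) - \<phi> (z + L w) - ?D (z + L w) (y - z)) * k w)"
          using int\<phi>[of y] int\<phi>[of z] intD[of "y - z"] by (simp add: algebra_simps)
        show "norm ((\<phi> (y + L w) - \<phi> (z + L w) - ?D (z + L w) (y - z)) * k w)
          \<le> norm (y - z) * (e / (I + 1)) * norm (k w)" for w
          unfolding norm_mult by (intro mult_right_mono pt) auto
      qed (use intk in simp)
      also have "\<dots> = norm (y - z) * (e * (I / (I + 1)))" by (simp add: I_def)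
      also have "\<dots> \<le> norm (y - z) * (e * 1)"
        using e I0 by (intro mult_left_mono) auto
      finally show ?thesis by (simp add: mult.commute)
    qed
    with d(1) show "\<exists>d>0. \<forall>y. norm (y - z) < d \<longrightarrow>
      norm ((\<integral>w. \<phi> (y + L w) * k w \<partial>lborel) - (\<integral>w. \<phi> (z + L w) * k w \<partial>lborel) -
        (\<integral>w. ?D (z + L w) (y - z) * k w \<partial>lborel)) \<le> e * norm (y - z)" by blast
  qed
qed

lemma Ck_integral_translate:
  fixes \<phi> :: "'a::euclidean_space \<Rightarrow> complex" and L :: "'b::euclidean_space \<Rightarrow> 'a"
  assumes L: "bounded_linear L" and k: "integrable lborel k" and K: "compact K"
  shows "Ck (Suc m) \<phi> \<Longrightarrow> (\<And>x. x \<notin> K \<Longrightarrow> \<phi> x = 0) \<Longrightarrow> Ck m (\<lambda>z. \<integral>w. \<phi> (z + L w) * k w \<partial>lborel)"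
proof (induction m arbitrary: \<phi>)
  case 0
  show ?case
    using has_derivative_continuous[OF has_derivative_integral_translate[OF L 0(1) K 0(2) k]]
    by (auto intro: continuous_at_imp_continuous_on)
next
  case (Suc m)
  have 1: "Ck (Suc 0) \<phi>"
    using Suc.prems(1) Ck_continuous[where k="Suc m"] by (auto simp del: Ck.simps(2) simp: Ck.simps(2)[of "Suc m" \<phi>] Ck.simps(2)[of 0])
  show ?case
  proof (rule Ck_SucI[OF has_derivative_integral_translate[OF L 1 K Suc.prems(2) k]])
    fix v :: 'a assume "v \<in> Basis"
    then have "Ck (Suc m) (\<lambda>x. frechet_derivative \<phi> (at x) v)"
      using Suc.prems(1) Ck.simps(2)[of "Suc m" \<phi>] by blast
    then show "Ck m (\<lambda>z. \<integral>w. frechet_derivative \<phi> (at (z + L w)) v * k w \<partial>lborel)"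
      using frechet_derivative_zero_outside[OF compact_imp_closed[OF K] Suc.prems(2)] by (rule Suc.IH)
  qed
qed

section \<open>Translations and locally integrable powers\<close>

lemma nn_integral_translate:
  fixes c :: "'a::euclidean_space"
  assumes "f \<in> borel_measurable borel"
  shows "(\<integral>\<^sup>+x. f (x + c) \<partial>lborel) = (\<integral>\<^sup>+x. f x \<partial>lborel)"
proof -
  have "(\<integral>\<^sup>+x. f x \<partial>lborel) = (\<integral>\<^sup>+x. f x \<partial>distr lborel borel ((+) c))"
    by (simp add: lborel_distr_plus)
  also have "\<dots> = (\<integral>\<^sup>+x. f (x + c) \<partial>lborel)"
    using assms by (subst nn_integral_distr) (auto simp: add.commute)
  finally show ?thesis by simp
qed

lemma integral_translate:
  fixes c :: "'a::euclidean_space" and f :: "'a \<Rightarrow> complex"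
  assumes "f \<in> borel_measurable borel"
  shows "(\<integral>x. f (x + c) \<partial>lborel) = (\<integral>x. f x \<partial>lborel)"
proof -
  have "(\<integral>x. f x \<partial>lborel) = (\<integral>x. f x \<partial>distr lborel borel ((+) c))"
    by (simp add: lborel_distr_plus)
  also have "\<dots> = (\<integral>x. f (x + c) \<partial>lborel)"
    using assms by (subst integral_distr) (auto simp: add.commute)
  finally show ?thesis by simp
qed

lemma AE_lborel_translate:
  fixes c :: "'a::euclidean_space"
  assumes "AE x in lborel. P x"
  shows "AE x in lborel. P (x + c)"
proof -
  have "AE x in distr lborel borel ((+) c). P x" using assms unfolding lborel_distr_plus .
  then have "AE x in lborel. P (c + x)" by (rule AE_distrD[rotated]) simp
  then show ?thesis by (simp add: add.commute)
qed

lemma nn_integral_even_bound: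
  assumes [measurable]: "f \<in> borel_measurable borel" and "\<And>x. f (- x) = f (x::real)"
  shows "(\<integral>\<^sup>+x. f x \<partial>lborel) \<le> 2 * (\<integral>\<^sup>+x. f x * indicator {0..} x \<partial>lborel)"
proof -
  have "(\<integral>\<^sup>+x. f x \<partial>lborel) \<le> (\<integral>\<^sup>+x. f x * indicator {0..} x + f (- x) * indicator {0..} (- x) \<partial>lborel)"
    by (intro nn_integral_mono) (auto simp: assms(2) split: split_indicator)
  also have "\<dots> = (\<integral>\<^sup>+x. f x * indicator {0..} x \<partial>lborel) + (\<integral>\<^sup>+x. f (- x) * indicator {0..} (- x) \<partial>lborel)"
    by (intro nn_integral_add) auto
  also have "(\<integral>\<^sup>+x. f (- x) * indicator {0..} (- x) \<partial>lborel) = (\<integral>\<^sup>+x. f x * indicator {0..} x \<partial>lborel)"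
    using nn_integral_real_affine[of "\<lambda>x. f x * indicator {0..} x" "-1" 0] by simp
  finally show ?thesis by (simp add: mult_2)
qed

lemma nn_integral_complex_prod:
  assumes [measurable]: "f \<in> borel_measurable borel" "g \<in> borel_measurable borel"
  shows "(\<integral>\<^sup>+w. f (Re w) * g (Im w) \<partial>lborel) = (\<integral>\<^sup>+x. f x \<partial>lborel) * (\<integral>\<^sup>+x. g x \<partial>lborel)"
proof -
  have "1 \<noteq> \<i>" "\<i> \<noteq> 1" by (auto simp: complex_eq_iff)
  then show ?thesis
    using nn_integral_lborel_prod[where f="\<lambda>b::complex. if b = 1 then f else g"]
    by (simp add: Basis_complex_def inner_complex_def)
qed

text \<open>For \<open>b > 0\<close> the bound \<open>|w|\<^sup>-\<^sup>b \<le> |Re w|\<^sup>-\<^sup>b\<^sup>/\<^sup>2 |Im w|\<^sup>-\<^sup>b\<^sup>/\<^sup>2\<close> reduces the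
integral to a product of two one-dimensional ones, which converge because \<open>b/2 < 1\<close>. This takes the
place of polar coordinates.\<close>

lemma inverse_norm_powr_locally_integrable:
  fixes b :: real
  assumes b: "b < 2"
  shows "(\<integral>\<^sup>+w. ennreal (cmod w powr (- b)) * indicator (cball 0 R) w \<partial>lborel) < \<infinity>"
proof (cases "b \<le> 0")
  case True
  have "(\<integral>\<^sup>+w. ennreal (cmod w powr (- b)) * indicator (cball 0 R) w \<partial>lborel) \<le>
     (\<integral>\<^sup>+w. ennreal (R powr (- b)) * indicator (cball 0 R) (w::complex) \<partial>lborel)"
    using True by (intro nn_integral_mono) (auto split: split_indicator intro!: ennreal_leI powr_mono2)
  also have "\<dots> = ennreal (R powr (- b)) * emeasure lborel (cball (0::complex) R)"
    by (rule nn_integral_cmult_indicator) simp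
  also have "\<dots> < \<infinity>" using emeasure_lborel_cball_finite by (auto simp: ennreal_mult_less_top)
  finally show ?thesis .
next
  case False
  \<comment> \<open>The exponent of each of the two one-dimensional factors.\<close>
  define c where "c = - b / 2"
  have c: "-1 < c" "c < 0" using b False by (auto simp: c_def)
  define f where "f x = ennreal (\<bar>x\<bar> powr c) * indicator {-\<bar>R\<bar>..\<bar>R\<bar>} x" for x :: real
  have [measurable]: "f \<in> borel_measurable borel" unfolding f_def by measurable
  have "(\<integral>\<^sup>+x. f x \<partial>lborel) \<le> 2 * (\<integral>\<^sup>+x. f x * indicator {0..} x \<partial>lborel)"
    by (rule nn_integral_even_bound) (auto simp: f_def split: split_indicator)
  also have "(\<integral>\<^sup>+x. f x * indicator {0..} x \<partial>lborel) = (\<integral>\<^sup>+x. ennreal (x powr c) * indicator {0..\<bar>R\<bar>} x \<partial>lborel)"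
    by (intro nn_integral_cong) (auto simp: f_def split: split_indicator)
  also have "\<dots> = ennreal (\<bar>R\<bar> powr (c + 1) / (c + 1))"
    by (rule nn_integral_has_integral_lebesgue'[OF _ has_integral_powr_from_0]) (use c in auto)
  finally have fin: "(\<integral>\<^sup>+x. f x \<partial>lborel) < \<infinity>"
    by (rule order.strict_trans1) (auto simp: ennreal_mult_less_top)
  have Re0: "AE w in lborel. Re w \<noteq> 0 \<and> Im w \<noteq> 0"
    using AE_lborel_inner_neq[of "1::complex" 0] AE_lborel_inner_neq[of \<i> 0]
    by (auto simp: Basis_complex_def inner_complex_def)
  have "(\<integral>\<^sup>+w. ennreal (cmod w powr (- b)) * indicator (cball 0 R) w \<partial>lborel) \<le> (\<integral>\<^sup>+w. f (Re w) * f (Im w) \<partial>lborel)"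
  proof (rule nn_integral_mono_AE)
    show "AE w in lborel. ennreal (cmod w powr (- b)) * indicator (cball 0 R) w \<le> f (Re w) * f (Im w)"
      using Re0
    proof eventually_elim
      case (elim w)
      show ?case
      proof (cases "cmod w \<le> R")
        case True
        have "cmod w powr (- b) = cmod w powr c * cmod w powr c"
          by (simp add: powr_add[symmetric] c_def)
        also have "\<dots> \<le> \<bar>Re w\<bar> powr c * \<bar>Im w\<bar> powr c"
          using elim c abs_Re_le_cmod abs_Im_le_cmod by (intro mult_mono powr_mono2') auto
        finally have "ennreal (cmod w powr (- b)) \<le> ennreal (\<bar>Re w\<bar> powr c) * ennreal (\<bar>Im w\<bar> powr c)"
          by (simp add: ennreal_mult[symmetric] ennreal_leI)
        moreover have "\<bar>Re w\<bar> \<le> \<bar>R\<bar>" "\<bar>Im w\<bar> \<le> \<bar>R\<bar>"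
          using abs_Re_le_cmod[of w] abs_Im_le_cmod[of w] True by linarith+
        then have "f (Re w) = ennreal (\<bar>Re w\<bar> powr c)" "f (Im w) = ennreal (\<bar>Im w\<bar> powr c)"
          by (auto simp: f_def abs_le_iff)
        ultimately show ?thesis using True by simp
      qed simp
    qed
  qed
  also have "\<dots> = (\<integral>\<^sup>+x. f x \<partial>lborel) * (\<integral>\<^sup>+x. f x \<partial>lborel)" by (rule nn_integral_complex_prod) auto
  also have "\<dots> < \<infinity>" using fin by (auto simp: ennreal_mult_less_top)
  finally show ?thesis .
qed

text \<open>Truncation at radius \<open>R\<close> makes the kernel integrable on the whole plane. On a domain of radius
\<open>R/2\<close> about the origin no difference of two points is affected by it.\<close>

definition cauchy_kernel :: "real \<Rightarrow> complex \<Rightarrow> complex" where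
  "cauchy_kernel R w = (if cmod w \<le> R then inverse w else 0)"

lemma cauchy_kernel_measurable [measurable]: "cauchy_kernel R \<in> borel_measurable borel"
  unfolding cauchy_kernel_def[abs_def] by measurable

lemma norm_cauchy_kernel: "norm (cauchy_kernel R w) = cmod w powr (-1) * indicator (cball 0 R) w"
  by (auto simp: cauchy_kernel_def norm_inverse powr_minus split: split_indicator)

lemma integrable_cauchy_kernel: "integrable lborel (cauchy_kernel R)"
proof (rule integrableI_bounded)
  have "(\<integral>\<^sup>+w. ennreal (norm (cauchy_kernel R w)) \<partial>lborel) = 
    (\<integral>\<^sup>+w. ennreal (cmod w powr (- 1)) * indicator (cball 0 R) w \<partial>lborel)"
    by (intro nn_integral_cong) (auto simp: norm_cauchy_kernel split: split_indicator)
  also have "\<dots> < \<infinity>" by (rule inverse_norm_powr_locally_integrable) simp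
  finally show "(\<integral>\<^sup>+w. ennreal (norm (cauchy_kernel R w)) \<partial>lborel) < \<infinity>" .
qed simp

section \<open>The Cauchy-Pompeiu formula\<close>

text \<open>The integral of \<open>F\<close> over all of space does not change when \<open>F\<close> is translated; differentiating
in the translation parameter gives the claim.\<close>

lemma integral_frechet_derivative_zero:
  fixes F :: "'a::euclidean_space \<Rightarrow> complex"
  assumes F: "Ck (Suc 0) F" and K: "compact K" "\<And>x. x \<notin> K \<Longrightarrow> F x = 0"
  shows "(\<integral>w. frechet_derivative F (at w) v \<partial>lborel) = 0"
proof -
  obtain B where B: "\<And>x. x \<in> K \<Longrightarrow> norm x \<le> B" using compact_imp_bounded[OF K(1)] unfolding bounded_iff by blast
  define k :: "'a \<Rightarrow> complex" where "k w = indicator (cball 0 (B + 1)) w" for w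
  have k: "integrable lborel k" unfolding k_def
    by (rule integrable_real_indicator[THEN integrable_of_real, simplified of_real_indicator])
       (auto simp: emeasure_lborel_cball_finite[unfolded infinity_ennreal_def])
  have D: "((\<lambda>z. \<integral>w. F (z + w) * k w \<partial>lborel) has_derivative
    (\<lambda>h. \<integral>w. frechet_derivative F (at (0 + w)) h * k w \<partial>lborel)) (at 0)"
    using has_derivative_integral_translate[OF bounded_linear_ident F K k] .
  have [measurable]: "F \<in> borel_measurable borel" by (rule borel_measurable_continuous_onI[OF Ck_continuous[OF F]])
  have const: "(\<integral>w. F (z + w) * k w \<partial>lborel) = (\<integral>w. F w \<partial>lborel)" if "z \<in> ball 0 1" for z
  proof -
    have "F (z + w) * k w = F (w + z)" for w
    proof (cases "norm w \<le> B + 1")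
      case False
      then have "w + z \<notin> K" using B[of "w + z"] that norm_triangle_ineq2[of w "-z"] by auto
      then show ?thesis using K(2) by (simp add: add.commute)
    qed (simp add: k_def add.commute)
    then show ?thesis by (simp add: integral_translate)
  qed
  have "((\<lambda>z. \<integral>w. F w \<partial>lborel) has_derivative (\<lambda>h. 0)) (at 0)" by simp
  then have "((\<lambda>z. \<integral>w. F (z + w) * k w \<partial>lborel) has_derivative (\<lambda>h. 0)) (at 0)"
    by (rule has_derivative_transform_within_open[where s="ball 0 1"]) (use const in auto)
  from has_derivative_unique[OF this D]
  have "(\<integral>w. frechet_derivative F (at (0 + w)) v * k w \<partial>lborel) = 0" by metis
  moreover have "frechet_derivative F (at w) v * k w = frechet_derivative F (at w) v" for w
  proof (cases "w \<in> K")
    case True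
    then show ?thesis using B[OF True] by (simp add: k_def)
  next
    case False
    then show ?thesis using frechet_derivative_zero_outside[OF compact_imp_closed[OF K(1)] K(2) False] by simp
  qed
  ultimately show ?thesis by (simp only: add_0)
qed

lemma integral_scaleR_complex:
  fixes f :: "complex \<Rightarrow> complex"
  assumes [measurable]: "f \<in> borel_measurable borel" and "c \<noteq> 0"
  shows "(\<integral>w. f w \<partial>lborel) = c\<^sup>2 *\<^sub>R (\<integral>w. f (c *\<^sub>R w) \<partial>lborel)"
proof -
  have "(\<integral>w. f w \<partial>lborel) = (\<integral>w. f w \<partial>density (distr lborel borel (\<lambda>w. c *\<^sub>R w)) (\<lambda>_. \<bar>c\<bar>^DIM(complex)))"
    using lborel_affine[OF assms(2), of "0::complex"] by simp
  also have "\<dots> = c\<^sup>2 *\<^sub>R (\<integral>w. f (c *\<^sub>R w) \<partial>lborel)"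
    by (simp add: integral_density integral_distr)
  finally show ?thesis .
qed

lemma integral_half_add_ii:
  fixes f g :: "_ \<Rightarrow> complex"
  assumes "integrable M f" "integrable M g"
  shows "(\<integral>w. (f w + \<i> * g w) / 2 \<partial>M) = ((\<integral>w. f w \<partial>M) + \<i> * (\<integral>w. g w \<partial>M)) / 2"
  using assms by simp

text \<open>The total mass of the approximate identity that arises in \<open>integral_dbar_reg_kernel\<close>. Its value is
\<open>\<pi>\<close>. As a factor that only has to be divided out, it is kept as an integral.\<close>

definition cauchy_const :: real where
  "cauchy_const = (\<integral>u. 1 / (1 + (cmod u)\<^sup>2)\<^sup>2 \<partial>(lborel::complex measure))"

lemma integrable_cauchy_const: "integrable lborel (\<lambda>u::complex. 1 / (1 + (cmod u)\<^sup>2)\<^sup>2)"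
proof (rule integrableI_bounded)
  define f where "f x = ennreal (inverse (1 + x\<^sup>2))" for x :: real
  have [measurable]: "f \<in> borel_measurable borel" unfolding f_def by measurable
  have "(\<integral>\<^sup>+x. f x \<partial>lborel) \<le> 2 * (\<integral>\<^sup>+x. f x * indicator {0..} x \<partial>lborel)"
    by (rule nn_integral_even_bound) (auto simp: f_def)
  also have "(\<integral>\<^sup>+x. f x * indicator {0..} x \<partial>lborel) = ennreal (pi / 2 - arctan 0)"
    unfolding f_def
    by (rule nn_integral_FTC_atLeast) (use tendsto_arctan_at_top in \<open>auto intro!: derivative_eq_intros\<close>)
  finally have fin: "(\<integral>\<^sup>+x. f x \<partial>lborel) < \<infinity>"
    by (rule order.strict_trans1) (auto simp: ennreal_mult_less_top)
  have "(\<integral>\<^sup>+u. ennreal (norm (1 / (1 + (cmod u)\<^sup>2)\<^sup>2)) \<partial>(lborel::complex measure)) \<le> (\<integral>\<^sup>+u. f (Re u) * f (Im u) \<partial>lborel)"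
  proof (rule nn_integral_mono)
    fix u :: complex
    have "(1 + (Re u)\<^sup>2) * (1 + (Im u)\<^sup>2) \<le> (1 + (cmod u)\<^sup>2) * (1 + (cmod u)\<^sup>2)"
      by (intro mult_mono) (auto simp: cmod_power2)
    then have "1 / (1 + (cmod u)\<^sup>2)\<^sup>2 \<le> 1 / ((1 + (Re u)\<^sup>2) * (1 + (Im u)\<^sup>2))"
      by (intro divide_left_mono) (auto simp: power2_eq_square intro!: mult_pos_pos add_pos_nonneg)
    also have "\<dots> = inverse (1 + (Re u)\<^sup>2) * inverse (1 + (Im u)\<^sup>2)" by (simp add: divide_inverse)
    finally show "ennreal (norm (1 / (1 + (cmod u)\<^sup>2)\<^sup>2)) \<le> f (Re u) * f (Im u)"
      by (simp add: f_def ennreal_mult[symmetric] ennreal_leI)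
  qed
  also have "\<dots> = (\<integral>\<^sup>+x. f x \<partial>lborel) * (\<integral>\<^sup>+x. f x \<partial>lborel)" by (rule nn_integral_complex_prod) auto
  also have "\<dots> < \<infinity>" using fin by (auto simp: ennreal_mult_less_top)
  finally show "(\<integral>\<^sup>+u. ennreal (norm (1 / (1 + (cmod u)\<^sup>2)\<^sup>2)) \<partial>(lborel::complex measure)) < \<infinity>" .
qed simp

lemma cauchy_const_pos: "cauchy_const > 0"
proof -
  have "cauchy_const \<ge> 0" unfolding cauchy_const_def by simp
  moreover have "cauchy_const \<noteq> 0"
  proof
    assume "cauchy_const = 0"
    then have "AE u::complex in lborel. 1 / (1 + (cmod u)\<^sup>2)\<^sup>2 = 0"
      using integrable_cauchy_const unfolding cauchy_const_def
      by (subst (asm) integral_nonneg_eq_0_iff_AE) auto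
    moreover have "1 / (1 + (cmod u)\<^sup>2)\<^sup>2 \<noteq> 0" for u :: complex
      by (smt (verit) divide_eq_0_iff power_not_zero zero_le_power2)
    ultimately have "AE u::complex in lborel. False" by simp
    then show False by (simp add: AE_iff_measurable[of UNIV])
  qed
  ultimately show ?thesis by simp
qed

lemma reg_kernel_has_derivative:
  fixes e :: real assumes "e > 0"
  shows "((\<lambda>w. cnj w / of_real ((cmod w)\<^sup>2 + e\<^sup>2)) has_derivative
    (\<lambda>v. (cnj v * of_real ((cmod w)\<^sup>2 + e\<^sup>2) - cnj w * of_real (2 * (w \<bullet> v))) / of_real (((cmod w)\<^sup>2 + e\<^sup>2)\<^sup>2))) (at w)"
proof -
  have nz: "(cmod w)\<^sup>2 + e\<^sup>2 \<noteq> 0" using assms by (smt (verit) zero_le_power2 zero_less_power)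
  have d1: "((\<lambda>w. complex_of_real ((w \<bullet> w) + e\<^sup>2)) has_derivative (\<lambda>v. of_real (2 * (w \<bullet> v)))) (at w)"
    by (auto intro!: derivative_eq_intros simp: inner_commute)
  have d2: "(cnj has_derivative cnj) (at w)"
    by (rule bounded_linear_imp_has_derivative) (rule bounded_linear_cnj)
  have "((\<lambda>w. cnj w / complex_of_real ((w \<bullet> w) + e\<^sup>2)) has_derivative
    (\<lambda>v. (cnj v * of_real ((w \<bullet> w) + e\<^sup>2) - cnj w * of_real (2 * (w \<bullet> v))) / 
       (of_real ((w \<bullet> w) + e\<^sup>2) * of_real ((w \<bullet> w) + e\<^sup>2)))) (at w)"
    by (rule has_derivative_divide'[OF d2 d1]) (use nz in \<open>simp only: of_real_eq_0_iff power2_norm_eq_inner\<close>, simp)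
  then show ?thesis by (simp add: power2_norm_eq_inner power2_eq_square[of "_ + _"])
qed

lemma Ck_reg_kernel:
  assumes "e > 0"
  shows "Ck (Suc 0) (\<lambda>w. cnj w / of_real ((cmod w)\<^sup>2 + e\<^sup>2))"
proof (rule Ck_SucI[OF reg_kernel_has_derivative[OF assms]])
  fix v :: complex
  have "(cmod w)\<^sup>2 + e\<^sup>2 \<noteq> 0" for w using assms by (smt (verit) zero_le_power2 zero_less_power)
  then have "complex_of_real (((cmod w)\<^sup>2 + e\<^sup>2)\<^sup>2) \<noteq> 0" for w
    by (metis of_real_eq_0_iff power_not_zero)
  then show "Ck 0 (\<lambda>w. (cnj v * of_real ((cmod w)\<^sup>2 + e\<^sup>2) - cnj w * of_real (2 * (w \<bullet> v))) / of_real (((cmod w)\<^sup>2 + e\<^sup>2)\<^sup>2))"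
    unfolding Ck.simps by (intro continuous_intros) auto
qed

text \<open>The smooth kernel \<open>cnj w / (|w|\<^sup>2 + e\<^sup>2)\<close> replaces \<open>1/w\<close>. Its z-bar-derivative is
\<open>e\<^sup>2 / (|w|\<^sup>2 + e\<^sup>2)\<^sup>2\<close>, so integration by parts and the substitution \<open>w = e u\<close> give the
right-hand side.\<close>

lemma integral_dbar_reg_kernel:
  fixes \<psi> :: "complex \<Rightarrow> complex"
  assumes \<psi>: "Ck (Suc 0) \<psi>" and K: "compact K" "\<And>x. x \<notin> K \<Longrightarrow> \<psi> x = 0" and e: "e > 0"
  shows "(\<integral>w. (frechet_derivative \<psi> (at w) 1 + \<i> * frechet_derivative \<psi> (at w) \<i>) / 2 *
      (cnj w / of_real ((cmod w)\<^sup>2 + e\<^sup>2)) \<partial>lborel) =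
    - (\<integral>u. \<psi> (e *\<^sub>R u) * of_real (1 / (1 + (cmod u)\<^sup>2)\<^sup>2) \<partial>lborel)"
proof -
  let ?k = "\<lambda>w. cnj w / complex_of_real ((cmod w)\<^sup>2 + e\<^sup>2)"
  let ?k' = "\<lambda>w v. (cnj v * of_real ((cmod w)\<^sup>2 + e\<^sup>2) - cnj w * of_real (2 * (w \<bullet> v))) / complex_of_real (((cmod w)\<^sup>2 + e\<^sup>2)\<^sup>2)"
  let ?D = "\<lambda>w v. frechet_derivative \<psi> (at w) v"
  let ?F = "\<lambda>w. \<psi> w * ?k w"
  have nz: "(cmod w)\<^sup>2 + e\<^sup>2 > 0" for w using e by (smt (verit) zero_le_power2 zero_less_power)
  have CF: "Ck (Suc 0) ?F" by (rule Ck_mult[OF \<psi> Ck_reg_kernel[OF e]])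
  have dF: "(?F has_derivative (\<lambda>v. \<psi> w * ?k' w v + ?D w v * ?k w)) (at w)" for w
    by (rule has_derivative_mult[OF Ck_has_derivative[OF \<psi>] reg_kernel_has_derivative[OF e]])
  have fd: "frechet_derivative ?F (at w) = (\<lambda>v. \<psi> w * ?k' w v + ?D w v * ?k w)" for w
    using frechet_derivative_at[OF dF] by simp
  have FK: "x \<notin> K \<Longrightarrow> ?F x = 0" for x using K(2) by simp
  have z: "(\<integral>w. \<psi> w * ?k' w v + ?D w v * ?k w \<partial>lborel) = 0" for v
    using integral_frechet_derivative_zero[OF CF K(1) FK, of v] unfolding fd by simp
  have cont: "continuous_on UNIV (\<lambda>w. ?D w v)" if "v \<in> Basis" for v using \<psi> that by simp
  have ck: "continuous_on UNIV ?k" by (rule Ck_continuous[OF Ck_reg_kernel[OF e]])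
  have "complex_of_real (((cmod w)\<^sup>2 + e\<^sup>2)\<^sup>2) \<noteq> 0" for w
    using nz[of w] by (metis of_real_eq_0_iff power_not_zero less_irrefl)
  then have ck': "continuous_on UNIV (\<lambda>w. ?k' w v)" for v
    by (intro continuous_intros) auto
  have int: "integrable lborel f" if "continuous_on UNIV f" "\<And>x. x \<notin> K \<Longrightarrow> f x = 0" for f :: "complex \<Rightarrow> complex"
  proof -
    have "integrable lborel (\<lambda>x. indicator K x *\<^sub>R f x)"
      using borel_integrable_compact[OF K(1), of f] that(1) by (auto intro: continuous_on_subset simp: set_integrable_def)
    moreover have "indicator K x *\<^sub>R f x = f x" for x using that(2) by (auto split: split_indicator)
    ultimately show ?thesis by simp
  qed
  have D0: "x \<notin> K \<Longrightarrow> ?D x v = 0" for x v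
    by (rule frechet_derivative_zero_outside[OF compact_imp_closed[OF K(1)] K(2)])
  have B: "1 \<in> (Basis::complex set)" "\<i> \<in> (Basis::complex set)" by (auto simp: Basis_complex_def)
  have i1: "integrable lborel (\<lambda>w. \<psi> w * ?k' w v)" for v
    by (rule int[OF continuous_on_mult[OF Ck_continuous[OF \<psi>] ck']]) (drule K(2), simp only: mult_zero_left)
  have i2: "integrable lborel (\<lambda>w. ?D w v * ?k w)" if "v \<in> Basis" for v
    by (rule int[OF continuous_on_mult[OF cont[OF that] ck]]) (drule D0[of _ v], simp only: mult_zero_left)
  have eq: "(\<integral>w. ?D w v * ?k w \<partial>lborel) = - (\<integral>w. \<psi> w * ?k' w v \<partial>lborel)" if "v \<in> Basis" for v
    using z[of v] Bochner_Integration.integral_add[OF i1 i2[OF that]] by (simp add: add_eq_0_iff)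
  have sum: "?k' w 1 + \<i> * ?k' w \<i> = of_real (2 * e\<^sup>2 / ((cmod w)\<^sup>2 + e\<^sup>2)\<^sup>2)" for w
  proof -
    have 1: "of_real (w \<bullet> 1) + \<i> * of_real (w \<bullet> \<i>) = w" by (simp add: inner_complex_def complex_eq_iff)
    have 2: "cnj w * w = of_real ((cmod w)\<^sup>2)" by (metis complex_norm_square mult.commute)
    have "?k' w 1 + \<i> * ?k' w \<i> = (2 * of_real ((cmod w)\<^sup>2 + e\<^sup>2) - 2 * (cnj w * (of_real (w \<bullet> 1) + \<i> * of_real (w \<bullet> \<i>)))) / of_real (((cmod w)\<^sup>2 + e\<^sup>2)\<^sup>2)"
      by (simp add: add_divide_distrib diff_divide_distrib algebra_simps)
    also have "\<dots> = of_real (2 * e\<^sup>2) / of_real (((cmod w)\<^sup>2 + e\<^sup>2)\<^sup>2)"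
      unfolding 1 2 by simp
    finally show ?thesis by simp
  qed
  have "(\<integral>w. (?D w 1 + \<i> * ?D w \<i>) / 2 * ?k w \<partial>lborel) = (\<integral>w. (?D w 1 * ?k w + \<i> * (?D w \<i> * ?k w)) / 2 \<partial>lborel)"
  proof -
    have "(a + \<i> * b) / 2 * c = (a * c + \<i> * (b * c)) / 2" for a b c :: complex by (simp add: algebra_simps)
    then show ?thesis by (simp only:)
  qed
  also have "\<dots> = ((\<integral>w. ?D w 1 * ?k w \<partial>lborel) + \<i> * (\<integral>w. ?D w \<i> * ?k w \<partial>lborel)) / 2"
    by (rule integral_half_add_ii[OF i2[OF B(1)] i2[OF B(2)]])
  also have "\<dots> = - ((\<integral>w. \<psi> w * ?k' w 1 \<partial>lborel) + \<i> * (\<integral>w. \<psi> w * ?k' w \<i> \<partial>lborel)) / 2"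
    unfolding eq[OF B(1)] eq[OF B(2)] by simp
  also have "\<dots> = - (\<integral>w. (\<psi> w * ?k' w 1 + \<i> * (\<psi> w * ?k' w \<i>)) / 2 \<partial>lborel)"
    unfolding integral_half_add_ii[OF i1[of 1] i1[of \<i>]] minus_divide_left ..
  also have "\<dots> = - (\<integral>w. \<psi> w * of_real (e\<^sup>2 / ((cmod w)\<^sup>2 + e\<^sup>2)\<^sup>2) \<partial>lborel)"
  proof -
    have "(\<psi> w * ?k' w 1 + \<i> * (\<psi> w * ?k' w \<i>)) / 2 = \<psi> w * of_real (e\<^sup>2 / ((cmod w)\<^sup>2 + e\<^sup>2)\<^sup>2)" for w
    proof -
      have "(\<psi> w * ?k' w 1 + \<i> * (\<psi> w * ?k' w \<i>)) / 2 = \<psi> w * (?k' w 1 + \<i> * ?k' w \<i>) / 2" by (simp only: distrib_left mult.left_commute)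
      also have "\<dots> = \<psi> w * of_real (e\<^sup>2 / ((cmod w)\<^sup>2 + e\<^sup>2)\<^sup>2)" unfolding sum by simp
      finally show ?thesis .
    qed
    then show ?thesis by simp
  qed
  also have "\<dots> = - (e\<^sup>2 *\<^sub>R (\<integral>w. \<psi> (e *\<^sub>R w) * of_real (e\<^sup>2 / ((cmod (e *\<^sub>R w))\<^sup>2 + e\<^sup>2)\<^sup>2) \<partial>lborel))"
  proof -
    have [measurable]: "\<psi> \<in> borel_measurable borel" by (rule borel_measurable_continuous_onI[OF Ck_continuous[OF \<psi>]])
    show ?thesis
      by (subst integral_scaleR_complex[where c=e]) (use e in auto)
  qed
  also have "\<dots> = - (\<integral>w. \<psi> (e *\<^sub>R w) * of_real (1 / (1 + (cmod w)\<^sup>2)\<^sup>2) \<partial>lborel)"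
  proof -
    have "e\<^sup>2 *\<^sub>R (\<psi> (e *\<^sub>R w) * of_real (e\<^sup>2 / ((cmod (e *\<^sub>R w))\<^sup>2 + e\<^sup>2)\<^sup>2)) = \<psi> (e *\<^sub>R w) * of_real (1 / (1 + (cmod w)\<^sup>2)\<^sup>2)" for w
    proof -
      have "e\<^sup>2 * (e\<^sup>2 / ((cmod (e *\<^sub>R w))\<^sup>2 + e\<^sup>2)\<^sup>2) = e\<^sup>2 * e\<^sup>2 / (e\<^sup>2 * (1 + (cmod w)\<^sup>2))\<^sup>2"
        by (simp add: power_mult_distrib algebra_simps)
      also have "\<dots> = (e\<^sup>2)\<^sup>2 * 1 / ((e\<^sup>2)\<^sup>2 * (1 + (cmod w)\<^sup>2)\<^sup>2)" by (simp only: power_mult_distrib power2_eq_square[of "e\<^sup>2"] mult_1_right)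
      also have "\<dots> = 1 / (1 + (cmod w)\<^sup>2)\<^sup>2" using e by (subst mult_divide_mult_cancel_left) auto
      finally have eq: "e\<^sup>2 * (e\<^sup>2 / ((cmod (e *\<^sub>R w))\<^sup>2 + e\<^sup>2)\<^sup>2) = 1 / (1 + (cmod w)\<^sup>2)\<^sup>2" .
      show ?thesis unfolding eq[symmetric] scaleR_conv_of_real by (simp only: of_real_mult mult.left_commute)
    qed
    then show ?thesis by (simp only: integral_scaleR_right[symmetric])
  qed
  finally show ?thesis .
qed

text \<open>The Cauchy-Pompeiu formula at the origin, the limit \<open>e \<rightarrow> 0\<close> of the formula for the smooth
kernel. Both sides converge by dominated convergence: the regularised kernels are bounded by
\<open>1/|w|\<close>, and \<open>\<psi> (e u)\<close> tends to \<open>\<psi> 0\<close>.\<close>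

lemma integral_dbar_cauchy:
  fixes \<psi> :: "complex \<Rightarrow> complex"
  assumes \<psi>: "Ck (Suc 0) \<psi>" and K: "compact K" "\<And>x. x \<notin> K \<Longrightarrow> \<psi> x = 0" and R: "K \<subseteq> cball 0 R"
  shows "(\<integral>w. (frechet_derivative \<psi> (at w) 1 + \<i> * frechet_derivative \<psi> (at w) \<i>) / 2 *
      cauchy_kernel R w \<partial>lborel) = - of_real cauchy_const * \<psi> 0"
proof -
  let ?g = "\<lambda>w. (frechet_derivative \<psi> (at w) 1 + \<i> * frechet_derivative \<psi> (at w) \<i>) / 2"
  define e where "e n = 1 / real (Suc n)" for n
  have e: "e n > 0" for n by (simp add: e_def)
  have e0: "e \<longlonglongrightarrow> 0" unfolding e_def using LIMSEQ_Suc[OF lim_1_over_n[where 'a=real]] by simp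
  have B: "1 \<in> (Basis::complex set)" "\<i> \<in> (Basis::complex set)" by (auto simp: Basis_complex_def)
  have cg: "continuous_on UNIV ?g" using \<psi> B by (auto intro!: continuous_intros)
  have g0: "x \<notin> K \<Longrightarrow> ?g x = 0" for x
    using frechet_derivative_zero_outside[OF compact_imp_closed[OF K(1)] K(2)] by simp
  obtain M where M: "M > 0" "\<And>x. norm (?g x) \<le> M" using bounded_compact_support[OF cg K(1) g0] by blast
  obtain M' where M': "M' > 0" "\<And>x. norm (\<psi> x) \<le> M'"
    using bounded_compact_support[OF Ck_continuous[OF \<psi>] K] by blast
  have [measurable]: "cnj \<in> borel_measurable borel"
    by (intro borel_measurable_continuous_onI continuous_intros)
  have [measurable]: "(\<lambda>w. frechet_derivative \<psi> (at w) 1) \<in> borel_measurable borel"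
    "(\<lambda>w. frechet_derivative \<psi> (at w) \<i>) \<in> borel_measurable borel"
    using \<psi> B by (auto intro!: borel_measurable_continuous_onI)
  have [measurable]: "\<psi> \<in> borel_measurable borel" by (rule borel_measurable_continuous_onI[OF Ck_continuous[OF \<psi>]])
  have L1: "(\<lambda>n. \<integral>w. ?g w * (cnj w / of_real ((cmod w)\<^sup>2 + (e n)\<^sup>2)) \<partial>lborel) \<longlonglongrightarrow> (\<integral>w. ?g w * cauchy_kernel R w \<partial>lborel)"
  proof (rule integral_dominated_convergence[where w="\<lambda>w. M * norm (cauchy_kernel R w)"])
    show "integrable lborel (\<lambda>w. M * norm (cauchy_kernel R w))" using integrable_cauchy_kernel by simp
    show "AE w in lborel. (\<lambda>n. ?g w * (cnj w / of_real ((cmod w)\<^sup>2 + (e n)\<^sup>2))) \<longlonglongrightarrow> ?g w * cauchy_kernel R w"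
      using AE_lborel_singleton[of 0]
    proof eventually_elim
      case (elim w)
      show ?case
      proof (cases "w \<in> K")
        case True
        then have "cauchy_kernel R w = cnj w / of_real ((cmod w)\<^sup>2 + 0\<^sup>2)"
          using R elim complex_norm_square[of w] by (auto simp: cauchy_kernel_def field_simps)
        moreover have "(\<lambda>n. ?g w * (cnj w / of_real ((cmod w)\<^sup>2 + (e n)\<^sup>2))) \<longlonglongrightarrow> ?g w * (cnj w / of_real ((cmod w)\<^sup>2 + 0\<^sup>2))"
          using elim by (intro tendsto_intros e0) auto
        ultimately show ?thesis by simp
      qed (drule g0, simp only: mult_zero_left tendsto_const)
    qed
    show "AE w in lborel. norm (?g w * (cnj w / of_real ((cmod w)\<^sup>2 + (e n)\<^sup>2))) \<le> M * norm (cauchy_kernel R w)" for n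
      using AE_lborel_singleton[of 0]
    proof eventually_elim
      case (elim w)
      show ?case
      proof (cases "w \<in> K")
        case True
        have "norm (cnj w / complex_of_real ((cmod w)\<^sup>2 + (e n)\<^sup>2)) = cmod w / ((cmod w)\<^sup>2 + (e n)\<^sup>2)"
          by (simp only: norm_divide complex_mod_cnj norm_of_real) simp
        also have "\<dots> \<le> cmod w / (cmod w)\<^sup>2"
          using elim by (intro divide_left_mono) (auto intro!: mult_pos_pos add_pos_nonneg)
        also have "\<dots> = norm (cauchy_kernel R w)"
          using True R elim by (auto simp: cauchy_kernel_def norm_divide power2_eq_square field_simps)
        finally show ?thesis using M by (simp only: norm_mult) (intro mult_mono, auto)
      next
        case False
        show ?thesis unfolding norm_mult g0[OF False] using M(1) by simp
      qed
    qed
  qed measurable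
  have L2: "(\<lambda>n. \<integral>u. \<psi> (e n *\<^sub>R u) * of_real (1 / (1 + (cmod u)\<^sup>2)\<^sup>2) \<partial>lborel) \<longlonglongrightarrow>
    (\<integral>u. \<psi> 0 * of_real (1 / (1 + (cmod u)\<^sup>2)\<^sup>2) \<partial>(lborel::complex measure))"
  proof (rule integral_dominated_convergence[where w="\<lambda>u. M' * (1 / (1 + (cmod u)\<^sup>2)\<^sup>2)"])
    show "integrable lborel (\<lambda>u::complex. M' * (1 / (1 + (cmod u)\<^sup>2)\<^sup>2))"
      by (intro integrable_mult_right integrable_cauchy_const)
    show "AE u in lborel. (\<lambda>n. \<psi> (e n *\<^sub>R u) * of_real (1 / (1 + (cmod u)\<^sup>2)\<^sup>2)) \<longlonglongrightarrow> \<psi> 0 * of_real (1 / (1 + (cmod u)\<^sup>2)\<^sup>2)"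
    proof (intro AE_I2 tendsto_mult tendsto_const)
      fix u :: complex
      have "(\<lambda>n. e n *\<^sub>R u) \<longlonglongrightarrow> 0 *\<^sub>R u" by (rule tendsto_scaleR[OF e0 tendsto_const])
      then have "(\<lambda>n. \<psi> (e n *\<^sub>R u)) \<longlonglongrightarrow> \<psi> (0 *\<^sub>R u)"
        using Ck_continuous[OF \<psi>] by (intro continuous_on_tendsto_compose[of UNIV \<psi>]) auto
      then show "(\<lambda>n. \<psi> (e n *\<^sub>R u)) \<longlonglongrightarrow> \<psi> 0" by simp
    qed
    show "AE u in lborel. norm (\<psi> (e n *\<^sub>R u) * of_real (1 / (1 + (cmod u)\<^sup>2)\<^sup>2)) \<le> M' * (1 / (1 + (cmod u)\<^sup>2)\<^sup>2)" for n
      using M' by (intro AE_I2) (simp only: norm_mult norm_of_real abs_divide, intro mult_mono, auto)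
  qed measurable
  have "(\<integral>u. \<psi> 0 * of_real (1 / (1 + (cmod u)\<^sup>2)\<^sup>2) \<partial>(lborel::complex measure)) = \<psi> 0 * of_real cauchy_const"
    unfolding cauchy_const_def by (simp only: integral_mult_right_zero integral_complex_of_real)
  with L2 have L3: "(\<lambda>n. \<integral>u. \<psi> (e n *\<^sub>R u) * of_real (1 / (1 + (cmod u)\<^sup>2)\<^sup>2) \<partial>lborel) \<longlonglongrightarrow> \<psi> 0 * of_real cauchy_const" by simp
  have "(\<lambda>n. - (\<integral>u. \<psi> (e n *\<^sub>R u) * of_real (1 / (1 + (cmod u)\<^sup>2)\<^sup>2) \<partial>lborel)) \<longlonglongrightarrow> (\<integral>w. ?g w * cauchy_kernel R w \<partial>lborel)"
    using L1 by (rule back_subst[where P="\<lambda>f. f \<longlonglongrightarrow> _"])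
      (rule ext, rule integral_dbar_reg_kernel[OF \<psi> K e])
  from LIMSEQ_unique[OF this tendsto_minus[OF L3]] show ?thesis by (simp add: mult.commute)
qed

section \<open>Translations along one coordinate\<close>

lemma nn_integral_reflect:
  fixes z :: "'a::euclidean_space"
  assumes [measurable]: "f \<in> borel_measurable borel"
  shows "(\<integral>\<^sup>+w. f (z - w) \<partial>lborel) = (\<integral>\<^sup>+w. f w \<partial>lborel)"
proof -
  have "(\<integral>\<^sup>+w. f w \<partial>lborel) = (\<integral>\<^sup>+w. f w \<partial>density (distr lborel borel (\<lambda>w. z + (-1) *\<^sub>R w)) (\<lambda>_. 1))"
    using lborel_affine[of "-1" z] by simp
  also have "\<dots> = (\<integral>\<^sup>+w. f (z - w) \<partial>lborel)"
    by (simp add: nn_integral_density nn_integral_distr)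
  finally show ?thesis by simp
qed

lemma bounded_linear_axis: "bounded_linear (axis j :: complex \<Rightarrow> complex^'n)"
proof (rule linear_conv_bounded_linear[THEN iffD1])
  show "linear (axis j :: complex \<Rightarrow> complex^'n)"
    by (rule linearI) (auto simp: vec_eq_iff axis_def)
qed

lemma axis_measurable [measurable]: "(axis j :: complex \<Rightarrow> complex^'n) \<in> borel_measurable borel"
  by (intro borel_measurable_continuous_onI linear_continuous_on bounded_linear_axis)

lemma component_measurable [measurable]: "(\<lambda>z::complex^'n. z $ j) \<in> borel_measurable borel"
  by (intro borel_measurable_continuous_onI continuous_intros)

lemma axis_measurable' [measurable (raw)]:
  "f \<in> borel_measurable M \<Longrightarrow> (\<lambda>x. axis j (f x) :: complex^'n) \<in> borel_measurable M"
  by (rule measurable_compose[OF _ axis_measurable])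

lemma component_measurable' [measurable (raw)]:
  "f \<in> borel_measurable M \<Longrightarrow> (\<lambda>x. (f x :: complex^'n) $ j) \<in> borel_measurable M"
  by (rule measurable_compose[OF _ component_measurable])

lemma axis_nth_same [simp]: "axis j w $ j = w" by (simp add: axis_def)
lemma axis_nth_other: "i \<noteq> j \<Longrightarrow> axis j w $ i = 0" by (simp add: axis_def)

lemma indicator_cball_measurable [measurable]: "(indicator (cball (z::'a::euclidean_space) r) :: _ \<Rightarrow> ennreal) \<in> borel_measurable borel"
    "(indicator (cball (z::'a::euclidean_space) r) :: _ \<Rightarrow> real) \<in> borel_measurable borel"
  by (intro borel_measurable_indicator, simp)+

lemma AE_component_nonzero: "AE y::complex^'n in lborel. y $ j \<noteq> 0"
proof -
  have "axis j (1::complex) \<in> Basis" by (simp add: axis_in_Basis_iff)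
  from AE_lborel_inner_neq[OF this, of 0]
  show ?thesis by eventually_elim (auto simp: inner_axis)
qed

text \<open>Convolution in the \<open>j\<close>-th coordinate moves from one factor to the other with its direction
reversed. This is the source both of the Schur test and of the adjoint of the Cauchy transform.\<close>

lemma nn_integral_shift_adjoint:
  fixes U :: "complex^'n \<Rightarrow> ennreal"
  assumes [measurable]: "U \<in> borel_measurable borel" "G \<in> borel_measurable borel" "\<kappa> \<in> borel_measurable borel"
  shows "(\<integral>\<^sup>+z. G z * (\<integral>\<^sup>+w. U (z - axis j w) * \<kappa> w \<partial>lborel) \<partial>lborel) =
    (\<integral>\<^sup>+y. U y * (\<integral>\<^sup>+w. G (y + axis j w) * \<kappa> w \<partial>lborel) \<partial>lborel)"
proof -
  have "(\<integral>\<^sup>+z. G z * (\<integral>\<^sup>+w. U (z - axis j w) * \<kappa> w \<partial>lborel) \<partial>lborel) =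
    (\<integral>\<^sup>+z. \<integral>\<^sup>+w. G z * (U (z - axis j w) * \<kappa> w) \<partial>lborel \<partial>lborel)"
    by (intro nn_integral_cong nn_integral_cmult[symmetric]) simp
  also have "\<dots> = (\<integral>\<^sup>+w. \<integral>\<^sup>+z. G z * (U (z - axis j w) * \<kappa> w) \<partial>lborel \<partial>lborel)"
    by (rule lborel_pair.Fubini'[symmetric]) simp
  also have "\<dots> = (\<integral>\<^sup>+w. \<integral>\<^sup>+y. G (y + axis j w) * (U y * \<kappa> w) \<partial>lborel \<partial>lborel)"
  proof (rule nn_integral_cong)
    fix w
    show "(\<integral>\<^sup>+z. G z * (U (z - axis j w) * \<kappa> w) \<partial>lborel) = (\<integral>\<^sup>+y. G (y + axis j w) * (U y * \<kappa> w) \<partial>lborel)"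
      by (subst nn_integral_translate[symmetric, where c="axis j w"]) simp_all
  qed
  also have "\<dots> = (\<integral>\<^sup>+y. \<integral>\<^sup>+w. G (y + axis j w) * (U y * \<kappa> w) \<partial>lborel \<partial>lborel)"
    by (rule lborel_pair.Fubini') simp
  also have "\<dots> = (\<integral>\<^sup>+y. U y * (\<integral>\<^sup>+w. G (y + axis j w) * \<kappa> w \<partial>lborel) \<partial>lborel)"
    by (intro nn_integral_cong) (simp add: nn_integral_cmult[symmetric] mult.left_commute)
  finally show ?thesis .
qed

text \<open>The Cauchy transform of \<open>|u|\<close> with the kernel replaced by its absolute value. Its values lie in
the extended reals, so estimates can be made before any integral is known to converge.\<close>

definition cauchy_majorant :: "real \<Rightarrow> 'n \<Rightarrow> (complex^'n \<Rightarrow> complex) \<Rightarrow> complex^'n::finite \<Rightarrow> ennreal" where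
  "cauchy_majorant R j u z =
     (\<integral>\<^sup>+w. ennreal (cmod (u (z - axis j w))) * ennreal (cmod (cauchy_kernel R w)) \<partial>lborel)"

lemma cauchy_majorant_measurable [measurable]:
  assumes [measurable]: "u \<in> borel_measurable borel"
  shows "cauchy_majorant R j u \<in> borel_measurable borel"
  unfolding cauchy_majorant_def[abs_def] by measurable

section \<open>Extended real powers and bounds in L^p\<close>

lemma enn2real_ge_1: "1 \<le> p \<Longrightarrow> p \<noteq> \<infinity> \<Longrightarrow> enn2real p \<ge> 1"
  by (metis enn2real_mono enn2real_1 ennreal_less_top infinity_ennreal_def less_top)

text \<open>The real power extended to \<open>\<infinity>\<close> by \<open>\<infinity>\<close>, also for the exponent zero.\<close>

definition ennreal_powr :: "real \<Rightarrow> ennreal \<Rightarrow> ennreal" where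
  "ennreal_powr p x = (if x = \<infinity> then \<infinity> else ennreal (enn2real x powr p))"

lemma ennreal_powr_ennreal: "r \<ge> 0 \<Longrightarrow> ennreal_powr p (ennreal r) = ennreal (r powr p)"
  by (simp add: ennreal_powr_def)

lemma ennreal_powr_mono: "p \<ge> 0 \<Longrightarrow> x \<le> y \<Longrightarrow> ennreal_powr p x \<le> ennreal_powr p y"
  by (cases x; cases y) (auto simp: ennreal_powr_def ennreal_leI powr_mono2 top_unique)

lemma ennreal_powr_0 [simp]: "ennreal_powr p 0 = 0" by (simp add: ennreal_powr_def)

lemma ennreal_powr_mult: "r > 0 \<Longrightarrow> ennreal_powr p (ennreal r * x) = ennreal (r powr p) * ennreal_powr p x"
  by (cases x) (auto simp: ennreal_powr_def ennreal_mult[symmetric] ennreal_mult_top enn2real_mult powr_mult)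

lemma ennreal_powr_measurable [measurable]: "ennreal_powr p \<in> borel_measurable borel"
  unfolding ennreal_powr_def[abs_def] by measurable

text \<open>The statement that the \<open>L\<^sup>p\<close> norm of \<open>f\<close> is at most \<open>A\<close>, for extended nonnegative
functions. For finite \<open>p\<close> it compares \<open>p\<close>-th powers, so no root of an integral is taken.\<close>

definition Lp_le :: "ennreal \<Rightarrow> 'a measure \<Rightarrow> ('a \<Rightarrow> ennreal) \<Rightarrow> real \<Rightarrow> bool" where
  "Lp_le p M f A \<longleftrightarrow> (if p = \<infinity> then AE x in M. f x \<le> ennreal A
     else (\<integral>\<^sup>+x. ennreal_powr (enn2real p) (f x) \<partial>M) \<le> ennreal (A powr enn2real p))"

text \<open>The convex function \<open>x\<^sup>p\<close> lies above its tangent at \<open>m\<close>; solving the tangent inequality for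
\<open>x\<close> gives this form.\<close>

lemma powr_tangent:
  fixes x m p :: real
  assumes "p \<ge> 1" "m > 0" "x \<ge> 0"
  shows "x \<le> (1 - 1 / p) * m + x powr p / (p * m powr (p - 1))"
proof (cases "x = 0")
  case True
  then show ?thesis using assms by simp
next
  case False
  define t where "t = x / m"
  have t: "t > 0" using assms False by (simp add: t_def)
  have "(t powr p) powr (1 / p) * 1 powr (1 - 1 / p) \<le> (1 / p) * t powr p + (1 - 1 / p) * 1"
    using assms t by (intro Youngs_inequality_0) (auto simp: field_simps)
  then have "t \<le> (1 - 1 / p) + t powr p / p" using t assms by (simp add: powr_powr)
  then have "m * t \<le> m * ((1 - 1 / p) + t powr p / p)" using assms by (intro mult_left_mono) auto
  moreover have "m * t = x" using assms by (simp add: t_def)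
  moreover have "m * (t powr p / p) = x powr p / (p * m powr (p - 1))"
    using assms by (simp add: t_def powr_divide powr_diff field_simps)
  ultimately show ?thesis by (simp add: algebra_simps)
qed

text \<open>Jensen's inequality for a measure \<open>g M\<close> of total mass at most \<open>C\<close>. It follows by integrating
the tangent inequality at the point \<open>m\<close> with \<open>m\<^sup>p = S / C\<close>, where \<open>S\<close> is the integral on
the right.\<close>

lemma nn_integral_jensen:
  fixes f g :: "'a \<Rightarrow> real"
  assumes [measurable]: "f \<in> borel_measurable M" "g \<in> borel_measurable M"
    and f: "\<And>x. f x \<ge> 0" and g: "\<And>x. g x \<ge> 0" and p: "p \<ge> 1" and C: "C > 0"
    and gC: "(\<integral>\<^sup>+x. ennreal (g x) \<partial>M) \<le> ennreal C"
  shows "ennreal_powr p (\<integral>\<^sup>+x. ennreal (f x * g x) \<partial>M) \<le>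
    ennreal (C powr (p - 1)) * (\<integral>\<^sup>+x. ennreal (f x powr p * g x) \<partial>M)"
proof -
  let ?S = "\<integral>\<^sup>+x. ennreal (f x powr p * g x) \<partial>M"
  show ?thesis
  proof (cases "?S = \<infinity>")
    case True
    then show ?thesis using C by (simp add: ennreal_mult_top)
  next
    case False
    then obtain S where S: "?S = ennreal S" "S \<ge> 0" by (cases ?S) auto
    show ?thesis
    proof (cases "S = 0")
      case True
      then have "?S = 0" using S by simp
      then have "AE x in M. ennreal (f x powr p * g x) = 0"
        by (subst (asm) nn_integral_0_iff_AE) auto
      then have "AE x in M. ennreal (f x * g x) = 0"
      proof eventually_elim
        case (elim x)
        then have "f x powr p * g x = 0" using f[of x] g[of x]
          by (metis ennreal_eq_0_iff mult_nonneg_nonneg order_antisym powr_ge_zero)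
        then show ?case by auto
      qed
      then have "(\<integral>\<^sup>+x. ennreal (f x * g x) \<partial>M) = 0" by (subst nn_integral_0_iff_AE) auto
      then show ?thesis by simp
    next
      case False
      \<comment> \<open>The optimal point of tangency: the two terms of the bound become \<open>(1 - 1/p) m C\<close> and \<open>m C / p\<close>.\<close>
      define m where "m = (S / C) powr (1 / p)"
      have m: "m > 0" using False S C by (simp add: m_def)
      have mp: "m powr p = S / C" using p C S by (simp add: m_def powr_powr)
      have "(\<integral>\<^sup>+x. ennreal (f x * g x) \<partial>M) \<le>
        (\<integral>\<^sup>+x. ennreal ((1 - 1 / p) * m) * ennreal (g x) + ennreal (1 / (p * m powr (p - 1))) * ennreal (f x powr p * g x) \<partial>M)"
      proof (rule nn_integral_mono)
        fix x
        have "f x * g x \<le> ((1 - 1 / p) * m + f x powr p / (p * m powr (p - 1))) * g x"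
          by (intro mult_right_mono powr_tangent p m f g)
        also have "\<dots> = (1 - 1 / p) * m * g x + 1 / (p * m powr (p - 1)) * (f x powr p * g x)"
          by (simp add: algebra_simps)
        finally have "ennreal (f x * g x) \<le> ennreal ((1 - 1 / p) * m * g x + 1 / (p * m powr (p - 1)) * (f x powr p * g x))"
          by (rule ennreal_leI)
        also have "\<dots> = ennreal ((1 - 1 / p) * m) * ennreal (g x) + ennreal (1 / (p * m powr (p - 1))) * ennreal (f x powr p * g x)"
          using p m g[of x] by (simp add: ennreal_mult[symmetric] ennreal_plus[symmetric] del: ennreal_plus)
        finally show "ennreal (f x * g x) \<le> \<dots>" .
      qed
      also have "\<dots> = ennreal ((1 - 1 / p) * m) * (\<integral>\<^sup>+x. ennreal (g x) \<partial>M) + ennreal (1 / (p * m powr (p - 1))) * ?S"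
        by (simp add: nn_integral_add nn_integral_cmult)
      also have "\<dots> \<le> ennreal ((1 - 1 / p) * m) * ennreal C + ennreal (1 / (p * m powr (p - 1))) * ennreal S"
        unfolding S by (intro add_mono mult_left_mono gC) auto
      also have "\<dots> = ennreal ((1 - 1 / p) * m * C + 1 / (p * m powr (p - 1)) * S)"
        using p m C S by (simp add: ennreal_mult[symmetric] ennreal_plus[symmetric] del: ennreal_plus)
      also have "1 / (p * m powr (p - 1)) * S = m * C / p"
      proof -
        have "S = m powr p * C" using mp C by simp
        then show ?thesis using m p by (simp add: powr_diff)
      qed
      also have "(1 - 1 / p) * m * C + m * C / p = m * C" using p by (simp add: field_simps)
      finally have "ennreal_powr p (\<integral>\<^sup>+x. ennreal (f x * g x) \<partial>M) \<le> ennreal_powr p (ennreal (m * C))"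
        using p by (intro ennreal_powr_mono) auto
      also have "\<dots> = ennreal ((m * C) powr p)" using m C by (simp add: ennreal_powr_ennreal)
      also have "(m * C) powr p = C powr (p - 1) * S"
        using m C mp by (simp add: powr_mult powr_diff)
      finally show ?thesis using S C by (simp add: ennreal_mult)
    qed
  qed
qed

section \<open>Weighted integrals of the Cauchy kernel\<close>

text \<open>Subadditivity of \<open>t\<^sup>\<beta>\<close> for exponents between 0 and 1. The case distinctions encode the
convention \<open>0\<^sup>0 = 0\<close> of the real power in this degenerate case.\<close>

lemma powr_add_subadditive:
  fixes x y \<beta> :: real assumes "x \<ge> 0" "y \<ge> 0" "0 \<le> \<beta>" "\<beta> \<le> 1" "x + y > 0"
  shows "(x + y) powr \<beta> \<le> (if x = 0 then 0 else x powr \<beta>) + (if y = 0 then 0 else y powr \<beta>)"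
proof -
  have *: "t / (x + y) * (x + y) powr \<beta> \<le> (if t = 0 then 0 else t powr \<beta>)" if "0 \<le> t" "t \<le> x + y" for t
  proof (cases "t = 0")
    case False
    have "(t / (x + y)) powr 1 \<le> (t / (x + y)) powr \<beta>"
      using that False assms by (intro powr_mono') auto
    then have "t / (x + y) \<le> t powr \<beta> / (x + y) powr \<beta>"
      using that False assms by (simp add: powr_divide)
    then show ?thesis using False assms by (simp add: field_simps)
  qed simp
  have "x / (x + y) + y / (x + y) = 1" using assms by (simp add: add_divide_distrib[symmetric])
  then have "(x + y) powr \<beta> = x / (x + y) * (x + y) powr \<beta> + y / (x + y) * (x + y) powr \<beta>"
    by (simp only: distrib_right[symmetric] mult_1_left)
  also have "\<dots> \<le> (if x = 0 then 0 else x powr \<beta>) + (if y = 0 then 0 else y powr \<beta>)"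
    using assms by (intro add_mono *) auto
  finally show ?thesis .
qed

lemma powr_le_bounded:
  fixes x a b B :: real
  assumes "0 \<le> x" "x \<le> B" "b \<le> a"
  shows "x powr a \<le> max 1 (B powr (a - b)) * x powr b"
proof (cases "x = 0")
  case False
  have "x powr a = x powr (a - b) * x powr b" using False assms by (simp add: powr_add[symmetric])
  also have "\<dots> \<le> max 1 (B powr (a - b)) * x powr b"
    using assms False by (intro mult_right_mono max.coboundedI2 powr_mono2) auto
  finally show ?thesis .
qed simp

lemma powr_mult_le_add:
  fixes x y a b :: real assumes "x \<ge> 0" "y \<ge> 0" "a \<ge> 0" "b \<ge> 0"
  shows "x powr (- a) * y powr (- b) \<le> x powr (- (a + b)) + y powr (- (a + b))"
proof (cases "x = 0 \<or> y = 0")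
  case False
  then have xy: "x > 0" "y > 0" using assms by auto
  show ?thesis
  proof (cases "x \<le> y")
    case True
    have "y powr (- b) \<le> x powr (- b)" using True xy assms by (intro powr_mono2') auto
    then have "x powr (- a) * y powr (- b) \<le> x powr (- a) * x powr (- b)" by (intro mult_left_mono) auto
    then show ?thesis using xy by (simp add: powr_add[symmetric] add_increasing2)
  next
    case False
    have "x powr (- a) \<le> y powr (- a)" using False xy assms by (intro powr_mono2') auto
    then have "x powr (- a) * y powr (- b) \<le> y powr (- a) * y powr (- b)" by (intro mult_right_mono) auto
    then show ?thesis using xy by (simp add: powr_add[symmetric] add_increasing)
  qed
qed auto

text \<open>A product of two singular powers is at most the sum of the two powers with exponent \<open>a + b\<close>, one
centred at each singularity (\<open>powr_mult_le_add\<close>), and each of these is locally integrable.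
Negative exponents are first replaced by zero, at the cost of a constant on bounded sets.\<close>

lemma two_point_kernel_bound:
  fixes a b B R :: real
  assumes "a < 2" "b < 2" "a + b < 2"
  shows "\<exists>C>0. \<forall>z. (\<integral>\<^sup>+w. ennreal (cmod (z - w) powr (- a) * indicator (cball 0 B) (z - w) *
      (cmod w powr (- b) * indicator (cball 0 R) w)) \<partial>lborel) \<le> ennreal C"
proof -
  define a' b' where "a' = max a 0" and "b' = max b 0"
  define c where "c = a' + b'"
  have c: "c < 2" "a' \<ge> 0" "b' \<ge> 0" "a \<le> a'" "b \<le> b'" using assms by (auto simp: c_def a'_def b'_def)
  define D where "D = max 1 (B powr (- a - (- a'))) * max 1 (R powr (- b - (- b')))"
  have D: "D > 0" unfolding D_def by (intro mult_pos_pos) auto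
  let ?I = "\<lambda>r. \<integral>\<^sup>+w. ennreal (cmod w powr (- c)) * indicator (cball 0 r) w \<partial>lborel"
  have fin: "?I r < \<infinity>" for r by (rule inverse_norm_powr_locally_integrable[OF c(1)])
  have "(\<integral>\<^sup>+w. ennreal (cmod (z - w) powr (- a) * indicator (cball 0 B) (z - w) *
      (cmod w powr (- b) * indicator (cball 0 R) w)) \<partial>lborel) \<le> ennreal D * (?I B + ?I R)" for z
  proof -
    have "(\<integral>\<^sup>+w. ennreal (cmod (z - w) powr (- a) * indicator (cball 0 B) (z - w) *
        (cmod w powr (- b) * indicator (cball 0 R) w)) \<partial>lborel)
      \<le> (\<integral>\<^sup>+w. ennreal D * (ennreal (cmod (z - w) powr (- c)) * indicator (cball 0 B) (z - w) +
            ennreal (cmod w powr (- c)) * indicator (cball 0 R) w) \<partial>lborel)"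
    proof (rule nn_integral_mono)
      fix w
      show "ennreal (cmod (z - w) powr (- a) * indicator (cball 0 B) (z - w) *
        (cmod w powr (- b) * indicator (cball 0 R) w)) \<le>
        ennreal D * (ennreal (cmod (z - w) powr (- c)) * indicator (cball 0 B) (z - w) +
            ennreal (cmod w powr (- c)) * indicator (cball 0 R) w)"
      proof (cases "cmod (z - w) \<le> B \<and> cmod w \<le> R")
        case True
        have "cmod (z - w) powr (- a) * cmod w powr (- b) \<le>
          (max 1 (B powr (- a - (- a'))) * cmod (z - w) powr (- a')) * (max 1 (R powr (- b - (- b'))) * cmod w powr (- b'))"
          using True c by (intro mult_mono powr_le_bounded) auto
        also have "\<dots> = D * (cmod (z - w) powr (- a') * cmod w powr (- b'))" by (simp add: D_def)
        also have "\<dots> \<le> D * (cmod (z - w) powr (- c) + cmod w powr (- c))"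
          unfolding c_def using D c by (intro mult_left_mono powr_mult_le_add) auto
        finally have "ennreal (cmod (z - w) powr (- a) * cmod w powr (- b)) \<le> ennreal (D * (cmod (z - w) powr (- c) + cmod w powr (- c)))"
          by (rule ennreal_leI)
        then show ?thesis using True D by (simp add: ennreal_mult)
      qed (auto split: split_indicator)
    qed
    also have "\<dots> = ennreal D * ((\<integral>\<^sup>+w. ennreal (cmod (z - w) powr (- c)) * indicator (cball 0 B) (z - w) \<partial>lborel) + ?I R)"
      by (simp add: nn_integral_cmult nn_integral_add)
    also have "(\<integral>\<^sup>+w. ennreal (cmod (z - w) powr (- c)) * indicator (cball 0 B) (z - w) \<partial>lborel) = ?I B"
      by (rule nn_integral_reflect[of "\<lambda>w. ennreal (cmod w powr (- c)) * indicator (cball 0 B) w"]) simp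
    finally show ?thesis .
  qed
  moreover have "ennreal D * (?I B + ?I R) < \<infinity>" using fin by (simp add: ennreal_mult_less_top)
  then obtain C where "ennreal D * (?I B + ?I R) = ennreal C" "C \<ge> 0"
    by (cases "ennreal D * (?I B + ?I R)") auto
  moreover have "ennreal C \<le> ennreal (C + 1)" by (intro ennreal_leI) simp
  ultimately have "\<forall>z. (\<integral>\<^sup>+w. ennreal (cmod (z - w) powr (- a) * indicator (cball 0 B) (z - w) *
      (cmod w powr (- b) * indicator (cball 0 R) w)) \<partial>lborel) \<le> ennreal (C + 1)"
    by (metis (no_types, lifting) order_trans)
  with \<open>C \<ge> 0\<close> show ?thesis by (intro exI[of _ "C + 1"]) auto
qed

text \<open>Inserting \<open>1 \<le> |z|\<^sup>-\<^sup>\<beta> (|z - w|\<^sup>\<beta> + |w|\<^sup>\<beta>)\<close> extracts the factor in \<open>z\<close> and leaves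
two integrals of the kind treated in \<open>two_point_kernel_bound\<close>. The total exponent in both is
\<open>\<alpha> - \<beta> + 1\<close>, which is where \<open>\<beta> > \<alpha> - 1\<close> enters.\<close>

lemma weighted_cauchy_kernel_bound:
  fixes \<alpha> \<beta> B R :: real
  assumes "\<alpha> < 2" "0 \<le> \<beta>" "\<beta> \<le> 1" "\<beta> > \<alpha> - 1"
  shows "\<exists>C>0. \<forall>z. z \<noteq> 0 \<longrightarrow> (\<integral>\<^sup>+w. ennreal (cmod (z - w) powr (- \<alpha>) * indicator (cball 0 B) (z - w) *
      cmod (cauchy_kernel R w)) \<partial>lborel) \<le> ennreal (C * cmod z powr (- \<beta>))"
proof -
  let ?J = "\<lambda>a b z. \<integral>\<^sup>+w. ennreal (cmod (z - w) powr (- a) * indicator (cball 0 B) (z - w) *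
      (cmod w powr (- b) * indicator (cball 0 R) w)) \<partial>lborel"
  have "\<exists>C>0. \<forall>z. ?J (\<alpha> - \<beta>) 1 z \<le> ennreal C"
    by (rule two_point_kernel_bound) (use assms in auto)
  then obtain C1 where C1: "C1 > 0" "\<And>z. ?J (\<alpha> - \<beta>) 1 z \<le> ennreal C1" by blast
  have "\<exists>C>0. \<forall>z. ?J \<alpha> (1 - \<beta>) z \<le> ennreal C"
    by (rule two_point_kernel_bound) (use assms in auto)
  then obtain C2 where C2: "C2 > 0" "\<And>z. ?J \<alpha> (1 - \<beta>) z \<le> ennreal C2" by blast
  have "?J \<alpha> 1 z \<le> ennreal ((C1 + C2) * cmod z powr (- \<beta>))" if z: "z \<noteq> 0" for z
  proof -
    have "?J \<alpha> 1 z \<le> (\<integral>\<^sup>+w. ennreal (cmod z powr (- \<beta>)) *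
       (ennreal (cmod (z - w) powr (- (\<alpha> - \<beta>)) * indicator (cball 0 B) (z - w) * (cmod w powr (- 1) * indicator (cball 0 R) w)) +
        ennreal (cmod (z - w) powr (- \<alpha>) * indicator (cball 0 B) (z - w) * (cmod w powr (- (1 - \<beta>)) * indicator (cball 0 R) w))) \<partial>lborel)"
    proof (rule nn_integral_mono)
      fix w
      let ?i = "indicator (cball 0 B) (z - w) :: real" and ?r = "indicator (cball 0 R) w :: real"
      have "0 < cmod z" using z by simp
      then have pos: "0 < cmod (z - w) + cmod w" using norm_triangle_sub[of z w] by linarith
      have "cmod z powr \<beta> \<le> (cmod (z - w) + cmod w) powr \<beta>"
        using norm_triangle_sub[of z w] assms by (intro powr_mono2) (auto simp: add.commute)
      also have "\<dots> \<le> (if cmod (z - w) = 0 then 0 else cmod (z - w) powr \<beta>) + (if cmod w = 0 then 0 else cmod w powr \<beta>)"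
        using assms pos by (intro powr_add_subadditive) auto
      also have "\<dots> = cmod (z - w) powr \<beta> + cmod w powr \<beta>" by auto
      finally have "1 \<le> cmod z powr (- \<beta>) * (cmod (z - w) powr \<beta> + cmod w powr \<beta>)"
        using z by (simp add: powr_minus field_simps)
      then have "1 * (cmod (z - w) powr (- \<alpha>) * ?i * (cmod w powr (- 1) * ?r)) \<le>
        cmod z powr (- \<beta>) * (cmod (z - w) powr \<beta> + cmod w powr \<beta>) * (cmod (z - w) powr (- \<alpha>) * ?i * (cmod w powr (- 1) * ?r))"
        by (intro mult_right_mono) auto
      also have "\<dots> = cmod z powr (- \<beta>) * ((cmod (z - w) powr \<beta> * cmod (z - w) powr (- \<alpha>)) * ?i * (cmod w powr (- 1) * ?r) +
         cmod (z - w) powr (- \<alpha>) * ?i * ((cmod w powr \<beta> * cmod w powr (- 1)) * ?r))"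
      proof -
        have "zb * (a + b) * (c * i * (v * r)) = zb * ((a * c) * i * (v * r) + c * i * ((b * v) * r))"
          for zb a b c i v r :: real by (simp add: algebra_simps)
        then show ?thesis by (simp only:)
      qed
      also have "\<dots> = cmod z powr (- \<beta>) * (cmod (z - w) powr (- (\<alpha> - \<beta>)) * ?i * (cmod w powr (- 1) * ?r) +
         cmod (z - w) powr (- \<alpha>) * ?i * (cmod w powr (- (1 - \<beta>)) * ?r))"
      proof -
        have 1: "cmod (z - w) powr \<beta> * cmod (z - w) powr (- \<alpha>) = cmod (z - w) powr (- (\<alpha> - \<beta>))"
          by (simp add: powr_add[symmetric])
        have 2: "cmod w powr \<beta> * cmod w powr (- 1) = cmod w powr (- (1 - \<beta>))"
          by (simp only: powr_add[symmetric]) simp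
        show ?thesis unfolding 1 2 ..
      qed
      finally have "ennreal (cmod (z - w) powr (- \<alpha>) * ?i * (cmod w powr (- 1) * ?r)) \<le> ennreal (cmod z powr (- \<beta>) * (cmod (z - w) powr (- (\<alpha> - \<beta>)) * ?i * (cmod w powr (- 1) * ?r) +
         cmod (z - w) powr (- \<alpha>) * ?i * (cmod w powr (- (1 - \<beta>)) * ?r)))"
        by (intro ennreal_leI) simp
      then show "ennreal (cmod (z - w) powr (- \<alpha>) * ?i * (cmod w powr (- 1) * ?r)) \<le> ennreal (cmod z powr (- \<beta>)) *
       (ennreal (cmod (z - w) powr (- (\<alpha> - \<beta>)) * ?i * (cmod w powr (- 1) * ?r)) +
        ennreal (cmod (z - w) powr (- \<alpha>) * ?i * (cmod w powr (- (1 - \<beta>)) * ?r)))"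
        by (simp add: ennreal_mult)
    qed
    also have "\<dots> = ennreal (cmod z powr (- \<beta>)) * (?J (\<alpha> - \<beta>) 1 z + ?J \<alpha> (1 - \<beta>) z)"
      by (simp add: nn_integral_cmult nn_integral_add)
    also have "\<dots> \<le> ennreal (cmod z powr (- \<beta>)) * (ennreal C1 + ennreal C2)"
      by (intro mult_left_mono add_mono C1 C2) auto
    also have "\<dots> = ennreal ((C1 + C2) * cmod z powr (- \<beta>))"
      using C1(1) C2(1) by (simp add: ennreal_mult[symmetric] ennreal_plus[symmetric] mult.commute del: ennreal_plus)
    finally show ?thesis .
  qed
  then show ?thesis using C1(1) C2(1) unfolding norm_cauchy_kernel by (intro exI[of _ "C1 + C2"]) auto
qed

section \<open>Weighted L^p bounds for the Cauchy majorant\<close>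

text \<open>The exponents \<open>\<alpha>\<close>, \<open>\<beta>\<close>, \<open>\<gamma>\<close> are the free parameters of a weighted Schur test. The
Cauchy integral of \<open>|y|\<^sup>-\<^sup>\<alpha>\<close> is \<open>O(|z|\<^sup>-\<^sup>\<beta>)\<close>; after Jensen's inequality the weight in
\<open>z\<close> is \<open>|z|\<^sup>-\<^sup>\<delta>\<close> with \<open>\<delta> = \<tau> P + \<beta> (P - 1)\<close>, and its Cauchy integral is
\<open>O(|y|\<^sup>-\<^sup>\<gamma>)\<close>. The last inequality says that what has accumulated in \<open>y\<close> is dominated by the
given weight \<open>|y|\<^sup>-\<^sup>\<sigma>\<^sup>P\<close>. For \<open>p = \<infinity>\<close> one application of the kernel bound with
\<open>\<alpha> = - \<sigma>\<close> suffices.\<close>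

definition admissible :: "ennreal \<Rightarrow> real \<Rightarrow> real \<Rightarrow> bool" where
  "admissible p \<sigma> \<tau> \<longleftrightarrow>
    (if p = \<infinity> then \<exists>\<beta>. \<sigma> > -2 \<and> 0 \<le> \<beta> \<and> \<beta> \<le> 1 \<and> \<beta> > - \<sigma> - 1 \<and> \<beta> \<le> - \<tau>
     else let P = enn2real p in \<exists>\<alpha> \<beta> \<gamma>. \<alpha> < 2 \<and> 0 \<le> \<beta> \<and> \<beta> \<le> 1 \<and> \<beta> > \<alpha> - 1 \<and>
       \<tau> * P + \<beta> * (P - 1) < 2 \<and> 0 \<le> \<gamma> \<and> \<gamma> \<le> 1 \<and> \<gamma> > \<tau> * P + \<beta> * (P - 1) - 1 \<and>
       \<gamma> \<le> \<sigma> * P + \<alpha> * (P - 1))"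

text \<open>Boundedness with constant \<open>C\<close> of the Cauchy majorant in the \<open>j\<close>-th coordinate, from the weight
\<open>|z\<^sub>j|\<^sup>\<sigma>\<close> to the weight \<open>|z\<^sub>j|\<^sup>\<tau>\<close>, on functions supported where \<open>|z\<^sub>j| \<le> B\<close> and
measured there.\<close>

definition majorant_bounded :: "ennreal \<Rightarrow> 'n::finite \<Rightarrow> real \<Rightarrow> real \<Rightarrow> real \<Rightarrow> real \<Rightarrow> real \<Rightarrow> bool" where
  "majorant_bounded p j \<sigma> \<tau> B R C \<longleftrightarrow> (\<forall>u::complex^'n \<Rightarrow> complex. \<forall>A\<ge>0. u \<in> borel_measurable borel \<longrightarrow>
    (\<forall>y. u y \<noteq> 0 \<longrightarrow> cmod (y $ j) \<le> B) \<longrightarrow>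
    Lp_le p lborel (\<lambda>y. ennreal (cmod (y $ j) powr (- \<sigma>) * cmod (u y))) A \<longrightarrow>
    Lp_le p lborel (\<lambda>z. ennreal (cmod (z $ j) powr (- \<tau>) * indicator (cball 0 B) (z $ j)) * cauchy_majorant R j u z) (C * A))"

text \<open>The Schur test. Split \<open>|u(y)| = (|u(y)| |y\<^sub>j|\<^sup>\<alpha>) |y\<^sub>j|\<^sup>-\<^sup>\<alpha>\<close> and apply Jensen's inequality to the
measure \<open>|y\<^sub>j|\<^sup>-\<^sup>\<alpha> |w|\<^sup>-\<^sup>1 dw\<close>, where \<open>y = z - w e\<^sub>j\<close>. Then integrate over \<open>z\<close>, move the kernel to the other factor by
\<open>nn_integral_shift_adjoint\<close>, and bound it there a second time.\<close>

lemma cauchy_majorant_bound_finite: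
  fixes j :: "'n::finite"
  assumes p: "1 \<le> p" "p \<noteq> \<infinity>" and adm: "admissible p \<sigma> \<tau>" and B: "B > 0"
  shows "\<exists>C>0. majorant_bounded p j \<sigma> \<tau> B R C"
proof -
  define P where "P = enn2real p"
  have P1: "P \<ge> 1" unfolding P_def by (rule enn2real_ge_1[OF p])
  obtain \<alpha> \<beta> \<gamma> where par: "\<alpha> < 2" "0 \<le> \<beta>" "\<beta> \<le> 1" "\<beta> > \<alpha> - 1"
      "\<tau> * P + \<beta> * (P - 1) < 2" "0 \<le> \<gamma>" "\<gamma> \<le> 1" "\<gamma> > \<tau> * P + \<beta> * (P - 1) - 1"
      "\<gamma> \<le> \<sigma> * P + \<alpha> * (P - 1)"
    using adm p(2) unfolding admissible_def P_def Let_def by auto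
  \<comment> \<open>The power of \<open>|z\<^sub>j|\<^sup>-\<^sup>1\<close> after Jensen: \<open>\<tau> P\<close> from the target weight, \<open>\<beta> (P - 1)\<close> from the mass of the measure.\<close>
  define \<delta> where "\<delta> = \<tau> * P + \<beta> * (P - 1)"
  let ?k = "\<lambda>w. cmod (cauchy_kernel R w)"
  obtain C1 where C1: "C1 > 0" "\<And>z. z \<noteq> 0 \<Longrightarrow> (\<integral>\<^sup>+w. ennreal (cmod (z - w) powr (- \<alpha>) * indicator (cball 0 B) (z - w) * ?k w) \<partial>lborel)
      \<le> ennreal (C1 * cmod z powr (- \<beta>))"
    using weighted_cauchy_kernel_bound[OF par(1-4), of B R] by blast
  obtain C2 where C2: "C2 > 0" "\<And>z. z \<noteq> 0 \<Longrightarrow> (\<integral>\<^sup>+w. ennreal (cmod (z - w) powr (- \<delta>) * indicator (cball 0 B) (z - w) * ?k w) \<partial>lborel)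
      \<le> ennreal (C2 * cmod z powr (- \<gamma>))"
    using weighted_cauchy_kernel_bound[of \<delta> \<gamma> B R] par unfolding \<delta>_def by blast
  define D where "D = max 1 (B powr (\<alpha> * (P - 1) - \<gamma> - (- \<sigma> * P)))"
  have D: "D > 0" unfolding D_def by auto
  define E where "E = C1 powr (P - 1) * (C2 * D)"
  have E: "E > 0" using C1 C2 D by (simp add: E_def)
  define C where "C = E powr (1 / P)"
  have C: "C > 0" using E by (simp add: C_def)
  have CP: "C powr P = E" using E P1 by (simp add: C_def powr_powr)
  show ?thesis
    unfolding majorant_bounded_def
  proof (intro exI[of _ C] conjI allI impI C)
    fix u :: "complex^'n \<Rightarrow> complex" and A :: real
    assume A: "A \<ge> 0" and [measurable]: "u \<in> borel_measurable borel"
      and supp: "\<forall>y. u y \<noteq> 0 \<longrightarrow> cmod (y $ j) \<le> B"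
      and L: "Lp_le p lborel (\<lambda>y. ennreal (cmod (y $ j) powr (- \<sigma>) * cmod (u y))) A"
    define U where "U y = cmod (u y) powr P * cmod (y $ j) powr (\<alpha> * (P - 1))" for y
    have [measurable]: "U \<in> borel_measurable borel" unfolding U_def by measurable
    define G where "G z = cmod (z $ j) powr (- \<delta>) * indicator (cball 0 B) (z $ j)" for z :: "complex^'n"
    have [measurable]: "G \<in> borel_measurable borel" unfolding G_def by measurable
    have 1: "(\<integral>\<^sup>+z. ennreal_powr P (ennreal (cmod (z $ j) powr (- \<tau>) * indicator (cball 0 B) (z $ j)) * cauchy_majorant R j u z) \<partial>lborel)
      \<le> (\<integral>\<^sup>+z. ennreal (C1 powr (P - 1)) * (ennreal (G z) * (\<integral>\<^sup>+w. ennreal (U (z - axis j w)) * ennreal (?k w) \<partial>lborel)) \<partial>lborel)"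
    proof (rule nn_integral_mono_AE)
      show "AE z::complex^'n in lborel. ennreal_powr P (ennreal (cmod (z $ j) powr (- \<tau>) * indicator (cball 0 B) (z $ j)) * cauchy_majorant R j u z)
        \<le> ennreal (C1 powr (P - 1)) * (ennreal (G z) * (\<integral>\<^sup>+w. ennreal (U (z - axis j w)) * ennreal (?k w) \<partial>lborel))"
        using AE_component_nonzero[of j]
      proof eventually_elim
        case (elim z)
        show ?case
        proof (cases "cmod (z $ j) \<le> B")
          case True
          let ?f = "\<lambda>w. cmod (u (z - axis j w)) * cmod (z $ j - w) powr \<alpha>"
          let ?g = "\<lambda>w. cmod (z $ j - w) powr (- \<alpha>) * indicator (cball 0 B) (z $ j - w) * ?k w"
          have ind: "u (z - axis j w) \<noteq> 0 \<Longrightarrow> cmod (z $ j - w) \<le> B" for w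
            using supp[rule_format, of "z - axis j w"] by simp
          have "cauchy_majorant R j u z \<le> (\<integral>\<^sup>+w. ennreal (?f w * ?g w) \<partial>lborel)"
            unfolding cauchy_majorant_def
          proof (rule nn_integral_mono_AE)
            show "AE w in lborel. ennreal (cmod (u (z - axis j w))) * ennreal (?k w) \<le> ennreal (?f w * ?g w)"
              using AE_lborel_singleton[of "z $ j"]
            proof eventually_elim
              case (elim w)
              then have "cmod (z $ j - w) powr \<alpha> * cmod (z $ j - w) powr (- \<alpha>) = 1"
                by (simp add: powr_add[symmetric])
              then have "?f w * ?g w = cmod (u (z - axis j w)) * (indicator (cball 0 B) (z $ j - w) * ?k w)"
                by (simp add: mult.left_commute mult.assoc)
              also have "\<dots> = cmod (u (z - axis j w)) * ?k w" using ind[of w] by (cases "u (z - axis j w) = 0") auto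
              finally have eq: "?f w * ?g w = cmod (u (z - axis j w)) * ?k w" .
              show ?case unfolding eq by (simp add: ennreal_mult)
            qed
          qed
          then have "ennreal_powr P (cauchy_majorant R j u z) \<le> ennreal_powr P (\<integral>\<^sup>+w. ennreal (?f w * ?g w) \<partial>lborel)"
            using P1 by (intro ennreal_powr_mono) auto
          also have "\<dots> \<le> ennreal ((C1 * cmod (z $ j) powr (- \<beta>)) powr (P - 1)) * (\<integral>\<^sup>+w. ennreal (?f w powr P * ?g w) \<partial>lborel)"
            by (rule nn_integral_jensen) (use C1 elim P1 in auto)
          also have "\<dots> \<le> ennreal ((C1 * cmod (z $ j) powr (- \<beta>)) powr (P - 1)) * (\<integral>\<^sup>+w. ennreal (U (z - axis j w)) * ennreal (?k w) \<partial>lborel)"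
          proof (intro mult_left_mono nn_integral_mono)
            fix w
            have "?f w powr P * ?g w = cmod (u (z - axis j w)) powr P * (cmod (z $ j - w) powr (\<alpha> * P) * cmod (z $ j - w) powr (- \<alpha>)) *
                (indicator (cball 0 B) (z $ j - w) * ?k w)"
              by (simp add: powr_mult powr_powr mult_ac)
            also have "cmod (z $ j - w) powr (\<alpha> * P) * cmod (z $ j - w) powr (- \<alpha>) = cmod (z $ j - w) powr (\<alpha> * (P - 1))"
              by (simp add: powr_add[symmetric] algebra_simps)
            also have "cmod (u (z - axis j w)) powr P * cmod (z $ j - w) powr (\<alpha> * (P - 1)) *
                (indicator (cball 0 B) (z $ j - w) * ?k w) \<le> cmod (u (z - axis j w)) powr P * cmod (z $ j - w) powr (\<alpha> * (P - 1)) * (1 * ?k w)"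
              by (intro mult_left_mono mult_right_mono) (auto split: split_indicator)
            finally show "ennreal (?f w powr P * ?g w) \<le> ennreal (U (z - axis j w)) * ennreal (?k w)"
              by (simp add: U_def ennreal_mult[symmetric] ennreal_leI)
          qed simp
          finally have *: "ennreal_powr P (cauchy_majorant R j u z) \<le> ennreal ((C1 * cmod (z $ j) powr (- \<beta>)) powr (P - 1)) * (\<integral>\<^sup>+w. ennreal (U (z - axis j w)) * ennreal (?k w) \<partial>lborel)" .
          have "ennreal_powr P (ennreal (cmod (z $ j) powr (- \<tau>) * indicator (cball 0 B) (z $ j)) * cauchy_majorant R j u z)
             = ennreal ((cmod (z $ j) powr (- \<tau>)) powr P) * ennreal_powr P (cauchy_majorant R j u z)"
            using True elim by (simp add: ennreal_powr_mult)
          also have "\<dots> \<le> ennreal ((cmod (z $ j) powr (- \<tau>)) powr P) * (ennreal ((C1 * cmod (z $ j) powr (- \<beta>)) powr (P - 1)) * (\<integral>\<^sup>+w. ennreal (U (z - axis j w)) * ennreal (?k w) \<partial>lborel))"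
            by (intro mult_left_mono *) simp
          also have "\<dots> = ennreal ((cmod (z $ j) powr (- \<tau>)) powr P * (C1 * cmod (z $ j) powr (- \<beta>)) powr (P - 1)) * (\<integral>\<^sup>+w. ennreal (U (z - axis j w)) * ennreal (?k w) \<partial>lborel)"
            by (simp add: ennreal_mult mult.assoc)
          also have "(cmod (z $ j) powr (- \<tau>)) powr P * (C1 * cmod (z $ j) powr (- \<beta>)) powr (P - 1) = C1 powr (P - 1) * G z"
          proof -
            have "(cmod (z $ j) powr (- \<tau>)) powr P * (C1 * cmod (z $ j) powr (- \<beta>)) powr (P - 1) =
              C1 powr (P - 1) * (cmod (z $ j) powr (- \<tau> * P) * cmod (z $ j) powr (- \<beta> * (P - 1)))"
              using C1(1) by (simp add: powr_mult powr_powr)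
            also have "cmod (z $ j) powr (- \<tau> * P) * cmod (z $ j) powr (- \<beta> * (P - 1)) = G z"
              using True unfolding G_def \<delta>_def powr_add[symmetric] by simp
            finally show ?thesis .
          qed
          finally show ?thesis using C1(1) by (simp add: ennreal_mult G_def mult.assoc)
        qed simp
      qed
    qed
    also have "\<dots> = ennreal (C1 powr (P - 1)) * (\<integral>\<^sup>+z. ennreal (G z) * (\<integral>\<^sup>+w. ennreal (U (z - axis j w)) * ennreal (?k w) \<partial>lborel) \<partial>lborel)"
      by (rule nn_integral_cmult) measurable
    also have "(\<integral>\<^sup>+z. ennreal (G z) * (\<integral>\<^sup>+w. ennreal (U (z - axis j w)) * ennreal (?k w) \<partial>lborel) \<partial>lborel)
        = (\<integral>\<^sup>+y. ennreal (U y) * (\<integral>\<^sup>+w. ennreal (G (y + axis j w)) * ennreal (?k w) \<partial>lborel) \<partial>lborel)"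
      by (rule nn_integral_shift_adjoint) auto
    also have "\<dots> \<le> (\<integral>\<^sup>+y. ennreal (C2 * D) * ennreal_powr P (ennreal (cmod (y $ j) powr (- \<sigma>) * cmod (u y))) \<partial>lborel)"
    proof (rule nn_integral_mono_AE)
      show "AE y::complex^'n in lborel. ennreal (U y) * (\<integral>\<^sup>+w. ennreal (G (y + axis j w)) * ennreal (?k w) \<partial>lborel) \<le>
        ennreal (C2 * D) * ennreal_powr P (ennreal (cmod (y $ j) powr (- \<sigma>) * cmod (u y)))"
        using AE_component_nonzero[of j]
      proof eventually_elim
        case (elim y)
        have "(\<integral>\<^sup>+w. ennreal (G (y + axis j w)) * ennreal (?k w) \<partial>lborel) =
          (\<integral>\<^sup>+w. ennreal (G (y + axis j (0 - w))) * ennreal (?k (0 - w)) \<partial>lborel)"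
          by (rule nn_integral_reflect[symmetric]) measurable
        also have "\<dots> = (\<integral>\<^sup>+w. ennreal (cmod (y $ j - w) powr (- \<delta>) * indicator (cball 0 B) (y $ j - w) * ?k w) \<partial>lborel)"
          by (intro nn_integral_cong) (simp add: G_def ennreal_mult[symmetric] norm_cauchy_kernel indicator_def)
        also have "\<dots> \<le> ennreal (C2 * cmod (y $ j) powr (- \<gamma>))" using C2(2) elim by blast
        finally have "ennreal (U y) * (\<integral>\<^sup>+w. ennreal (G (y + axis j w)) * ennreal (?k w) \<partial>lborel) \<le> ennreal (U y) * ennreal (C2 * cmod (y $ j) powr (- \<gamma>))"
          by (intro mult_left_mono) auto
        also have "\<dots> = ennreal (U y * (C2 * cmod (y $ j) powr (- \<gamma>)))" using C2(1) by (simp add: ennreal_mult U_def)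
        also have "\<dots> \<le> ennreal (C2 * D * (cmod (y $ j) powr (- \<sigma>) * cmod (u y)) powr P)"
        proof (rule ennreal_leI)
          show "U y * (C2 * cmod (y $ j) powr (- \<gamma>)) \<le> C2 * D * (cmod (y $ j) powr (- \<sigma>) * cmod (u y)) powr P"
          proof (cases "u y = 0")
            case False
            then have yB: "cmod (y $ j) \<le> B" using supp by blast
            have "U y * (C2 * cmod (y $ j) powr (- \<gamma>)) = C2 * cmod (u y) powr P * (cmod (y $ j) powr (\<alpha> * (P - 1)) * cmod (y $ j) powr (- \<gamma>))"
              by (simp add: U_def mult_ac)
            also have "cmod (y $ j) powr (\<alpha> * (P - 1)) * cmod (y $ j) powr (- \<gamma>) = cmod (y $ j) powr (\<alpha> * (P - 1) - \<gamma>)"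
              by (simp add: powr_add[symmetric])
            also have "C2 * cmod (u y) powr P * cmod (y $ j) powr (\<alpha> * (P - 1) - \<gamma>) \<le> C2 * cmod (u y) powr P * (D * cmod (y $ j) powr (- \<sigma> * P))"
              unfolding D_def using par yB C2(1) by (intro mult_left_mono powr_le_bounded) auto
            also have "\<dots> = C2 * D * (cmod (y $ j) powr (- \<sigma>) * cmod (u y)) powr P"
              by (simp add: powr_mult powr_powr mult_ac)
            finally show ?thesis .
          qed (simp add: U_def)
        qed
        also have "\<dots> = ennreal (C2 * D) * ennreal_powr P (ennreal (cmod (y $ j) powr (- \<sigma>) * cmod (u y)))"
          using C2(1) D by (subst ennreal_powr_ennreal) (auto simp: ennreal_mult)
        finally show ?case .
      qed
    qed
    also have "\<dots> = ennreal (C2 * D) * (\<integral>\<^sup>+y. ennreal_powr P (ennreal (cmod (y $ j) powr (- \<sigma>) * cmod (u y))) \<partial>lborel)"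
      by (rule nn_integral_cmult) measurable
    also have "\<dots> \<le> ennreal (C2 * D) * ennreal (A powr P)"
      using L p(2) by (intro mult_left_mono) (auto simp: Lp_le_def P_def)
    also have "ennreal (C1 powr (P - 1)) * (ennreal (C2 * D) * ennreal (A powr P)) = ennreal (E * A powr P)"
      using C1(1) C2(1) D by (simp add: E_def ennreal_mult mult.assoc)
    also have "E * A powr P = (C * A) powr P" using C A CP by (simp add: powr_mult)
    finally show "Lp_le p lborel (\<lambda>z. ennreal (cmod (z $ j) powr (- \<tau>) * indicator (cball 0 B) (z $ j)) * cauchy_majorant R j u z) (C * A)"
      using p(2) by (simp add: Lp_le_def P_def mult_left_mono)
  qed
qed

text \<open>Here \<open>|u(y)| \<le> A |y\<^sub>j|\<^sup>\<sigma>\<close> almost everywhere, so the majorant is at most \<open>A\<close> times the Cauchy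
integral of \<open>|y\<^sub>j|\<^sup>\<sigma>\<close>.\<close>

lemma cauchy_majorant_bound_infinite:
  fixes j :: "'n::finite"
  assumes adm: "admissible \<infinity> \<sigma> \<tau>" and B: "B > 0"
  shows "\<exists>C>0. majorant_bounded \<infinity> j \<sigma> \<tau> B R C"
proof -
  obtain \<beta> where par: "\<sigma> > -2" "0 \<le> \<beta>" "\<beta> \<le> 1" "\<beta> > - \<sigma> - 1" "\<beta> \<le> - \<tau>"
    using adm unfolding admissible_def by auto
  let ?k = "\<lambda>w. cmod (cauchy_kernel R w)"
  obtain C1 where C1: "C1 > 0" "\<And>z. z \<noteq> 0 \<Longrightarrow> (\<integral>\<^sup>+w. ennreal (cmod (z - w) powr (- (- \<sigma>)) * indicator (cball 0 B) (z - w) * ?k w) \<partial>lborel)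
      \<le> ennreal (C1 * cmod z powr (- \<beta>))"
    using weighted_cauchy_kernel_bound[of "- \<sigma>" \<beta> B R] par by auto
  define D where "D = max 1 (B powr (- \<tau> - \<beta>))"
  have D: "D > 0" unfolding D_def by auto
  show ?thesis
    unfolding majorant_bounded_def
  proof (intro exI[of _ "C1 * D"] conjI allI impI)
    show "C1 * D > 0" using C1 D by simp
    fix u :: "complex^'n \<Rightarrow> complex" and A :: real
    assume A: "A \<ge> 0" and [measurable]: "u \<in> borel_measurable borel"
      and supp: "\<forall>y. u y \<noteq> 0 \<longrightarrow> cmod (y $ j) \<le> B"
      and L: "Lp_le \<infinity> lborel (\<lambda>y. ennreal (cmod (y $ j) powr (- \<sigma>) * cmod (u y))) A"
    have ae: "AE y in lborel. cmod (u y) \<le> A * cmod (y $ j) powr \<sigma> * indicator (cball 0 B) (y $ j)"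
    proof -
      have "AE y in lborel. ennreal (cmod (y $ j) powr (- \<sigma>) * cmod (u y)) \<le> ennreal A"
        using L by (simp add: Lp_le_def)
      then show ?thesis using AE_component_nonzero[of j]
    proof eventually_elim
      case (elim y)
      show ?case
      proof (cases "u y = 0")
        case False
        then have "cmod (y $ j) \<le> B" using supp by blast
        moreover have "cmod (y $ j) powr (- \<sigma>) * cmod (u y) \<le> A" using elim A by (simp add: ennreal_le_iff)
        then have "cmod (u y) \<le> A * cmod (y $ j) powr \<sigma>" using elim
          by (simp add: powr_minus field_simps)
        ultimately show ?thesis by simp
      qed (use A in simp)
    qed
    qed
    have "AE z in lborel. AE w in lborel. cmod (u (z - axis j w)) \<le> A * cmod ((z - axis j w) $ j) powr \<sigma> * indicator (cball 0 B) ((z - axis j w) $ j)"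
    proof (rule lborel_pair.AE_commute[THEN iffD1])
      show "AE w in lborel. AE z in lborel. cmod (u (z - axis j w)) \<le> A * cmod ((z - axis j w) $ j) powr \<sigma> * indicator (cball 0 B) ((z - axis j w) $ j)"
      proof (rule AE_I2)
        fix w
        show "AE z in lborel. cmod (u (z - axis j w)) \<le> A * cmod ((z - axis j w) $ j) powr \<sigma> * indicator (cball 0 B) ((z - axis j w) $ j)"
          using AE_lborel_translate[OF ae, of "- axis j w"] by simp
      qed
    qed measurable
    then have "AE z in lborel. ennreal (cmod (z $ j) powr (- \<tau>) * indicator (cball 0 B) (z $ j)) * cauchy_majorant R j u z \<le> ennreal (C1 * D * A)"
      using AE_component_nonzero[of j]
    proof eventually_elim
      case (elim z)
      show ?case
      proof (cases "cmod (z $ j) \<le> B")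
        case True
        have "cauchy_majorant R j u z \<le> (\<integral>\<^sup>+w. ennreal A * ennreal (cmod (z $ j - w) powr (- (- \<sigma>)) * indicator (cball 0 B) (z $ j - w) * ?k w) \<partial>lborel)"
          unfolding cauchy_majorant_def
        proof (rule nn_integral_mono_AE)
          show "AE w in lborel. ennreal (cmod (u (z - axis j w))) * ennreal (?k w)
            \<le> ennreal A * ennreal (cmod (z $ j - w) powr (- (- \<sigma>)) * indicator (cball 0 B) (z $ j - w) * ?k w)"
            using elim(1)
          proof eventually_elim
            case (elim w)
            then have "cmod (u (z - axis j w)) * ?k w \<le> A * cmod (z $ j - w) powr \<sigma> * indicator (cball 0 B) (z $ j - w) * ?k w"
              by (intro mult_right_mono) auto
            then show ?case using A by (simp add: ennreal_mult[symmetric] ennreal_leI mult.assoc)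
          qed
        qed
        also have "\<dots> \<le> ennreal A * ennreal (C1 * cmod (z $ j) powr (- \<beta>))"
          using C1(2)[OF elim(2)] by (subst nn_integral_cmult) (auto intro: mult_left_mono)
        finally have "ennreal (cmod (z $ j) powr (- \<tau>)) * cauchy_majorant R j u z \<le> ennreal (cmod (z $ j) powr (- \<tau>)) * (ennreal A * ennreal (C1 * cmod (z $ j) powr (- \<beta>)))"
          by (intro mult_left_mono) auto
        also have "\<dots> = ennreal (C1 * A * (cmod (z $ j) powr (- \<tau>) * cmod (z $ j) powr (- \<beta>)))"
          using A C1(1) by (simp add: ennreal_mult[symmetric] mult_ac)
        also have "cmod (z $ j) powr (- \<tau>) * cmod (z $ j) powr (- \<beta>) = cmod (z $ j) powr (- \<tau> - \<beta>)"
          by (simp add: powr_add[symmetric])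
        also have "ennreal (C1 * A * cmod (z $ j) powr (- \<tau> - \<beta>)) \<le> ennreal (C1 * A * (D * cmod (z $ j) powr 0))"
          using powr_le_bounded[of "cmod (z $ j)" B 0 "- \<tau> - \<beta>"] True par C1(1) A
          by (intro ennreal_leI mult_left_mono) (auto simp: D_def)
        finally show ?thesis using True elim by (simp add: mult_ac)
      qed simp
    qed
    then show "Lp_le \<infinity> lborel (\<lambda>z. ennreal (cmod (z $ j) powr (- \<tau>) * indicator (cball 0 B) (z $ j)) * cauchy_majorant R j u z) (C1 * D * A)"
      by (simp add: Lp_le_def)
  qed
qed

section \<open>The Cauchy transform in one coordinate and its adjoint\<close>

text \<open>Convolution with \<open>1 / (\<pi> w)\<close> in the coordinate \<open>j\<close>, truncated. The variable of integration is the
displacement along \<open>e\<^sub>j\<close>, so that the same Lebesgue measure on \<open>complex\<close> serves all coordinates.\<close>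

definition cauchy_transform :: "real \<Rightarrow> 'n \<Rightarrow> (complex^'n \<Rightarrow> complex) \<Rightarrow> complex^'n::finite \<Rightarrow> complex" where
  "cauchy_transform R j u z =
     (\<integral>w. u (z - axis j w) * cauchy_kernel R w \<partial>lborel) / of_real cauchy_const"

text \<open>The transpose of the Cauchy transform with respect to the bilinear pairing given by the integral of
a product.\<close>

definition cauchy_adjoint :: "real \<Rightarrow> 'n \<Rightarrow> (complex^'n \<Rightarrow> complex) \<Rightarrow> complex^'n::finite \<Rightarrow> complex" where
  "cauchy_adjoint R j \<phi> z =
     (\<integral>w. \<phi> (z + axis j w) * cauchy_kernel R w \<partial>lborel) / of_real cauchy_const"

lemma cauchy_transform_measurable [measurable]:
  assumes [measurable]: "u \<in> borel_measurable borel"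
  shows "cauchy_transform R j u \<in> borel_measurable borel"
  unfolding cauchy_transform_def[abs_def] by measurable

lemma norm_integral_le_nn_integral:
  fixes f :: "'a \<Rightarrow> complex"
  shows "ennreal (norm (integral\<^sup>L M f)) \<le> (\<integral>\<^sup>+x. ennreal (norm (f x)) \<partial>M)"
proof (cases "integrable M f")
  case True then show ?thesis by (rule integral_norm_bound_ennreal)
qed (simp add: not_integrable_integral_eq)

lemma norm_cauchy_transform_le:
  "ennreal (cmod (cauchy_transform R j u z)) \<le> ennreal (1 / cauchy_const) * cauchy_majorant R j u z"
proof -
  have "cmod (cauchy_transform R j u z) = 1 / cauchy_const * cmod (\<integral>w. u (z - axis j w) * cauchy_kernel R w \<partial>lborel)"
    using cauchy_const_pos by (simp add: cauchy_transform_def norm_divide)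
  then have "ennreal (cmod (cauchy_transform R j u z)) = ennreal (1 / cauchy_const) * ennreal (cmod (\<integral>w. u (z - axis j w) * cauchy_kernel R w \<partial>lborel))"
    using cauchy_const_pos by (simp add: ennreal_mult[symmetric])
  also have "\<dots> \<le> ennreal (1 / cauchy_const) * cauchy_majorant R j u z"
    unfolding cauchy_majorant_def
    by (intro mult_left_mono order_trans[OF norm_integral_le_nn_integral]) (auto simp: norm_mult ennreal_mult)
  finally show ?thesis .
qed

text \<open>Finiteness of the pairing of the majorant with \<open>|\<psi>|\<close> is exactly absolute integrability of the
double integral, so Fubini's theorem applies.\<close>

lemma cauchy_transform_adjoint:
  assumes [measurable]: "u \<in> borel_measurable borel" "\<psi> \<in> borel_measurable borel"
    and fin: "(\<integral>\<^sup>+z. ennreal (cmod (\<psi> z)) * cauchy_majorant R j u z \<partial>lborel) < \<infinity>"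
  shows "(\<integral>z. cauchy_transform R j u z * \<psi> z \<partial>lborel) = (\<integral>y. u y * cauchy_adjoint R j \<psi> y \<partial>lborel)"
proof -
  let ?k = "cauchy_kernel R"
  let ?c = "complex_of_real cauchy_const"
  have int: "integrable (lborel \<Otimes>\<^sub>M lborel) (\<lambda>(z, w). \<psi> z * (u (z - axis j w) * ?k w))"
  proof (rule integrableI_bounded)
    have "(\<integral>\<^sup>+x. ennreal (norm (case x of (z, w) \<Rightarrow> \<psi> z * (u (z - axis j w) * ?k w))) \<partial>(lborel \<Otimes>\<^sub>M lborel)) =
      (\<integral>\<^sup>+z. \<integral>\<^sup>+w. ennreal (norm (\<psi> z * (u (z - axis j w) * ?k w))) \<partial>lborel \<partial>lborel)"
      by (subst lborel.nn_integral_fst[symmetric]) simp_all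
    also have "\<dots> = (\<integral>\<^sup>+z. ennreal (cmod (\<psi> z)) * cauchy_majorant R j u z \<partial>lborel)"
      unfolding cauchy_majorant_def
      by (intro nn_integral_cong) (simp add: norm_mult ennreal_mult nn_integral_cmult)
    finally show "(\<integral>\<^sup>+x. ennreal (norm (case x of (z, w) \<Rightarrow> \<psi> z * (u (z - axis j w) * ?k w))) \<partial>(lborel \<Otimes>\<^sub>M lborel)) < \<infinity>"
      using fin by simp
  qed simp
  have int2: "integrable (lborel \<Otimes>\<^sub>M lborel) (\<lambda>(y, w). \<psi> (y + axis j w) * (u y * ?k w))"
  proof (rule integrableI_bounded)
    have "(\<integral>\<^sup>+x. ennreal (norm (case x of (y, w) \<Rightarrow> \<psi> (y + axis j w) * (u y * ?k w))) \<partial>(lborel \<Otimes>\<^sub>M lborel)) =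
      (\<integral>\<^sup>+y. \<integral>\<^sup>+w. ennreal (norm (\<psi> (y + axis j w) * (u y * ?k w))) \<partial>lborel \<partial>lborel)"
      by (subst lborel.nn_integral_fst[symmetric]) simp_all
    also have "\<dots> = (\<integral>\<^sup>+y. ennreal (cmod (u y)) * (\<integral>\<^sup>+w. ennreal (cmod (\<psi> (y + axis j w))) * ennreal (cmod (?k w)) \<partial>lborel) \<partial>lborel)"
      by (intro nn_integral_cong) (simp add: norm_mult ennreal_mult nn_integral_cmult[symmetric] mult.left_commute)
    also have "\<dots> = (\<integral>\<^sup>+z. ennreal (cmod (\<psi> z)) * cauchy_majorant R j u z \<partial>lborel)"
      unfolding cauchy_majorant_def
      by (rule nn_integral_shift_adjoint[symmetric]) auto
    finally show "(\<integral>\<^sup>+x. ennreal (norm (case x of (y, w) \<Rightarrow> \<psi> (y + axis j w) * (u y * ?k w))) \<partial>(lborel \<Otimes>\<^sub>M lborel)) < \<infinity>"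
      using fin by simp
  qed simp
  have "(\<integral>z. cauchy_transform R j u z * \<psi> z \<partial>lborel) = (\<integral>z. (\<integral>w. \<psi> z * (u (z - axis j w) * ?k w) \<partial>lborel) / ?c \<partial>lborel)"
    by (intro Bochner_Integration.integral_cong) (auto simp: cauchy_transform_def)
  also have "\<dots> = (\<integral>z. \<integral>w. \<psi> z * (u (z - axis j w) * ?k w) \<partial>lborel \<partial>lborel) / ?c"
    by simp
  also have "(\<integral>z. \<integral>w. \<psi> z * (u (z - axis j w) * ?k w) \<partial>lborel \<partial>lborel) = (\<integral>w. \<integral>z. \<psi> z * (u (z - axis j w) * ?k w) \<partial>lborel \<partial>lborel)"
    by (rule lborel_pair.Fubini_integral[symmetric, OF int])
  also have "\<dots> = (\<integral>w. \<integral>y. \<psi> (y + axis j w) * (u y * ?k w) \<partial>lborel \<partial>lborel)"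
  proof (rule Bochner_Integration.integral_cong[OF refl])
    fix w
    show "(\<integral>z. \<psi> z * (u (z - axis j w) * ?k w) \<partial>lborel) = (\<integral>y. \<psi> (y + axis j w) * (u y * ?k w) \<partial>lborel)"
      by (subst integral_translate[symmetric, where c="axis j w"]) simp_all
  qed
  also have "\<dots> = (\<integral>y. \<integral>w. \<psi> (y + axis j w) * (u y * ?k w) \<partial>lborel \<partial>lborel)"
    by (rule lborel_pair.Fubini_integral[OF int2])
  also have "\<dots> / ?c = (\<integral>y. (\<integral>w. \<psi> (y + axis j w) * (u y * ?k w) \<partial>lborel) / ?c \<partial>lborel)"
    by simp
  also have "\<dots> = (\<integral>y. u y * cauchy_adjoint R j \<psi> y \<partial>lborel)"
  proof (rule Bochner_Integration.integral_cong[OF refl])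
    fix y
    have "(\<lambda>w. \<psi> (y + axis j w) * (u y * ?k w)) = (\<lambda>w. u y * (\<psi> (y + axis j w) * ?k w))" by (auto simp: mult_ac)
    then show "(\<integral>w. \<psi> (y + axis j w) * (u y * ?k w) \<partial>lborel) / ?c = u y * cauchy_adjoint R j \<psi> y"
      by (simp add: cauchy_adjoint_def)
  qed
  finally show ?thesis .
qed

text \<open>After moving the kernel to the bounded function \<open>\<psi>\<close>, the inner integral is bounded and vanishes
unless \<open>y\<close> lies in \<open>L\<close>, so integrability of \<open>u\<close> over \<open>L\<close> is enough.\<close>

lemma cauchy_majorant_finite:
  assumes [measurable]: "u \<in> borel_measurable borel" "\<psi> \<in> borel_measurable borel" "L \<in> sets borel"
    and M: "\<And>z. cmod (\<psi> z) \<le> M"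
    and L: "\<And>y w. u y \<noteq> 0 \<Longrightarrow> \<psi> (y + axis j w) \<noteq> 0 \<Longrightarrow> y \<in> L"
    and fin: "(\<integral>\<^sup>+y. ennreal (cmod (u y)) * indicator L y \<partial>lborel) < \<infinity>"
  shows "(\<integral>\<^sup>+z. ennreal (cmod (\<psi> z)) * cauchy_majorant R j u z \<partial>lborel) < \<infinity>"
proof -
  have M0: "M \<ge> 0" using order_trans[OF norm_ge_zero M] by blast
  let ?I = "\<integral>\<^sup>+w. ennreal (cmod (cauchy_kernel R w)) \<partial>lborel"
  have I: "?I < \<infinity>" using integrable_cauchy_kernel[of R] unfolding integrable_iff_bounded by simp
  have "(\<integral>\<^sup>+z. ennreal (cmod (\<psi> z)) * cauchy_majorant R j u z \<partial>lborel) =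
    (\<integral>\<^sup>+y. ennreal (cmod (u y)) * (\<integral>\<^sup>+w. ennreal (cmod (\<psi> (y + axis j w))) * ennreal (cmod (cauchy_kernel R w)) \<partial>lborel) \<partial>lborel)"
    unfolding cauchy_majorant_def by (rule nn_integral_shift_adjoint) auto
  also have "\<dots> \<le> (\<integral>\<^sup>+y. (ennreal M * ?I) * (ennreal (cmod (u y)) * indicator L y) \<partial>lborel)"
  proof (rule nn_integral_mono)
    fix y
    show "ennreal (cmod (u y)) * (\<integral>\<^sup>+w. ennreal (cmod (\<psi> (y + axis j w))) * ennreal (cmod (cauchy_kernel R w)) \<partial>lborel)
      \<le> (ennreal M * ?I) * (ennreal (cmod (u y)) * indicator L y)"
    proof (cases "u y \<noteq> 0 \<and> (\<exists>w. \<psi> (y + axis j w) \<noteq> 0)")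
      case True
      then have "y \<in> L" using L by blast
      have "(\<integral>\<^sup>+w. ennreal (cmod (\<psi> (y + axis j w))) * ennreal (cmod (cauchy_kernel R w)) \<partial>lborel) \<le> (\<integral>\<^sup>+w. ennreal M * ennreal (cmod (cauchy_kernel R w)) \<partial>lborel)"
        by (intro nn_integral_mono mult_right_mono ennreal_leI M) auto
      also have "\<dots> = ennreal M * ?I" by (rule nn_integral_cmult) simp
      finally show ?thesis using \<open>y \<in> L\<close> by (simp add: mult.commute mult_left_mono)
    qed auto
  qed
  also have "\<dots> = (ennreal M * ?I) * (\<integral>\<^sup>+y. ennreal (cmod (u y)) * indicator L y \<partial>lborel)"
    by (rule nn_integral_cmult) simp
  also have "\<dots> < \<infinity>" using fin I by (simp add: ennreal_mult_less_top)
  finally show ?thesis .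
qed

lemma AE_shift:
  fixes f :: "complex^'n \<Rightarrow> complex"
  assumes [measurable]: "f \<in> borel_measurable borel" "g \<in> borel_measurable borel"
    and ae: "AE y in lborel. f y = g y"
  shows "AE z in lborel. AE w in lborel. f (z - axis j w) = g (z - axis j w)"
proof (rule lborel_pair.AE_commute[THEN iffD1])
  show "AE w in lborel. AE z in lborel. f (z - axis j w) = g (z - axis j w)"
  proof (rule AE_I2)
    fix w
    show "AE z in lborel. f (z - axis j w) = g (z - axis j w)"
      using AE_lborel_translate[OF ae, of "- axis j w"] by simp
  qed
qed measurable

text \<open>A relation that holds almost everywhere for the functions holds, by Fubini's theorem, for almost
every \<open>z\<close> at almost every point of the fibre through \<open>z\<close>. Where the majorants are finite the
integrals converge and may be combined.\<close>

lemma cauchy_transform_lincomb_AE: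
  fixes u u' u'' :: "complex^'n \<Rightarrow> complex"
  assumes [measurable]: "u \<in> borel_measurable borel" "u' \<in> borel_measurable borel" "u'' \<in> borel_measurable borel"
    and ae: "AE y in lborel. u'' y = a * u y + b * u' y"
    and S: "AE z in lborel. z \<in> S \<longrightarrow> cauchy_majorant R j u z < \<infinity>"
      "AE z in lborel. z \<in> S \<longrightarrow> cauchy_majorant R j u' z < \<infinity>"
  shows "AE z in lborel. z \<in> S \<longrightarrow>
    cauchy_transform R j u'' z = a * cauchy_transform R j u z + b * cauchy_transform R j u' z"
proof -
  have int: "integrable lborel (\<lambda>w. v (z - axis j w) * cauchy_kernel R w)"
    if "cauchy_majorant R j v z < \<infinity>" "v \<in> borel_measurable borel" for v z
    using that unfolding cauchy_majorant_def
    by (intro integrableI_bounded) (auto simp: norm_mult ennreal_mult)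
  have "AE z in lborel. AE w in lborel. u'' (z - axis j w) = a * u (z - axis j w) + b * u' (z - axis j w)"
    by (rule AE_shift[OF _ _ ae]) measurable
  then show ?thesis using S
  proof eventually_elim
    case (elim z)
    show ?case
    proof
      assume z: "z \<in> S"
      have "(\<integral>w. u'' (z - axis j w) * cauchy_kernel R w \<partial>lborel) =
        (\<integral>w. a * (u (z - axis j w) * cauchy_kernel R w) + b * (u' (z - axis j w) * cauchy_kernel R w) \<partial>lborel)"
      proof (rule integral_cong_AE)
        show "AE w in lborel. u'' (z - axis j w) * cauchy_kernel R w = a * (u (z - axis j w) * cauchy_kernel R w) + b * (u' (z - axis j w) * cauchy_kernel R w)"
          using elim(1) by eventually_elim (simp add: algebra_simps)
      qed measurable
      also have "\<dots> = a * (\<integral>w. u (z - axis j w) * cauchy_kernel R w \<partial>lborel) + b * (\<integral>w. u' (z - axis j w) * cauchy_kernel R w \<partial>lborel)"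
        using int[of u z] int[of u' z] elim z by simp
      finally show "cauchy_transform R j u'' z = a * cauchy_transform R j u z + b * cauchy_transform R j u' z"
        by (simp add: cauchy_transform_def add_divide_distrib)
    qed
  qed
qed

section \<open>The adjoint on test functions\<close>

lemma test_function_compact_support:
  assumes "test_function D \<phi>"
  obtains K where "compact K" "K \<subseteq> D" "\<And>x. x \<notin> K \<Longrightarrow> \<phi> x = 0"
proof (rule that)
  show "compact (closure {x. \<phi> x \<noteq> 0})" "closure {x. \<phi> x \<noteq> 0} \<subseteq> D"
    using assms by (auto simp: test_function_def)
  show "\<phi> x = 0" if "x \<notin> closure {x. \<phi> x \<noteq> 0}" for x
    using that subsetD[OF closure_subset, of x "{x. \<phi> x \<noteq> 0}"] by auto
qed

lemma test_functionI:
  assumes "\<And>k. Ck k \<phi>" "compact K" "K \<subseteq> D" "\<And>x. x \<notin> K \<Longrightarrow> \<phi> x = 0"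
  shows "test_function D \<phi>"
proof -
  have "closure {x. \<phi> x \<noteq> 0} \<subseteq> K"
    using assms by (intro closure_minimal compact_imp_closed) auto
  moreover from this have "compact (closure {x. \<phi> x \<noteq> 0})"
    using compact_Int_closed[OF assms(2), of "closure {x. \<phi> x \<noteq> 0}"] by (simp add: Int_absorb1)
  ultimately show ?thesis unfolding test_function_def using assms by auto
qed

lemma cauchy_adjoint_has_derivative:
  assumes \<phi>: "Ck (Suc 0) \<phi>" and K: "compact K" "\<And>x. x \<notin> K \<Longrightarrow> \<phi> x = 0"
  shows "(cauchy_adjoint R j \<phi> has_derivative (\<lambda>h. cauchy_adjoint R j (\<lambda>x. frechet_derivative \<phi> (at x) h) z)) (at z)"
  unfolding cauchy_adjoint_def
  by (rule bounded_linear.has_derivative[OF bounded_linear_divide])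
     (rule has_derivative_integral_translate[OF bounded_linear_axis \<phi> K integrable_cauchy_kernel])

lemma Ck_cauchy_adjoint:
  assumes "\<And>k. Ck k \<phi>" and K: "compact K" "\<And>x. x \<notin> K \<Longrightarrow> \<phi> x = 0"
  shows "Ck k (cauchy_adjoint R j \<phi>)"
  unfolding cauchy_adjoint_def[abs_def] divide_inverse
  by (intro Ck_mult Ck_const Ck_integral_translate[OF bounded_linear_axis integrable_cauchy_kernel K(1) assms(1) K(2)])

lemma integrable_adjoint:
  assumes "continuous_on UNIV \<phi>" "compact K" "\<And>x. x \<notin> K \<Longrightarrow> \<phi> x = 0"
  shows "integrable lborel (\<lambda>w. \<phi> (z + axis j w) * cauchy_kernel R w)"
  by (rule integrable_translate_kernel[OF assms bounded_linear_axis integrable_cauchy_kernel])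

lemma axis_Basis: "axis j 1 \<in> (Basis :: (complex^'n) set)" "axis j \<i> \<in> (Basis :: (complex^'n) set)"
  by (auto simp: axis_in_Basis_iff Basis_complex_def)

lemma wirtinger_bar_cauchy_adjoint:
  assumes \<phi>: "Ck (Suc 0) \<phi>" and K: "compact K" "\<And>x. x \<notin> K \<Longrightarrow> \<phi> x = 0"
  shows "wirtinger_bar i (cauchy_adjoint R j \<phi>) z = cauchy_adjoint R j (wirtinger_bar i \<phi>) z"
proof -
  have fd: "frechet_derivative (cauchy_adjoint R j \<phi>) (at z) = (\<lambda>h. cauchy_adjoint R j (\<lambda>x. frechet_derivative \<phi> (at x) h) z)"
    using frechet_derivative_at[OF cauchy_adjoint_has_derivative[OF assms]] by simp
  have D: "integrable lborel (\<lambda>w. frechet_derivative \<phi> (at (z + axis j w)) v * cauchy_kernel R w)" if "v \<in> Basis" for v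
    by (rule integrable_adjoint[OF _ K(1), of "\<lambda>x. frechet_derivative \<phi> (at x) v"])
       (use \<phi> that frechet_derivative_zero_outside[OF compact_imp_closed[OF K(1)] K(2)] in auto)
  have "(\<integral>w. wirtinger_bar i \<phi> (z + axis j w) * cauchy_kernel R w \<partial>lborel) =
    (\<integral>w. (frechet_derivative \<phi> (at (z + axis j w)) (axis i 1) * cauchy_kernel R w +
       \<i> * (frechet_derivative \<phi> (at (z + axis j w)) (axis i \<i>) * cauchy_kernel R w)) / 2 \<partial>lborel)"
    unfolding wirtinger_bar_def by (intro Bochner_Integration.integral_cong) (auto simp: algebra_simps)
  also have "\<dots> = ((\<integral>w. frechet_derivative \<phi> (at (z + axis j w)) (axis i 1) * cauchy_kernel R w \<partial>lborel) +
       \<i> * (\<integral>w. frechet_derivative \<phi> (at (z + axis j w)) (axis i \<i>) * cauchy_kernel R w \<partial>lborel)) / 2"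
    by (rule integral_half_add_ii[OF D D]) (rule axis_Basis)+
  finally have eq: "(\<integral>w. wirtinger_bar i \<phi> (z + axis j w) * cauchy_kernel R w \<partial>lborel) = \<dots>" .
  show ?thesis
    unfolding wirtinger_bar_def[of i "cauchy_adjoint R j \<phi>"] fd unfolding cauchy_adjoint_def eq
    by (simp add: add_divide_distrib mult.commute)
qed

text \<open>The Cauchy-Pompeiu formula along the fibre through \<open>z\<close>, with the coordinate shifted so that the
point of evaluation is the origin. The bound on \<open>R\<close> ensures that the truncation of the kernel lies
outside the support.\<close>

lemma cauchy_adjoint_wirtinger_bar:
  fixes z :: "complex^'n::finite" and \<phi> :: "complex^'n \<Rightarrow> complex"
  assumes \<phi>: "Ck (Suc 0) \<phi>" and K: "compact K" "\<And>x. x \<notin> K \<Longrightarrow> \<phi> x = 0"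
    and B: "\<And>x::complex^'n. x \<in> K \<Longrightarrow> cmod (x $ j) \<le> B" "cmod (z $ j) \<le> B" and R: "R \<ge> 2 * B"
  shows "cauchy_adjoint R j (wirtinger_bar j \<phi>) z = - \<phi> z"
proof -
  define \<psi> where "\<psi> w = \<phi> (axis j w + z)" for w
  have \<psi>: "Ck (Suc 0) \<psi>" unfolding \<psi>_def by (rule Ck_compose_affine[OF bounded_linear_axis \<phi>])
  define K' where "K' = (\<lambda>x. x $ j - z $ j) ` K"
  have K': "compact K'" unfolding K'_def by (intro compact_continuous_image continuous_intros K)
  have K'0: "\<psi> w = 0" if "w \<notin> K'" for w
  proof (rule ccontr)
    assume "\<psi> w \<noteq> 0"
    then have "axis j w + z \<in> K" unfolding \<psi>_def using K(2) by blast
    then have "(axis j w + z) $ j - z $ j \<in> K'" unfolding K'_def by (rule imageI)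
    then show False using that by simp
  qed
  have K'R: "K' \<subseteq> cball 0 R"
  proof
    fix w assume "w \<in> K'"
    then obtain x where x: "x \<in> K" "w = x $ j - z $ j" unfolding K'_def by auto
    have "cmod w \<le> cmod (x $ j) + cmod (z $ j)" unfolding x(2) by (rule norm_triangle_ineq4)
    then show "w \<in> cball 0 R" using B(1)[OF x(1)] B(2) R by simp
  qed
  have fd: "frechet_derivative \<psi> (at w) v = frechet_derivative \<phi> (at (z + axis j w)) (axis j v)" for w v
  proof -
    have d: "((\<lambda>w. axis j w + z) has_derivative axis j) (at w)"
      using bounded_linear_imp_has_derivative[OF bounded_linear_axis] by (auto intro!: derivative_eq_intros)
    have "(\<psi> has_derivative (\<lambda>v. frechet_derivative \<phi> (at (axis j w + z)) (axis j v))) (at w)"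
      unfolding \<psi>_def by (rule has_derivative_compose[OF d Ck_has_derivative[OF \<phi>]])
    from frechet_derivative_at[OF this] show ?thesis by (metis add.commute)
  qed
  have "(\<integral>w. wirtinger_bar j \<phi> (z + axis j w) * cauchy_kernel R w \<partial>lborel) = - of_real cauchy_const * \<psi> 0"
    using integral_dbar_cauchy[OF \<psi> K' K'0 K'R] unfolding fd wirtinger_bar_def .
  then show ?thesis using cauchy_const_pos bounded_linear.linear[OF bounded_linear_axis[of j], THEN linear_0]
    by (simp add: cauchy_adjoint_def \<psi>_def)
qed

lemma wirtinger_bar_mult:
  assumes "f differentiable (at z)" "g differentiable (at z)"
  shows "wirtinger_bar i (\<lambda>z. f z * g z) z = wirtinger_bar i f z * g z + f z * wirtinger_bar i g z"
proof -
  have "((\<lambda>z. f z * g z) has_derivative (\<lambda>h. f z * frechet_derivative g (at z) h + frechet_derivative f (at z) h * g z)) (at z)"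
    using assms by (intro has_derivative_mult) (auto simp: frechet_derivative_works[symmetric])
  from frechet_derivative_at[OF this] have "frechet_derivative (\<lambda>z. f z * g z) (at z) = (\<lambda>h. f z * frechet_derivative g (at z) h + frechet_derivative f (at z) h * g z)"
    by simp
  then show ?thesis by (simp add: wirtinger_bar_def algebra_simps add_divide_distrib)
qed

section \<open>Cut-off functions\<close>

lemma integral_bump_nonzero:
  assumes "d > 0" shows "(\<integral>w. bump d w \<partial>lborel) \<noteq> 0"
proof
  assume z: "(\<integral>w. bump d w \<partial>lborel) = 0"
  obtain r where r: "\<And>w. r w \<ge> 0" "\<And>w. bump d w = of_real (r w)" using bump_real_nonneg by metis
  have supp: "w \<notin> cbox (Complex (-d) (-d)) (Complex d d) \<Longrightarrow> bump d w = 0" for w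
    using bump_nonzero_iff[of d w] by (auto simp: in_cbox_complex_iff)
  have "integrable lborel (\<lambda>w. indicator (cbox (Complex (-d) (-d)) (Complex d d)) w *\<^sub>R bump d w)"
    using borel_integrable_compact[of "cbox (Complex (-d) (-d)) (Complex d d)" "bump d"] Ck_continuous[OF Ck_bump]
    by (auto intro: continuous_on_subset simp: set_integrable_def)
  moreover have "indicator (cbox (Complex (-d) (-d)) (Complex d d)) w *\<^sub>R bump d w = bump d w" for w
    using supp[of w] by (auto split: split_indicator)
  ultimately have "integrable lborel (bump d)" by simp
  then have ir: "integrable lborel r" unfolding r(2)[abs_def] by (simp add: complex_of_real_integrable_eq)
  have "(\<integral>w. r w \<partial>lborel) = 0"
    using z unfolding r(2) by (metis integral_complex_of_real of_real_eq_0_iff)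
  then have ae: "AE w in lborel. r w = 0"
    using integral_nonneg_eq_0_iff_AE[OF ir] r(1) by simp
  have "AE w in lborel. w \<notin> box (Complex (-d) (-d)) (Complex d d)"
    using ae
  proof eventually_elim
    case (elim w)
    then have "bump d w = 0" using r(2) by simp
    then show ?case using bump_nonzero_iff[of d w] by (auto simp: in_box_complex_iff)
  qed
  then have "box (Complex (-d) (-d)) (Complex d d) \<in> null_sets lborel"
    by (subst (asm) AE_iff_null) (auto simp: borel_open)
  moreover have "emeasure lborel (box (Complex (-d) (-d)) (Complex d d)) = ennreal (2 * d * (2 * d))"
  proof -
    have "1 \<noteq> \<i>" "\<i> \<noteq> 1" by (auto simp: complex_eq_iff)
    then show ?thesis using assms
      by (simp add: emeasure_lborel_box_eq Basis_complex_def inner_complex_def)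
  qed
  moreover have "d * d > 0" using assms by simp
  ultimately show False by (simp add: null_sets_def ennreal_eq_0_iff)
qed

text \<open>Mollify the indicator function of the neighbourhood of \<open>C0\<close> of radius \<open>e/2\<close> by a bump
supported within distance \<open>e/4\<close> of the origin. The result is 1 up to distance \<open>e/4\<close> from \<open>C0\<close> and vanishes beyond
distance \<open>3e/4\<close>.\<close>

lemma smooth_cutoff:
  fixes C0 D :: "complex set"
  assumes C0: "compact C0" and D: "open D" "C0 \<subseteq> D"
  obtains \<theta> K V where "\<And>k. Ck k \<theta>" "compact K" "K \<subseteq> D" "\<And>x. x \<notin> K \<Longrightarrow> \<theta> x = 0"
    "open V" "C0 \<subseteq> V" "\<And>x. x \<in> V \<Longrightarrow> \<theta> x = 1"
proof -
  obtain e where e: "e > 0" "(\<Union>x\<in>C0. cball x e) \<subseteq> D"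
    using compact_subset_open_imp_cball_epsilon_subset[OF C0 D(1) D(2)] by blast
  have comp: "compact (\<Union>x\<in>C0. cball x r)" for r :: real
  proof -
    have "(\<Union>x\<in>C0. cball x r) = {x + y |x y. x \<in> C0 \<and> y \<in> cball 0 r}"
      by (auto simp: dist_norm norm_minus_commute) (metis add_diff_cancel_left' diff_add_cancel add.commute)
    then show ?thesis using compact_sums[OF C0 compact_cball[of 0 r]] by simp
  qed
  \<comment> \<open>The bump is supported in a square of half-side \<open>d\<close>, hence within distance \<open>2 d = e/4\<close>.\<close>
  define d where "d = e / 8"
  define W where "W = (\<Union>x\<in>C0. cball x (e / 2))"
  have d: "d > 0" using e by (simp add: d_def)
  have bs: "dist z w < e / 4" if "bump d (z - w) \<noteq> 0" for z w
  proof -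
    have "\<bar>Re (z - w)\<bar> < d" "\<bar>Im (z - w)\<bar> < d" using that bump_nonzero_iff by auto
    then show ?thesis using cmod_le[of "z - w"] by (simp add: dist_norm d_def)
  qed
  define k :: "complex \<Rightarrow> complex" where "k w = indicator W w" for w
  have k: "integrable lborel k" unfolding k_def
    by (rule integrable_real_indicator[THEN integrable_of_real, simplified of_real_indicator])
       (use comp emeasure_compact_finite in \<open>auto simp: W_def intro!: borel_compact\<close>)
  define c where "c = (\<integral>w. bump d w \<partial>lborel)"
  have c: "c \<noteq> 0" unfolding c_def by (rule integral_bump_nonzero[OF d])
  define \<theta> where "\<theta> z = (\<integral>w. bump d (z + - w) * k w \<partial>lborel) * (1 / c)" for z
  have [measurable]: "bump d \<in> borel_measurable borel"
    by (rule borel_measurable_continuous_onI[OF Ck_continuous[OF Ck_bump]])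
  have b0: "x \<notin> cball 0 (e / 4) \<Longrightarrow> bump d x = 0" for x using bs[of x 0] by (auto simp: dist_norm)
  have "bounded_linear (\<lambda>w::complex. - w)" by (rule bounded_linear_minus[OF bounded_linear_ident])
  from Ck_integral_translate[OF this k compact_cball Ck_bump b0]
  have "Ck m \<theta>" for m unfolding \<theta>_def[abs_def] by (intro Ck_mult Ck_const)
  moreover have "\<theta> x = 0" if "x \<notin> (\<Union>x\<in>C0. cball x (3 * e / 4))" for x
  proof -
    have "bump d (x + - w) * k w = 0" for w
    proof (cases "w \<in> W \<and> bump d (x - w) \<noteq> 0")
      case True
      then obtain y where "y \<in> C0" "dist y w \<le> e / 2" unfolding W_def by auto
      moreover have "dist x w < e / 4" using bs True by blast
      ultimately have "dist y x \<le> 3 * e / 4" using dist_triangle[of y x w] by (simp add: dist_commute)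
      then show ?thesis using that \<open>y \<in> C0\<close> by auto
    qed (auto simp: k_def)
    then have "(\<lambda>w. bump d (x + - w) * k w) = (\<lambda>w. 0)" by (rule ext)
    then show ?thesis unfolding \<theta>_def by simp
  qed
  moreover have "\<theta> x = 1" if xC: "x \<in> (\<Union>x\<in>C0. ball x (e / 4))" for x
  proof -
    have "bump d (x + - w) * k w = bump d (x - w)" for w
    proof (cases "bump d (x - w) = 0")
      case False
      obtain y where y: "y \<in> C0" "dist y x < e / 4" using xC by auto
      have "dist y w \<le> e / 2" using dist_triangle[of y w x] bs[OF False] y by (simp add: dist_commute)
      then have "w \<in> W" using y unfolding W_def by auto
      then show ?thesis by (simp add: k_def)
    qed simp
    then have "(\<lambda>w. bump d (x + - w) * k w) = (\<lambda>w. bump d (x - w))" by (rule ext)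
    then have "\<theta> x = (\<integral>w. bump d (x - w) \<partial>lborel) * (1 / c)" unfolding \<theta>_def by simp
    also have "(\<integral>w. bump d (x - w) \<partial>lborel) = c"
    proof -
      have "(\<integral>w. bump d w \<partial>lborel) = (\<integral>w. bump d w \<partial>density (distr lborel borel (\<lambda>w. x + (-1) *\<^sub>R w)) (\<lambda>_. 1))"
        using lborel_affine[of "-1" x] by simp
      also have "\<dots> = (\<integral>w. bump d (x - w) \<partial>lborel)"
        by (simp add: density_1 integral_distr)
      finally show ?thesis by (simp add: c_def)
    qed
    finally show ?thesis using c by simp
  qed
  moreover have "(\<Union>x\<in>C0. cball x (3 * e / 4)) \<subseteq> D" using e by (force simp: subset_iff)
  moreover have "open (\<Union>x\<in>C0. ball x (e / 4))" "C0 \<subseteq> (\<Union>x\<in>C0. ball x (e / 4))" using e(1) by force+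
  ultimately show ?thesis using comp[of "3 * e / 4"] that by blast
qed

section \<open>Multiplying the adjoint by a cut-off function\<close>

definition loc_int :: "'a::euclidean_space set \<Rightarrow> ('a \<Rightarrow> complex) \<Rightarrow> bool" where
  "loc_int \<Omega> u \<longleftrightarrow> (\<forall>K. compact K \<and> K \<subseteq> \<Omega> \<longrightarrow> (\<integral>\<^sup>+x. ennreal (cmod (u x)) * indicator K x \<partial>lborel) < \<infinity>)"

text \<open>The integral identity of \<open>has_dbar\<close> with respect to Lebesgue-Borel measure on the whole space, where
Fubini's theorem and translation invariance are directly applicable. Local integrability is recorded
separately by \<open>loc_int\<close>.\<close>

definition weak_dbar ::
    "(complex^'n::{finite,linorder}) set \<Rightarrow> nat \<Rightarrow> 'n form \<Rightarrow> 'n form \<Rightarrow> bool" where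
  "weak_dbar \<Omega> q f h \<longleftrightarrow> (\<forall>J \<phi>. card J = Suc q \<and> test_function \<Omega> \<phi> \<longrightarrow>
     (\<integral>z. h J z * \<phi> z \<partial>lborel) =
     - (\<Sum>j\<in>J. (-1) ^ card {i\<in>J. i < j} * (\<integral>z. f (J - {j}) z * wirtinger_bar j \<phi> z \<partial>lborel)))"

lemma loc_int_integrable:
  assumes [measurable]: "u \<in> borel_measurable borel" and u: "loc_int \<Omega> u"
    and \<phi>: "continuous_on UNIV \<phi>" and K: "compact K" "K \<subseteq> \<Omega>" "\<And>x. x \<notin> K \<Longrightarrow> \<phi> x = 0"
  shows "integrable lborel (\<lambda>z. u z * \<phi> z)"
proof -
  obtain M where M: "M > 0" "\<And>x. norm (\<phi> x) \<le> M" using bounded_compact_support[OF \<phi> K(1) K(3)] by blast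
  have [measurable]: "\<phi> \<in> borel_measurable borel" by (rule borel_measurable_continuous_onI[OF \<phi>])
  have [measurable]: "K \<in> sets borel" using K(1) by (rule borel_compact)
  show ?thesis
  proof (rule integrableI_bounded)
    have "(\<integral>\<^sup>+z. ennreal (norm (u z * \<phi> z)) \<partial>lborel) \<le> (\<integral>\<^sup>+z. ennreal M * (ennreal (cmod (u z)) * indicator K z) \<partial>lborel)"
    proof (rule nn_integral_mono)
      fix z
      show "ennreal (norm (u z * \<phi> z)) \<le> ennreal M * (ennreal (cmod (u z)) * indicator K z)"
      proof (cases "z \<in> K")
        case True
        have "norm (u z * \<phi> z) \<le> M * cmod (u z)" unfolding norm_mult using M(2)[of z]
          by (metis mult.commute mult_left_mono norm_ge_zero)
        then show ?thesis using True M(1) by (simp add: ennreal_mult[symmetric] ennreal_leI)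
      qed (simp add: K(3))
    qed
    also have "\<dots> = ennreal M * (\<integral>\<^sup>+z. ennreal (cmod (u z)) * indicator K z \<partial>lborel)" by (rule nn_integral_cmult) simp
    also have "\<dots> < \<infinity>" using u K by (auto simp: loc_int_def ennreal_mult_less_top)
    finally show "(\<integral>\<^sup>+z. ennreal (norm (u z * \<phi> z)) \<partial>lborel) < \<infinity>" .
  qed simp
qed

text \<open>All points that arise from \<open>K\<close> by replacing the \<open>j\<close>-th coordinate by an element of \<open>C\<close>. It
contains the support of \<open>\<eta> (y\<^sub>j)\<close> times the adjoint transform of \<open>\<psi>\<close>, if \<open>\<psi>\<close> is
supported in \<open>K\<close> and \<open>\<eta>\<close> in \<open>C\<close>.\<close>

definition fibre_hull :: "'n \<Rightarrow> (complex^'n) set \<Rightarrow> complex set \<Rightarrow> (complex^'n::finite) set" where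
  "fibre_hull j K C = (\<lambda>(z, t). z + axis j (t - z $ j)) ` (K \<times> C)"

lemma compact_fibre_hull: "compact K \<Longrightarrow> compact C \<Longrightarrow> compact (fibre_hull j K C)"
  unfolding fibre_hull_def
  by (intro compact_continuous_image compact_Times)
     (auto simp: case_prod_unfold intro!: continuous_intros bounded_linear.continuous_on[OF bounded_linear_axis])

lemma fibre_hullI:
  fixes y :: "complex^'n::finite"
  assumes "y + axis j w \<in> K" "y $ j \<in> C"
  shows "y \<in> fibre_hull j K C"
proof -
  have "y + axis j w + axis j (y $ j - (y + axis j w) $ j) = y"
    by (simp add: vec_eq_iff axis_def)
  then show ?thesis unfolding fibre_hull_def using assms by (force intro!: image_eqI[of _ _ "(y + axis j w, y $ j)"])
qed

lemma fibre_hull_subset: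
  assumes "K \<subseteq> product_set (D(j := G))" "C \<subseteq> D j"
  shows "fibre_hull j K C \<subseteq> product_set D"
proof
  fix y assume "y \<in> fibre_hull j K C"
  then obtain z t where zt: "z \<in> K" "t \<in> C" "y = z + axis j (t - z $ j)" unfolding fibre_hull_def by auto
  have z: "z $ i \<in> (D(j := G)) i" for i using assms(1) zt(1) unfolding product_set_def by blast
  have "y $ i \<in> D i" for i
    using z[of i] zt assms(2) by (cases "i = j") (auto simp: axis_def)
  then show "y \<in> product_set D" by (simp add: product_set_def)
qed

definition dbar1 :: "(complex \<Rightarrow> complex) \<Rightarrow> complex \<Rightarrow> complex" where
  "dbar1 \<eta> w = (frechet_derivative \<eta> (at w) 1 + \<i> * frechet_derivative \<eta> (at w) \<i>) / 2"

lemma Ck_dbar1: "(\<And>k. Ck k \<eta>) \<Longrightarrow> Ck k (dbar1 \<eta>)"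
proof -
  assume a: "\<And>k. Ck k \<eta>"
  have "Ck k (\<lambda>w. frechet_derivative \<eta> (at w) 1)" "Ck k (\<lambda>w. frechet_derivative \<eta> (at w) \<i>)"
    using a[of "Suc k"] by (auto simp: Basis_complex_def)
  then show ?thesis unfolding dbar1_def[abs_def] divide_inverse by (intro Ck_mult Ck_add Ck_const)
qed

lemma dbar1_zero_outside: "closed C \<Longrightarrow> (\<And>w. w \<notin> C \<Longrightarrow> \<eta> w = 0) \<Longrightarrow> w \<notin> C \<Longrightarrow> dbar1 \<eta> w = 0"
  using frechet_derivative_zero_outside[of C \<eta> w] by (simp add: dbar1_def)

lemma dbar1_zero_const:
  assumes "open V" "\<And>w. w \<in> V \<Longrightarrow> \<eta> w = c" "w \<in> V" shows "dbar1 \<eta> w = 0"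
proof -
  have "((\<lambda>w. c) has_derivative (\<lambda>v. 0)) (at w)" by simp
  then have "(\<eta> has_derivative (\<lambda>v. 0)) (at w)"
    by (rule has_derivative_transform_within_open[where s=V]) (use assms in auto)
  then have "frechet_derivative \<eta> (at w) = (\<lambda>v. 0)" using frechet_derivative_at by metis
  then show ?thesis by (simp add: dbar1_def)
qed

lemma bounded_linear_component: "bounded_linear (\<lambda>z::complex^'n. z $ j)"
  by (rule bounded_linear_vec_nth)

lemma Ck_component: "Ck k \<eta> \<Longrightarrow> Ck k (\<lambda>z::complex^'n. \<eta> (z $ j))"
  using Ck_compose_affine[OF bounded_linear_component[of j], where c=0] by simp

lemma wirtinger_bar_component:
  assumes "Ck (Suc 0) \<eta>"
  shows "wirtinger_bar i (\<lambda>z::complex^'n. \<eta> (z $ j)) z = (if i = j then dbar1 \<eta> (z $ j) else 0)"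
proof -
  have "((\<lambda>z::complex^'n. \<eta> (z $ j)) has_derivative (\<lambda>v. frechet_derivative \<eta> (at (z $ j)) (v $ j))) (at z)"
    by (rule has_derivative_compose[OF bounded_linear_imp_has_derivative[OF bounded_linear_component] Ck_has_derivative[OF assms]])
  from frechet_derivative_at[OF this]
  have fd: "frechet_derivative (\<lambda>z::complex^'n. \<eta> (z $ j)) (at z) = (\<lambda>v. frechet_derivative \<eta> (at (z $ j)) (v $ j))" by simp
  have "frechet_derivative \<eta> (at (z $ j)) 0 = 0"
    using linear_0[OF has_derivative_linear[OF Ck_has_derivative[OF assms]]] .
  then show ?thesis unfolding wirtinger_bar_def fd by (auto simp: dbar1_def axis_def)
qed

lemma wirtinger_bar_continuous:
  assumes "Ck (Suc 0) \<phi>" shows "continuous_on UNIV (wirtinger_bar i \<phi>)"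
proof -
  have "continuous_on UNIV (\<lambda>z. frechet_derivative \<phi> (at z) (axis i 1))"
    "continuous_on UNIV (\<lambda>z. frechet_derivative \<phi> (at z) (axis i \<i>))"
    using assms axis_Basis by auto
  then show ?thesis unfolding wirtinger_bar_def[abs_def] by (intro continuous_intros) auto
qed

lemma wirtinger_bar_zero_outside:
  "closed K \<Longrightarrow> (\<And>z. z \<notin> K \<Longrightarrow> \<phi> z = 0) \<Longrightarrow> z \<notin> K \<Longrightarrow> wirtinger_bar i \<phi> z = 0"
  using frechet_derivative_zero_outside[of K \<phi> z] by (simp add: wirtinger_bar_def)

text \<open>In one step of the solution the \<open>j\<close>-th factor \<open>D j\<close> shrinks to \<open>G\<close>. The set \<open>C\<close> carries
the cut-off function, and \<open>P\<close> is a set containing all domains that occur in the process: cutting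
off by its indicator function makes the forms globally defined, and the operators do not depend on
the current domain.\<close>

context
  fixes j :: "'n::{finite,linorder}" and D :: "'n \<Rightarrow> complex set" and G C :: "complex set"
    and P :: "(complex^'n::{finite,linorder}) set" and B R :: real
  assumes C: "compact C" "C \<subseteq> D j" and P: "P \<in> sets borel" "product_set D \<subseteq> P"
    and GD: "G \<subseteq> D j" and B: "\<And>w. w \<in> D j \<Longrightarrow> cmod w \<le> B" and R: "R \<ge> 2 * B"
begin

lemma cut_majorant_finite:
  assumes u: "u \<in> borel_measurable borel" "loc_int (product_set D) u"
    and \<eta>: "continuous_on UNIV \<eta>" "\<And>w. w \<notin> C \<Longrightarrow> \<eta> w = 0"
    and \<psi>: "\<psi> \<in> borel_measurable borel" "\<And>z. cmod (\<psi> z) \<le> M"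
    and K: "compact K" "K \<subseteq> product_set (D(j := G))" "\<And>z. z \<notin> K \<Longrightarrow> \<psi> z = 0"
  shows "(\<integral>\<^sup>+z. ennreal (cmod (\<psi> z)) * cauchy_majorant R j (\<lambda>z. indicator P z * (\<eta> (z $ j) * u z)) z \<partial>lborel) < \<infinity>"
proof (rule cauchy_majorant_finite[where L="fibre_hull j K C"])
  have [measurable]: "\<eta> \<in> borel_measurable borel" by (rule borel_measurable_continuous_onI[OF \<eta>(1)])
  note [measurable] = P(1) u(1) \<psi>(1)
  have cL: "compact (fibre_hull j K C)" by (rule compact_fibre_hull[OF K(1) C(1)])
  show [measurable]: "fibre_hull j K C \<in> sets borel" using cL by (rule borel_compact)
  show "(\<lambda>z. indicator P z * (\<eta> (z $ j) * u z)) \<in> borel_measurable borel" by measurable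
  show "y \<in> fibre_hull j K C" if "indicator P y * (\<eta> (y $ j) * u y) \<noteq> 0" "\<psi> (y + axis j w) \<noteq> 0" for y w
    using that K(3) \<eta>(2) by (intro fibre_hullI[of _ _ w]) auto
  obtain M' where M': "M' > 0" "\<And>x. norm (\<eta> x) \<le> M'" using bounded_compact_support[OF \<eta>(1) C(1) \<eta>(2)] by blast
  have "(\<integral>\<^sup>+y. ennreal (cmod (indicator P y * (\<eta> (y $ j) * u y))) * indicator (fibre_hull j K C) y \<partial>lborel) \<le>
     (\<integral>\<^sup>+y. ennreal M' * (ennreal (cmod (u y)) * indicator (fibre_hull j K C) y) \<partial>lborel)"
  proof (rule nn_integral_mono)
    fix y
    have "cmod (indicator P y * (\<eta> (y $ j) * u y)) = indicator P y * (cmod (\<eta> (y $ j)) * cmod (u y))"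
      by (simp add: norm_mult split: split_indicator)
    also have "\<dots> \<le> 1 * (M' * cmod (u y))"
      using M'(1) by (intro mult_mono M'(2)) (auto split: split_indicator)
    finally have "ennreal (cmod (indicator P y * (\<eta> (y $ j) * u y))) \<le> ennreal M' * ennreal (cmod (u y))"
      using M'(1) by (simp add: ennreal_mult[symmetric] ennreal_leI)
    then show "ennreal (cmod (indicator P y * (\<eta> (y $ j) * u y))) * indicator (fibre_hull j K C) y \<le> ennreal M' * (ennreal (cmod (u y)) * indicator (fibre_hull j K C) y)"
      by (auto split: split_indicator)
  qed
  also have "\<dots> = ennreal M' * (\<integral>\<^sup>+y. ennreal (cmod (u y)) * indicator (fibre_hull j K C) y \<partial>lborel)"
    by (rule nn_integral_cmult) measurable
  also have "\<dots> < \<infinity>" using u(2) cL fibre_hull_subset[of K D j G C] K(2) C(2)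
    unfolding loc_int_def by (simp add: ennreal_mult_less_top)
  finally show "(\<integral>\<^sup>+y. ennreal (cmod (indicator P y * (\<eta> (y $ j) * u y))) * indicator (fibre_hull j K C) y \<partial>lborel) < \<infinity>" .
qed (use \<psi> in auto)

lemma cut_transform_loc_int:
  assumes u: "u \<in> borel_measurable borel" "loc_int (product_set D) u"
    and \<eta>: "continuous_on UNIV \<eta>" "\<And>w. w \<notin> C \<Longrightarrow> \<eta> w = 0"
  shows "loc_int (product_set (D(j := G))) (cauchy_transform R j (\<lambda>z. indicator P z * (\<eta> (z $ j) * u z)))"
  unfolding loc_int_def
proof (intro allI impI, elim conjE)
  let ?v = "\<lambda>z. indicator P z * (\<eta> (z $ j) * u z)"
  have [measurable]: "\<eta> \<in> borel_measurable borel" by (rule borel_measurable_continuous_onI[OF \<eta>(1)])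
  note [measurable] = P(1) u(1)
  fix K assume K: "compact K" "K \<subseteq> product_set (D(j := G))"
  have [measurable]: "K \<in> sets borel" using K(1) by (rule borel_compact)
  have "(\<integral>\<^sup>+x. ennreal (cmod (cauchy_transform R j ?v x)) * indicator K x \<partial>lborel) \<le>
    (\<integral>\<^sup>+x. ennreal (1 / cauchy_const) * (ennreal (cmod (indicator K x)) * cauchy_majorant R j ?v x) \<partial>lborel)"
  proof (rule nn_integral_mono)
    fix x
    show "ennreal (cmod (cauchy_transform R j ?v x)) * indicator K x \<le> ennreal (1 / cauchy_const) * (ennreal (cmod (indicator K x)) * cauchy_majorant R j ?v x)"
      using norm_cauchy_transform_le[of R j ?v x] by (auto split: split_indicator)
  qed
  also have "\<dots> = ennreal (1 / cauchy_const) * (\<integral>\<^sup>+x. ennreal (cmod (indicator K x)) * cauchy_majorant R j ?v x \<partial>lborel)"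
    by (rule nn_integral_cmult) measurable
  also have "\<dots> < \<infinity>"
    using cut_majorant_finite[OF u \<eta>, of "indicator K" 1 K] K by (auto simp: ennreal_mult_less_top split: split_indicator)
  finally show "(\<integral>\<^sup>+x. ennreal (cmod (cauchy_transform R j ?v x)) * indicator K x \<partial>lborel) < \<infinity>" .
qed

text \<open>The indicator of \<open>P\<close> disappears on the right, because \<open>\<eta> (y\<^sub>j)\<close> times the adjoint of
\<open>\<psi>\<close> is supported in a fibre hull that already lies in the product.\<close>

lemma cut_transform_adjoint:
  assumes u: "u \<in> borel_measurable borel" "loc_int (product_set D) u"
    and \<eta>: "continuous_on UNIV \<eta>" "\<And>w. w \<notin> C \<Longrightarrow> \<eta> w = 0"
    and \<psi>: "continuous_on UNIV \<psi>" and K: "compact K" "K \<subseteq> product_set (D(j := G))" "\<And>z. z \<notin> K \<Longrightarrow> \<psi> z = 0"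
  shows "(\<integral>z. cauchy_transform R j (\<lambda>z. indicator P z * (\<eta> (z $ j) * u z)) z * \<psi> z \<partial>lborel) =
    (\<integral>y. u y * (\<eta> (y $ j) * cauchy_adjoint R j \<psi> y) \<partial>lborel)"
proof -
  have [measurable]: "\<eta> \<in> borel_measurable borel" by (rule borel_measurable_continuous_onI[OF \<eta>(1)])
  have [measurable]: "\<psi> \<in> borel_measurable borel" by (rule borel_measurable_continuous_onI[OF \<psi>])
  note [measurable] = P(1) u(1)
  obtain M where M: "M > 0" "\<And>x. norm (\<psi> x) \<le> M" using bounded_compact_support[OF \<psi> K(1) K(3)] by blast
  have "(\<integral>z. cauchy_transform R j (\<lambda>z. indicator P z * (\<eta> (z $ j) * u z)) z * \<psi> z \<partial>lborel) =
    (\<integral>y. (indicator P y * (\<eta> (y $ j) * u y)) * cauchy_adjoint R j \<psi> y \<partial>lborel)"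
    by (rule cauchy_transform_adjoint) (use cut_majorant_finite[OF u \<eta> _ M(2) K] in simp_all)
  also have "\<dots> = (\<integral>y. u y * (\<eta> (y $ j) * cauchy_adjoint R j \<psi> y) \<partial>lborel)"
  proof (rule Bochner_Integration.integral_cong[OF refl])
    fix y
    show "(indicator P y * (\<eta> (y $ j) * u y)) * cauchy_adjoint R j \<psi> y = u y * (\<eta> (y $ j) * cauchy_adjoint R j \<psi> y)"
    proof (cases "y \<in> P")
      case False
      have "\<eta> (y $ j) * cauchy_adjoint R j \<psi> y = 0"
      proof (cases "y $ j \<in> C")
        case True
        have "\<psi> (y + axis j w) = 0" for w
        proof (rule ccontr)
          assume "\<psi> (y + axis j w) \<noteq> 0"
          then have "y \<in> fibre_hull j K C" using K(3) True by (intro fibre_hullI[of _ _ w]) auto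
          then show False using fibre_hull_subset[of K D j G C] K(2) C(2) P(2) False by blast
        qed
        then show ?thesis by (simp add: cauchy_adjoint_def)
      qed (simp add: \<eta>(2))
      then show ?thesis using False by simp
    qed simp
  qed
  finally show ?thesis .
qed

lemma test_function_support_D:
  fixes x :: "complex^'n::{finite,linorder}"
  assumes "K \<subseteq> product_set (D(j := G))" "x \<in> K" shows "cmod (x $ j) \<le> B"
proof -
  have "x $ j \<in> (D(j := G)) j" using assms unfolding product_set_def by blast
  then show ?thesis using GD B by auto
qed

text \<open>The adjoint transform of a test function is smooth but spreads along the fibres; the factor
\<open>\<eta> (y\<^sub>j)\<close> confines it to a compact fibre hull inside the larger product. In the directions
\<open>i \<noteq> j\<close> the z-bar-derivative passes through both operations, in the direction \<open>j\<close> the product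
rule produces a term with the derivative of \<open>\<eta>\<close> and, by Cauchy-Pompeiu, a local term.\<close>

lemma cut_test_function:
  assumes \<eta>: "\<And>k. Ck k \<eta>" "\<And>w. w \<notin> C \<Longrightarrow> \<eta> w = 0" and \<phi>: "test_function (product_set (D(j := G))) \<phi>"
  shows "test_function (product_set D) (\<lambda>y. \<eta> (y $ j) * cauchy_adjoint R j \<phi> y)"
    and "i \<noteq> j \<Longrightarrow> wirtinger_bar i (\<lambda>y. \<eta> (y $ j) * cauchy_adjoint R j \<phi> y) y =
      \<eta> (y $ j) * cauchy_adjoint R j (wirtinger_bar i \<phi>) y"
    and "wirtinger_bar j (\<lambda>y. \<eta> (y $ j) * cauchy_adjoint R j \<phi> y) y =
      dbar1 \<eta> (y $ j) * cauchy_adjoint R j \<phi> y - \<eta> (y $ j) * \<phi> y"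
    and "\<eta> (y $ j) * cauchy_adjoint R j (wirtinger_bar j \<phi>) y = - (\<eta> (y $ j) * \<phi> y)"
proof -
  obtain K where K: "compact K" "K \<subseteq> product_set (D(j := G))" "\<And>x. x \<notin> K \<Longrightarrow> \<phi> x = 0"
    using test_function_compact_support[OF \<phi>] by blast
  have C\<phi>: "Ck k \<phi>" for k using \<phi> by (simp add: test_function_def)
  have CT: "Ck k (cauchy_adjoint R j \<phi>)" for k by (rule Ck_cauchy_adjoint[OF C\<phi> K(1) K(3)])
  have C\<eta>: "Ck k (\<lambda>y::complex^'n::{finite,linorder}. \<eta> (y $ j))" for k by (rule Ck_component[OF \<eta>(1)])
  show "test_function (product_set D) (\<lambda>y. \<eta> (y $ j) * cauchy_adjoint R j \<phi> y)"
  proof (rule test_functionI[where K="fibre_hull j K C"])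
    show "Ck k (\<lambda>y. \<eta> (y $ j) * cauchy_adjoint R j \<phi> y)" for k by (rule Ck_mult[OF C\<eta> CT])
    show "compact (fibre_hull j K C)" by (rule compact_fibre_hull[OF K(1) C(1)])
    show "fibre_hull j K C \<subseteq> product_set D" by (rule fibre_hull_subset[OF K(2) C(2)])
    fix y assume y: "y \<notin> fibre_hull j K C"
    show "\<eta> (y $ j) * cauchy_adjoint R j \<phi> y = 0"
    proof (cases "y $ j \<in> C")
      case True
      then have "\<phi> (y + axis j w) = 0" for w using y K(3) fibre_hullI[of y j w K C] by blast
      then show ?thesis by (simp add: cauchy_adjoint_def)
    qed (simp add: \<eta>(2))
  qed
  have W: "wirtinger_bar i (cauchy_adjoint R j \<phi>) y = cauchy_adjoint R j (wirtinger_bar i \<phi>) y" for i y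
    by (rule wirtinger_bar_cauchy_adjoint[OF C\<phi> K(1) K(3)])
  have M: "wirtinger_bar i (\<lambda>y. \<eta> (y $ j) * cauchy_adjoint R j \<phi> y) y =
    (if i = j then dbar1 \<eta> (y $ j) else 0) * cauchy_adjoint R j \<phi> y + \<eta> (y $ j) * cauchy_adjoint R j (wirtinger_bar i \<phi>) y" for i y
    using C\<eta>[of "Suc 0"] CT[of "Suc 0"]
    by (subst wirtinger_bar_mult) (simp_all add: wirtinger_bar_component[OF \<eta>(1)] W)
  show N: "\<eta> (y $ j) * cauchy_adjoint R j (wirtinger_bar j \<phi>) y = - (\<eta> (y $ j) * \<phi> y)" for y
  proof (cases "y $ j \<in> C")
    case True
    then have "cmod (y $ j) \<le> B" using C(2) B by blast
    then have "cauchy_adjoint R j (wirtinger_bar j \<phi>) y = - \<phi> y"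
      by (intro cauchy_adjoint_wirtinger_bar[OF C\<phi> K(1) K(3) test_function_support_D[OF K(2)] _ R])
    then show ?thesis by simp
  qed (simp add: \<eta>(2))
  show "i \<noteq> j \<Longrightarrow> wirtinger_bar i (\<lambda>y. \<eta> (y $ j) * cauchy_adjoint R j \<phi> y) y =
      \<eta> (y $ j) * cauchy_adjoint R j (wirtinger_bar i \<phi>) y" by (simp add: M)
  show "wirtinger_bar j (\<lambda>y. \<eta> (y $ j) * cauchy_adjoint R j \<phi> y) y =
      dbar1 \<eta> (y $ j) * cauchy_adjoint R j \<phi> y - \<eta> (y $ j) * \<phi> y" by (simp add: M N)
qed

end

section \<open>The homotopy formula in one coordinate\<close>

text \<open>Contraction of \<open>g\<close> with \<open>d\<close>z-bar\<open>\<^sub>j\<close>, followed by the cut-off Cauchy transform. The sign moves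
\<open>d\<close>z-bar\<open>\<^sub>j\<close> from the front to its place in the increasing order of \<open>insert j I\<close>.\<close>

definition homotopy_op :: "real \<Rightarrow> 'n \<Rightarrow> (complex \<Rightarrow> complex) \<Rightarrow> (complex^'n::{finite,linorder}) set \<Rightarrow> 'n form \<Rightarrow> 'n form" where
  "homotopy_op R j \<theta> P g I z = (if j \<in> I then 0 else (-1) ^ card {i\<in>I. i < j} *
     cauchy_transform R j (\<lambda>z. indicator P z * (\<theta> (z $ j) * g (insert j I) z)) z)"

text \<open>The error committed by the cut-off: only the part of \<open>g\<close> without \<open>d\<close>z-bar\<open>\<^sub>j\<close> contributes, and
only where the cut-off function is not holomorphic.\<close>

definition remainder_op :: "real \<Rightarrow> 'n \<Rightarrow> (complex \<Rightarrow> complex) \<Rightarrow> (complex^'n::{finite,linorder}) set \<Rightarrow> 'n form \<Rightarrow> 'n form" where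
  "remainder_op R j \<theta> P g I z = (if j \<in> I then 0 else
     cauchy_transform R j (\<lambda>z. indicator P z * (dbar1 \<theta> (z $ j) * g I z)) z)"

text \<open>Removing \<open>i\<close> and inserting \<open>j\<close> in either order gives opposite signs: the two differentials
anticommute.\<close>

lemma sign_swap:
  fixes i j :: "'n::{finite,linorder}"
  assumes "i \<in> J" "j \<notin> J"
  shows "(-1::complex) ^ card {k\<in>J. k < i} * (-1) ^ card {k\<in>J - {i}. k < j} =
    - ((-1) ^ card {k\<in>insert j J. k < i} * (-1) ^ card {k\<in>J. k < j})"
proof -
  have ij: "i \<noteq> j" using assms by auto
  consider "i < j" | "j < i" using ij by (meson linorder_neqE)
  then show ?thesis
  proof cases
    case 1
    have "{k\<in>insert j J. k < i} = {k\<in>J. k < i}" using 1 by auto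
    moreover have "{k\<in>J. k < j} = insert i {k\<in>J - {i}. k < j}" using 1 assms by auto
    then have "card {k\<in>J. k < j} = Suc (card {k\<in>J - {i}. k < j})"
      by (simp add: card_insert_disjoint)
    ultimately show ?thesis by simp
  next
    case 2
    have "{k\<in>insert j J. k < i} = insert j {k\<in>J. k < i}" using 2 by auto
    then have "card {k\<in>insert j J. k < i} = Suc (card {k\<in>J. k < i})"
      using assms by (simp add: card_insert_disjoint)
    moreover have "{k\<in>J - {i}. k < j} = {k\<in>J. k < j}" using 2 by auto
    ultimately show ?thesis by simp
  qed
qed

lemma minus_one_power_square: "(-1::complex) ^ n * ((-1) ^ n * x) = x"
  by (simp add: mult.assoc[symmetric] power_mult_distrib[symmetric])

text \<open>Test against \<open>\<phi>\<close> and move the Cauchy transform to the other side. For an index set \<open>J\<close> that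
contains \<open>j\<close> only the derivative in \<open>z\<^sub>j\<close> survives, and the Cauchy-Pompeiu formula returns the
coefficient \<open>g J\<close>. For \<open>J\<close> without \<open>j\<close> the identity is the closedness of \<open>g\<close> in the
component \<open>insert j J\<close>, tested against \<open>\<theta> (y\<^sub>j)\<close> times the adjoint transform of \<open>\<phi>\<close>. The
same argument with the derivative of \<open>\<theta>\<close> in place of \<open>\<theta>\<close> shows that the remainder is
closed, since that derivative vanishes over \<open>G\<close>.\<close>

lemma homotopy_step:
  fixes j :: "'n::{finite,linorder}" and g :: "'n form"
  assumes C: "compact C" "C \<subseteq> D j" and P: "P \<in> sets borel" "product_set D \<subseteq> P"
    and GD: "G \<subseteq> D j" and B: "\<And>w. w \<in> D j \<Longrightarrow> cmod w \<le> B" and R: "R \<ge> 2 * B"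
    and \<theta>: "\<And>k. Ck k \<theta>" "\<And>w. w \<notin> C \<Longrightarrow> \<theta> w = 0"
    and V: "open V" "G \<subseteq> V" "\<And>w. w \<in> V \<Longrightarrow> \<theta> w = 1"
    and g: "\<And>I. g I \<in> borel_measurable borel" "\<And>I. card I = Suc q \<Longrightarrow> loc_int (product_set D) (g I)"
    and closed: "weak_dbar (product_set D) (Suc q) g (\<lambda>I z. 0)"
  shows "weak_dbar (product_set (D(j := G))) q (homotopy_op R j \<theta> P g) (\<lambda>I z. g I z - remainder_op R j \<theta> P g I z)"
    and "weak_dbar (product_set (D(j := G))) (Suc q) (remainder_op R j \<theta> P g) (\<lambda>I z. 0)"
    and "card I = q \<Longrightarrow> loc_int (product_set (D(j := G))) (homotopy_op R j \<theta> P g I)"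
    and "card I = Suc q \<Longrightarrow> loc_int (product_set (D(j := G))) (remainder_op R j \<theta> P g I)"
proof -
  let ?\<Omega> = "product_set D" and ?\<Omega>' = "product_set (D(j := G))"
  let ?T = "\<lambda>u. cauchy_transform R j (\<lambda>z. indicator P z * (\<theta> (z $ j) * u z))"
  let ?T' = "\<lambda>u. cauchy_transform R j (\<lambda>z. indicator P z * (dbar1 \<theta> (z $ j) * u z))"
  have \<theta>': "Ck k (dbar1 \<theta>)" for k by (rule Ck_dbar1[OF \<theta>(1)])
  have \<theta>'0: "w \<notin> C \<Longrightarrow> dbar1 \<theta> w = 0" for w
    by (rule dbar1_zero_outside[OF compact_imp_closed[OF C(1)] \<theta>(2)])
  have sub: "?\<Omega>' \<subseteq> ?\<Omega>"
  proof
    fix z assume "z \<in> ?\<Omega>'"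
    then have z: "z $ i \<in> (D(j := G)) i" for i unfolding product_set_def by blast
    have "z $ i \<in> D i" for i using z[of i] GD by (cases "i = j") auto
    then show "z \<in> ?\<Omega>" by (simp add: product_set_def)
  qed
  have lT: "loc_int ?\<Omega>' (?T (g I))" if "card I = Suc q" for I
    by (rule cut_transform_loc_int[OF C P GD B R g(1) g(2)[OF that] Ck_continuous[OF \<theta>(1)] \<theta>(2)])
  have lT': "loc_int ?\<Omega>' (?T' (g I))" if "card I = Suc q" for I
    by (rule cut_transform_loc_int[OF C P GD B R g(1) g(2)[OF that] Ck_continuous[OF \<theta>'] \<theta>'0])
  show "loc_int ?\<Omega>' (homotopy_op R j \<theta> P g I)" if "card I = q" for I
  proof (cases "j \<in> I")
    case True then show ?thesis by (simp add: homotopy_op_def[abs_def] loc_int_def)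
  next
    case False
    then have "card (insert j I) = Suc q" using that by simp
    from lT[OF this] show ?thesis using False unfolding loc_int_def homotopy_op_def by (simp add: norm_mult norm_power)
  qed
  show lres: "loc_int ?\<Omega>' (remainder_op R j \<theta> P g I)" if "card I = Suc q" for I
  proof (cases "j \<in> I")
    case True then show ?thesis by (simp add: remainder_op_def[abs_def] loc_int_def)
  next
    case False
    with lT'[OF that] show ?thesis unfolding loc_int_def remainder_op_def by simp
  qed
  have adj: "(\<integral>z. ?T (g I) z * \<psi> z \<partial>lborel) = (\<integral>y. g I y * (\<theta> (y $ j) * cauchy_adjoint R j \<psi> y) \<partial>lborel)"
    "(\<integral>z. ?T' (g I) z * \<psi> z \<partial>lborel) = (\<integral>y. g I y * (dbar1 \<theta> (y $ j) * cauchy_adjoint R j \<psi> y) \<partial>lborel)"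
    if "card I = Suc q" "continuous_on UNIV \<psi>" "compact K" "K \<subseteq> ?\<Omega>'" "\<And>z. z \<notin> K \<Longrightarrow> \<psi> z = 0" for I \<psi> K
    by (rule cut_transform_adjoint[OF C P GD B R g(1) g(2)[OF that(1)] Ck_continuous[OF \<theta>(1)] \<theta>(2) that(2-5)],
        assumption+)
       (rule cut_transform_adjoint[OF C P GD B R g(1) g(2)[OF that(1)] Ck_continuous[OF \<theta>'] \<theta>'0 that(2-5)])
  have cut: "test_function ?\<Omega> (\<lambda>y. \<eta> (y $ j) * cauchy_adjoint R j \<phi> y)"
    "\<And>i y. i \<noteq> j \<Longrightarrow> wirtinger_bar i (\<lambda>y. \<eta> (y $ j) * cauchy_adjoint R j \<phi> y) y =
      \<eta> (y $ j) * cauchy_adjoint R j (wirtinger_bar i \<phi>) y"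
    "\<And>y. wirtinger_bar j (\<lambda>y. \<eta> (y $ j) * cauchy_adjoint R j \<phi> y) y =
      dbar1 \<eta> (y $ j) * cauchy_adjoint R j \<phi> y - \<eta> (y $ j) * \<phi> y"
    "\<And>y. \<eta> (y $ j) * cauchy_adjoint R j (wirtinger_bar j \<phi>) y = - (\<eta> (y $ j) * \<phi> y)"
    if "\<forall>k. Ck k \<eta>" "\<forall>w. w \<notin> C \<longrightarrow> \<eta> w = 0" "test_function ?\<Omega>' \<phi>" for \<eta> and \<phi> :: "complex^'n::{finite,linorder} \<Rightarrow> complex"
    using that cut_test_function[where \<eta>=\<eta> and \<phi>=\<phi>, OF C P GD B R] by blast+
  have "\<forall>k. Ck k \<theta>" "\<forall>w. w \<notin> C \<longrightarrow> \<theta> w = 0" "\<forall>k. Ck k (dbar1 \<theta>)" "\<forall>w. w \<notin> C \<longrightarrow> dbar1 \<theta> w = 0"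
    using \<theta> \<theta>' \<theta>'0 by blast+
  note ctf = cut[OF this(1,2)] and ctf' = cut[OF this(3,4)]
  show "weak_dbar ?\<Omega>' (Suc q) (remainder_op R j \<theta> P g) (\<lambda>I z. 0)"
    unfolding weak_dbar_def
  proof (intro allI impI, elim conjE)
    fix J :: "'n set" and \<phi> :: "complex^'n::{finite,linorder} \<Rightarrow> complex"
    assume J: "card J = Suc (Suc q)" and \<phi>: "test_function ?\<Omega>' \<phi>"
    obtain K where K: "compact K" "K \<subseteq> ?\<Omega>'" "\<And>x. x \<notin> K \<Longrightarrow> \<phi> x = 0"
      using test_function_compact_support[OF \<phi>] by blast
    have C\<phi>: "Ck k \<phi>" for k using \<phi> by (simp add: test_function_def)
    have W0: "x \<notin> K \<Longrightarrow> wirtinger_bar i \<phi> x = 0" for i x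
      by (rule wirtinger_bar_zero_outside[OF compact_imp_closed[OF K(1)] K(3)])
    have cardJ: "i \<in> J \<Longrightarrow> card (J - {i}) = Suc q" for i using J by simp
    have trm: "(\<integral>z. ?T' (g (J - {i})) z * wirtinger_bar i \<phi> z \<partial>lborel) =
        (\<integral>y. g (J - {i}) y * (dbar1 \<theta> (y $ j) * cauchy_adjoint R j (wirtinger_bar i \<phi>) y) \<partial>lborel)" if "i \<in> J" for i
      by (rule adj(2)[OF cardJ[OF that] wirtinger_bar_continuous[OF C\<phi>] K(1,2) W0])
    have "(\<Sum>i\<in>J. (-1) ^ card {k\<in>J. k < i} * (\<integral>z. remainder_op R j \<theta> P g (J - {i}) z * wirtinger_bar i \<phi> z \<partial>lborel)) = 0"
    proof (cases "j \<in> J")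
      case True
      have "(\<integral>z. remainder_op R j \<theta> P g (J - {i}) z * wirtinger_bar i \<phi> z \<partial>lborel) = 0" if "i \<in> J" for i
      proof (cases "i = j")
        case False then show ?thesis using True by (simp add: remainder_op_def)
      next
        case [simp]: True
        have "(\<integral>z. remainder_op R j \<theta> P g (J - {i}) z * wirtinger_bar i \<phi> z \<partial>lborel) =
          (\<integral>y. g (J - {i}) y * (dbar1 \<theta> (y $ j) * cauchy_adjoint R j (wirtinger_bar i \<phi>) y) \<partial>lborel)"
          using trm[OF that] by (simp add: remainder_op_def)
        also have "\<dots> = (\<integral>y. 0 \<partial>(lborel :: (complex^'n::{finite,linorder}) measure))"
        proof (rule Bochner_Integration.integral_cong[OF refl])
          fix y
          have "dbar1 \<theta> (y $ j) * \<phi> y = 0"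
          proof (cases "y \<in> K")
            case True
            then have "y $ j \<in> (D(j := G)) j" using K(2) unfolding product_set_def by blast
            then have "y $ j \<in> V" using V(2) by auto
            then show ?thesis using dbar1_zero_const[OF V(1) V(3)] by simp
          qed (simp add: K(3))
          then show "g (J - {i}) y * (dbar1 \<theta> (y $ j) * cauchy_adjoint R j (wirtinger_bar i \<phi>) y) = 0"
            using ctf'(4)[OF \<phi>, of y] by simp
        qed
        finally show ?thesis by simp
      qed
      then show ?thesis by simp
    next
      case False
      let ?\<Phi> = "\<lambda>y. dbar1 \<theta> (y $ j) * cauchy_adjoint R j \<phi> y"
      have "(\<integral>z. 0 * ?\<Phi> z \<partial>lborel) = - (\<Sum>i\<in>J. (-1) ^ card {k\<in>J. k < i} * (\<integral>z. g (J - {i}) z * wirtinger_bar i ?\<Phi> z \<partial>lborel))"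
        using closed J ctf'(1)[OF \<phi>] unfolding weak_dbar_def by blast
      moreover have "(\<integral>z. g (J - {i}) z * wirtinger_bar i ?\<Phi> z \<partial>lborel) = (\<integral>z. remainder_op R j \<theta> P g (J - {i}) z * wirtinger_bar i \<phi> z \<partial>lborel)"
        if "i \<in> J" for i
      proof -
        have ij: "i \<noteq> j" using that False by auto
        show ?thesis unfolding ctf'(2)[OF \<phi> ij] using trm[OF that] False by (simp add: remainder_op_def)
      qed
      ultimately show ?thesis by simp
    qed
    then show "(\<integral>z. 0 * \<phi> z \<partial>lborel) = - (\<Sum>i\<in>J. (-1) ^ card {k\<in>J. k < i} * (\<integral>z. remainder_op R j \<theta> P g (J - {i}) z * wirtinger_bar i \<phi> z \<partial>lborel))"
      by simp
  qed
  show "weak_dbar ?\<Omega>' q (homotopy_op R j \<theta> P g) (\<lambda>I z. g I z - remainder_op R j \<theta> P g I z)"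
    unfolding weak_dbar_def
  proof (intro allI impI, elim conjE)
    fix J :: "'n set" and \<phi> :: "complex^'n::{finite,linorder} \<Rightarrow> complex"
    assume J: "card J = Suc q" and \<phi>: "test_function ?\<Omega>' \<phi>"
    obtain K where K: "compact K" "K \<subseteq> ?\<Omega>'" "\<And>x. x \<notin> K \<Longrightarrow> \<phi> x = 0"
      using test_function_compact_support[OF \<phi>] by blast
    have C\<phi>: "Ck k \<phi>" for k using \<phi> by (simp add: test_function_def)
    have W0: "x \<notin> K \<Longrightarrow> wirtinger_bar i \<phi> x = 0" for i x
      by (rule wirtinger_bar_zero_outside[OF compact_imp_closed[OF K(1)] K(3)])
    have finJ: "finite J" by simp
    have K\<Omega>: "K \<subseteq> ?\<Omega>" using K(2) sub by blast
    have \<theta>1: "\<theta> (y $ j) * \<phi> y = \<phi> y" for y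
    proof (cases "y \<in> K")
      case True
      then have "y $ j \<in> (D(j := G)) j" using K(2) unfolding product_set_def by blast
      then have "y $ j \<in> V" using V(2) by auto
      then show ?thesis using V(3) by simp
    qed (simp add: K(3))
    have ig: "integrable lborel (\<lambda>z. g J z * \<phi> z)"
      by (rule loc_int_integrable[OF g(1) g(2)[OF J] Ck_continuous[OF C\<phi>] K(1) K\<Omega> K(3)])
    show "(\<integral>z. (g J z - remainder_op R j \<theta> P g J z) * \<phi> z \<partial>lborel) =
      - (\<Sum>i\<in>J. (-1) ^ card {k\<in>J. k < i} * (\<integral>z. homotopy_op R j \<theta> P g (J - {i}) z * wirtinger_bar i \<phi> z \<partial>lborel))"
    proof (cases "j \<in> J")
      case True
      have ins: "insert j (J - {j}) = J" using True by auto
      have sg: "{k\<in>J - {j}. k < j} = {k\<in>J. k < j}" by auto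
      have "(\<Sum>i\<in>J. (-1) ^ card {k\<in>J. k < i} * (\<integral>z. homotopy_op R j \<theta> P g (J - {i}) z * wirtinger_bar i \<phi> z \<partial>lborel))
        = (\<Sum>i\<in>{j}. (-1) ^ card {k\<in>J. k < i} * (\<integral>z. homotopy_op R j \<theta> P g (J - {i}) z * wirtinger_bar i \<phi> z \<partial>lborel))"
      proof (rule sum.mono_neutral_right[OF finJ])
        show "\<forall>i\<in>J - {j}. (-1) ^ card {k\<in>J. k < i} * (\<integral>z. homotopy_op R j \<theta> P g (J - {i}) z * wirtinger_bar i \<phi> z \<partial>lborel) = 0"
        proof
          fix i assume "i \<in> J - {j}"
          then have "homotopy_op R j \<theta> P g (J - {i}) z = 0" for z using True by (auto simp: homotopy_op_def)
          then show "(-1) ^ card {k\<in>J. k < i} * (\<integral>z. homotopy_op R j \<theta> P g (J - {i}) z * wirtinger_bar i \<phi> z \<partial>lborel) = 0" by simp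
        qed
      qed (use True in simp)
      also have "\<dots> = (-1) ^ card {k\<in>J. k < j} * ((-1) ^ card {k\<in>J. k < j} * (\<integral>z. ?T (g J) z * wirtinger_bar j \<phi> z \<partial>lborel))"
      proof -
        have "homotopy_op R j \<theta> P g (J - {j}) z = (-1) ^ card {k\<in>J. k < j} * ?T (g J) z" for z
          unfolding homotopy_op_def ins sg by simp
        then show ?thesis by (simp add: mult.assoc)
      qed
      also have "\<dots> = (\<integral>z. ?T (g J) z * wirtinger_bar j \<phi> z \<partial>lborel)" by (rule minus_one_power_square)
      also have "\<dots> = (\<integral>y. g J y * (\<theta> (y $ j) * cauchy_adjoint R j (wirtinger_bar j \<phi>) y) \<partial>lborel)"
        by (rule adj(1)[OF J wirtinger_bar_continuous[OF C\<phi>] K(1,2) W0])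
      also have "\<dots> = - (\<integral>y. g J y * \<phi> y \<partial>lborel)" unfolding ctf(4)[OF \<phi>] \<theta>1 by simp
      finally show ?thesis using True by (simp add: remainder_op_def)
    next
      case False
      \<comment> \<open>Closedness of \<open>g\<close> in the component \<open>insert j J\<close>, tested against \<open>?\<Phi>\<close>, expresses the terms with \<open>i \<noteq> j\<close> by the one with \<open>i = j\<close>.\<close>
      let ?\<Phi> = "\<lambda>y. \<theta> (y $ j) * cauchy_adjoint R j \<phi> y"
      let ?J' = "insert j J"
      let ?e = "\<lambda>i J. (-1::complex) ^ card {k\<in>J. k < i}"
      have J': "card ?J' = Suc (Suc q)" using J False by simp
      have "(\<integral>z. 0 * ?\<Phi> z \<partial>lborel) = - (\<Sum>i\<in>?J'. ?e i ?J' * (\<integral>z. g (?J' - {i}) z * wirtinger_bar i ?\<Phi> z \<partial>lborel))"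
        using closed J' ctf(1)[OF \<phi>] unfolding weak_dbar_def by blast
      then have "(\<Sum>i\<in>?J'. ?e i ?J' * (\<integral>z. g (?J' - {i}) z * wirtinger_bar i ?\<Phi> z \<partial>lborel)) = 0"
        by (simp only: mult_zero_left Bochner_Integration.integral_zero neg_0_equal_iff_equal)
      then have "?e j ?J' * (\<integral>z. g (?J' - {j}) z * wirtinger_bar j ?\<Phi> z \<partial>lborel) + (\<Sum>i\<in>J. ?e i ?J' * (\<integral>z. g (?J' - {i}) z * wirtinger_bar i ?\<Phi> z \<partial>lborel)) = 0"
        unfolding sum.insert[OF finJ False] .
      moreover have "?J' - {j} = J" "{k\<in>?J'. k < j} = {k\<in>J. k < j}" using False by auto
      ultimately have cl: "(\<Sum>i\<in>J. ?e i ?J' * (\<integral>z. g (?J' - {i}) z * wirtinger_bar i ?\<Phi> z \<partial>lborel)) = - (?e j J * (\<integral>z. g J z * wirtinger_bar j ?\<Phi> z \<partial>lborel))"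
        by (simp add: add_eq_0_iff2)
      have tm: "?e i J * (\<integral>z. homotopy_op R j \<theta> P g (J - {i}) z * wirtinger_bar i \<phi> z \<partial>lborel) =
         - (?e j J * (?e i ?J' * (\<integral>z. g (?J' - {i}) z * wirtinger_bar i ?\<Phi> z \<partial>lborel)))" if "i \<in> J" for i
      proof -
        have ij: "i \<noteq> j" using that False by auto
        have ins: "insert j (J - {i}) = ?J' - {i}" using ij by auto
        have ci: "card (?J' - {i}) = Suc q" using J' that by simp
        have "(\<integral>z. homotopy_op R j \<theta> P g (J - {i}) z * wirtinger_bar i \<phi> z \<partial>lborel) =
          ?e j (J - {i}) * (\<integral>z. ?T (g (?J' - {i})) z * wirtinger_bar i \<phi> z \<partial>lborel)"
          using False by (simp add: homotopy_op_def ins mult.assoc)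
        also have "(\<integral>z. ?T (g (?J' - {i})) z * wirtinger_bar i \<phi> z \<partial>lborel) = (\<integral>z. g (?J' - {i}) z * wirtinger_bar i ?\<Phi> z \<partial>lborel)"
          unfolding ctf(2)[OF \<phi> ij]
          by (rule adj(1)[OF ci wirtinger_bar_continuous[OF C\<phi>] K(1,2) W0])
        finally have "?e i J * (\<integral>z. homotopy_op R j \<theta> P g (J - {i}) z * wirtinger_bar i \<phi> z \<partial>lborel) =
          (?e i J * ?e j (J - {i})) * (\<integral>z. g (?J' - {i}) z * wirtinger_bar i ?\<Phi> z \<partial>lborel)" by simp
        also have "?e i J * ?e j (J - {i}) = - (?e i ?J' * ?e j J)" by (rule sign_swap[OF that False])
        finally show ?thesis by (simp add: mult_ac)
      qed
      have "(\<Sum>i\<in>J. ?e i J * (\<integral>z. homotopy_op R j \<theta> P g (J - {i}) z * wirtinger_bar i \<phi> z \<partial>lborel)) =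
        - (?e j J * (\<Sum>i\<in>J. ?e i ?J' * (\<integral>z. g (?J' - {i}) z * wirtinger_bar i ?\<Phi> z \<partial>lborel)))"
        by (simp add: tm sum_negf sum_distrib_left)
      also have "\<dots> = (\<integral>z. g J z * wirtinger_bar j ?\<Phi> z \<partial>lborel)"
        unfolding cl by (simp add: minus_one_power_square)
      also have "\<dots> = (\<integral>z. g J z * (dbar1 \<theta> (z $ j) * cauchy_adjoint R j \<phi> z) - g J z * \<phi> z \<partial>lborel)"
        unfolding ctf(3)[OF \<phi>] \<theta>1 by (simp add: right_diff_distrib)
      also have "\<dots> = (\<integral>z. g J z * (dbar1 \<theta> (z $ j) * cauchy_adjoint R j \<phi> z) \<partial>lborel) - (\<integral>z. g J z * \<phi> z \<partial>lborel)"
      proof (rule Bochner_Integration.integral_diff[OF _ ig])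
        obtain L where L: "compact L" "L \<subseteq> ?\<Omega>" "\<And>x. x \<notin> L \<Longrightarrow> dbar1 \<theta> (x $ j) * cauchy_adjoint R j \<phi> x = 0"
          using test_function_compact_support[OF ctf'(1)[OF \<phi>]] by blast
        have "Ck 0 (\<lambda>y. dbar1 \<theta> (y $ j) * cauchy_adjoint R j \<phi> y)"
          using ctf'(1)[OF \<phi>] unfolding test_function_def by blast
        from Ck_continuous[OF this]
        show "integrable lborel (\<lambda>z. g J z * (dbar1 \<theta> (z $ j) * cauchy_adjoint R j \<phi> z))"
          by (rule loc_int_integrable[OF g(1) g(2)[OF J] _ L])
      qed
      also have "(\<integral>z. g J z * (dbar1 \<theta> (z $ j) * cauchy_adjoint R j \<phi> z) \<partial>lborel) = (\<integral>z. remainder_op R j \<theta> P g J z * \<phi> z \<partial>lborel)"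
        using adj(2)[OF J Ck_continuous[OF C\<phi>] K] False by (simp add: remainder_op_def)
      finally have S: "(\<Sum>i\<in>J. ?e i J * (\<integral>z. homotopy_op R j \<theta> P g (J - {i}) z * wirtinger_bar i \<phi> z \<partial>lborel)) =
        (\<integral>z. remainder_op R j \<theta> P g J z * \<phi> z \<partial>lborel) - (\<integral>z. g J z * \<phi> z \<partial>lborel)" .
      have [measurable]: "\<theta> \<in> borel_measurable borel" "dbar1 \<theta> \<in> borel_measurable borel"
        by (intro borel_measurable_continuous_onI Ck_continuous[OF \<theta>(1)] Ck_continuous[OF \<theta>'])+
      note [measurable] = g(1) P(1)
      have "remainder_op R j \<theta> P g J \<in> borel_measurable borel" using False unfolding remainder_op_def[abs_def] by simp
      then have "integrable lborel (\<lambda>z. remainder_op R j \<theta> P g J z * \<phi> z)"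
        by (rule loc_int_integrable[OF _ lres[OF J] Ck_continuous[OF C\<phi>] K])
      then show ?thesis unfolding S using ig by (simp add: left_diff_distrib)
    qed
  qed
qed

section \<open>Weighted bounds for the cut-off Cauchy transform\<close>

lemma Lp_le_mono:
  assumes p: "1 \<le> p" and c: "c > 0" and A: "A \<ge> 0"
    and le: "AE x in M. f x \<le> ennreal c * g x" and [measurable]: "g \<in> borel_measurable M"
    and g: "Lp_le p M g A"
  shows "Lp_le p M f (c * A)"
proof (cases "p = \<infinity>")
  case True
  then have "AE x in M. g x \<le> ennreal A" using g by (simp add: Lp_le_def)
  with le have "AE x in M. f x \<le> ennreal (c * A)"
  proof eventually_elim
    case (elim x)
    have "f x \<le> ennreal c * ennreal A" using elim by (meson mult_left_mono order_trans zero_le)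
    then show ?case using c A by (simp add: ennreal_mult)
  qed
  then show ?thesis using True by (simp add: Lp_le_def)
next
  case False
  let ?P = "enn2real p"
  have P: "?P \<ge> 0" by simp
  have "(\<integral>\<^sup>+x. ennreal_powr ?P (f x) \<partial>M) \<le> (\<integral>\<^sup>+x. ennreal (c powr ?P) * ennreal_powr ?P (g x) \<partial>M)"
  proof (rule nn_integral_mono_AE)
    show "AE x in M. ennreal_powr ?P (f x) \<le> ennreal (c powr ?P) * ennreal_powr ?P (g x)"
      using le
    proof eventually_elim
      case (elim x)
      then show ?case using ennreal_powr_mono[OF P elim] c by (simp add: ennreal_powr_mult)
    qed
  qed
  also have "\<dots> = ennreal (c powr ?P) * (\<integral>\<^sup>+x. ennreal_powr ?P (g x) \<partial>M)" by (rule nn_integral_cmult) measurable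
  also have "\<dots> \<le> ennreal (c powr ?P) * ennreal (A powr ?P)"
    using g False by (intro mult_left_mono) (auto simp: Lp_le_def)
  also have "\<dots> = ennreal ((c * A) powr ?P)" using c A by (simp add: powr_mult ennreal_mult)
  finally show ?thesis using False by (simp add: Lp_le_def)
qed

lemma ennreal_powr_add_le: 
  assumes "P \<ge> 0" shows "ennreal_powr P (x + y) \<le> ennreal (2 powr P) * (ennreal_powr P x + ennreal_powr P y)"
proof -
  have m: "x + y \<le> ennreal 2 * max x y"
    by (metis add_mono max.cobounded1 max.cobounded2 mult_2 ennreal_numeral numeral_One one_add_one ennreal_1)
  have "ennreal_powr P (x + y) \<le> ennreal_powr P (ennreal 2 * max x y)" by (rule ennreal_powr_mono[OF assms m])
  also have "\<dots> = ennreal (2 powr P) * ennreal_powr P (max x y)" by (rule ennreal_powr_mult) simp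
  also have "ennreal_powr P (max x y) \<le> ennreal_powr P x + ennreal_powr P y" by (simp add: max_def)
  finally show ?thesis by (simp add: mult_left_mono)
qed

text \<open>A factor 2 replaces Minkowski's inequality; it comes from
\<open>(x + y)\<^sup>P \<le> 2\<^sup>P (x\<^sup>P + y\<^sup>P)\<close>.\<close>

lemma Lp_le_add:
  assumes p: "1 \<le> p" and A: "A \<ge> 0" "A' \<ge> 0"
    and [measurable]: "f \<in> borel_measurable M" "g \<in> borel_measurable M"
    and f: "Lp_le p M f A" and g: "Lp_le p M g A'"
  shows "Lp_le p M (\<lambda>x. f x + g x) (2 * (A + A'))"
proof (cases "p = \<infinity>")
  case True
  then have "AE x in M. f x \<le> ennreal A" "AE x in M. g x \<le> ennreal A'" using f g by (auto simp: Lp_le_def)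
  then have "AE x in M. f x + g x \<le> ennreal (2 * (A + A'))"
  proof eventually_elim
    case (elim x)
    have "f x + g x \<le> ennreal A + ennreal A'" by (rule add_mono[OF elim])
    also have "\<dots> = ennreal (A + A')" using A by simp
    also have "\<dots> \<le> ennreal (2 * (A + A'))" using A by (intro ennreal_leI) auto
    finally show ?case .
  qed
  then show ?thesis using True by (simp add: Lp_le_def)
next
  case False
  let ?P = "enn2real p"
  have P: "?P \<ge> 1" by (rule enn2real_ge_1[OF p False])
  have "(\<integral>\<^sup>+x. ennreal_powr ?P (f x + g x) \<partial>M) \<le> (\<integral>\<^sup>+x. ennreal (2 powr ?P) * (ennreal_powr ?P (f x) + ennreal_powr ?P (g x)) \<partial>M)"
    by (intro nn_integral_mono ennreal_powr_add_le) simp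
  also have "\<dots> = ennreal (2 powr ?P) * ((\<integral>\<^sup>+x. ennreal_powr ?P (f x) \<partial>M) + (\<integral>\<^sup>+x. ennreal_powr ?P (g x) \<partial>M))"
    by (simp add: nn_integral_cmult nn_integral_add)
  also have "\<dots> \<le> ennreal (2 powr ?P) * (ennreal (A powr ?P) + ennreal (A' powr ?P))"
    using f g False by (intro mult_left_mono add_mono) (auto simp: Lp_le_def)
  also have "\<dots> = ennreal (2 powr ?P * (A powr ?P + A' powr ?P))" by (simp add: ennreal_mult)
  also have "\<dots> \<le> ennreal (2 powr ?P * (A + A') powr ?P)"
  proof (intro ennreal_leI mult_left_mono)
    show "A powr ?P + A' powr ?P \<le> (A + A') powr ?P"
    proof (cases "A + A' = 0")
      case False
      have *: "t powr ?P \<le> t * (A + A') powr (?P - 1)" if "0 \<le> t" "t \<le> A + A'" for t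
      proof (cases "t = 0")
        case False
        have "t powr ?P = t * t powr (?P - 1)" using False that by (simp add: powr_diff)
        also have "\<dots> \<le> t * (A + A') powr (?P - 1)" using that P by (intro mult_left_mono powr_mono2) auto
        finally show ?thesis .
      qed simp
      have "A powr ?P + A' powr ?P \<le> A * (A + A') powr (?P - 1) + A' * (A + A') powr (?P - 1)"
        using A by (intro add_mono *) auto
      also have "\<dots> = (A + A') * (A + A') powr (?P - 1)" by (simp add: distrib_right)
      also have "\<dots> = (A + A') powr ?P" using False A by (simp add: powr_diff)
      finally show ?thesis .
    next
      case True
      then have "A = 0" "A' = 0" using A by linarith+
      then show ?thesis by simp
    qed
  qed simp
  also have "2 powr ?P * (A + A') powr ?P = (2 * (A + A')) powr ?P"
    by (subst powr_mult) (use A in auto)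
  finally show ?thesis using False by (simp add: Lp_le_def)
qed

lemma Lp_le_AE_finite:
  assumes "1 \<le> p" and [measurable]: "f \<in> borel_measurable M" and "Lp_le p M f A"
  shows "AE x in M. f x < \<infinity>"
proof (cases "p = \<infinity>")
  case True
  then have "AE x in M. f x \<le> ennreal A" using assms by (simp add: Lp_le_def)
  then show ?thesis by eventually_elim (simp add: le_less_trans)
next
  case False
  then have "(\<integral>\<^sup>+x. ennreal_powr (enn2real p) (f x) \<partial>M) \<noteq> \<infinity>"
    using assms(3) by (auto simp: Lp_le_def top_unique)
  then have "AE x in M. ennreal_powr (enn2real p) (f x) \<noteq> \<infinity>"
    by (intro nn_integral_noteq_infinite) measurable
  then show ?thesis by eventually_elim (auto simp: ennreal_powr_def less_top split: if_splits)
qed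

text \<open>The function \<open>|z|\<^sup>-\<^sup>\<sigma>\<close> by which the elements of \<open>|z|\<^sup>\<sigma> L\<^sup>p\<close> are multiplied.\<close>

definition weight :: "('n \<Rightarrow> real) \<Rightarrow> complex^'n::finite \<Rightarrow> real" where
  "weight \<sigma> z = (\<Prod>i\<in>UNIV. cmod (z $ i) powr (- \<sigma> i))"

lemma weight_measurable [measurable]: "weight \<sigma> \<in> borel_measurable borel"
  unfolding weight_def[abs_def] by measurable

lemma weight_nonneg: "weight \<sigma> z \<ge> 0" by (auto simp: weight_def intro!: prod_nonneg)

text \<open>The factors of the weight in the variables other than \<open>z\<^sub>j\<close>. They are constant along the fibres in
direction \<open>j\<close> and therefore commute with the Cauchy transform in that coordinate.\<close>

definition coweight :: "'n \<Rightarrow> ('n \<Rightarrow> real) \<Rightarrow> complex^'n::finite \<Rightarrow> real" where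
  "coweight j \<sigma> z = (\<Prod>i\<in>UNIV - {j}. cmod (z $ i) powr (- \<sigma> i))"

lemma coweight_measurable [measurable]: "coweight j \<sigma> \<in> borel_measurable borel"
  unfolding coweight_def[abs_def] by measurable

lemma coweight_nonneg: "coweight j \<sigma> z \<ge> 0" by (auto simp: coweight_def intro!: prod_nonneg)

lemma weight_split: "weight (\<sigma>(j := t)) z = cmod (z $ j) powr (- t) * coweight j \<sigma> z"
  unfolding weight_def coweight_def
  by (subst prod.remove[of UNIV j]) (auto intro!: prod.cong)

lemma weight_split': "weight \<sigma> z = cmod (z $ j) powr (- \<sigma> j) * coweight j \<sigma> z"
  using weight_split[of \<sigma> j "\<sigma> j" z] by simp

lemma coweight_shift: "coweight j \<sigma> (z - axis j w) = coweight j \<sigma> z"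
  unfolding coweight_def by (intro prod.cong) (auto simp: axis_nth_other)

lemma AE_all_components_nonzero: "AE z::complex^'n::finite in lborel. \<forall>i. z $ i \<noteq> 0"
  using AE_component_nonzero by (subst AE_all_countable) auto

lemma cauchy_majorant_bound:
  assumes "1 \<le> p" "admissible p \<sigma> \<tau>" "B > 0"
  shows "\<exists>C>0. majorant_bounded p j \<sigma> \<tau> B R C"
  using assms cauchy_majorant_bound_finite cauchy_majorant_bound_infinite by (cases "p = \<infinity>") blast+

text \<open>Weighted boundedness of the cut-off transform in the coordinate \<open>j\<close>, changing only the \<open>j\<close>-th
exponent to \<open>\<tau>\<close>. The second clause records that the defining integral converges absolutely almost everywhere in
\<open>P\<close>, which is what linearity of the transform rests on.\<close>

definition cut_bounded ::
    "ennreal \<Rightarrow> ('n \<Rightarrow> real) \<Rightarrow> 'n \<Rightarrow> real \<Rightarrow> (complex^'n::finite) set \<Rightarrow> real \<Rightarrow> (complex \<Rightarrow> complex) \<Rightarrow> real \<Rightarrow> bool" where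
  "cut_bounded p \<sigma> j \<tau> P R \<eta> C \<longleftrightarrow> (\<forall>u A. A \<ge> 0 \<longrightarrow> u \<in> borel_measurable borel \<longrightarrow>
    Lp_le p lborel (\<lambda>z. ennreal (indicator P z * weight \<sigma> z * cmod (u z))) A \<longrightarrow>
    Lp_le p lborel (\<lambda>z. ennreal (indicator P z * weight (\<sigma>(j := \<tau>)) z *
       cmod (cauchy_transform R j (\<lambda>z. indicator P z * (\<eta> (z $ j) * u z)) z))) (C * A) \<and>
    (AE z in lborel. z \<in> P \<longrightarrow> cauchy_majorant R j (\<lambda>z. indicator P z * (\<eta> (z $ j) * u z)) z < \<infinity>))"

lemma cut_boundedD:
  assumes "cut_bounded p \<sigma> j \<tau> P R \<eta> C" "A \<ge> 0" "u \<in> borel_measurable borel"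
    "Lp_le p lborel (\<lambda>z. ennreal (indicator P z * weight \<sigma> z * cmod (u z))) A"
  shows "Lp_le p lborel (\<lambda>z. ennreal (indicator P z * weight (\<sigma>(j := \<tau>)) z *
       cmod (cauchy_transform R j (\<lambda>z. indicator P z * (\<eta> (z $ j) * u z)) z))) (C * A)"
    "AE z in lborel. z \<in> P \<longrightarrow> cauchy_majorant R j (\<lambda>z. indicator P z * (\<eta> (z $ j) * u z)) z < \<infinity>"
  using assms unfolding cut_bounded_def by blast+

text \<open>Absorb the weight in the other variables into the function, apply the bound in the variable
\<open>z\<^sub>j\<close> alone, and take the weight out again.\<close>

lemma cut_transform_bound:
  fixes j :: "'n::finite" and P :: "(complex^'n::finite) set"
  assumes p: "1 \<le> p" and adm: "admissible p (\<sigma> j) \<tau>" and B: "B > 0"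
    and P: "P \<in> sets borel" "\<And>z. z \<in> P \<Longrightarrow> cmod (z $ j) \<le> B"
    and \<eta>: "continuous_on UNIV \<eta>" "compact C" "\<And>w. w \<notin> C \<Longrightarrow> \<eta> w = 0"
  shows "\<exists>C'>0. cut_bounded p \<sigma> j \<tau> P R \<eta> C'"
proof -
  obtain M where M: "M > 0" "\<And>x. norm (\<eta> x) \<le> M" using bounded_compact_support[OF \<eta>] by blast
  obtain C1 where C1: "C1 > 0" "majorant_bounded p j (\<sigma> j) \<tau> B R C1"
    using cauchy_majorant_bound[OF p adm B] by blast
  have [measurable]: "\<eta> \<in> borel_measurable borel" by (rule borel_measurable_continuous_onI[OF \<eta>(1)])
  note [measurable] = P(1)
  show ?thesis
    unfolding cut_bounded_def
  proof (intro exI[of _ "(1 / cauchy_const) * (C1 * M)"] conjI allI impI)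
    show "(1 / cauchy_const) * (C1 * M) > 0" using cauchy_const_pos C1(1) M(1) by simp
    fix u :: "complex^'n \<Rightarrow> complex" and A :: real
    assume A: "A \<ge> 0" and [measurable]: "u \<in> borel_measurable borel"
      and u: "Lp_le p lborel (\<lambda>z. ennreal (indicator P z * weight \<sigma> z * cmod (u z))) A"
    define v where "v z = indicator P z * (\<eta> (z $ j) * u z)" for z
    have [measurable]: "v \<in> borel_measurable borel" unfolding v_def by measurable
    \<comment> \<open>The weight in the other variables is moved into the function, where it is invariant under translations along \<open>e\<^sub>j\<close>.\<close>
    define v' where "v' z = of_real (coweight j \<sigma> z) * v z" for z
    have [measurable]: "v' \<in> borel_measurable borel" unfolding v'_def by measurable
    have maj: "cauchy_majorant R j v' z = ennreal (coweight j \<sigma> z) * cauchy_majorant R j v z" for z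
      unfolding cauchy_majorant_def v'_def coweight_shift
      using coweight_nonneg[of j \<sigma> z]
      by (subst nn_integral_cmult[symmetric]) (auto simp: norm_mult ennreal_mult mult.assoc)
    have L1: "Lp_le p lborel (\<lambda>y. ennreal (cmod (y $ j) powr (- \<sigma> j) * cmod (v' y))) (M * A)"
    proof (rule Lp_le_mono[OF p M(1) A _ _ u])
      show "AE y in lborel. ennreal (cmod (y $ j) powr (- \<sigma> j) * cmod (v' y)) \<le> ennreal M * ennreal (indicator P y * weight \<sigma> y * cmod (u y))"
      proof (rule AE_I2)
        fix y
        have "cmod (y $ j) powr (- \<sigma> j) * cmod (v' y) = cmod (\<eta> (y $ j)) * (indicator P y * weight \<sigma> y * cmod (u y))"
          using coweight_nonneg[of j \<sigma> y] unfolding weight_split'[of \<sigma> y j]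
          by (simp add: v'_def v_def norm_mult mult_ac split: split_indicator)
        also have "\<dots> \<le> M * (indicator P y * weight \<sigma> y * cmod (u y))"
          by (intro mult_right_mono M(2) mult_nonneg_nonneg weight_nonneg) auto
        finally show "ennreal (cmod (y $ j) powr (- \<sigma> j) * cmod (v' y)) \<le> ennreal M * ennreal (indicator P y * weight \<sigma> y * cmod (u y))"
          using M(1) weight_nonneg[of \<sigma> y] by (simp add: ennreal_mult[symmetric] ennreal_leI)
      qed
    qed measurable
    have L2: "Lp_le p lborel (\<lambda>z. ennreal (cmod (z $ j) powr (- \<tau>) * indicator (cball 0 B) (z $ j)) * cauchy_majorant R j v' z) (C1 * (M * A))"
    proof (rule C1(2)[unfolded majorant_bounded_def, rule_format, OF _ _ _ L1])
      fix y assume "v' y \<noteq> 0"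
      then have "y \<in> P" by (auto simp: v'_def v_def split: split_indicator_asm)
      then show "cmod (y $ j) \<le> B" by (rule P(2))
    qed (use A M in auto)
    have L3: "Lp_le p lborel (\<lambda>z. ennreal (indicator P z * weight (\<sigma>(j := \<tau>)) z * cmod (cauchy_transform R j v z))) (1 / cauchy_const * (C1 * (M * A)))"
    proof (rule Lp_le_mono[OF p _ _ _ _ L2])
      show "AE z in lborel. ennreal (indicator P z * weight (\<sigma>(j := \<tau>)) z * cmod (cauchy_transform R j v z)) \<le>
        ennreal (1 / cauchy_const) * (ennreal (cmod (z $ j) powr (- \<tau>) * indicator (cball 0 B) (z $ j)) * cauchy_majorant R j v' z)"
      proof (rule AE_I2)
        fix z
        show "ennreal (indicator P z * weight (\<sigma>(j := \<tau>)) z * cmod (cauchy_transform R j v z)) \<le>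
          ennreal (1 / cauchy_const) * (ennreal (cmod (z $ j) powr (- \<tau>) * indicator (cball 0 B) (z $ j)) * cauchy_majorant R j v' z)"
        proof (cases "z \<in> P")
          case True
          have "ennreal (weight (\<sigma>(j := \<tau>)) z * cmod (cauchy_transform R j v z)) = ennreal (weight (\<sigma>(j := \<tau>)) z) * ennreal (cmod (cauchy_transform R j v z))"
            by (simp add: ennreal_mult weight_nonneg)
          also have "\<dots> \<le> ennreal (weight (\<sigma>(j := \<tau>)) z) * (ennreal (1 / cauchy_const) * cauchy_majorant R j v z)"
            by (intro mult_left_mono norm_cauchy_transform_le) simp
          also have "\<dots> = ennreal (1 / cauchy_const) * (ennreal (cmod (z $ j) powr (- \<tau>)) * cauchy_majorant R j v' z)"
            unfolding maj weight_split by (simp add: ennreal_mult coweight_nonneg mult_ac)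
          finally show ?thesis using True P(2)[OF True] by simp
        qed simp
      qed
    qed (use cauchy_const_pos A C1(1) M(1) in auto)
    have "AE z in lborel. ennreal (cmod (z $ j) powr (- \<tau>) * indicator (cball 0 B) (z $ j)) * cauchy_majorant R j v' z < \<infinity>"
      by (rule Lp_le_AE_finite[OF p _ L2]) measurable
    then have F: "AE z in lborel. z \<in> P \<longrightarrow> cauchy_majorant R j v z < \<infinity>"
      using AE_all_components_nonzero
    proof eventually_elim
      case (elim z)
      show ?case
      proof
        assume z: "z \<in> P"
        have "coweight j \<sigma> z > 0" using elim(2) unfolding coweight_def by (intro prod_pos) auto
        moreover have "cmod (z $ j) powr (- \<tau>) > 0" using elim(2) by simp
        moreover have "ennreal (cmod (z $ j) powr (- \<tau>)) * (ennreal (coweight j \<sigma> z) * cauchy_majorant R j v z) < \<infinity>"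
          using elim(1) P(2)[OF z] unfolding maj by simp
        ultimately show "cauchy_majorant R j v z < \<infinity>"
          by (auto simp: ennreal_mult_less_top ennreal_eq_0_iff)
      qed
    qed
    show "Lp_le p lborel (\<lambda>z. ennreal (indicator P z * weight (\<sigma>(j := \<tau>)) z *
       cmod (cauchy_transform R j (\<lambda>z. indicator P z * (\<eta> (z $ j) * u z)) z))) ((1 / cauchy_const) * (C1 * M) * A)"
      using L3 unfolding v_def by (simp add: mult.assoc)
    show "AE z in lborel. z \<in> P \<longrightarrow> cauchy_majorant R j (\<lambda>z. indicator P z * (\<eta> (z $ j) * u z)) z < \<infinity>"
      using F unfolding v_def .
  qed
qed

section \<open>Solving coordinate by coordinate\<close>

definition form_le :: "ennreal \<Rightarrow> ('n \<Rightarrow> real) \<Rightarrow> (complex^'n::finite) set \<Rightarrow> nat \<Rightarrow> 'n form \<Rightarrow> real \<Rightarrow> bool" where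
  "form_le p \<sigma> P q g A \<longleftrightarrow> (\<forall>I. card I = q \<longrightarrow>
     Lp_le p lborel (\<lambda>z. ennreal (indicator P z * weight \<sigma> z * cmod (g I z))) A)"

text \<open>The product in which the coordinates in \<open>S\<close> still range over the large domains, while those
already treated have been restricted to the small ones.\<close>

definition mixed_product :: "('n \<Rightarrow> complex set) \<Rightarrow> ('n \<Rightarrow> complex set) \<Rightarrow> 'n set \<Rightarrow> (complex^'n::finite) set" where
  "mixed_product D G S = product_set (\<lambda>i. if i \<in> S then D i else G i)"

text \<open>The invariant of the construction before the coordinates in \<open>S\<close> have been treated: a closed form on
the mixed product that involves only the differentials of coordinates in \<open>S\<close>, with its norm over the
full product \<open>D\<close> bounded by \<open>A\<close>.\<close>

definition closed_data :: "ennreal \<Rightarrow> ('n \<Rightarrow> real) \<Rightarrow> ('n \<Rightarrow> complex set) \<Rightarrow> ('n \<Rightarrow> complex set) \<Rightarrow> 'n set \<Rightarrow>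
    nat \<Rightarrow> 'n::{finite,linorder} form \<Rightarrow> real \<Rightarrow> bool" where
  "closed_data p \<sigma> D G S q g A \<longleftrightarrow> (\<forall>I. g I \<in> borel_measurable borel) \<and>
     form_le p \<sigma> (product_set D) (Suc q) g A \<and>
     (\<forall>I. card I = Suc q \<longrightarrow> loc_int (mixed_product D G S) (g I)) \<and>
     weak_dbar (mixed_product D G S) (Suc q) g (\<lambda>I z. 0) \<and>
     (\<forall>I z. card I = Suc q \<longrightarrow> \<not> I \<subseteq> S \<longrightarrow> g I z = 0)"

definition ae_lincomb :: "(complex^'n::finite) set \<Rightarrow> nat \<Rightarrow> 'n form \<Rightarrow> complex \<Rightarrow> 'n form \<Rightarrow> complex \<Rightarrow> 'n form \<Rightarrow> bool" where
  "ae_lincomb P q g'' a g b g' \<longleftrightarrow>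
     (\<forall>I. card I = q \<longrightarrow> (AE z in lborel. z \<in> P \<longrightarrow> g'' I z = a * g I z + b * g' I z))"

text \<open>An operator that is defined on all families of Borel functions, and on closed data is bounded, solves
d-bar over the small product, and is linear. Linearity is stated for an arbitrary Borel form \<open>g''\<close>
that agrees almost everywhere with the linear combination: forms are only determined up to null sets,
and representatives are chosen later without regard to linearity.\<close>

definition solution_operator :: "ennreal \<Rightarrow> ('n \<Rightarrow> complex set) \<Rightarrow> ('n \<Rightarrow> complex set) \<Rightarrow> 'n set \<Rightarrow>
    nat \<Rightarrow> ('n \<Rightarrow> real) \<Rightarrow> ('n \<Rightarrow> real) \<Rightarrow> ('n::{finite,linorder} form \<Rightarrow> 'n form) \<Rightarrow> real \<Rightarrow> bool" where
  "solution_operator p D G S q \<sigma> \<rho> H C \<longleftrightarrow>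
     (\<forall>g. (\<forall>I. g I \<in> borel_measurable borel) \<longrightarrow> (\<forall>I. H g I \<in> borel_measurable borel)) \<and>
     (\<forall>g A. A \<ge> 0 \<longrightarrow> closed_data p \<sigma> D G S q g A \<longrightarrow>
        form_le p \<rho> (product_set D) q (H g) (C * A) \<and>
        (\<forall>I. card I = q \<longrightarrow> loc_int (product_set G) (H g I)) \<and>
        weak_dbar (product_set G) q (H g) g) \<and>
     (\<forall>g g' g'' a b A A'. A \<ge> 0 \<longrightarrow> A' \<ge> 0 \<longrightarrow> closed_data p \<sigma> D G S q g A \<longrightarrow> closed_data p \<sigma> D G S q g' A' \<longrightarrow>
        (\<forall>I. g'' I \<in> borel_measurable borel) \<longrightarrow> ae_lincomb (product_set D) (Suc q) g'' a g b g' \<longrightarrow>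
        ae_lincomb (product_set D) q (H g'') a (H g) b (H g'))"

lemma Lp_le_zero: "A \<ge> 0 \<Longrightarrow> Lp_le p M (\<lambda>x. 0) A"
  by (simp add: Lp_le_def)

lemma weak_dbar_mono:
  assumes "weak_dbar \<Omega> q f h" "\<Omega>' \<subseteq> \<Omega>" shows "weak_dbar \<Omega>' q f h"
  using assms unfolding weak_dbar_def test_function_def by blast

lemma loc_int_mono: "loc_int \<Omega> u \<Longrightarrow> \<Omega>' \<subseteq> \<Omega> \<Longrightarrow> loc_int \<Omega>' u"
  unfolding loc_int_def by blast

lemma loc_int_add:
  assumes [measurable]: "u \<in> borel_measurable borel" "v \<in> borel_measurable borel"
    and "loc_int \<Omega> u" "loc_int \<Omega> v"
  shows "loc_int \<Omega> (\<lambda>z. u z + v z)"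
  unfolding loc_int_def
proof (intro allI impI, elim conjE)
  fix K assume K: "compact K" "K \<subseteq> \<Omega>"
  have [measurable]: "K \<in> sets borel" using K(1) by (rule borel_compact)
  have "(\<integral>\<^sup>+x. ennreal (cmod (u x + v x)) * indicator K x \<partial>lborel) \<le>
    (\<integral>\<^sup>+x. ennreal (cmod (u x)) * indicator K x + ennreal (cmod (v x)) * indicator K x \<partial>lborel)"
    by (intro nn_integral_mono)
       (auto split: split_indicator simp: ennreal_plus[symmetric] norm_triangle_ineq simp del: ennreal_plus intro!: ennreal_leI)
  also have "\<dots> = (\<integral>\<^sup>+x. ennreal (cmod (u x)) * indicator K x \<partial>lborel) + (\<integral>\<^sup>+x. ennreal (cmod (v x)) * indicator K x \<partial>lborel)"
    by (rule nn_integral_add) measurable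
  also have "\<dots> < \<infinity>" using assms(3,4) K by (auto simp: loc_int_def)
  finally show "(\<integral>\<^sup>+x. ennreal (cmod (u x + v x)) * indicator K x \<partial>lborel) < \<infinity>" .
qed

lemma weak_dbar_add:
  assumes f: "\<And>I. f I \<in> borel_measurable borel" "\<And>I. card I = q \<Longrightarrow> loc_int \<Omega> (f I)"
    and f': "\<And>I. f' I \<in> borel_measurable borel" "\<And>I. card I = q \<Longrightarrow> loc_int \<Omega> (f' I)"
    and h: "\<And>I. h I \<in> borel_measurable borel" "\<And>I. card I = Suc q \<Longrightarrow> loc_int \<Omega> (h I)"
    and h': "\<And>I. h' I \<in> borel_measurable borel" "\<And>I. card I = Suc q \<Longrightarrow> loc_int \<Omega> (h' I)"
    and d: "weak_dbar \<Omega> q f h" "weak_dbar \<Omega> q f' h'"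
  shows "weak_dbar \<Omega> q (\<lambda>I z. f I z + f' I z) (\<lambda>I z. h I z + h' I z)"
  unfolding weak_dbar_def
proof (intro allI impI, elim conjE)
  fix J :: "'a set" and \<phi> :: "complex^'a::{finite,linorder} \<Rightarrow> complex"
  assume J: "card J = Suc q" and \<phi>: "test_function \<Omega> \<phi>"
  obtain K where K: "compact K" "K \<subseteq> \<Omega>" "\<And>x. x \<notin> K \<Longrightarrow> \<phi> x = 0"
    using test_function_compact_support[OF \<phi>] by blast
  have C\<phi>: "Ck k \<phi>" for k using \<phi> by (simp add: test_function_def)
  have W0: "x \<notin> K \<Longrightarrow> wirtinger_bar i \<phi> x = 0" for i x
    by (rule wirtinger_bar_zero_outside[OF compact_imp_closed[OF K(1)] K(3)])
  have c: "i \<in> J \<Longrightarrow> card (J - {i}) = q" for i using J by simp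
  have i1: "integrable lborel (\<lambda>z. h J z * \<phi> z)"
    by (rule loc_int_integrable[OF h(1) h(2)[OF J] Ck_continuous[OF C\<phi>] K])
  have i1': "integrable lborel (\<lambda>z. h' J z * \<phi> z)"
    by (rule loc_int_integrable[OF h'(1) h'(2)[OF J] Ck_continuous[OF C\<phi>] K])
  have i2: "integrable lborel (\<lambda>z. f (J - {i}) z * wirtinger_bar i \<phi> z)" if "i \<in> J" for i
    by (rule loc_int_integrable[OF f(1) f(2)[OF c[OF that]] wirtinger_bar_continuous[OF C\<phi>] K(1,2) W0])
  have i2': "integrable lborel (\<lambda>z. f' (J - {i}) z * wirtinger_bar i \<phi> z)" if "i \<in> J" for i
    by (rule loc_int_integrable[OF f'(1) f'(2)[OF c[OF that]] wirtinger_bar_continuous[OF C\<phi>] K(1,2) W0])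
  have e1: "(\<integral>z. (h J z + h' J z) * \<phi> z \<partial>lborel) = (\<integral>z. h J z * \<phi> z \<partial>lborel) + (\<integral>z. h' J z * \<phi> z \<partial>lborel)"
    using i1 i1' by (simp add: distrib_right)
  have e2: "(\<integral>z. (f (J - {i}) z + f' (J - {i}) z) * wirtinger_bar i \<phi> z \<partial>lborel) =
    (\<integral>z. f (J - {i}) z * wirtinger_bar i \<phi> z \<partial>lborel) + (\<integral>z. f' (J - {i}) z * wirtinger_bar i \<phi> z \<partial>lborel)" if "i \<in> J" for i
    using i2[OF that] i2'[OF that] by (simp add: distrib_right)
  have "(\<integral>z. h J z * \<phi> z \<partial>lborel) = - (\<Sum>j\<in>J. (-1) ^ card {i\<in>J. i < j} * (\<integral>z. f (J - {j}) z * wirtinger_bar j \<phi> z \<partial>lborel))"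
    "(\<integral>z. h' J z * \<phi> z \<partial>lborel) = - (\<Sum>j\<in>J. (-1) ^ card {i\<in>J. i < j} * (\<integral>z. f' (J - {j}) z * wirtinger_bar j \<phi> z \<partial>lborel))"
    using d J \<phi> unfolding weak_dbar_def by blast+
  then show "(\<integral>z. (h J z + h' J z) * \<phi> z \<partial>lborel) = - (\<Sum>j\<in>J. (-1) ^ card {i\<in>J. i < j} * (\<integral>z. (f (J - {j}) z + f' (J - {j}) z) * wirtinger_bar j \<phi> z \<partial>lborel))"
    unfolding e1 by (simp add: e2 distrib_left sum.distrib)
qed

lemma product_set_mono: "(\<And>i. D i \<subseteq> D' i) \<Longrightarrow> product_set D \<subseteq> product_set D'"
  unfolding product_set_def by blast

lemma open_product_set:
  assumes "\<And>i. open (D i)" shows "open (product_set D)"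
proof -
  have "product_set D = (\<Inter>i. (\<lambda>z. z $ i) -` D i)" by (auto simp: product_set_def)
  also have "open \<dots>" by (intro open_INT finite ballI open_vimage assms continuous_intros)
  finally show ?thesis .
qed

text \<open>Once all coordinates are treated, every coefficient of positive degree vanishes and zero is a
solution.\<close>

lemma solution_operator_empty: "solution_operator p D G {} q \<sigma> \<rho> (\<lambda>g I z. 0) 1"
  unfolding solution_operator_def
proof (intro conjI allI impI)
  fix g :: "'a form" and A :: real
  assume A: "0 \<le> A" and g: "closed_data p \<sigma> D G {} q g A"
  show "form_le p \<rho> (product_set D) q (\<lambda>I z. 0) (1 * A)"
    using A by (simp add: form_le_def Lp_le_zero)
  show "loc_int (product_set G) (\<lambda>z. 0)" by (simp add: loc_int_def)
  show "weak_dbar (product_set G) q (\<lambda>I z. 0) g"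
    unfolding weak_dbar_def
  proof (intro allI impI, elim conjE)
    fix J :: "'a set" and \<phi> :: "complex^'a::{finite,linorder} \<Rightarrow> complex" assume J: "card J = Suc q"
    then have "J \<noteq> {}" by auto
    then have "g J z = 0" for z using g J unfolding closed_data_def by auto
    then show "(\<integral>z. g J z * \<phi> z \<partial>lborel) = - (\<Sum>j\<in>J. (-1) ^ card {i\<in>J. i < j} * (\<integral>z. 0 * wirtinger_bar j \<phi> z \<partial>lborel))" by simp
  qed
qed (auto simp: ae_lincomb_def)

text \<open>Treat the coordinate \<open>j\<close> by \<open>K\<close>, and solve for the remainder \<open>S g\<close> with the operator given
for fewer coordinates. Only \<open>K\<close> and \<open>S\<close> see the original exponent \<open>\<sigma> j\<close>; the given
operator keeps the improved exponent \<open>\<tau>\<close>.\<close>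

lemma solution_operator_insert:
  fixes D G :: "'n::{finite,linorder} \<Rightarrow> complex set"
  assumes p: "1 \<le> p" and D: "\<And>i. open (D i)" and G: "\<And>i. compact (closure (G i))" "\<And>i. closure (G i) \<subseteq> D i"
    and B: "B > 0" "\<And>i w. w \<in> D i \<Longrightarrow> cmod w \<le> B"
    and j: "j \<notin> S" and adm: "admissible p (\<sigma> j) \<tau>"
    and sol: "C3 > 0" "solution_operator p D G S q (\<sigma>(j := \<tau>)) (\<sigma>(j := \<tau>)) H' C3"
  shows "\<exists>H C. C > 0 \<and> solution_operator p D G (insert j S) q \<sigma> (\<sigma>(j := \<tau>)) H C"
proof -
  let ?P = "product_set D" and ?\<sigma> = "\<sigma>(j := \<tau>)"
  obtain \<theta> K V where \<theta>: "\<And>k. Ck k \<theta>" "compact K" "K \<subseteq> D j" "\<And>w. w \<notin> K \<Longrightarrow> \<theta> w = 0"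
    "open V" "closure (G j) \<subseteq> V" "\<And>w. w \<in> V \<Longrightarrow> \<theta> w = 1"
    using smooth_cutoff[OF G(1) D G(2)] by blast
  have \<theta>': "Ck k (dbar1 \<theta>)" for k by (rule Ck_dbar1[OF \<theta>(1)])
  have \<theta>'0: "w \<notin> K \<Longrightarrow> dbar1 \<theta> w = 0" for w
    by (rule dbar1_zero_outside[OF compact_imp_closed[OF \<theta>(2)] \<theta>(4)])
  have GD: "G i \<subseteq> D i" for i using G(2)[of i] closure_subset[of "G i"] by blast
  have [measurable]: "?P \<in> sets borel" using open_product_set[OF D] by (rule borel_open)
  have PB: "z \<in> ?P \<Longrightarrow> cmod (z $ j) \<le> B" for z using B(2) unfolding product_set_def by blast
  have [measurable]: "\<theta> \<in> borel_measurable borel" "dbar1 \<theta> \<in> borel_measurable borel"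
    by (intro borel_measurable_continuous_onI Ck_continuous[OF \<theta>(1)] Ck_continuous[OF \<theta>'])+
  \<comment> \<open>Differences of coordinates of points in the product have modulus at most \<open>2 B\<close>.\<close>
  define R where "R = 2 * B"
  define D' where "D' i = (if i \<in> insert j S then D i else G i)" for i
  have mp: "mixed_product D G (insert j S) = product_set D'" unfolding mixed_product_def D'_def ..
  have "D'(j := G j) = (\<lambda>i. if i \<in> S then D i else G i)" using j by (auto simp: D'_def fun_eq_iff)
  then have mp': "mixed_product D G S = product_set (D'(j := G j))" unfolding mixed_product_def by simp
  have D'P: "product_set D' \<subseteq> ?P" unfolding D'_def by (rule product_set_mono) (use GD in auto)
  have QO: "product_set G \<subseteq> mixed_product D G S"
    unfolding mixed_product_def by (rule product_set_mono) (use GD in auto)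
  have QO2: "mixed_product D G S \<subseteq> mixed_product D G (insert j S)"
    unfolding mixed_product_def by (rule product_set_mono) (use GD in auto)
  have "\<exists>C>0. cut_bounded p \<sigma> j \<tau> ?P R \<theta> C"
    by (rule cut_transform_bound[where C=K and B=B])
       (use p adm B(1) PB Ck_continuous[OF \<theta>(1)] \<theta>(2,4) in auto)
  then obtain C1 where C1: "C1 > 0" "cut_bounded p \<sigma> j \<tau> ?P R \<theta> C1" by blast
  have "\<exists>C>0. cut_bounded p \<sigma> j \<tau> ?P R (dbar1 \<theta>) C"
    by (rule cut_transform_bound[where C=K and B=B])
       (use p adm B(1) PB Ck_continuous[OF \<theta>'] \<theta>(2) \<theta>'0 in auto)
  then obtain C2 where C2: "C2 > 0" "cut_bounded p \<sigma> j \<tau> ?P R (dbar1 \<theta>) C2" by blast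
  let ?K = "homotopy_op R j \<theta> ?P" and ?S = "remainder_op R j \<theta> ?P"
  have Kmeas: "?K g I \<in> borel_measurable borel" if [measurable]: "\<And>I. g I \<in> borel_measurable borel" for g I
    by (cases "j \<in> I") (simp_all add: homotopy_op_def[abs_def])
  have Smeas: "?S g I \<in> borel_measurable borel" if [measurable]: "\<And>I. g I \<in> borel_measurable borel" for g I
    by (cases "j \<in> I") (simp_all add: remainder_op_def[abs_def])
  have step: "form_le p ?\<sigma> ?P q (?K g) (C1 * A)"
      "closed_data p ?\<sigma> D G S q (?S g) (C2 * A)"
      "\<forall>I. card I = q \<longrightarrow> loc_int (product_set G) (?K g I)"
      "weak_dbar (product_set G) q (?K g) (\<lambda>I z. g I z - ?S g I z)"
    if A: "A \<ge> 0" and g: "closed_data p \<sigma> D G (insert j S) q g A" for g A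
  proof -
    have gm: "g I \<in> borel_measurable borel" for I using g by (simp add: closed_data_def)
    have gl: "card I = Suc q \<Longrightarrow> loc_int (product_set D') (g I)" for I
      using g mp by (simp add: closed_data_def)
    have gc: "weak_dbar (product_set D') (Suc q) g (\<lambda>I z. 0)" using g mp by (simp add: closed_data_def)
    have gn: "card I = Suc q \<Longrightarrow> Lp_le p lborel (\<lambda>z. ennreal (indicator ?P z * weight \<sigma> z * cmod (g I z))) A" for I
      using g by (simp add: closed_data_def form_le_def)
    have D'j: "D' j = D j" by (simp add: D'_def)
    have hs: "weak_dbar (product_set (D'(j := G j))) q (?K g) (\<lambda>I z. g I z - ?S g I z)"
      "weak_dbar (product_set (D'(j := G j))) (Suc q) (?S g) (\<lambda>I z. 0)"
      "\<And>I. card I = q \<Longrightarrow> loc_int (product_set (D'(j := G j))) (?K g I)"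
      "\<And>I. card I = Suc q \<Longrightarrow> loc_int (product_set (D'(j := G j))) (?S g I)"
      using homotopy_step[of K D' j ?P "G j" B R \<theta> V g q] \<theta> D'P GD[of j] B(2)[of _ j] gm gl gc closure_subset[of "G j"]
      unfolding D'j R_def by (auto simp: order_trans)
    show "form_le p ?\<sigma> ?P q (?K g) (C1 * A)"
      unfolding form_le_def
    proof (intro allI impI)
      fix I :: "'n set" assume I: "card I = q"
      show "Lp_le p lborel (\<lambda>z. ennreal (indicator ?P z * weight ?\<sigma> z * cmod (?K g I z))) (C1 * A)"
      proof (cases "j \<in> I")
        case True
        then show ?thesis using A C1(1) by (simp add: homotopy_op_def Lp_le_zero)
      next
        case False
        then have "card (insert j I) = Suc q" using I by simp
        from cut_boundedD(1)[OF C1(2) A gm gn[OF this]] show ?thesis using False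
          by (simp add: homotopy_op_def norm_mult norm_power)
      qed
    qed
    show "closed_data p ?\<sigma> D G S q (?S g) (C2 * A)"
      unfolding closed_data_def mp'
    proof (intro conjI allI impI)
      show "?S g I \<in> borel_measurable borel" for I by (rule Smeas[OF gm])
      show "form_le p ?\<sigma> ?P (Suc q) (?S g) (C2 * A)"
        unfolding form_le_def
      proof (intro allI impI)
        fix I :: "'n set" assume I: "card I = Suc q"
        show "Lp_le p lborel (\<lambda>z. ennreal (indicator ?P z * weight ?\<sigma> z * cmod (?S g I z))) (C2 * A)"
        proof (cases "j \<in> I")
          case True
          then show ?thesis using A C2(1) by (simp add: remainder_op_def Lp_le_zero)
        next
          case False
          from cut_boundedD(1)[OF C2(2) A gm gn[OF I]] show ?thesis using False by (simp add: remainder_op_def)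
        qed
      qed
      show "card I = Suc q \<Longrightarrow> loc_int (product_set (D'(j := G j))) (?S g I)" for I by (rule hs(4))
      show "weak_dbar (product_set (D'(j := G j))) (Suc q) (?S g) (\<lambda>I z. 0)" by (rule hs(2))
      fix I z assume I: "card I = Suc q" "\<not> I \<subseteq> S"
      show "?S g I z = 0"
      proof (cases "j \<in> I")
        case False
        then have "g I z = 0" for z using g I unfolding closed_data_def by blast
        then show ?thesis by (simp add: remainder_op_def cauchy_transform_def)
      qed (simp add: remainder_op_def)
    qed
    show "\<forall>I. card I = q \<longrightarrow> loc_int (product_set G) (?K g I)"
      using hs(3) QO unfolding mp' by (auto intro: loc_int_mono)
    show "weak_dbar (product_set G) q (?K g) (\<lambda>I z. g I z - ?S g I z)"
      using weak_dbar_mono[OF hs(1)] QO unfolding mp' by blast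
  qed
  have AEcomb: "AE z in lborel. z \<in> ?P \<longrightarrow> cauchy_transform R j (\<lambda>z. indicator ?P z * (\<eta> (z $ j) * u'' z)) z =
      a * cauchy_transform R j (\<lambda>z. indicator ?P z * (\<eta> (z $ j) * u z)) z + b * cauchy_transform R j (\<lambda>z. indicator ?P z * (\<eta> (z $ j) * u' z)) z"
    if [measurable]: "u \<in> borel_measurable borel" "u' \<in> borel_measurable borel" "u'' \<in> borel_measurable borel" "\<eta> \<in> borel_measurable borel"
      and ae: "AE z in lborel. z \<in> ?P \<longrightarrow> u'' z = a * u z + b * u' z"
      and m: "AE z in lborel. z \<in> ?P \<longrightarrow> cauchy_majorant R j (\<lambda>z. indicator ?P z * (\<eta> (z $ j) * u z)) z < \<infinity>"
       "AE z in lborel. z \<in> ?P \<longrightarrow> cauchy_majorant R j (\<lambda>z. indicator ?P z * (\<eta> (z $ j) * u' z)) z < \<infinity>"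
    for u u' u'' \<eta> a b
  proof (rule cauchy_transform_lincomb_AE[OF _ _ _ _ m])
    show "AE z in lborel. indicator ?P z * (\<eta> (z $ j) * u'' z) = a * (indicator ?P z * (\<eta> (z $ j) * u z)) + b * (indicator ?P z * (\<eta> (z $ j) * u' z))"
      using ae by eventually_elim (auto simp: algebra_simps split: split_indicator)
  qed measurable
  \<comment> \<open>From d-bar \<open>K g = g - S g\<close> and d-bar \<open>H\' (S g) = S g\<close> the sum solves d-bar \<open>H g = g\<close>.\<close>
  define H where "H g I z = ?K g I z + H' (?S g) I z" for g I z
  have H'm: "\<And>g I. (\<And>I. g I \<in> borel_measurable borel) \<Longrightarrow> H' g I \<in> borel_measurable borel"
    using sol(2) unfolding solution_operator_def by blast
  have H's: "form_le p ?\<sigma> ?P q (H' g) (C3 * A)" "\<forall>I. card I = q \<longrightarrow> loc_int (product_set G) (H' g I)" "weak_dbar (product_set G) q (H' g) g"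
    if "A \<ge> 0" "closed_data p ?\<sigma> D G S q g A" for g A
    using sol(2) that unfolding solution_operator_def by blast+
  have H'l: "ae_lincomb ?P q (H' g'') a (H' g) b (H' g')"
    if "A \<ge> 0" "A' \<ge> 0" "closed_data p ?\<sigma> D G S q g A" "closed_data p ?\<sigma> D G S q g' A'"
      "\<forall>I. g'' I \<in> borel_measurable borel" "ae_lincomb ?P (Suc q) g'' a g b g'" for g g' g'' a b A A'
    using sol(2) that unfolding solution_operator_def by blast
  define C where "C = 2 * (C1 + C3 * C2)"
  have "solution_operator p D G (insert j S) q \<sigma> ?\<sigma> H C"
    unfolding solution_operator_def
  proof (intro conjI allI impI)
    fix g :: "'n form" and I assume gm: "\<forall>I. g I \<in> borel_measurable borel"
    have [measurable]: "?K g I \<in> borel_measurable borel" "H' (?S g) I \<in> borel_measurable borel"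
      using gm by (auto intro!: Kmeas H'm Smeas)
    show "H g I \<in> borel_measurable borel" unfolding H_def[abs_def] by measurable
  next
    fix g :: "'n form" and A :: real
    assume A: "0 \<le> A" and g: "closed_data p \<sigma> D G (insert j S) q g A"
    have gm: "g I \<in> borel_measurable borel" for I using g by (simp add: closed_data_def)
    note st = step[OF A g]
    have A2: "0 \<le> C2 * A" using A C2(1) by simp
    note h = H's[OF A2 st(2)]
    note [measurable] = Kmeas[OF gm] Smeas[OF gm] H'm[of "?S g", OF Smeas[OF gm]] gm
    show "form_le p ?\<sigma> ?P q (H g) (C * A)"
      unfolding form_le_def
    proof (intro allI impI)
      fix I :: "'n set" assume I: "card I = q"
      have L: "Lp_le p lborel (\<lambda>z. ennreal (indicator ?P z * weight ?\<sigma> z * cmod (?K g I z)) + ennreal (indicator ?P z * weight ?\<sigma> z * cmod (H' (?S g) I z))) (2 * (C1 * A + C3 * (C2 * A)))"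
        by (rule Lp_le_add[OF p]) (use st(1) h(1) I A C1(1) C2(1) sol(1) in \<open>auto simp: form_le_def\<close>)
      have "Lp_le p lborel (\<lambda>z. ennreal (indicator ?P z * weight ?\<sigma> z * cmod (H g I z))) (1 * (2 * (C1 * A + C3 * (C2 * A))))"
      proof (rule Lp_le_mono[OF p _ _ _ _ L])
        show "AE z in lborel. ennreal (indicator ?P z * weight ?\<sigma> z * cmod (H g I z)) \<le>
          ennreal 1 * (ennreal (indicator ?P z * weight ?\<sigma> z * cmod (?K g I z)) + ennreal (indicator ?P z * weight ?\<sigma> z * cmod (H' (?S g) I z)))"
        proof (rule AE_I2)
          fix z
          have w: "indicator ?P z * weight ?\<sigma> z \<ge> 0" by (simp add: weight_nonneg)
          have "indicator ?P z * weight ?\<sigma> z * cmod (H g I z) \<le> indicator ?P z * weight ?\<sigma> z * (cmod (?K g I z) + cmod (H' (?S g) I z))"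
            unfolding H_def by (intro mult_left_mono norm_triangle_ineq w)
          then have "ennreal (indicator ?P z * weight ?\<sigma> z * cmod (H g I z)) \<le> ennreal (indicator ?P z * weight ?\<sigma> z * cmod (?K g I z) + indicator ?P z * weight ?\<sigma> z * cmod (H' (?S g) I z))"
            by (intro ennreal_leI) (simp add: distrib_left)
          also have "\<dots> = ennreal (indicator ?P z * weight ?\<sigma> z * cmod (?K g I z)) + ennreal (indicator ?P z * weight ?\<sigma> z * cmod (H' (?S g) I z))"
            using w by (intro ennreal_plus) auto
          finally show "ennreal (indicator ?P z * weight ?\<sigma> z * cmod (H g I z)) \<le>
            ennreal 1 * (ennreal (indicator ?P z * weight ?\<sigma> z * cmod (?K g I z)) + ennreal (indicator ?P z * weight ?\<sigma> z * cmod (H' (?S g) I z)))" by simp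
        qed
      qed (use A C1(1) C2(1) sol(1) in auto)
      then show "Lp_le p lborel (\<lambda>z. ennreal (indicator ?P z * weight ?\<sigma> z * cmod (H g I z))) (C * A)"
        by (simp add: C_def algebra_simps)
    qed
    show "loc_int (product_set G) (H g I)" if "card I = q" for I
      unfolding H_def[abs_def] by (rule loc_int_add) (use st(3) h(2) that in auto)
    have lg: "card I = Suc q \<Longrightarrow> loc_int (product_set G) (g I)" for I
      using g QO QO2 unfolding closed_data_def by (meson loc_int_mono order_trans)
    have lS: "card I = Suc q \<Longrightarrow> loc_int (product_set G) (?S g I)" for I
      using st(2) QO unfolding closed_data_def by (meson loc_int_mono)
    have "loc_int (product_set G) (\<lambda>z. g I z + (-1) * ?S g I z)" if "card I = Suc q" for I
      using lS[OF that] by (intro loc_int_add lg that) (auto simp: loc_int_def norm_mult)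
    then have lgS: "card I = Suc q \<Longrightarrow> loc_int (product_set G) (\<lambda>z. g I z - ?S g I z)" for I by simp
    have "weak_dbar (product_set G) q (\<lambda>I z. ?K g I z + H' (?S g) I z) (\<lambda>I z. (g I z - ?S g I z) + ?S g I z)"
      by (rule weak_dbar_add[OF _ _ _ _ _ lgS _ lS st(4) h(3)]) (use st(3) h(2) in auto)
    then show "weak_dbar (product_set G) q (H g) g" unfolding H_def[abs_def] by simp
  next
    fix g g' g'' :: "'n form" and a b :: complex and A A' :: real
    assume A: "0 \<le> A" "0 \<le> A'" and g: "closed_data p \<sigma> D G (insert j S) q g A" "closed_data p \<sigma> D G (insert j S) q g' A'"
      and gm'': "\<forall>I. g'' I \<in> borel_measurable borel" and ae: "ae_lincomb ?P (Suc q) g'' a g b g'"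
    have gm: "g I \<in> borel_measurable borel" "g' I \<in> borel_measurable borel" for I using g by (simp_all add: closed_data_def)
    have gn: "Lp_le p lborel (\<lambda>z. ennreal (indicator ?P z * weight \<sigma> z * cmod (g I z))) A"
        "Lp_le p lborel (\<lambda>z. ennreal (indicator ?P z * weight \<sigma> z * cmod (g' I z))) A'" if "card I = Suc q" for I
      using g that by (simp_all add: closed_data_def form_le_def)
    have aeI: "AE z in lborel. z \<in> ?P \<longrightarrow> g'' I z = a * g I z + b * g' I z" if "card I = Suc q" for I
      using ae that unfolding ae_lincomb_def by blast
    have Kc: "ae_lincomb ?P q (?K g'') a (?K g) b (?K g')"
      unfolding ae_lincomb_def
    proof (intro allI impI)
      fix I :: "'n set" assume I: "card I = q"
      show "AE z in lborel. z \<in> ?P \<longrightarrow> ?K g'' I z = a * ?K g I z + b * ?K g' I z"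
      proof (cases "j \<in> I")
        case False
        then have c: "card (insert j I) = Suc q" using I by simp
        have "AE z in lborel. z \<in> ?P \<longrightarrow> cauchy_transform R j (\<lambda>z. indicator ?P z * (\<theta> (z $ j) * g'' (insert j I) z)) z =
          a * cauchy_transform R j (\<lambda>z. indicator ?P z * (\<theta> (z $ j) * g (insert j I) z)) z + b * cauchy_transform R j (\<lambda>z. indicator ?P z * (\<theta> (z $ j) * g' (insert j I) z)) z"
          by (rule AEcomb[OF gm _ _ aeI[OF c]])
             (use gm'' cut_boundedD(2)[OF C1(2) A(1) gm(1) gn(1)[OF c]] cut_boundedD(2)[OF C1(2) A(2) gm(2) gn(2)[OF c]] in auto)
        then show ?thesis by eventually_elim (use False in \<open>simp add: homotopy_op_def algebra_simps\<close>)
      qed (simp add: homotopy_op_def)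
    qed
    have Sc: "ae_lincomb ?P (Suc q) (?S g'') a (?S g) b (?S g')"
      unfolding ae_lincomb_def
    proof (intro allI impI)
      fix I :: "'n set" assume c: "card I = Suc q"
      show "AE z in lborel. z \<in> ?P \<longrightarrow> ?S g'' I z = a * ?S g I z + b * ?S g' I z"
      proof (cases "j \<in> I")
        case False
        have "AE z in lborel. z \<in> ?P \<longrightarrow> cauchy_transform R j (\<lambda>z. indicator ?P z * (dbar1 \<theta> (z $ j) * g'' I z)) z =
          a * cauchy_transform R j (\<lambda>z. indicator ?P z * (dbar1 \<theta> (z $ j) * g I z)) z + b * cauchy_transform R j (\<lambda>z. indicator ?P z * (dbar1 \<theta> (z $ j) * g' I z)) z"
          by (rule AEcomb[OF gm _ _ aeI[OF c]])
             (use gm'' cut_boundedD(2)[OF C2(2) A(1) gm(1) gn(1)[OF c]] cut_boundedD(2)[OF C2(2) A(2) gm(2) gn(2)[OF c]] in auto)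
        then show ?thesis by eventually_elim (use False in \<open>simp add: remainder_op_def\<close>)
      qed (simp add: remainder_op_def)
    qed
    have "ae_lincomb ?P q (H' (?S g'')) a (H' (?S g)) b (H' (?S g'))"
      by (rule H'l[OF _ _ step(2)[OF A(1) g(1)] step(2)[OF A(2) g(2)] _ Sc])
         (use A C2(1) gm'' in \<open>auto intro!: Smeas\<close>)
    with Kc show "ae_lincomb ?P q (H g'') a (H g) b (H g')"
      unfolding ae_lincomb_def
    proof (intro allI impI, elim allE, elim impE)
      fix I :: "'n set" assume "card I = q" "card I = q"
      assume "AE z in lborel. z \<in> ?P \<longrightarrow> ?K g'' I z = a * ?K g I z + b * ?K g' I z"
        "AE z in lborel. z \<in> ?P \<longrightarrow> H' (?S g'') I z = a * H' (?S g) I z + b * H' (?S g') I z"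
      then show "AE z in lborel. z \<in> ?P \<longrightarrow> H g'' I z = a * H g I z + b * H g' I z"
        by eventually_elim (simp add: H_def algebra_simps)
    qed
  qed
  moreover have "C > 0" using C1(1) C2(1) sol(1) by (simp add: C_def add_pos_pos)
  ultimately show ?thesis by blast
qed

lemma solution_operator_exists:
  fixes D G :: "'n::{finite,linorder} \<Rightarrow> complex set"
  assumes p: "1 \<le> p" and D: "\<And>i. open (D i)" and G: "\<And>i. compact (closure (G i))" "\<And>i. closure (G i) \<subseteq> D i"
    and B: "B > 0" "\<And>i w. w \<in> D i \<Longrightarrow> cmod w \<le> B"
    and S: "finite S" and adm: "\<And>i. i \<in> S \<Longrightarrow> admissible p (\<sigma> i) (\<sigma> i)"
  shows "\<exists>H C. C > 0 \<and> solution_operator p D G S q \<sigma> \<sigma> H C"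
  using S adm
proof (induction S rule: finite_induct)
  case empty
  show ?case using solution_operator_empty[of p D G q \<sigma> \<sigma>] zero_less_one by blast
next
  case (insert j S)
  then obtain H C where "C > 0" "solution_operator p D G S q \<sigma> \<sigma> H C" by auto
  then have sol: "C > 0" "solution_operator p D G S q (\<sigma>(j := \<sigma> j)) (\<sigma>(j := \<sigma> j)) H C" by simp_all
  have "admissible p (\<sigma> j) (\<sigma> j)" using insert.prems by simp
  from solution_operator_insert[OF p D G B insert.hyps(2) this sol]
  show ?case by simp
qed

section \<open>L^p norms on Lebesgue sets\<close>

lemma nn_integral_lebesgue_on:
  assumes "K \<in> sets borel"
  shows "(\<integral>\<^sup>+x. f x \<partial>lebesgue_on K) = (\<integral>\<^sup>+x. f x * indicator K x \<partial>lborel)"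
  using assms by (subst nn_integral_restrict_space) (auto simp: nn_integral_completion)

lemma AE_lebesgue_on_iff:
  assumes "K \<in> sets borel"
  shows "(AE x in lebesgue_on K. Q x) \<longleftrightarrow> (AE x in lborel. x \<in> K \<longrightarrow> Q x)"
  using assms by (subst AE_restrict_space_iff) (auto simp: AE_completion_iff)

text \<open>The bridge between the norm of the function spaces and the bounds by \<open>p\<close>-th powers used in the
estimates.\<close>

lemma Lp_norm_le_iff:
  assumes p: "1 \<le> p" and A: "A \<ge> 0" and f: "f \<in> borel_measurable M"
  shows "Lp_norm p M f \<le> ennreal A \<longleftrightarrow> Lp_le p M (\<lambda>x. ennreal (norm (f x))) A"
proof (cases "p = \<infinity>")
  case True
  have [measurable]: "(\<lambda>x. ennreal (norm (f x))) \<in> borel_measurable M" using f by measurable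
  have "esssup M (\<lambda>x. ennreal (norm (f x))) \<le> ennreal A \<longleftrightarrow> (AE x in M. ennreal (norm (f x)) \<le> ennreal A)"
  proof
    assume le: "esssup M (\<lambda>x. ennreal (norm (f x))) \<le> ennreal A"
    show "AE x in M. ennreal (norm (f x)) \<le> ennreal A"
      using esssup_AE[of "\<lambda>x. ennreal (norm (f x))" M] by eventually_elim (use le in \<open>auto intro: order_trans\<close>)
  next
    assume "AE x in M. ennreal (norm (f x)) \<le> ennreal A"
    then show "esssup M (\<lambda>x. ennreal (norm (f x))) \<le> ennreal A" by (rule esssup_I[rotated]) measurable
  qed
  then show ?thesis using True by (simp add: Lp_norm_def Lp_le_def)
next
  case False
  let ?P = "enn2real p"
  have P: "?P \<ge> 1" by (rule enn2real_ge_1[OF p False])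
  let ?I = "\<integral>\<^sup>+x. ennreal (norm (f x) powr ?P) \<partial>M"
  have I: "(\<integral>\<^sup>+x. ennreal_powr ?P (ennreal (norm (f x))) \<partial>M) = ?I" by (simp add: ennreal_powr_ennreal)
  show ?thesis
  proof (cases "?I = \<infinity>")
    case True
    then show ?thesis using False by (simp add: Lp_norm_def Lp_le_def I top_unique)
  next
    case fin: False
    then obtain r where r: "?I = ennreal r" "r \<ge> 0" by (cases ?I) auto
    have "r powr (1 / ?P) \<le> A \<longleftrightarrow> r \<le> A powr ?P"
    proof
      assume "r powr (1 / ?P) \<le> A"
      then have "(r powr (1 / ?P)) powr ?P \<le> A powr ?P" using P by (intro powr_mono2) auto
      then show "r \<le> A powr ?P" using P r(2) by (simp add: powr_powr)
    next
      assume "r \<le> A powr ?P"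
      then have "r powr (1 / ?P) \<le> (A powr ?P) powr (1 / ?P)" using P r(2) by (intro powr_mono2) auto
      then show "r powr (1 / ?P) \<le> A" using P A by (simp add: powr_powr)
    qed
    then show ?thesis using False fin r A by (simp add: Lp_norm_def Lp_le_def I ennreal_le_iff)
  qed
qed

lemma Lp_norm_finite_iff:
  assumes "p \<noteq> \<infinity>"
  shows "Lp_norm p M f < \<infinity> \<longleftrightarrow> (\<integral>\<^sup>+x. ennreal (norm (f x) powr enn2real p) \<partial>M) < \<infinity>"
  using assms by (auto simp: Lp_norm_def Let_def less_top)

lemma Lp_norm_infinite_finite_iff:
  assumes f: "f \<in> borel_measurable M"
  shows "Lp_norm \<infinity> M f < \<infinity> \<longleftrightarrow> (\<exists>c\<ge>0. AE x in M. norm (f x) \<le> c)"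
proof
  assume "Lp_norm \<infinity> M f < \<infinity>"
  then obtain c where c: "Lp_norm \<infinity> M f \<le> ennreal c" "c \<ge> 0" by (cases "Lp_norm \<infinity> M f") auto
  then have "AE x in M. ennreal (norm (f x)) \<le> ennreal c"
    using Lp_norm_le_iff[OF _ c(2) f, of \<infinity>] by (simp add: Lp_le_def)
  then show "\<exists>c\<ge>0. AE x in M. norm (f x) \<le> c" using c(2) by auto
next
  assume "\<exists>c\<ge>0. AE x in M. norm (f x) \<le> c"
  then obtain c where c: "c \<ge> 0" "AE x in M. norm (f x) \<le> c" by blast
  then have "Lp_norm \<infinity> M f \<le> ennreal c"
    using Lp_norm_le_iff[OF _ c(1) f, of \<infinity>] by (simp add: Lp_le_def)
  then show "Lp_norm \<infinity> M f < \<infinity>" by (simp add: le_less_trans)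
qed

section \<open>Dyadic annuli\<close>

text \<open>The index \<open>n\<close> of the annulus \<open>2\<^sup>-\<^sup>n\<^sup>-\<^sup>1 < |z| \<le> 2\<^sup>-\<^sup>n\<close> that contains a point of the
punctured unit disc.\<close>

definition level :: "complex \<Rightarrow> nat" where
  "level z = (LEAST n. (1/2) ^ Suc n < cmod z)"

lemma level_measurable [measurable]: "level \<in> measurable borel (count_space UNIV)"
  unfolding level_def[abs_def] by measurable

lemma level_bounds:
  assumes "0 < cmod z" "cmod z \<le> 1"
  shows "(1/2) ^ Suc (level z) < cmod z" "cmod z \<le> (1/2) ^ level z"
proof -
  obtain n where "(1/2) ^ n < cmod z" using real_arch_pow_inv[OF assms(1), of "1/2"] by auto
  then have "(1/2) ^ Suc n < cmod z" by (simp add: less_le_trans)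
  then show "(1/2) ^ Suc (level z) < cmod z" unfolding level_def by (rule LeastI)
  show "cmod z \<le> (1/2) ^ level z"
  proof (cases "level z")
    case (Suc m)
    then have "\<not> (1/2) ^ Suc m < cmod z" unfolding level_def by (intro not_less_Least) auto
    then show ?thesis using Suc by simp
  qed (use assms in simp)
qed

definition punctured_disc :: "complex set" where
  "punctured_disc = cball 0 1 - {0}"

lemma punctured_disc_sets [measurable]: "punctured_disc \<in> sets borel"
  unfolding punctured_disc_def by simp

lemma half_power_square: "((1/2::real) ^ n)\<^sup>2 = (1/4) ^ n"
  by (simp add: power2_eq_square power_mult_distrib[symmetric])

lemma quarter_power: "(1/4::real) ^ n = inverse (4 ^ n)"
  by (simp add: power_one_over inverse_eq_divide)

lemma four_power_powr: "(4::real) ^ n = 2 powr (2 * real n)"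
proof -
  have "2 powr (2 * real n) = (2 powr 2) powr real n" by (simp only: powr_powr)
  also have "(2::real) powr 2 = 4" by simp
  also have "4 powr real n = 4 ^ n" by (rule powr_realpow) simp
  finally show ?thesis by simp
qed

definition annulus_const :: real where "annulus_const = unit_ball_vol 2 * (3/4)"

lemma annulus_const_pos: "annulus_const > 0"
  by (simp add: annulus_const_def)

text \<open>The annulus of index \<open>n\<close> has area proportional to \<open>4\<^sup>-\<^sup>n\<close>, so integrals of functions that are
constant on the annuli are series.\<close>

lemma nn_integral_level:
  "(\<integral>\<^sup>+z. F (level z) * indicator punctured_disc z \<partial>lborel) = (\<Sum>n. F n * ennreal (annulus_const * (1/4) ^ n))"
proof -
  define ann where "ann n = cball 0 ((1/2) ^ n) - cball (0::complex) ((1/2) ^ Suc n)" for n :: nat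
  have [measurable]: "ann n \<in> sets borel" for n unfolding ann_def by simp
  have lev: "z \<in> ann n \<longleftrightarrow> z \<in> punctured_disc \<and> level z = n" for z n
  proof
    assume z: "z \<in> ann n"
    have "(1/2::real) ^ n \<le> 1" by (simp add: power_le_one)
    moreover have "(0::real) < (1/2) ^ Suc n" by simp
    ultimately have "z \<in> punctured_disc" using z by (auto simp: ann_def punctured_disc_def)
    moreover have "level z = n" unfolding level_def
    proof (rule Least_equality)
      show "(1/2) ^ Suc n < cmod z" using z by (simp add: ann_def)
      fix m assume m: "(1/2) ^ Suc m < cmod z"
      show "n \<le> m"
      proof (rule ccontr)
        assume "\<not> n \<le> m"
        then have "(1/2::real) ^ n \<le> (1/2) ^ Suc m" by (intro power_decreasing) auto
        then show False using m z by (simp add: ann_def)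
      qed
    qed
    ultimately show "z \<in> punctured_disc \<and> level z = n" by simp
  next
    assume "z \<in> punctured_disc \<and> level z = n"
    then show "z \<in> ann n" using level_bounds[of z] by (auto simp: punctured_disc_def ann_def not_le)
  qed
  have em: "emeasure lborel (ann n) = ennreal (annulus_const * (1/4) ^ n)" for n
  proof -
    have "emeasure lborel (ann n) = emeasure lborel (cball (0::complex) ((1/2) ^ n)) - emeasure lborel (cball (0::complex) ((1/2) ^ Suc n))"
      unfolding ann_def by (rule emeasure_Diff) (auto simp: emeasure_cball intro!: subset_cball power_decreasing)
    also have "\<dots> = ennreal (unit_ball_vol 2 * ((1/2) ^ n)\<^sup>2) - ennreal (unit_ball_vol 2 * ((1/2) ^ Suc n)\<^sup>2)"
      by (simp only: emeasure_cball DIM_complex zero_le_power zero_le_divide_1_iff zero_le_numeral) simp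
    also have "\<dots> = ennreal (unit_ball_vol 2 * ((1/2) ^ n)\<^sup>2 - unit_ball_vol 2 * ((1/2) ^ Suc n)\<^sup>2)"
      by (rule ennreal_minus) simp
    also have "((1/2::real) ^ n)\<^sup>2 = (1/4) ^ n" by (rule half_power_square)
    also have "((1/2::real) ^ Suc n)\<^sup>2 = (1/4) * (1/4) ^ n" unfolding half_power_square by simp
    finally show ?thesis by (simp add: annulus_const_def field_simps)
  qed
  have "(\<integral>\<^sup>+z. F (level z) * indicator punctured_disc z \<partial>lborel) = (\<integral>\<^sup>+z. (\<Sum>n. F n * indicator (ann n) z) \<partial>lborel)"
  proof (rule nn_integral_cong)
    fix z
    show "F (level z) * indicator punctured_disc z = (\<Sum>n. F n * indicator (ann n) z)"
    proof (cases "z \<in> punctured_disc")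
      case True
      have "(\<Sum>n. F n * indicator (ann n) z) = (\<Sum>n\<in>{level z}. F n * indicator (ann n) z)"
        by (rule suminf_finite) (auto simp: lev)
      then show ?thesis using True by (simp add: lev)
    qed (simp add: lev)
  qed
  also have "\<dots> = (\<Sum>n. \<integral>\<^sup>+z. F n * indicator (ann n) z \<partial>lborel)" by (rule nn_integral_suminf) measurable
  also have "\<dots> = (\<Sum>n. F n * ennreal (annulus_const * (1/4) ^ n))"
    by (simp add: nn_integral_cmult_indicator em)
  finally show ?thesis .
qed

lemma level_powr_upper:
  assumes "z \<in> punctured_disc"
  shows "cmod z powr a \<le> 2 powr \<bar>a\<bar> * 2 powr (- (real (level z) * a))"
proof -
  have z: "0 < cmod z" "cmod z \<le> 1" using assms by (auto simp: punctured_disc_def)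
  let ?n = "level z"
  have e: "(1/2::real) ^ n = 2 powr (- real n)" for n by (simp add: powr_minus powr_realpow power_one_over field_simps)
  note lb = level_bounds[OF z, unfolded e]
  show ?thesis
  proof (cases "a \<ge> 0")
    case True
    have "cmod z powr a \<le> (2 powr (- real ?n)) powr a" using lb(2) z True by (intro powr_mono2) auto
    also have "\<dots> = 1 * 2 powr (- (real ?n * a))" by (simp add: powr_powr)
    also have "\<dots> \<le> 2 powr \<bar>a\<bar> * 2 powr (- (real ?n * a))" by (intro mult_right_mono ge_one_powr_ge_zero) auto
    finally show ?thesis .
  next
    case False
    have "cmod z powr a \<le> (2 powr (- real (Suc ?n))) powr a" using lb(1) z False by (intro powr_mono2') auto
    also have "\<dots> = 2 powr \<bar>a\<bar> * 2 powr (- (real ?n * a))"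
      using False by (simp add: powr_powr powr_add[symmetric] algebra_simps)
    finally show ?thesis .
  qed
qed

lemma nn_integral_inverse_power_infinite:
  assumes "b \<ge> 2"
  shows "(\<integral>\<^sup>+z. ennreal (cmod z powr (- b)) * indicator (cball 0 1) z \<partial>lborel) = \<infinity>"
proof -
  have "(\<Sum>n. ennreal (4 ^ n) * ennreal (annulus_const * (1/4) ^ n)) = (\<Sum>n::nat. ennreal annulus_const)"
    using annulus_const_pos by (intro suminf_cong) (simp add: ennreal_mult[symmetric] power_one_over)
  also have "\<dots> = \<infinity>"
  proof (rule ccontr)
    assume "(\<Sum>n::nat. ennreal annulus_const) \<noteq> \<infinity>"
    then have "summable (\<lambda>n::nat. annulus_const)"
      using annulus_const_pos by (intro summable_suminf_not_top) auto
    then show False using annulus_const_pos by (simp add: summable_const_iff)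
  qed
  finally have "(\<integral>\<^sup>+z. ennreal (4 ^ level z) * indicator punctured_disc z \<partial>lborel) = \<infinity>"
    using nn_integral_level[of "\<lambda>n. ennreal (4 ^ n)"] by simp
  moreover have "(\<integral>\<^sup>+z. ennreal (4 ^ level z) * indicator punctured_disc z \<partial>lborel) \<le>
    (\<integral>\<^sup>+z. ennreal (cmod z powr (- b)) * indicator (cball 0 1) z \<partial>lborel)"
  proof (rule nn_integral_mono)
    fix z
    show "ennreal (4 ^ level z) * indicator punctured_disc z \<le> ennreal (cmod z powr (- b)) * indicator (cball 0 1) z"
    proof (cases "z \<in> punctured_disc")
      case True
      then have z: "0 < cmod z" "cmod z \<le> 1" by (auto simp: punctured_disc_def)
      have "(4::real) ^ level z = inverse (((1/2) ^ level z)\<^sup>2)"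
        unfolding half_power_square quarter_power by simp
      also have "\<dots> \<le> inverse ((cmod z)\<^sup>2)"
        using level_bounds(2)[OF z] z by (intro le_imp_inverse_le power_mono) auto
      also have "\<dots> = cmod z powr (- 2)" using z by (simp add: powr_minus powr_numeral)
      also have "\<dots> \<le> cmod z powr (- b)" using z assms by (intro powr_mono') auto
      finally show ?thesis using True z by (simp add: ennreal_leI)
    qed simp
  qed
  ultimately show ?thesis by (simp add: top_unique)
qed

text \<open>With the values \<open>4\<^sup>n / (1 + n)\<close> on the annuli the integral becomes the harmonic series. The
logarithmic factor makes one function serve for all \<open>p\<close>: at the critical exponent the series for
the \<open>P\<close>-th power is \<open>\<Sum> (1 + n)\<^sup>-\<^sup>P\<close>, which converges for every \<open>P > 1\<close>.\<close>

definition spike :: "complex \<Rightarrow> real" where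
  "spike z = (if z \<in> punctured_disc then 4 ^ level z / (1 + real (level z)) else 0)"

lemma spike_measurable [measurable]: "spike \<in> borel_measurable borel"
  unfolding spike_def[abs_def] by measurable

lemma spike_nonneg: "spike z \<ge> 0" by (simp add: spike_def)

lemma nn_integral_spike: "(\<integral>\<^sup>+z. ennreal (spike z) * indicator (cball 0 1) z \<partial>lborel) = \<infinity>"
proof -
  have "(\<integral>\<^sup>+z. ennreal (spike z) * indicator (cball 0 1) z \<partial>lborel) =
    (\<integral>\<^sup>+z. ennreal (4 ^ level z / (1 + real (level z))) * indicator punctured_disc z \<partial>lborel)"
    by (intro nn_integral_cong) (auto simp: spike_def punctured_disc_def split: split_indicator)
  also have "\<dots> = (\<Sum>n. ennreal (4 ^ n / (1 + real n)) * ennreal (annulus_const * (1/4) ^ n))"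
    by (rule nn_integral_level)
  also have "\<dots> = (\<Sum>n. ennreal (annulus_const * (1 / (1 + real n))))"
    using annulus_const_pos by (intro suminf_cong) (simp add: ennreal_mult[symmetric] power_one_over field_simps)
  also have "\<dots> = \<infinity>"
  proof (rule ccontr)
    assume "(\<Sum>n. ennreal (annulus_const * (1 / (1 + real n)))) \<noteq> \<infinity>"
    then have "summable (\<lambda>n. annulus_const * (1 / (1 + real n)))"
      using annulus_const_pos by (intro summable_suminf_not_top) auto
    then have "summable (\<lambda>n. (1 / (1 + real n)))" using annulus_const_pos by (subst (asm) summable_cmult_iff) auto
    then have "summable (\<lambda>n. real (Suc n) powr (-1))" by (simp add: powr_minus inverse_eq_divide)
    then have "summable (\<lambda>n. real n powr (-1))" by (subst (asm) summable_Suc_iff)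
    then show False by (simp only: summable_real_powr_iff)
  qed
  finally show ?thesis .
qed

text \<open>On the annulus of index \<open>n\<close> the integral is of the order \<open>2\<^sup>n\<^sup>r (1 + n)\<^sup>-\<^sup>P\<close> with
\<open>r = t P + 2 P - 2 \<le> 0\<close>. For \<open>P = 1\<close> the exponent \<open>r = t\<close> is negative and the series is dominated by a
geometric one; for \<open>P > 1\<close> the second factor suffices.\<close>

lemma nn_integral_spike_powr:
  assumes P: "P \<ge> 1" and t: "(P = 1 \<and> t < 0) \<or> (P > 1 \<and> t \<le> 2 / P - 2)"
  shows "(\<integral>\<^sup>+z. ennreal ((cmod z powr (- t) * spike z) powr P) \<partial>lborel) < \<infinity>"
proof -
  define D where "D = 2 powr \<bar>t\<bar>"
  define a where "a n = annulus_const * D powr P * (2 powr (real n * (t * P + 2 * P - 2)) * (1 + real n) powr (- P))" for n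
  have le: "t * P + 2 * P - 2 \<le> 0"
    using t P by (auto simp: field_simps)
  have sum: "summable a"
  proof -
    have "summable (\<lambda>n. 2 powr (real n * (t * P + 2 * P - 2)) * (1 + real n) powr (- P))"
    proof (cases "P = 1")
      case True
      then have t0: "t < 0" using t by auto
      have "summable (\<lambda>n. (2 powr t) ^ n)"
        using t0 by (intro summable_geometric) (simp add: powr_less_one)
      then show ?thesis
      proof (rule summable_comparison_test'[where N=0])
        fix n :: nat
        have "2 powr (real n * t) = (2 powr t) ^ n" by (simp add: powr_powr[symmetric] powr_realpow[symmetric] mult.commute)
        moreover have "(1 + real n) powr (- 1) \<le> 1" by (simp add: powr_minus inverse_le_1_iff)
        ultimately have "2 powr (real n * t) * (1 + real n) powr (- 1) \<le> (2 powr t) ^ n * 1"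
          by (intro mult_mono) auto
        then show "norm (2 powr (real n * (t * P + 2 * P - 2)) * (1 + real n) powr (- P)) \<le> (2 powr t) ^ n"
          using True by simp
      qed
    next
      case False
      have "summable (\<lambda>n. real n powr (- P))" using False P by (simp add: summable_real_powr_iff)
      then have "summable (\<lambda>n. real (Suc n) powr (- P))" by (subst summable_Suc_iff)
      then show ?thesis
      proof (rule summable_comparison_test'[where N=0])
        fix n :: nat
        have "2 powr (real n * (t * P + 2 * P - 2)) \<le> 2 powr 0"
          using le by (intro powr_mono) (auto simp: mult_nonneg_nonpos)
        then show "norm (2 powr (real n * (t * P + 2 * P - 2)) * (1 + real n) powr (- P)) \<le> real (Suc n) powr (- P)"
          by (simp add: mult_left_le_one_le)
      qed
    qed
    then show ?thesis unfolding a_def by (rule summable_mult)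
  qed
  have a0: "a n \<ge> 0" for n using annulus_const_pos by (simp add: a_def)
  let ?F = "\<lambda>n. ennreal ((D * 2 powr (real n * t) * (4 ^ n / (1 + real n))) powr P)"
  have "(\<integral>\<^sup>+z. ennreal ((cmod z powr (- t) * spike z) powr P) \<partial>lborel) \<le>
    (\<integral>\<^sup>+z. ?F (level z) * indicator punctured_disc z \<partial>lborel)"
  proof (rule nn_integral_mono)
    fix z
    show "ennreal ((cmod z powr (- t) * spike z) powr P) \<le> ?F (level z) * indicator punctured_disc z"
    proof (cases "z \<in> punctured_disc")
      case True
      have "cmod z powr (- t) * spike z \<le> D * 2 powr (real (level z) * t) * (4 ^ level z / (1 + real (level z)))"
        using level_powr_upper[OF True, of "- t"] True unfolding D_def
        by (intro mult_mono) (auto simp: spike_def)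
      then have "(cmod z powr (- t) * spike z) powr P \<le> (D * 2 powr (real (level z) * t) * (4 ^ level z / (1 + real (level z)))) powr P"
        using P by (intro powr_mono2) (auto simp: spike_nonneg)
      then show ?thesis using True by (simp add: ennreal_leI)
    qed (simp add: spike_def)
  qed
  also have "\<dots> = (\<Sum>n. ?F n * ennreal (annulus_const * (1/4) ^ n))" by (rule nn_integral_level)
  also have "\<dots> = (\<Sum>n. ennreal (a n))"
  proof (rule suminf_cong)
    fix n
    note e4 = four_power_powr[of n]
    have "(D * 2 powr (real n * t) * (4 ^ n / (1 + real n))) powr P * (annulus_const * (1/4) ^ n)
      = annulus_const * D powr P * ((2 powr (real n * t)) powr P * ((4 ^ n) powr P * (1/4) ^ n) * (1 + real n) powr (- P))"
    proof -
      have "(D * x * (y / c)) powr P = D powr P * x powr P * (y powr P * c powr (- P))" if "x \<ge> 0" "y \<ge> 0" "c > 0" for x y c :: real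
        using that by (simp add: powr_mult powr_divide powr_minus_divide D_def)
      from this[of "2 powr (real n * t)" "4 ^ n" "1 + real n"] show ?thesis by (simp only: mult_ac) simp
    qed
    also have "(2 powr (real n * t)) powr P * ((4 ^ n) powr P * (1/4) ^ n) = 2 powr (real n * (t * P + 2 * P - 2))"
    proof -
      have q: "(1/4::real) ^ n = 2 powr (- (2 * real n))" unfolding powr_minus e4[symmetric] by (rule quarter_power)
      show ?thesis unfolding q unfolding e4 powr_powr powr_add[symmetric] by (simp add: algebra_simps)
    qed
    finally have "(D * 2 powr (real n * t) * (4 ^ n / (1 + real n))) powr P * (annulus_const * (1/4) ^ n) = a n"
      by (simp add: a_def)
    moreover have "?F n * ennreal (annulus_const * (1/4) ^ n) = ennreal ((D * 2 powr (real n * t) * (4 ^ n / (1 + real n))) powr P * (annulus_const * (1/4) ^ n))"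
      by (rule ennreal_mult[symmetric]) (use annulus_const_pos in auto)
    ultimately show "?F n * ennreal (annulus_const * (1/4) ^ n) = ennreal (a n)" by (simp only:)
  qed
  also have "\<dots> < \<infinity>" using ennreal_suminf_neq_top[OF sum a0] by (simp add: less_top)
  finally show ?thesis .
qed

lemma spike_bounded:
  assumes "t \<le> -2"
  shows "cmod z powr (- t) * spike z \<le> 2 powr \<bar>t\<bar>"
proof (cases "z \<in> punctured_disc")
  case True
  let ?n = "real (level z)"
  note e4 = four_power_powr[of "level z"]
  have "cmod z powr (- t) * spike z \<le> 2 powr \<bar>t\<bar> * 2 powr (?n * t) * (4 ^ level z / 1)"
    using level_powr_upper[OF True, of "- t"] True unfolding spike_def if_P[OF True]
    by (intro mult_mono divide_left_mono) auto
  also have "\<dots> = 2 powr \<bar>t\<bar> * 2 powr (?n * (t + 2))" unfolding e4 by (simp add: powr_add[symmetric] algebra_simps)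
  also have "\<dots> \<le> 2 powr \<bar>t\<bar> * 2 powr 0"
    using assms by (intro mult_left_mono powr_mono) (auto simp: mult_nonneg_nonpos)
  finally show ?thesis by simp
qed (simp add: spike_def)

section \<open>The two weights\<close>

text \<open>The exponents \<open>t\<close> for which \<open>|z|\<^sup>t L\<^sup>p\<close> is locally contained in \<open>L\<^sup>1\<close>. The endpoint belongs
to the range only for \<open>p = 1\<close>.\<close>

definition dbar_weight_exponent :: "ennreal \<Rightarrow> real \<Rightarrow> bool" where
  "dbar_weight_exponent p t \<longleftrightarrow> (if p = \<infinity> then t > -2 else if p = 1 then t \<ge> 0 else t > 2 / enn2real p - 2)"

text \<open>The exponents \<open>t\<close> for which the constant function 1 lies locally in \<open>|z|\<^sup>t L\<^sup>p\<close>.\<close>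

definition mod_weight_exponent :: "ennreal \<Rightarrow> real \<Rightarrow> bool" where
  "mod_weight_exponent p t \<longleftrightarrow> (if p = \<infinity> then t \<le> 0 else t * enn2real p < 2)"

lemma enn2real_gt_1: "1 \<le> p \<Longrightarrow> p \<noteq> \<infinity> \<Longrightarrow> p \<noteq> 1 \<Longrightarrow> enn2real p > 1"
  by (cases p) (auto simp: ennreal_1[symmetric] ennreal_le_iff simp del: ennreal_1)

lemma borel_measurable_lebesgue_on:
  "f \<in> borel_measurable borel \<Longrightarrow> f \<in> borel_measurable (lebesgue_on U)"
  by (intro measurable_restrict_space1 measurable_completion) simp

lemma young_powr:
  fixes x y P :: real
  assumes "x \<ge> 0" "y \<ge> 0" "P > 1"
  shows "x * y \<le> x powr (P / (P - 1)) + y powr P"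
proof (cases "x = 0 \<or> y = 0")
  case False
  then have xy: "x > 0" "y > 0" using assms by auto
  show ?thesis
  proof (cases "x \<le> y powr (P - 1)")
    case True
    then have "x * y \<le> y powr (P - 1) * y powr 1" using xy by (intro mult_mono) auto
    also have "\<dots> = y powr P" unfolding powr_add[symmetric] by simp
    finally show ?thesis by (simp add: add_increasing)
  next
    case False
    then have "(y powr (P - 1)) powr (1 / (P - 1)) \<le> x powr (1 / (P - 1))" using assms by (intro powr_mono2) auto
    then have "y \<le> x powr (1 / (P - 1))" using xy assms by (simp add: powr_powr)
    then have "x * y \<le> x powr 1 * x powr (1 / (P - 1))" using xy by (intro mult_mono) auto
    also have "\<dots> = x powr (P / (P - 1))" unfolding powr_add[symmetric] using assms by (simp add: field_simps)
    finally show ?thesis by (simp add: add_increasing2)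
  qed
qed auto

lemma weighted_norm: "cmod (of_real (cmod z powr a) * w) = cmod z powr a * cmod w"
  by (simp add: norm_mult)

text \<open>With \<open>h = |z|\<^sup>-\<^sup>\<sigma> f\<close> the function to be integrated is \<open>|z|\<^sup>t |h|\<close>, and Young's inequality
separates \<open>|h|\<^sup>P\<close> from a power of \<open>|z|\<close> with exponent greater than \<open>-2\<close>.\<close>

lemma wLp_loc_subset_L1:
  assumes p: "1 \<le> p" and ok: "dbar_weight_exponent p (\<sigma> - real_of_int m)"
  shows "wLp_loc p \<sigma> UNIV \<subseteq> wLp_loc 1 (real_of_int m) UNIV"
proof
  fix f assume f: "f \<in> wLp_loc p \<sigma> UNIV"
  define t where "t = \<sigma> - real_of_int m"
  have fm: "f \<in> borel_measurable (lebesgue_on UNIV)" using f by (simp add: wLp_loc_def)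
  have gm: "(\<lambda>z. complex_of_real (cmod z powr a) * f z) \<in> borel_measurable (lebesgue_on UNIV)" for a
    by (intro borel_measurable_times fm borel_measurable_lebesgue_on) measurable
  define h where "h z = of_real (cmod z powr (- \<sigma>)) * f z" for z
  have hK: "compact K \<Longrightarrow> Lp_norm p (lebesgue_on K) h < \<infinity>" for K
    using f by (simp add: wLp_loc_def Lp_loc_def h_def[abs_def])
  have hm: "h \<in> borel_measurable (lebesgue_on K)" for K
    using gm[of "- \<sigma>"] unfolding h_def[abs_def] by (intro measurable_restrict_space1) simp
  have "Lp_norm 1 (lebesgue_on K) (\<lambda>z. of_real (cmod z powr (- real_of_int m)) * f z) < \<infinity>" if K: "compact K" for K
  proof -
    have Kb [measurable]: "K \<in> sets borel" using K by (rule borel_compact)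
    obtain B where B: "B > 0" "\<And>z. z \<in> K \<Longrightarrow> cmod z \<le> B" using compact_imp_bounded[OF K] unfolding bounded_pos by blast
    have fin: "(\<integral>\<^sup>+z. ennreal (cmod z powr s) * indicator K z \<partial>lborel) < \<infinity>" if "s > -2" for s
    proof -
      have "(\<integral>\<^sup>+z. ennreal (cmod z powr s) * indicator K z \<partial>lborel) \<le> (\<integral>\<^sup>+z. ennreal (cmod z powr (- (- s))) * indicator (cball 0 B) z \<partial>lborel)"
        using B by (intro nn_integral_mono) (auto split: split_indicator)
      also have "\<dots> < \<infinity>" using that by (intro inverse_norm_powr_locally_integrable) auto
      finally show ?thesis .
    qed
    have id: "AE z in lborel. cmod z powr (- real_of_int m) * cmod (f z) = cmod z powr t * cmod (h z)"
      using AE_lborel_singleton[of 0]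
      by eventually_elim (simp add: h_def weighted_norm t_def mult.assoc[symmetric] powr_add[symmetric])
    have "(\<integral>\<^sup>+z. ennreal (cmod z powr (- real_of_int m) * cmod (f z)) * indicator K z \<partial>lborel) =
      (\<integral>\<^sup>+z. ennreal (cmod z powr t * cmod (h z)) * indicator K z \<partial>lborel)"
    proof (rule nn_integral_cong_AE)
      show "AE z in lborel. ennreal (cmod z powr (- real_of_int m) * cmod (f z)) * indicator K z = ennreal (cmod z powr t * cmod (h z)) * indicator K z"
        using id by eventually_elim simp
    qed
    also have "\<dots> < \<infinity>"
    proof (cases "p = \<infinity>")
      case True
      then obtain c where c: "c \<ge> 0" "AE z in lebesgue_on K. cmod (h z) \<le> c"
        using hK[OF K] Lp_norm_infinite_finite_iff[OF hm] by auto
      then have "AE z in lborel. z \<in> K \<longrightarrow> cmod (h z) \<le> c" by (simp add: AE_lebesgue_on_iff)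
      then have "(\<integral>\<^sup>+z. ennreal (cmod z powr t * cmod (h z)) * indicator K z \<partial>lborel) \<le> (\<integral>\<^sup>+z. ennreal c * (ennreal (cmod z powr t) * indicator K z) \<partial>lborel)"
      proof (intro nn_integral_mono_AE, eventually_elim)
        case (elim z)
        show ?case
        proof (cases "z \<in> K")
          case True
          then have "cmod (h z) * cmod z powr t \<le> c * cmod z powr t" using elim by (intro mult_right_mono) auto
          then have "cmod z powr t * cmod (h z) \<le> c * cmod z powr t" by (simp only: mult.commute[of "cmod z powr t" "cmod (h z)"])
          then show ?thesis using True c by (simp add: ennreal_mult[symmetric] ennreal_leI)
        qed simp
      qed
      also have "\<dots> = ennreal c * (\<integral>\<^sup>+z. (ennreal (cmod z powr t) * indicator K z) \<partial>lborel)" by (rule nn_integral_cmult) measurable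
      also have "\<dots> < \<infinity>" using fin[of t] ok True by (simp add: dbar_weight_exponent_def t_def ennreal_mult_less_top)
      finally show ?thesis .
    next
      case False
      let ?P = "enn2real p"
      have hfin: "(\<integral>\<^sup>+z. ennreal (cmod (h z) powr ?P) * indicator K z \<partial>lborel) < \<infinity>"
        using hK[OF K] Lp_norm_finite_iff[OF False, of "lebesgue_on K" h] unfolding nn_integral_lebesgue_on[OF Kb] by blast
      have hm2: "(\<lambda>z. ennreal (cmod (h z) powr ?P) * indicator K z) \<in> borel_measurable lebesgue"
        using hm[of UNIV] by (intro borel_measurable_times_ennreal) (simp_all add: borel_measurable_indicator)
      show ?thesis
      proof (cases "p = 1")
        case True
        then have t0: "t \<ge> 0" using ok False by (simp add: dbar_weight_exponent_def t_def)
        have "(\<integral>\<^sup>+z. ennreal (cmod z powr t * cmod (h z)) * indicator K z \<partial>lborel) \<le>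
          (\<integral>\<^sup>+z. ennreal (max 1 (B powr t)) * (ennreal (cmod (h z) powr ?P) * indicator K z) \<partial>lebesgue)"
          unfolding nn_integral_completion[symmetric, of lborel]
        proof (rule nn_integral_mono)
          fix z
          show "ennreal (cmod z powr t * cmod (h z)) * indicator K z \<le> ennreal (max 1 (B powr t)) * (ennreal (cmod (h z) powr ?P) * indicator K z)"
          proof (cases "z \<in> K")
            case zK: True
            have "cmod z powr t \<le> max 1 (B powr (t - 0)) * cmod z powr 0" using B zK t0 by (intro powr_le_bounded) auto
            also have "\<dots> \<le> max 1 (B powr (t - 0)) * 1" by (intro mult_left_mono) (cases "z = 0", auto)
            also have "\<dots> = max 1 (B powr t)" by simp
            finally have "cmod z powr t * cmod (h z) \<le> max 1 (B powr t) * cmod (h z)" by (rule mult_right_mono) simp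
            then have "ennreal (cmod z powr t * cmod (h z)) \<le> ennreal (max 1 (B powr t) * cmod (h z))" by (rule ennreal_leI)
            then show ?thesis using zK True by (simp add: ennreal_mult)
          qed simp
        qed
        also have "\<dots> = ennreal (max 1 (B powr t)) * (\<integral>\<^sup>+z. (ennreal (cmod (h z) powr ?P) * indicator K z) \<partial>lebesgue)"
          by (rule nn_integral_cmult[OF hm2])
        also have "\<dots> < \<infinity>" using hfin by (simp add: nn_integral_completion ennreal_mult_less_top)
        finally show ?thesis .
      next
        case p1: False
        have P: "?P > 1" using enn2real_gt_1[OF p False p1] .
        have s: "t * (?P / (?P - 1)) > -2"
        proof -
          have "t > 2 / ?P - 2" using ok False p1 by (simp add: dbar_weight_exponent_def t_def)
          then have "t * ?P > 2 - 2 * ?P" using P by (simp add: field_simps)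
          then show ?thesis using P by (simp add: field_simps)
        qed
        have "(\<integral>\<^sup>+z. ennreal (cmod z powr t * cmod (h z)) * indicator K z \<partial>lborel) \<le>
          (\<integral>\<^sup>+z. ennreal (cmod z powr (t * (?P / (?P - 1)))) * indicator K z + ennreal (cmod (h z) powr ?P) * indicator K z \<partial>lebesgue)"
          unfolding nn_integral_completion[symmetric, of lborel]
        proof (rule nn_integral_mono)
          fix z
          have "cmod z powr t * cmod (h z) \<le> (cmod z powr t) powr (?P / (?P - 1)) + cmod (h z) powr ?P"
            using P by (intro young_powr) auto
          then have "ennreal (cmod z powr t * cmod (h z)) \<le> ennreal (cmod z powr (t * (?P / (?P - 1)))) + ennreal (cmod (h z) powr ?P)"
            by (simp add: powr_powr ennreal_plus[symmetric] ennreal_leI del: ennreal_plus)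
          then show "ennreal (cmod z powr t * cmod (h z)) * indicator K z \<le> ennreal (cmod z powr (t * (?P / (?P - 1)))) * indicator K z + ennreal (cmod (h z) powr ?P) * indicator K z"
            by (auto split: split_indicator)
        qed
        also have "\<dots> = (\<integral>\<^sup>+z. ennreal (cmod z powr (t * (?P / (?P - 1)))) * indicator K z \<partial>lebesgue) + (\<integral>\<^sup>+z. ennreal (cmod (h z) powr ?P) * indicator K z \<partial>lebesgue)"
          by (rule nn_integral_add[OF measurable_completion hm2]) measurable
        also have "\<dots> < \<infinity>" using hfin fin[OF s] by (simp add: nn_integral_completion)
        finally show ?thesis .
      qed
    qed
    finally show ?thesis by (subst Lp_norm_finite_iff) (simp_all add: nn_integral_lebesgue_on norm_mult)
  qed
  then show "f \<in> wLp_loc 1 (real_of_int m) UNIV" using fm gm by (simp add: wLp_loc_def Lp_loc_def)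
qed

text \<open>The function \<open>|z|\<^sup>m\<close> times the spike is a counterexample for all exponents outside the range.\<close>

lemma wLp_loc_not_subset_L1:
  assumes p: "1 \<le> p" and ok: "\<not> dbar_weight_exponent p (\<sigma> - real_of_int m)"
  shows "\<not> wLp_loc p \<sigma> UNIV \<subseteq> wLp_loc 1 (real_of_int m) UNIV"
proof -
  define t where "t = \<sigma> - real_of_int m"
  define f where "f z = complex_of_real (cmod z powr real_of_int m * spike z)" for z
  have [measurable]: "f \<in> borel_measurable borel" unfolding f_def by measurable
  have fm: "f \<in> borel_measurable (lebesgue_on UNIV)" by (rule borel_measurable_lebesgue_on) measurable
  have gm: "(\<lambda>z. complex_of_real (cmod z powr a) * f z) \<in> borel_measurable (lebesgue_on K)" for a K
    by (rule borel_measurable_lebesgue_on) measurable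
  have eq: "cmod (of_real (cmod z powr a) * f z) = cmod z powr (a + real_of_int m) * spike z" for z a
  proof (cases "z = 0")
    case False then show ?thesis by (simp add: f_def norm_mult spike_nonneg powr_add abs_mult)
  qed (simp add: spike_def punctured_disc_def f_def)
  have "f \<in> wLp_loc p \<sigma> UNIV"
    unfolding wLp_loc_def Lp_loc_def
  proof (intro CollectI conjI fm gm allI impI)
    fix K :: "complex set" assume "compact K \<and> K \<subseteq> UNIV"
    then have Kb [measurable]: "K \<in> sets borel" by (auto intro: borel_compact)
    show "Lp_norm p (lebesgue_on K) (\<lambda>z. of_real (cmod z powr (- \<sigma>)) * f z) < \<infinity>"
    proof (cases "p = \<infinity>")
      case True
      then have "t \<le> -2" using ok by (simp add: dbar_weight_exponent_def t_def)
      then have "cmod (of_real (cmod z powr (- \<sigma>)) * f z) \<le> 2 powr \<bar>t\<bar>" for z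
        unfolding eq using spike_bounded[of t z] by (simp add: t_def)
      then show ?thesis unfolding True by (subst Lp_norm_infinite_finite_iff[OF gm]) (auto intro!: exI[of _ "2 powr \<bar>t\<bar>"])
    next
      case False
      let ?P = "enn2real p"
      have P: "?P \<ge> 1" by (rule enn2real_ge_1[OF p False])
      have "(?P = 1 \<and> t < 0) \<or> (?P > 1 \<and> t \<le> 2 / ?P - 2)"
        using ok False enn2real_gt_1[OF p False] by (cases "p = 1") (auto simp: dbar_weight_exponent_def t_def)
      from nn_integral_spike_powr[OF P this]
      have fin: "(\<integral>\<^sup>+z. ennreal ((cmod z powr (- t) * spike z) powr ?P) \<partial>lborel) < \<infinity>" .
      have "(\<integral>\<^sup>+z. ennreal (cmod (of_real (cmod z powr (- \<sigma>)) * f z) powr ?P) * indicator K z \<partial>lborel) \<le>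
        (\<integral>\<^sup>+z. ennreal ((cmod z powr (- t) * spike z) powr ?P) \<partial>lborel)"
        unfolding eq by (intro nn_integral_mono) (auto simp: t_def split: split_indicator)
      with fin show ?thesis by (subst Lp_norm_finite_iff[OF False]) (simp add: nn_integral_lebesgue_on le_less_trans)
    qed
  qed
  moreover have "f \<notin> wLp_loc 1 (real_of_int m) UNIV"
  proof
    assume "f \<in> wLp_loc 1 (real_of_int m) UNIV"
    then have "Lp_norm 1 (lebesgue_on (cball 0 1)) (\<lambda>z. of_real (cmod z powr (- real_of_int m)) * f z) < \<infinity>"
      by (simp add: wLp_loc_def Lp_loc_def)
    then have "(\<integral>\<^sup>+z. ennreal (cmod (of_real (cmod z powr (- real_of_int m)) * f z)) * indicator (cball 0 1) z \<partial>lborel) < \<infinity>"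
      by (subst (asm) Lp_norm_finite_iff) (simp_all add: nn_integral_lebesgue_on)
    moreover have "(\<integral>\<^sup>+z. ennreal (cmod (of_real (cmod z powr (- real_of_int m)) * f z)) * indicator (cball 0 1) z \<partial>lborel)
      = (\<integral>\<^sup>+z. ennreal (spike z) * indicator (cball 0 1) z \<partial>lborel)"
    proof (rule nn_integral_cong)
      fix z
      have "cmod z powr 0 * spike z = spike z" by (cases "z = 0") (auto simp: spike_def punctured_disc_def)
      then show "ennreal (cmod (of_real (cmod z powr (- real_of_int m)) * f z)) * indicator (cball 0 1) z = ennreal (spike z) * indicator (cball 0 1) z"
        unfolding eq by (cases "z = 0") (simp_all add: spike_def punctured_disc_def)
    qed
    ultimately show False by (simp add: nn_integral_spike)
  qed
  ultimately show ?thesis by blast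
qed

lemma powi_measurable [measurable]: "(\<lambda>z::complex. z powi m) \<in> borel_measurable borel"
proof (cases "m \<ge> 0")
  case True
  then show ?thesis by (simp add: power_int_def)
next
  case False
  then show ?thesis by (simp add: power_int_def)
qed

lemma norm_powi: "z \<noteq> 0 \<Longrightarrow> cmod (z powi m) = cmod z powr real_of_int m"
  by (simp add: norm_power_int powr_real_of_int')

text \<open>Such a section is \<open>z\<^sup>m\<close> times a continuous function outside the origin, so its weighted modulus is
locally bounded by a multiple of \<open>|z|\<^sup>-\<^sup>t\<close>.\<close>

lemma ideal_sections_subset:
  assumes p: "1 \<le> p" and ok: "mod_weight_exponent p (\<sigma> - real_of_int m)" and U: "open U"
  shows "ideal_sections m U \<subseteq> wLp_loc p \<sigma> U"
proof
  fix f assume "f \<in> ideal_sections m U"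
  then obtain h where h: "h holomorphic_on U" "\<And>z. z \<in> U - {0} \<Longrightarrow> z powi (- m) * f z = h z"
    unfolding ideal_sections_def by blast
  define t where "t = \<sigma> - real_of_int m"
  have f_eq: "f z = (if z = 0 then f 0 else z powi m * h z)" if "z \<in> U" for z
    using h(2)[of z] that by (auto simp: power_int_minus field_simps)
  have ch: "continuous_on U h" using h(1) by (rule holomorphic_on_imp_continuous_on)
  have Us [measurable]: "U \<in> sets borel" using U by (rule borel_open)
  have hm: "h \<in> borel_measurable (lebesgue_on U)"
    by (rule continuous_imp_measurable_on_sets_lebesgue[OF ch]) (simp add: Us)
  have fm: "f \<in> borel_measurable (lebesgue_on U)"
  proof -
    have "(\<lambda>z. (indicator {0} z * f 0 + (1 - indicator {0} z) * z powi m * h z)) \<in> borel_measurable (lebesgue_on U)"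
      by (intro borel_measurable_add borel_measurable_times hm borel_measurable_lebesgue_on borel_measurable_diff) measurable
    then show ?thesis
      by (rule measurable_cong[THEN iffD1, rotated]) (use f_eq in \<open>auto split: split_indicator\<close>)
  qed
  have gm: "(\<lambda>z. complex_of_real (cmod z powr (- \<sigma>)) * f z) \<in> borel_measurable (lebesgue_on U)"
    by (intro borel_measurable_times fm borel_measurable_lebesgue_on) measurable
  have "Lp_norm p (lebesgue_on K) (\<lambda>z. of_real (cmod z powr (- \<sigma>)) * f z) < \<infinity>" if K: "compact K" "K \<subseteq> U" for K
  proof -
    have Kb [measurable]: "K \<in> sets borel" using K(1) by (rule borel_compact)
    obtain B where B: "B > 0" "\<And>z. z \<in> K \<Longrightarrow> cmod z \<le> B" using compact_imp_bounded[OF K(1)] unfolding bounded_pos by blast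
    have "bounded (h ` K)" using K ch by (intro compact_imp_bounded compact_continuous_image) (auto intro: continuous_on_subset)
    then obtain M where M: "M > 0" "\<And>z. z \<in> K \<Longrightarrow> cmod (h z) \<le> M" unfolding bounded_pos by blast
    have bd: "cmod (of_real (cmod z powr (- \<sigma>)) * f z) \<le> M * cmod z powr (- t)" if z: "z \<in> K" for z
    proof (cases "z = 0")
      case False
      have "cmod (of_real (cmod z powr (- \<sigma>)) * f z) = cmod z powr (- t) * cmod (h z)"
        using f_eq[of z] z K(2) False by (auto simp: norm_mult norm_powi t_def mult.assoc[symmetric] powr_add[symmetric])
      also have "\<dots> \<le> cmod z powr (- t) * M" by (intro mult_left_mono M(2) z) simp
      finally show ?thesis by (simp add: mult.commute)
    qed (use M in simp)
    show ?thesis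
    proof (cases "p = \<infinity>")
      case True
      then have t0: "t \<le> 0" using ok by (simp add: mod_weight_exponent_def t_def)
      have gK: "(\<lambda>z. complex_of_real (cmod z powr (- \<sigma>)) * f z) \<in> borel_measurable (lebesgue_on K)"
        using gm K(2) by (rule measurable_restrict_mono)
      have "AE z in lebesgue_on K. cmod (of_real (cmod z powr (- \<sigma>)) * f z) \<le> M * B powr (- t)"
      proof (rule AE_I2)
        fix z assume "z \<in> space (lebesgue_on K)"
        then have z: "z \<in> K" by simp
        have "cmod z powr (- t) \<le> B powr (- t)" using t0 B(2)[OF z] by (intro powr_mono2) auto
        then show "cmod (of_real (cmod z powr (- \<sigma>)) * f z) \<le> M * B powr (- t)"
          using bd[OF z] M(1) by (meson mult_left_mono order_trans less_imp_le)
      qed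
      then show ?thesis unfolding True using M(1) by (subst Lp_norm_infinite_finite_iff[OF gK]) (auto intro!: exI[of _ "M * B powr (- t)"])
    next
      case False
      let ?P = "enn2real p"
      have P: "?P \<ge> 1" by (rule enn2real_ge_1[OF p False])
      have "t * ?P < 2" using ok False by (simp add: mod_weight_exponent_def t_def)
      then have fin: "(\<integral>\<^sup>+z. ennreal (cmod z powr (- (t * ?P))) * indicator (cball 0 B) z \<partial>lborel) < \<infinity>"
        by (rule inverse_norm_powr_locally_integrable)
      have "(\<integral>\<^sup>+z. ennreal (cmod (of_real (cmod z powr (- \<sigma>)) * f z) powr ?P) * indicator K z \<partial>lborel) \<le>
        (\<integral>\<^sup>+z. ennreal (M powr ?P) * (ennreal (cmod z powr (- (t * ?P))) * indicator (cball 0 B) z) \<partial>lborel)"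
      proof (rule nn_integral_mono)
        fix z
        show "ennreal (cmod (of_real (cmod z powr (- \<sigma>)) * f z) powr ?P) * indicator K z \<le> ennreal (M powr ?P) * (ennreal (cmod z powr (- (t * ?P))) * indicator (cball 0 B) z)"
        proof (cases "z \<in> K")
          case True
          have "cmod (of_real (cmod z powr (- \<sigma>)) * f z) powr ?P \<le> (M * cmod z powr (- t)) powr ?P"
            using P by (intro powr_mono2 bd True) auto
          also have "\<dots> = M powr ?P * cmod z powr (- (t * ?P))" using M(1) by (simp add: powr_mult powr_powr)
          finally have "ennreal (cmod (of_real (cmod z powr (- \<sigma>)) * f z) powr ?P) \<le> ennreal (M powr ?P * cmod z powr (- (t * ?P)))" by (rule ennreal_leI)
          then show ?thesis using True B(2)[OF True] by (simp add: ennreal_mult)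
        qed simp
      qed
      also have "\<dots> = ennreal (M powr ?P) * (\<integral>\<^sup>+z. (ennreal (cmod z powr (- (t * ?P))) * indicator (cball 0 B) z) \<partial>lborel)"
        by (rule nn_integral_cmult) measurable
      also have "\<dots> < \<infinity>" using fin by (simp add: ennreal_mult_less_top)
      finally show ?thesis by (subst Lp_norm_finite_iff[OF False]) (simp add: nn_integral_lebesgue_on)
    qed
  qed
  then show "f \<in> wLp_loc p \<sigma> U" using fm gm by (simp add: wLp_loc_def Lp_loc_def)
qed

text \<open>The monomial \<open>z\<^sup>m\<close> itself is a counterexample, already on the unit disc.\<close>

lemma ideal_sections_not_subset:
  assumes p: "1 \<le> p" and ok: "\<not> mod_weight_exponent p (\<sigma> - real_of_int m)"
  shows "\<not> ideal_sections m UNIV \<subseteq> wLp_loc p \<sigma> UNIV"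
proof -
  define t where "t = \<sigma> - real_of_int m"
  let ?f = "\<lambda>z::complex. z powi m"
  have "?f \<in> ideal_sections m UNIV"
    unfolding ideal_sections_def
    by (auto intro!: meromorphic_intros exI[of _ "\<lambda>z. 1"] simp: power_int_minus)
  moreover have "?f \<notin> wLp_loc p \<sigma> UNIV"
  proof
    assume "?f \<in> wLp_loc p \<sigma> UNIV"
    then have fin: "Lp_norm p (lebesgue_on (cball 0 1)) (\<lambda>z. of_real (cmod z powr (- \<sigma>)) * ?f z) < \<infinity>"
      by (simp add: wLp_loc_def Lp_loc_def)
    have eq: "z \<noteq> 0 \<Longrightarrow> cmod (of_real (cmod z powr (- \<sigma>)) * ?f z) = cmod z powr (- t)" for z
      by (simp add: norm_mult norm_powi t_def powr_add[symmetric])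
    show False
    proof (cases "p = \<infinity>")
      case True
      then have t0: "t > 0" using ok by (simp add: mod_weight_exponent_def t_def)
      have gm: "(\<lambda>z. complex_of_real (cmod z powr (- \<sigma>)) * ?f z) \<in> borel_measurable (lebesgue_on (cball 0 1))"
        by (rule borel_measurable_lebesgue_on) measurable
      obtain c where c: "c \<ge> 0" "AE z in lebesgue_on (cball 0 1). cmod (of_real (cmod z powr (- \<sigma>)) * ?f z) \<le> c"
        using fin Lp_norm_infinite_finite_iff[OF gm] True by auto
      \<comment> \<open>Inside this radius \<open>|z|\<^sup>-\<^sup>t\<close> is at least \<open>c + 1\<close>.\<close>
      define r where "r = (c + 1) powr (- 1 / t)"
      have "(c + 1) powr (- 1 / t) \<le> (c + 1) powr 0" using c t0 by (intro powr_mono) auto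
      then have r: "0 < r" "r \<le> 1" using c(1) by (auto simp: r_def)
      have rt: "r powr (- t) = c + 1" using t0 c by (simp add: r_def powr_powr)
      have "AE z in lborel. z \<notin> cball (0::complex) r"
        using c(2)[unfolded AE_lebesgue_on_iff[OF borel_closed[OF closed_cball]]] AE_lborel_singleton[of 0]
      proof eventually_elim
        case (elim z)
        show ?case
        proof
          assume z: "z \<in> cball 0 r"
          then have "cmod z powr (- t) \<le> c" using elim r eq[of z] by auto
          moreover have "r powr (- t) \<le> cmod z powr (- t)" using z elim t0 by (intro powr_mono2') auto
          ultimately show False using rt by simp
        qed
      qed
      then have "emeasure lborel (cball (0::complex) r) = 0"
        by (subst (asm) AE_iff_measurable[of "cball 0 r"]) auto
      moreover have "unit_ball_vol 2 * r\<^sup>2 > 0" using r(1) unit_ball_vol_pos[of 2] by (intro mult_pos_pos) auto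
      ultimately show False using r by (simp add: emeasure_cball ennreal_eq_0_iff)
    next
      case False
      let ?P = "enn2real p"
      have "(\<integral>\<^sup>+z. ennreal (cmod (of_real (cmod z powr (- \<sigma>)) * ?f z) powr ?P) * indicator (cball 0 1) z \<partial>lborel)
        = (\<integral>\<^sup>+z. ennreal (cmod z powr (- (t * ?P))) * indicator (cball 0 1) z \<partial>lborel)"
      proof (rule nn_integral_cong_AE)
        show "AE z in lborel. ennreal (cmod (of_real (cmod z powr (- \<sigma>)) * ?f z) powr ?P) * indicator (cball 0 1) z =
          ennreal (cmod z powr (- (t * ?P))) * indicator (cball 0 1) z"
          using AE_lborel_singleton[of 0]
        proof eventually_elim
          case (elim z)
          then show ?case unfolding eq[OF elim] by (simp add: powr_powr)
        qed
      qed
      also have "\<dots> = \<infinity>" by (rule nn_integral_inverse_power_infinite) (use ok False in \<open>simp add: mod_weight_exponent_def t_def\<close>)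
      finally show False using fin by (subst (asm) Lp_norm_finite_iff[OF False]) (simp add: nn_integral_lebesgue_on)
    qed
  qed
  ultimately show ?thesis by blast
qed

text \<open>The least element of a set of integers is defined by a description; it exists here because the set
is nonempty and bounded below. The second claim restates minimality.\<close>

lemma int_threshold:
  fixes Q :: "real \<Rightarrow> bool"
  assumes down: "\<And>x y. Q y \<Longrightarrow> x \<le> y \<Longrightarrow> Q x" and ex: "\<exists>x. Q x" and nex: "\<exists>x. \<not> Q x"
  shows "Q (\<sigma> - real_of_int (LEAST m::int. Q (\<sigma> - real_of_int m)))"
    and "\<not> Q (\<sigma> - real_of_int (LEAST m::int. Q (\<sigma> - real_of_int m)) + 1)"
proof -
  obtain x where x: "Q x" using ex by blast
  obtain y where y: "\<not> Q y" using nex by blast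
  \<comment> \<open>The integers from \<open>\<lfloor>\<sigma> - y\<rfloor>\<close> upwards; at the first of them \<open>Q\<close> still fails.\<close>
  define f where "f n = \<lfloor>\<sigma> - y\<rfloor> + int n" for n
  have "\<exists>n. Q (\<sigma> - real_of_int (f n))"
  proof
    have "\<sigma> - real_of_int (f (nat (\<lceil>\<sigma> - x\<rceil> - \<lfloor>\<sigma> - y\<rfloor>))) \<le> x" unfolding f_def by linarith
    then show "Q (\<sigma> - real_of_int (f (nat (\<lceil>\<sigma> - x\<rceil> - \<lfloor>\<sigma> - y\<rfloor>))))" by (rule down[OF x])
  qed
  then obtain n where n: "Q (\<sigma> - real_of_int (f n))" "\<And>k. k < n \<Longrightarrow> \<not> Q (\<sigma> - real_of_int (f k))"
    using exists_least_iff[of "\<lambda>n. Q (\<sigma> - real_of_int (f n))"] by blast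
  have n0: "n \<noteq> 0"
  proof
    assume "n = 0"
    moreover have "y \<le> \<sigma> - real_of_int (f 0)" unfolding f_def by simp linarith
    ultimately show False using n(1) down y by blast
  qed
  have prev: "\<not> Q (\<sigma> - real_of_int (f n) + 1)"
  proof -
    have "real_of_int (f (n - 1)) = real_of_int (f n) - 1" using n0 by (simp add: f_def of_nat_diff)
    then have "\<sigma> - real_of_int (f n) + 1 = \<sigma> - real_of_int (f (n - 1))" by linarith
    moreover have "\<not> Q (\<sigma> - real_of_int (f (n - 1)))" using n0 by (intro n(2)) simp
    ultimately show ?thesis by (simp only: not_False_eq_True)
  qed
  have L: "(LEAST m::int. Q (\<sigma> - real_of_int m)) = f n"
  proof (rule Least_equality)
    show "Q (\<sigma> - real_of_int (f n))" by (rule n(1))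
    fix m assume m: "Q (\<sigma> - real_of_int m)"
    show "f n \<le> m"
    proof (rule ccontr)
      assume "\<not> f n \<le> m"
      then have "real_of_int m \<le> real_of_int (f n) - 1" by linarith
      then have "\<sigma> - real_of_int (f n) + 1 \<le> \<sigma> - real_of_int m" by linarith
      then show False using down[OF m] prev by blast
    qed
  qed
  show "Q (\<sigma> - real_of_int (LEAST m::int. Q (\<sigma> - real_of_int m)))"
    "\<not> Q (\<sigma> - real_of_int (LEAST m::int. Q (\<sigma> - real_of_int m)) + 1)"
    unfolding L using n(1) prev by auto
qed

lemma mod_dbar_weight_bounds:
  assumes p: "1 \<le> p"
  shows "mod_weight_exponent p (\<sigma> - real_of_int (mod_dbar_weight p \<sigma>))"
    and "\<not> mod_weight_exponent p (\<sigma> - real_of_int (mod_dbar_weight p \<sigma>) + 1)"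
proof -
  have "(\<forall>U. open U \<longrightarrow> ideal_sections m U \<subseteq> wLp_loc p \<sigma> U) \<longleftrightarrow> mod_weight_exponent p (\<sigma> - real_of_int m)" for m
    using ideal_sections_subset[OF p] ideal_sections_not_subset[OF p] by (meson open_UNIV)
  then have eq: "mod_dbar_weight p \<sigma> = (LEAST m::int. mod_weight_exponent p (\<sigma> - real_of_int m))"
    by (simp add: mod_dbar_weight_def)
  have down: "mod_weight_exponent p x" if "mod_weight_exponent p y" "x \<le> y" for x y
  proof (cases "p = \<infinity>")
    case False
    have "x * enn2real p \<le> y * enn2real p" using that(2) by (intro mult_right_mono) auto
    then show ?thesis using that False by (simp add: mod_weight_exponent_def)
  qed (use that in \<open>simp add: mod_weight_exponent_def\<close>)
  have "mod_weight_exponent p 0" by (simp add: mod_weight_exponent_def)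
  moreover have "\<not> mod_weight_exponent p 2" using enn2real_ge_1[OF p] by (auto simp: mod_weight_exponent_def)
  ultimately show "mod_weight_exponent p (\<sigma> - real_of_int (mod_dbar_weight p \<sigma>))"
    "\<not> mod_weight_exponent p (\<sigma> - real_of_int (mod_dbar_weight p \<sigma>) + 1)"
    unfolding eq using int_threshold[of "mod_weight_exponent p" \<sigma>] down by blast+
qed

text \<open>The greatest admissible integer is one less than the least inadmissible one, which brings the
statement under \<open>int_threshold\<close>.\<close>

lemma dbar_weight_bounds:
  assumes p: "1 \<le> p"
  shows "dbar_weight_exponent p (\<sigma> - real_of_int (dbar_weight p \<sigma>))"
    and "\<not> dbar_weight_exponent p (\<sigma> - real_of_int (dbar_weight p \<sigma>) - 1)"
proof -
  have eqv: "wLp_loc p \<sigma> UNIV \<subseteq> wLp_loc 1 (real_of_int m) UNIV \<longleftrightarrow> dbar_weight_exponent p (\<sigma> - real_of_int m)" for m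
    using wLp_loc_subset_L1[OF p] wLp_loc_not_subset_L1[OF p] by blast
  define Q where "Q x \<longleftrightarrow> \<not> dbar_weight_exponent p x" for x
  define m where "m = (LEAST m::int. Q (\<sigma> - real_of_int m))"
  have up: "dbar_weight_exponent p y" if "dbar_weight_exponent p x" "x \<le> y" for x y
    using that by (auto simp: dbar_weight_exponent_def split: if_splits)
  have ex: "dbar_weight_exponent p 2" using enn2real_gt_1[OF p] by (auto simp: dbar_weight_exponent_def field_simps)
  have nex: "\<not> dbar_weight_exponent p (-2)" using enn2real_ge_1[OF p] by (auto simp: dbar_weight_exponent_def field_simps)
  have t: "Q (\<sigma> - real_of_int m)" "\<not> Q (\<sigma> - real_of_int m + 1)"
    unfolding m_def using int_threshold[of Q \<sigma>] up ex nex unfolding Q_def by blast+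
  have g: "dbar_weight p \<sigma> = m - 1"
    unfolding dbar_weight_def eqv
  proof (rule Greatest_equality)
    show "dbar_weight_exponent p (\<sigma> - real_of_int (m - 1))" using t(2) by (simp add: Q_def algebra_simps)
    fix k assume k: "dbar_weight_exponent p (\<sigma> - real_of_int k)"
    show "k \<le> m - 1"
    proof (rule ccontr)
      assume "\<not> k \<le> m - 1"
      then have "\<sigma> - real_of_int k \<le> \<sigma> - real_of_int m" by linarith
      then show False using up[OF k] t(1) by (simp add: Q_def)
    qed
  qed
  show "dbar_weight_exponent p (\<sigma> - real_of_int (dbar_weight p \<sigma>))"
    "\<not> dbar_weight_exponent p (\<sigma> - real_of_int (dbar_weight p \<sigma>) - 1)"
    unfolding g using t by (simp_all add: Q_def algebra_simps)
qed

text \<open>The interval for \<open>\<sigma>\<close> minus the d-bar-weight lies to the left of the one for \<open>\<sigma>\<close> minus the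
modified weight: for finite \<open>p\<close> they meet at \<open>2/p - 1\<close>, for \<open>p = \<infinity>\<close> at \<open>-1\<close>.\<close>

lemma mod_le_dbar_weight:
  assumes p: "1 \<le> p" shows "mod_dbar_weight p \<sigma> \<le> dbar_weight p \<sigma>"
proof -
  define t where "t = \<sigma> - real_of_int (dbar_weight p \<sigma>)"
  define u where "u = \<sigma> - real_of_int (mod_dbar_weight p \<sigma>)"
  have t: "\<not> dbar_weight_exponent p (t - 1)" unfolding t_def by (rule dbar_weight_bounds[OF p])
  have u: "\<not> mod_weight_exponent p (u + 1)" unfolding u_def by (rule mod_dbar_weight_bounds[OF p])
  have "t \<le> u"
  proof (cases "p = \<infinity>")
    case True then show ?thesis using t u by (simp add: dbar_weight_exponent_def mod_weight_exponent_def)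
  next
    case False
    let ?P = "enn2real p"
    have P: "?P \<ge> 1" by (rule enn2real_ge_1[OF p False])
    have "u + 1 \<ge> 2 / ?P" using u False P by (simp add: mod_weight_exponent_def field_simps)
    moreover have "t - 1 \<le> 2 / ?P - 2" using t False by (auto simp: dbar_weight_exponent_def split: if_splits)
    ultimately show ?thesis by simp
  qed
  then show ?thesis by (simp add: t_def u_def)
qed

section \<open>Admissible exponents for the two weights\<close>

lemma admissible_finiteI:
  assumes "p \<noteq> \<infinity>" "\<alpha> < 2" "0 \<le> \<beta>" "\<beta> \<le> 1" "\<beta> > \<alpha> - 1"
    "\<tau> * enn2real p + \<beta> * (enn2real p - 1) < 2" "0 \<le> \<gamma>" "\<gamma> \<le> 1"
    "\<gamma> > \<tau> * enn2real p + \<beta> * (enn2real p - 1) - 1"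
    "\<gamma> \<le> \<sigma> * enn2real p + \<alpha> * (enn2real p - 1)"
  shows "admissible p \<sigma> \<tau>"
  unfolding admissible_def Let_def if_not_P[OF assms(1)] using assms(2-) by blast

lemma admissible_antimono: "admissible p \<sigma> \<tau> \<Longrightarrow> \<tau>' \<le> \<tau> \<Longrightarrow> 1 \<le> p \<Longrightarrow> admissible p \<sigma> \<tau>'"
proof (cases "p = \<infinity>")
  case False
  assume a: "admissible p \<sigma> \<tau>" "\<tau>' \<le> \<tau>" "1 \<le> p"
  let ?P = "enn2real p"
  have "\<tau>' * ?P \<le> \<tau> * ?P" using a by (intro mult_right_mono) auto
  moreover obtain \<alpha> \<beta> \<gamma> where "\<alpha> < 2" "0 \<le> \<beta>" "\<beta> \<le> 1" "\<beta> > \<alpha> - 1"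
       "\<tau> * ?P + \<beta> * (?P - 1) < 2" "0 \<le> \<gamma>" "\<gamma> \<le> 1" "\<gamma> > \<tau> * ?P + \<beta> * (?P - 1) - 1"
       "\<gamma> \<le> \<sigma> * ?P + \<alpha> * (?P - 1)"
    using a(1) False unfolding admissible_def Let_def by auto
  ultimately show ?thesis
    by (intro admissible_finiteI[OF False, of \<alpha> \<beta> _ \<gamma>]) auto
qed (force simp: admissible_def)

text \<open>For \<open>t \<ge> 0\<close> the first use of the kernel bound can do without powers, \<open>\<alpha> = \<beta> = 0\<close>. For
negative \<open>t\<close> choose \<open>\<alpha>\<close> so that the accumulated weight in \<open>y\<close> is exactly trivial; the lower
bound on \<open>t\<close> gives \<open>\<alpha> < 1\<close>.\<close>

lemma admissible_mod:
  assumes p: "1 \<le> p" and t: "mod_weight_exponent p t" "\<not> mod_weight_exponent p (t + 1)"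
  shows "admissible p t t"
proof (cases "p = \<infinity>")
  case True
  then show ?thesis using t by (auto simp: admissible_def mod_weight_exponent_def intro!: exI[of _ "- t"])
next
  case False
  let ?P = "enn2real p"
  have P: "?P \<ge> 1" by (rule enn2real_ge_1[OF p False])
  have t2: "t * ?P < 2" "t * ?P + ?P \<ge> 2" using t False by (auto simp: mod_weight_exponent_def algebra_simps)
  have "\<exists>\<alpha> \<beta> \<gamma>. \<alpha> < 2 \<and> 0 \<le> \<beta> \<and> \<beta> \<le> 1 \<and> \<beta> > \<alpha> - 1 \<and>
       t * ?P + \<beta> * (?P - 1) < 2 \<and> 0 \<le> \<gamma> \<and> \<gamma> \<le> 1 \<and> \<gamma> > t * ?P + \<beta> * (?P - 1) - 1 \<and>
       \<gamma> \<le> t * ?P + \<alpha> * (?P - 1)"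
  proof (cases "t \<ge> 0")
    case True
    then have "t * ?P \<ge> 0" by simp
    then show ?thesis using t2 by (intro exI[of _ 0] exI[of _ "min 1 (t * ?P)"]) auto
  next
    case tn: False
    then have P1: "?P > 1" using t2 P by (cases "?P = 1") auto
    define \<alpha> where "\<alpha> = - t * ?P / (?P - 1)"
    have "x / y * y = x" if "y \<noteq> 0" for x y :: real using that by simp
    from this[of "?P - 1"] have a: "\<alpha> * (?P - 1) = - t * ?P" unfolding \<alpha>_def using P1 by auto
    have "\<alpha> < 1" using t2 P1 by (simp add: \<alpha>_def field_simps)
    moreover have "t * ?P < 0" using tn P by (simp add: mult_neg_pos)
    ultimately show ?thesis using a by (intro exI[of _ \<alpha>] exI[of _ 0]) auto
  qed
  then show ?thesis using False by (simp add: admissible_def Let_def)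
qed

text \<open>It suffices to gain \<open>1 - e\<close> for small \<open>e\<close>, since admissibility is inherited by smaller target
exponents. Both applications of the kernel bound then hold with margin \<open>e\<close>.\<close>

lemma admissible_dbar:
  assumes p: "1 \<le> p" and t: "dbar_weight_exponent p t" "\<not> dbar_weight_exponent p (t - 1)" and \<epsilon>: "\<epsilon> > 0"
  shows "admissible p t (t + 1 - \<epsilon>)"
proof (cases "p = \<infinity>")
  case True
  define e where "e = min \<epsilon> (t + 2)"
  have t2: "t > -2" "t \<le> -1" using t True by (auto simp: dbar_weight_exponent_def)
  have "admissible p t (t + 1 - e)"
    using t2 \<epsilon> True by (auto simp: admissible_def e_def intro!: exI[of _ "- (t + 1 - e)"])
  then show ?thesis by (rule admissible_antimono) (use p in \<open>auto simp: e_def\<close>)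
next
  case False
  let ?P = "enn2real p"
  have P: "?P \<ge> 1" by (rule enn2real_ge_1[OF p False])
  show ?thesis
  proof (cases "p = 1")
    case True
    define e where "e = min \<epsilon> 1"
    have e: "0 < e" "e \<le> 1" "e \<le> \<epsilon>" using \<epsilon> by (auto simp: e_def)
    have "0 \<le> t" "t < 1" using t True by (auto simp: dbar_weight_exponent_def)
    then have "admissible p t (t + 1 - e)" using True e
      by (auto simp: admissible_def Let_def intro!: exI[of _ 0] exI[of _ t])
    then show ?thesis by (rule admissible_antimono) (use p e in auto)
  next
    case p1: False
    have P1: "?P > 1" by (rule enn2real_gt_1[OF p False p1])
    define b where "b = - t * ?P / (?P - 1)"
    define e where "e = min \<epsilon> (min (1/2) (2 - b))"
    have t2: "t > 2 / ?P - 2" "t \<le> 2 / ?P - 1" using t False p1 by (auto simp: dbar_weight_exponent_def)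
    have t3: "t * ?P > 2 - 2 * ?P" "t * ?P \<le> 2 - ?P" using t2 P1 by (auto simp: field_simps)
    have b2: "b < 2" using t3 P1 by (simp add: b_def field_simps)
    have e: "0 < e" "e \<le> 1/2" "e \<le> \<epsilon>" "e \<le> 2 - b" using \<epsilon> b2 unfolding e_def by linarith+
    \<comment> \<open>With \<open>\<alpha> = b\<close> the exponent \<open>\<gamma>\<close> below is zero, so \<open>\<alpha> \<ge> b\<close> gives \<open>\<gamma> \<ge> 0\<close>; and \<open>\<alpha> \<ge> 1 - e\<close> gives \<open>\<beta> \<ge> 0\<close>.\<close>
    define \<alpha> where "\<alpha> = max (1 - e) b"
    define \<gamma> where "\<gamma> = t * ?P + \<alpha> * (?P - 1)"
    have "x / y * y = x" if "y \<noteq> 0" for x y :: real using that by simp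
    from this[of "?P - 1"] have tb: "b * (?P - 1) = - t * ?P" unfolding b_def using P1 by auto
    have al: "1 - e \<le> \<alpha>" "b \<le> \<alpha>" "\<alpha> \<le> 2 - e" using e by (auto simp: \<alpha>_def)
    have g0: "\<gamma> \<ge> 0"
    proof -
      have "b * (?P - 1) \<le> \<alpha> * (?P - 1)" using al P1 by (intro mult_right_mono) auto
      then show ?thesis using tb by (simp add: \<gamma>_def)
    qed
    have g1: "\<gamma> \<le> 1"
    proof (cases "\<alpha> = b")
      case True then show ?thesis using tb by (simp add: \<gamma>_def)
    next
      case False
      then have "\<alpha> = 1 - e" by (auto simp: \<alpha>_def max_def split: if_splits)
      then have "\<alpha> * (?P - 1) \<le> 1 * (?P - 1)" using e P1 by (intro mult_right_mono) auto
      then show ?thesis using t3 by (simp add: \<gamma>_def)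
    qed
    \<comment> \<open>This \<open>\<beta>\<close> exceeds \<open>\<alpha> - 1\<close> by \<open>e\<close>, and \<open>\<gamma>\<close> exceeds \<open>\<delta> - 1\<close> by the same amount.\<close>
    define \<beta> where "\<beta> = \<alpha> - 1 + e"
    have \<delta>: "(t + 1 - e) * ?P + \<beta> * (?P - 1) = \<gamma> + 1 - e"
      by (simp add: \<gamma>_def \<beta>_def algebra_simps)
    have "admissible p t (t + 1 - e)"
    proof (rule admissible_finiteI[OF False, of \<alpha> \<beta> _ \<gamma>])
      show "0 \<le> \<beta>" "\<beta> \<le> 1" "\<beta> > \<alpha> - 1" "\<alpha> < 2" using al e by (auto simp: \<beta>_def)
      show "\<gamma> \<le> t * ?P + \<alpha> * (?P - 1)" by (simp add: \<gamma>_def)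
      show "(t + 1 - e) * ?P + \<beta> * (?P - 1) < 2" "\<gamma> > (t + 1 - e) * ?P + \<beta> * (?P - 1) - 1"
        unfolding \<delta> using e g1 by auto
    qed (use g0 g1 in auto)
    then show ?thesis by (rule admissible_antimono) (use p e in auto)
  qed
qed

section \<open>Monomials and Lebesgue measurable forms\<close>

lemma monomial_component_holomorphic:
  "Ck k (\<lambda>w::complex. w ^ n)" "dbar1 (\<lambda>w. w ^ n) w = 0"
proof -
  show "Ck k (\<lambda>w::complex. w ^ n)"
    by (induction n) (simp_all add: Ck_const Ck_mult[OF Ck_bounded_linear[OF bounded_linear_ident]])
  have "((\<lambda>w::complex. w ^ n) has_field_derivative of_nat n * w ^ (n - 1)) (at w)"
    by (auto intro!: derivative_eq_intros)
  then have "((\<lambda>w::complex. w ^ n) has_derivative (\<lambda>v. (of_nat n * w ^ (n - 1)) * v)) (at w)"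
    by (simp add: has_field_derivative_def)
  from frechet_derivative_at[OF this]
  have "frechet_derivative (\<lambda>w::complex. w ^ n) (at w) = (\<lambda>v. (of_nat n * w ^ (n - 1)) * v)" by simp
  then show "dbar1 (\<lambda>w. w ^ n) w = 0" by (simp add: dbar1_def algebra_simps)
qed

lemma mono_pow_holomorphic:
  fixes m :: "int^'n::finite"
  assumes m: "\<And>i. 0 \<le> m $ i"
  shows "Ck k (mono_pow m)" "wirtinger_bar i (mono_pow m) z = 0"
proof -
  have eq: "(z $ j) powi (m $ j) = (z $ j) ^ nat (m $ j)" for z :: "complex^'n" and j
    using m[of j] by (simp add: power_int_def)
  define f where "f A z = (\<Prod>j\<in>A. (z $ j) ^ nat (m $ j))" for A and z :: "complex^'n"
  have mf: "mono_pow m = f UNIV" by (simp add: fun_eq_iff mono_pow_def f_def eq)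
  have C1: "Ck k (\<lambda>z::complex^'n. (z $ j) ^ n)" for k j n
    by (rule Ck_component[OF monomial_component_holomorphic(1)])
  have Cf: "Ck k (f A)" for k A unfolding f_def[abs_def] by (intro Ck_prod C1)
  show "Ck k (mono_pow m)" unfolding mf by (rule Cf)
  have "wirtinger_bar i (f A) z = 0" if "finite A" for A
    using that
  proof (induction A rule: finite_induct)
    case empty
    have "wirtinger_bar i (\<lambda>z::complex^'n. 1) z = 0"
      using frechet_derivative_const[of "1::complex" z] by (simp add: wirtinger_bar_def)
    then show ?case by (simp add: f_def[abs_def])
  next
    case (insert j A)
    have fi: "f (insert j A) = (\<lambda>z. (z $ j) ^ nat (m $ j) * f A z)"
      using insert.hyps by (simp add: f_def fun_eq_iff)
    have "wirtinger_bar i (\<lambda>z::complex^'n. (z $ j) ^ nat (m $ j)) z = 0"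
      using wirtinger_bar_component[OF monomial_component_holomorphic(1)[of "Suc 0" "nat (m $ j)"], where i=i and j=j and z=z]
      by (simp add: monomial_component_holomorphic(2))
    moreover have "(\<lambda>z::complex^'n. (z $ j) ^ nat (m $ j)) differentiable (at z)" "f A differentiable (at z)"
      using C1[of "Suc 0" j "nat (m $ j)"] Cf[of "Suc 0" A] by auto
    ultimately show ?case unfolding fi by (subst wirtinger_bar_mult) (simp_all add: insert.IH)
  qed
  then show "wirtinger_bar i (mono_pow m) z = 0" unfolding mf by simp
qed

lemma mono_pow_measurable [measurable]: "mono_pow c \<in> borel_measurable borel"
proof -
  have "(\<lambda>z::complex^'a. (z $ j) powi (c $ j)) \<in> borel_measurable borel" for j
    by (rule measurable_compose[OF component_measurable powi_measurable])
  then show ?thesis unfolding mono_pow_def[abs_def] by measurable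
qed

lemma abs_pow_measurable [measurable]: "abs_pow s \<in> borel_measurable borel"
  unfolding abs_pow_def[abs_def] by measurable

lemma mono_pow_add:
  fixes z :: "complex^'n::finite"
  assumes "\<And>i. z $ i \<noteq> 0" shows "mono_pow (a + b) z = mono_pow a z * mono_pow b z"
  using assms by (simp add: mono_pow_def power_int_add prod.distrib)

lemma mono_pow_0 [simp]: "mono_pow 0 z = 1" by (simp add: mono_pow_def)

text \<open>Off the coordinate hyperplanes, multiplying a form by \<open>z\<^sup>c\<close> shifts the weight exponent from \<open>s\<close> to
\<open>s - c\<close>. This converts the weighted problem with twist \<open>c\<close> to one for d-bar itself.\<close>

lemma norm_abs_pow_mono_pow:
  fixes z :: "complex^'n::finite"
  assumes z: "\<And>i. z $ i \<noteq> 0"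
  shows "cmod (abs_pow (- s) z * (mono_pow c z * w)) = weight (\<lambda>i. s $ i - real_of_int (c $ i)) z * cmod w"
proof -
  have "cmod (abs_pow (- s) z) = (\<Prod>i\<in>UNIV. cmod (z $ i) powr (- (s $ i)))"
    by (simp add: abs_pow_def abs_prod del: of_real_prod)
  moreover have "cmod (mono_pow c z) = (\<Prod>i\<in>UNIV. cmod (z $ i) powr real_of_int (c $ i))"
    using z by (simp add: mono_pow_def prod_norm[symmetric] norm_powi)
  moreover have "cmod (z $ i) powr (- (s $ i)) * cmod (z $ i) powr real_of_int (c $ i) = cmod (z $ i) powr (- (s $ i - real_of_int (c $ i)))" for i
    by (simp add: powr_add[symmetric])
  ultimately show ?thesis
    by (simp add: norm_mult weight_def prod.distrib[symmetric] mult.assoc[symmetric])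
qed

text \<open>A monomial with nonnegative exponents is smooth and annihilated by all z-bar-derivatives, so it may be
moved into the test function.\<close>

lemma weak_dbar_mono_pow:
  fixes m :: "int^'n::{finite,linorder}"
  assumes m: "\<And>i. 0 \<le> m $ i" and d: "weak_dbar \<Omega> q f h"
  shows "weak_dbar \<Omega> q (fmult (mono_pow m) f) (fmult (mono_pow m) h)"
  unfolding weak_dbar_def fmult_def
proof (intro allI impI, elim conjE)
  fix J :: "'n set" and \<phi> :: "complex^'n::{finite,linorder} \<Rightarrow> complex"
  assume J: "card J = Suc q" and \<phi>: "test_function \<Omega> \<phi>"
  let ?\<psi> = "\<lambda>z. mono_pow m z * \<phi> z"
  obtain K where K: "compact K" "K \<subseteq> \<Omega>" "\<And>x. x \<notin> K \<Longrightarrow> \<phi> x = 0"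
    using test_function_compact_support[OF \<phi>] by blast
  have C\<phi>: "Ck k \<phi>" for k using \<phi> by (simp add: test_function_def)
  have \<psi>: "test_function \<Omega> ?\<psi>"
    by (rule test_functionI[OF Ck_mult[OF mono_pow_holomorphic(1)[OF m] C\<phi>] K(1,2)]) (simp add: K(3))
  have W: "wirtinger_bar i ?\<psi> z = mono_pow m z * wirtinger_bar i \<phi> z" for i z
    using mono_pow_holomorphic(1)[OF m, of "Suc 0"] C\<phi>[of "Suc 0"]
    by (subst wirtinger_bar_mult) (simp_all add: mono_pow_holomorphic(2)[OF m])
  have "(\<integral>z. h J z * ?\<psi> z \<partial>lborel) = - (\<Sum>j\<in>J. (-1) ^ card {i\<in>J. i < j} * (\<integral>z. f (J - {j}) z * wirtinger_bar j ?\<psi> z \<partial>lborel))"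
    using d J \<psi> unfolding weak_dbar_def by blast
  then show "(\<integral>z. mono_pow m z * h J z * \<phi> z \<partial>lborel) = - (\<Sum>j\<in>J. (-1) ^ card {i\<in>J. i < j} * (\<integral>z. mono_pow m z * f (J - {j}) z * wirtinger_bar j \<phi> z \<partial>lborel))"
    unfolding W by (simp only: mult_ac)
qed

lemma loc_int_mult_continuous:
  fixes u a :: "'a::euclidean_space \<Rightarrow> complex"
  assumes [measurable]: "u \<in> borel_measurable borel" and a: "continuous_on UNIV a" and u: "loc_int \<Omega> u"
  shows "loc_int \<Omega> (\<lambda>z. a z * u z)"
  unfolding loc_int_def
proof (intro allI impI, elim conjE)
  fix K assume K: "compact K" "K \<subseteq> \<Omega>"
  have [measurable]: "K \<in> sets borel" using K(1) by (rule borel_compact)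
  have "bounded (a ` K)" using K(1) a by (intro compact_imp_bounded compact_continuous_image) (auto intro: continuous_on_subset)
  then obtain M where M: "M > 0" "\<And>z. z \<in> K \<Longrightarrow> cmod (a z) \<le> M" unfolding bounded_pos by blast
  have "(\<integral>\<^sup>+x. ennreal (cmod (a x * u x)) * indicator K x \<partial>lborel) \<le> (\<integral>\<^sup>+x. ennreal M * (ennreal (cmod (u x)) * indicator K x) \<partial>lborel)"
  proof (rule nn_integral_mono)
    fix x
    show "ennreal (cmod (a x * u x)) * indicator K x \<le> ennreal M * (ennreal (cmod (u x)) * indicator K x)"
    proof (cases "x \<in> K")
      case True
      have "cmod (a x * u x) \<le> M * cmod (u x)" unfolding norm_mult by (intro mult_right_mono M(2) True) simp
      then show ?thesis using True M(1) by (simp add: ennreal_mult[symmetric] ennreal_leI)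
    qed simp
  qed
  also have "\<dots> = ennreal M * (\<integral>\<^sup>+x. (ennreal (cmod (u x)) * indicator K x) \<partial>lborel)" by (rule nn_integral_cmult) measurable
  also have "\<dots> < \<infinity>" using u K by (auto simp: loc_int_def ennreal_mult_less_top)
  finally show "(\<integral>\<^sup>+x. ennreal (cmod (a x * u x)) * indicator K x \<partial>lborel) < \<infinity>" .
qed

lemma Lp_loc_1_iff_loc_int:
  fixes f g :: "'a::euclidean_space \<Rightarrow> complex"
  assumes \<Omega>: "\<Omega> \<in> sets borel" and f: "f \<in> borel_measurable (lebesgue_on \<Omega>)"
    and ae: "AE z in lborel. z \<in> \<Omega> \<longrightarrow> f z = g z"
  shows "f \<in> Lp_loc 1 \<Omega> \<longleftrightarrow> loc_int \<Omega> g"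
proof -
  have "Lp_norm 1 (lebesgue_on K) f < \<infinity> \<longleftrightarrow> (\<integral>\<^sup>+x. ennreal (cmod (g x)) * indicator K x \<partial>lborel) < \<infinity>"
    if K: "compact K" "K \<subseteq> \<Omega>" for K
  proof -
    have Kb: "K \<in> sets borel" using K(1) by (rule borel_compact)
    have "(\<integral>\<^sup>+x. ennreal (cmod (f x) powr enn2real 1) \<partial>lebesgue_on K) = (\<integral>\<^sup>+x. ennreal (cmod (g x)) * indicator K x \<partial>lborel)"
      unfolding nn_integral_lebesgue_on[OF Kb]
    proof (rule nn_integral_cong_AE)
      show "AE x in lborel. ennreal (cmod (f x) powr enn2real 1) * indicator K x = ennreal (cmod (g x)) * indicator K x"
        using ae by eventually_elim (use K(2) in \<open>auto split: split_indicator\<close>)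
    qed
    then show ?thesis by (subst Lp_norm_finite_iff) simp_all
  qed
  then show ?thesis using f unfolding Lp_loc_def loc_int_def by auto
qed

lemma integral_lebesgue_on_eq:
  fixes f g \<psi> :: "'a::euclidean_space \<Rightarrow> complex"
  assumes \<Omega>: "\<Omega> \<in> sets borel" and f: "f \<in> borel_measurable (lebesgue_on \<Omega>)"
    and g: "g \<in> borel_measurable borel" and \<psi>: "\<psi> \<in> borel_measurable borel"
    and ae: "AE z in lborel. z \<in> \<Omega> \<longrightarrow> f z = g z" and 0: "\<And>z. z \<notin> \<Omega> \<Longrightarrow> \<psi> z = 0"
  shows "(\<integral>z. f z * \<psi> z \<partial>lebesgue_on \<Omega>) = (\<integral>z. g z * \<psi> z \<partial>lborel)"
proof -
  note [measurable] = g \<psi>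
  have "(\<integral>z. f z * \<psi> z \<partial>lebesgue_on \<Omega>) = (\<integral>z. g z * \<psi> z \<partial>lebesgue_on \<Omega>)"
  proof (rule integral_cong_AE)
    show "(\<lambda>z. f z * \<psi> z) \<in> borel_measurable (lebesgue_on \<Omega>)"
      by (intro borel_measurable_times f borel_measurable_lebesgue_on \<psi>)
    show "(\<lambda>z. g z * \<psi> z) \<in> borel_measurable (lebesgue_on \<Omega>)"
      by (rule borel_measurable_lebesgue_on) measurable
    show "AE z in lebesgue_on \<Omega>. f z * \<psi> z = g z * \<psi> z"
      unfolding AE_lebesgue_on_iff[OF \<Omega>] using ae by eventually_elim simp
  qed
  also have "\<dots> = (\<integral>z. indicator \<Omega> z *\<^sub>R (g z * \<psi> z) \<partial>lebesgue)"
    by (rule integral_restrict_space) (use \<Omega> in simp)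
  also have "(\<lambda>z. indicator \<Omega> z *\<^sub>R (g z * \<psi> z)) = (\<lambda>z. g z * \<psi> z)"
    using 0 by (auto simp: fun_eq_iff split: split_indicator)
  also have "(\<integral>z. g z * \<psi> z \<partial>lebesgue) = (\<integral>z. g z * \<psi> z \<partial>lborel)"
    by (rule integral_completion) measurable
  finally show ?thesis .
qed

text \<open>The distributional equation only depends on the forms up to null sets, so Lebesgue measurable
coefficients may be exchanged for Borel measurable ones defined everywhere.\<close>

lemma has_dbar_iff_weak_dbar:
  fixes f g f0 g0 :: "'n::{finite,linorder} form"
  assumes \<Omega>: "\<Omega> \<in> sets borel"
    and f: "\<And>I. card I = q \<Longrightarrow> f I \<in> borel_measurable (lebesgue_on \<Omega>)" "\<And>I. f0 I \<in> borel_measurable borel"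
      "\<And>I. card I = q \<Longrightarrow> AE z in lborel. z \<in> \<Omega> \<longrightarrow> f I z = f0 I z"
    and g: "\<And>I. card I = Suc q \<Longrightarrow> g I \<in> borel_measurable (lebesgue_on \<Omega>)" "\<And>I. g0 I \<in> borel_measurable borel"
      "\<And>I. card I = Suc q \<Longrightarrow> AE z in lborel. z \<in> \<Omega> \<longrightarrow> g I z = g0 I z"
  shows "has_dbar \<Omega> q f g \<longleftrightarrow> (\<forall>I. card I = q \<longrightarrow> loc_int \<Omega> (f0 I)) \<and>
    (\<forall>I. card I = Suc q \<longrightarrow> loc_int \<Omega> (g0 I)) \<and> weak_dbar \<Omega> q f0 g0"
proof -
  have 1: "f \<in> form_L1_loc q \<Omega> \<longleftrightarrow> (\<forall>I. card I = q \<longrightarrow> loc_int \<Omega> (f0 I))"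
    using Lp_loc_1_iff_loc_int[OF \<Omega> f(1) f(3)] by (auto simp: form_L1_loc_def)
  have 2: "g \<in> form_L1_loc (Suc q) \<Omega> \<longleftrightarrow> (\<forall>I. card I = Suc q \<longrightarrow> loc_int \<Omega> (g0 I))"
    using Lp_loc_1_iff_loc_int[OF \<Omega> g(1) g(3)] by (auto simp: form_L1_loc_def)
  have 3: "(\<integral>z. g J z * \<phi> z \<partial>lebesgue_on \<Omega>) = (\<integral>z. g0 J z * \<phi> z \<partial>lborel)"
    "j \<in> J \<Longrightarrow> (\<integral>z. f (J - {j}) z * wirtinger_bar j \<phi> z \<partial>lebesgue_on \<Omega>) = (\<integral>z. f0 (J - {j}) z * wirtinger_bar j \<phi> z \<partial>lborel)"
    if J: "card J = Suc q" and \<phi>: "test_function \<Omega> \<phi>" for J \<phi> j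
  proof -
    obtain K where K: "compact K" "K \<subseteq> \<Omega>" "\<And>x. x \<notin> K \<Longrightarrow> \<phi> x = 0"
      using test_function_compact_support[OF \<phi>] by blast
    have C\<phi>: "Ck k \<phi>" for k using \<phi> by (simp add: test_function_def)
    have W0: "x \<notin> K \<Longrightarrow> wirtinger_bar i \<phi> x = 0" for i x
      by (rule wirtinger_bar_zero_outside[OF compact_imp_closed[OF K(1)] K(3)])
    show "(\<integral>z. g J z * \<phi> z \<partial>lebesgue_on \<Omega>) = (\<integral>z. g0 J z * \<phi> z \<partial>lborel)"
      by (rule integral_lebesgue_on_eq[OF \<Omega> g(1)[OF J] g(2) borel_measurable_continuous_onI[OF Ck_continuous[OF C\<phi>]] g(3)[OF J]])
         (use K in blast)
    assume "j \<in> J"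
    then have c: "card (J - {j}) = q" using J by simp
    show "(\<integral>z. f (J - {j}) z * wirtinger_bar j \<phi> z \<partial>lebesgue_on \<Omega>) = (\<integral>z. f0 (J - {j}) z * wirtinger_bar j \<phi> z \<partial>lborel)"
      by (rule integral_lebesgue_on_eq[OF \<Omega> f(1)[OF c] f(2) borel_measurable_continuous_onI[OF wirtinger_bar_continuous[OF C\<phi>]] f(3)[OF c]])
         (use K(2) W0 in blast)
  qed
  have "(\<forall>J \<phi>. card J = Suc q \<and> test_function \<Omega> \<phi> \<longrightarrow>
        (\<integral>z. g J z * \<phi> z \<partial>lebesgue_on \<Omega>) =
        - (\<Sum>j\<in>J. (-1) ^ card {i\<in>J. i < j} * (\<integral>z. f (J - {j}) z * wirtinger_bar j \<phi> z \<partial>lebesgue_on \<Omega>)))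
     \<longleftrightarrow> weak_dbar \<Omega> q f0 g0"
    unfolding weak_dbar_def by (intro all_cong1 imp_cong refl) (simp add: 3 cong: sum.cong)
  then show ?thesis unfolding has_dbar_def 1 2 by blast
qed

lemma ex_borel_version:
  fixes f :: "'a::euclidean_space \<Rightarrow> complex"
  assumes \<Omega>: "\<Omega> \<in> sets borel" and f: "f \<in> borel_measurable (lebesgue_on \<Omega>)"
  shows "\<exists>g\<in>borel_measurable borel. AE z in lborel. z \<in> \<Omega> \<longrightarrow> f z = g z"
proof -
  have h: "(\<lambda>z. indicator \<Omega> z *\<^sub>R f z) \<in> borel_measurable lebesgue"
    using f by (subst (asm) borel_measurable_restrict_space_iff) (use \<Omega> in auto)
  have ri: "(\<lambda>z. Re (indicator \<Omega> z *\<^sub>R f z)) \<in> borel_measurable lebesgue" "(\<lambda>z. Im (indicator \<Omega> z *\<^sub>R f z)) \<in> borel_measurable lebesgue"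
    by (intro measurable_compose[OF h] borel_measurable_continuous_onI continuous_intros)+
  obtain a where a: "a \<in> borel_measurable lborel" "AE z in lborel. Re (indicator \<Omega> z *\<^sub>R f z) = a z"
    using completion_ex_borel_measurable_real[OF ri(1)] by blast
  obtain b where b: "b \<in> borel_measurable lborel" "AE z in lborel. Im (indicator \<Omega> z *\<^sub>R f z) = b z"
    using completion_ex_borel_measurable_real[OF ri(2)] by blast
  note ab = a b
  have "AE z in lborel. z \<in> \<Omega> \<longrightarrow> f z = Complex (a z) (b z)"
    using ab(2,4) by eventually_elim (auto simp: complex_eq_iff)
  moreover have "(\<lambda>z. Complex (a z) (b z)) \<in> borel_measurable borel"
  proof -
    have [measurable]: "a \<in> borel_measurable borel" "b \<in> borel_measurable borel" using ab by simp_all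
    have "(\<lambda>z. complex_of_real (a z) + \<i> * complex_of_real (b z)) \<in> borel_measurable borel" by measurable
    then show ?thesis by (simp add: Complex_eq)
  qed
  ultimately show ?thesis by (intro bexI[of _ "\<lambda>z. Complex (a z) (b z)"])
qed

text \<open>A choice of Borel representatives of the coefficients. Coefficients of the wrong degree are set to
zero so that all members of the family are Borel functions.\<close>

definition borel_version :: "(complex^'n::finite) set \<Rightarrow> nat \<Rightarrow> 'n form \<Rightarrow> 'n form" where
  "borel_version \<Omega> q f I = (if card I = q
     then SOME g. g \<in> borel_measurable borel \<and> (AE z in lborel. z \<in> \<Omega> \<longrightarrow> f I z = g z)
     else (\<lambda>z. 0))"

lemma borel_version:
  assumes \<Omega>: "\<Omega> \<in> sets borel" and f: "measurable_form q \<Omega> f"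
  shows "borel_version \<Omega> q f I \<in> borel_measurable borel"
    and "card I = q \<Longrightarrow> AE z in lborel. z \<in> \<Omega> \<longrightarrow> f I z = borel_version \<Omega> q f I z"
proof -
  have ex: "\<exists>g. g \<in> borel_measurable borel \<and> (AE z in lborel. z \<in> \<Omega> \<longrightarrow> f I z = g z)" if "card I = q"
    using ex_borel_version[OF \<Omega>, of "f I"] f that unfolding measurable_form_def by blast
  show "borel_version \<Omega> q f I \<in> borel_measurable borel"
    using someI_ex[OF ex] by (auto simp: borel_version_def)
  show "card I = q \<Longrightarrow> AE z in lborel. z \<in> \<Omega> \<longrightarrow> f I z = borel_version \<Omega> q f I z"
    using someI_ex[OF ex] by (simp add: borel_version_def)
qed

lemma Lp_le_lebesgue_on:
  assumes \<Omega>: "\<Omega> \<in> sets borel" and p: "1 \<le> p" and A: "A \<ge> 0"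
  shows "Lp_le p (lebesgue_on \<Omega>) f A \<longleftrightarrow> Lp_le p lborel (\<lambda>z. f z * indicator \<Omega> z) A"
proof (cases "p = \<infinity>")
  case True
  have "(AE x in lborel. x \<in> \<Omega> \<longrightarrow> f x \<le> ennreal A) \<longleftrightarrow> (AE x in lborel. f x * indicator \<Omega> x \<le> ennreal A)"
    by (rule AE_cong) (auto split: split_indicator)
  then show ?thesis using True by (simp add: Lp_le_def AE_lebesgue_on_iff[OF \<Omega>])
next
  case False
  have "ennreal_powr P (f x) * indicator \<Omega> x = ennreal_powr P (f x * indicator \<Omega> x)" for P x
    by (auto split: split_indicator)
  then show ?thesis using False by (simp add: Lp_le_def nn_integral_lebesgue_on[OF \<Omega>])
qed

lemma Lp_le_sum:
  assumes p: "1 \<le> p" and "finite F"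
  shows "\<exists>K>0. \<forall>f A. A \<ge> 0 \<longrightarrow> (\<forall>i\<in>F. f i \<in> borel_measurable M \<and> Lp_le p M (f i) A) \<longrightarrow>
    Lp_le p M (\<lambda>x. \<Sum>i\<in>F. f i x) (K * A)"
  using assms(2)
proof (induction F rule: finite_induct)
  case empty
  show ?case by (intro exI[of _ 1]) (simp add: Lp_le_zero)
next
  case (insert i F)
  then obtain K where K: "K > 0" "\<And>f A. A \<ge> 0 \<Longrightarrow> (\<forall>i\<in>F. f i \<in> borel_measurable M \<and> Lp_le p M (f i) A) \<Longrightarrow>
    Lp_le p M (\<lambda>x. \<Sum>i\<in>F. f i x) (K * A)" by blast
  show ?case
  proof (intro exI[of _ "2 * (1 + K)"] conjI allI impI)
    show "2 * (1 + K) > 0" using K(1) by simp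
    fix f :: "'a \<Rightarrow> 'b \<Rightarrow> ennreal" and A :: real
    assume A: "0 \<le> A" and f: "\<forall>i\<in>insert i F. f i \<in> borel_measurable M \<and> Lp_le p M (f i) A"
    have "Lp_le p M (\<lambda>x. f i x + (\<Sum>i\<in>F. f i x)) (2 * (A + K * A))"
      by (rule Lp_le_add[OF p A]) (use A K f in \<open>auto intro!: borel_measurable_sum\<close>)
    then show "Lp_le p M (\<lambda>x. \<Sum>i\<in>insert i F. f i x) (2 * (1 + K) * A)"
      using insert.hyps by (simp add: algebra_simps)
  qed
qed

section \<open>The weighted solution operator\<close>

text \<open>Embed the factor into the product by fixing the other coordinates at points of \<open>G\<close>. The embedding
is continuous, so it maps the closure of the factor into the closure of the product.\<close>

lemma closure_factor_subset:
  fixes G D :: "'n::finite \<Rightarrow> complex set"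
  assumes ne: "\<And>i. G i \<noteq> {}" and rc: "rel_compact_in (product_set G) (product_set D)"
  shows "compact (closure (G i))" "closure (G i) \<subseteq> D i"
proof -
  define g where "g i = (SOME x. x \<in> G i)" for i
  have g: "g i \<in> G i" for i unfolding g_def using ne by (simp add: some_in_eq)
  define T where "T w = (\<chi> k. if k = i then w else g k)" for w
  have "continuous_on UNIV (\<lambda>w. if k = i then w else g k)" for k by (cases "k = i") simp_all
  then have cT: "continuous_on UNIV T" unfolding T_def by (intro continuous_on_vec_lambda)
  have "T ` G i \<subseteq> product_set G" using g by (auto simp: T_def product_set_def)
  moreover have "T ` closure (G i) \<subseteq> closure (T ` G i)"
    by (rule image_closure_subset[OF continuous_on_subset[OF cT subset_UNIV] closed_closure closure_subset])
  ultimately have sub: "T ` closure (G i) \<subseteq> closure (product_set G)" by (meson closure_mono order_trans)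
  have cl: "compact (closure (product_set G))" "closure (product_set G) \<subseteq> product_set D"
    using rc by (auto simp: rel_compact_in_def)
  have Ti: "T w $ i = w" for w by (simp add: T_def)
  show "closure (G i) \<subseteq> D i"
  proof
    fix w assume "w \<in> closure (G i)"
    then have "T w \<in> product_set D" using sub cl(2) by blast
    then have "T w $ i \<in> D i" unfolding product_set_def by blast
    then show "w \<in> D i" by (simp add: Ti)
  qed
  obtain B where B: "\<And>z. z \<in> closure (product_set G) \<Longrightarrow> norm z \<le> B"
    using compact_imp_bounded[OF cl(1)] unfolding bounded_iff by blast
  have "cmod w \<le> B" if "w \<in> closure (G i)" for w
  proof -
    have "norm (T w) \<le> B" using sub that B by blast
    then show ?thesis using Finite_Cartesian_Product.norm_nth_le[of "T w" i] by (simp add: Ti)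
  qed
  then have "bounded (closure (G i))" unfolding bounded_iff by blast
  then show "compact (closure (G i))" by (simp add: compact_eq_bounded_closed)
qed

text \<open>The starting point of the construction: nothing has been treated, and \<open>z\<^sup>-\<^sup>c \<omega>\<close> is closed in the
ordinary sense because the vanishing of \<open>z\<^sup>c\<close> d-bar\<open>(z\<^sup>-\<^sup>c \<omega>)\<close> can be divided by \<open>z\<^sup>c\<close>
almost everywhere.\<close>

lemma closed_data_borel_version:
  fixes D G :: "'n::{finite,linorder} \<Rightarrow> complex set" and c :: "int^'n::{finite,linorder}" and s :: "real^'n::{finite,linorder}"
  assumes P: "product_set D \<in> sets borel" and p: "1 \<le> p"
    and \<omega>: "\<omega> \<in> wform_Lp (Suc q) p s (product_set D)" "\<omega> \<in> ker_dbar_c (product_set D) c (Suc q)"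
    and A: "A \<ge> 0" "wform_norm (Suc q) p s (product_set D) \<omega> \<le> ennreal A"
  shows "closed_data p (\<lambda>i. s $ i - real_of_int (c $ i)) D G UNIV q
    (borel_version (product_set D) (Suc q) (fmult (mono_pow (- c)) \<omega>)) A"
proof -
  let ?P = "product_set D" and ?w = "fmult (mono_pow (- c)) \<omega>"
  let ?g = "borel_version ?P (Suc q) ?w"
  have wm: "measurable_form (Suc q) ?P ?w"
    using \<omega>(1) unfolding wform_Lp_def measurable_form_def fmult_def
    by (auto intro!: borel_measurable_times borel_measurable_lebesgue_on[OF mono_pow_measurable])
  note gb = borel_version[OF P wm]
  have wI: "card I = Suc q \<Longrightarrow> ?w I \<in> borel_measurable (lebesgue_on ?P)" for I
    using wm by (simp add: measurable_form_def)
  obtain g0 where g0: "has_dbar ?P (Suc q) ?w g0" "form_ae_eq (Suc (Suc q)) ?P (\<lambda>I z. 0) (fmult (mono_pow c) g0)"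
    using \<omega>(2) unfolding ker_dbar_c_def has_dbar_c_def by blast
  have g0m: "card I = Suc (Suc q) \<Longrightarrow> g0 I \<in> borel_measurable (lebesgue_on ?P)" for I
    using g0(1) unfolding has_dbar_def form_L1_loc_def Lp_loc_def by blast
  have g00: "AE z in lborel. z \<in> ?P \<longrightarrow> g0 I z = 0" if "card I = Suc (Suc q)" for I
  proof -
    have "AE z in lborel. z \<in> ?P \<longrightarrow> 0 = mono_pow c z * g0 I z"
      using g0(2) that unfolding form_ae_eq_def fmult_def AE_lebesgue_on_iff[OF P] by blast
    then show ?thesis using AE_all_components_nonzero
    proof eventually_elim
      case (elim z)
      then show ?case by (simp add: mono_pow_def)
    qed
  qed
  have hd: "(\<forall>I. card I = Suc q \<longrightarrow> loc_int ?P (?g I)) \<and> (\<forall>I::'n set. card I = Suc (Suc q) \<longrightarrow> loc_int ?P (\<lambda>z. 0)) \<and> weak_dbar ?P (Suc q) ?g (\<lambda>I z. 0)"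
    using has_dbar_iff_weak_dbar[where ?g0.0="\<lambda>I z. 0", OF P wI gb(1) gb(2) g0m _ g00] g0(1) by simp
  have fl: "form_le p (\<lambda>i. s $ i - real_of_int (c $ i)) ?P (Suc q) ?g A"
    unfolding form_le_def
  proof (intro allI impI)
    fix I :: "'n set" assume I: "card I = Suc q"
    let ?L = "\<lambda>z. L2_set (\<lambda>I. cmod (fmult (abs_pow (- s)) \<omega> I z)) {I. card I = Suc q}"
    have [measurable]: "fmult (abs_pow (- s)) \<omega> I \<in> borel_measurable (lebesgue_on ?P)" if "I \<in> {I. card I = Suc q}" for I
      using \<omega>(1) that by (auto simp: wform_Lp_def measurable_form_def)
    have Lm: "?L \<in> borel_measurable (lebesgue_on ?P)"
      unfolding L2_set_def by measurable
    have "Lp_le p (lebesgue_on ?P) (\<lambda>z. ennreal (norm (?L z))) A"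
      using A(2) unfolding wform_norm_def Lp_norm_le_iff[OF p A(1) Lm] .
    then have L: "Lp_le p lborel (\<lambda>z. ennreal (norm (?L z)) * indicator ?P z) A"
      unfolding Lp_le_lebesgue_on[OF P p A(1)] .
    show "Lp_le p lborel (\<lambda>z. ennreal (indicator ?P z * weight (\<lambda>i. s $ i - real_of_int (c $ i)) z * cmod (?g I z))) A"
    proof -
      have ae: "AE z in lborel. ennreal (indicator ?P z * weight (\<lambda>i. s $ i - real_of_int (c $ i)) z * cmod (?g I z)) \<le> ennreal (norm (?L z)) * indicator ?P z"
        using gb(2)[OF I] AE_all_components_nonzero
      proof eventually_elim
        case (elim z)
        show ?case
        proof (cases "z \<in> ?P")
          case True
          have "weight (\<lambda>i. s $ i - real_of_int (c $ i)) z * cmod (?g I z) = cmod (abs_pow (- s) z * (mono_pow c z * ?g I z))"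
            using norm_abs_pow_mono_pow[of z s c "?g I z"] elim(2) by simp
          also have "mono_pow c z * ?g I z = \<omega> I z"
          proof -
            have "mono_pow c z * ?g I z = mono_pow c z * (mono_pow (- c) z * \<omega> I z)" using elim(1) True by (simp add: fmult_def)
            also have "\<dots> = mono_pow (c + - c) z * \<omega> I z" using elim(2) by (subst mono_pow_add) auto
            finally show ?thesis by simp
          qed
          also have "cmod (abs_pow (- s) z * \<omega> I z) = cmod (fmult (abs_pow (- s)) \<omega> I z)" by (simp add: fmult_def)
          also have "\<dots> \<le> ?L z"
            by (rule member_le_L2_set[where f="\<lambda>I. cmod (fmult (abs_pow (- s)) \<omega> I z)"]) (use I in auto)
          finally show ?thesis using True by (simp add: ennreal_leI L2_set_nonneg)
        qed simp
      qed
      show ?thesis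
      proof (cases "p = \<infinity>")
        case True
        then have "AE z in lborel. ennreal (norm (?L z)) * indicator ?P z \<le> ennreal A" using L by (simp add: Lp_le_def)
        with ae have "AE z in lborel. ennreal (indicator ?P z * weight (\<lambda>i. s $ i - real_of_int (c $ i)) z * cmod (?g I z)) \<le> ennreal A"
          by eventually_elim (rule order_trans)
        then show ?thesis using True by (simp add: Lp_le_def)
      next
        case False
        have "(\<integral>\<^sup>+z. ennreal_powr (enn2real p) (ennreal (indicator ?P z * weight (\<lambda>i. s $ i - real_of_int (c $ i)) z * cmod (?g I z))) \<partial>lborel) \<le>
          (\<integral>\<^sup>+z. ennreal_powr (enn2real p) (ennreal (norm (?L z)) * indicator ?P z) \<partial>lborel)"
        proof (rule nn_integral_mono_AE)
          show "AE z in lborel. ennreal_powr (enn2real p) (ennreal (indicator ?P z * weight (\<lambda>i. s $ i - real_of_int (c $ i)) z * cmod (?g I z))) \<le> ennreal_powr (enn2real p) (ennreal (norm (?L z)) * indicator ?P z)"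
            using ae by eventually_elim (intro ennreal_powr_mono, auto)
        qed
        also have "\<dots> \<le> ennreal (A powr enn2real p)" using L False by (simp add: Lp_le_def)
        finally show ?thesis using False by (simp add: Lp_le_def)
      qed
    qed
  qed
  have mp: "mixed_product D G UNIV = ?P" by (simp add: mixed_product_def)
  show ?thesis unfolding closed_data_def mp using gb(1) fl hd by blast
qed

text \<open>The Euclidean norm of the coefficient vector is at most the sum of the moduli of the coefficients,
and there are finitely many of them.\<close>

lemma wform_norm_le_of_form_le:
  fixes P :: "(complex^'n::{finite,linorder}) set"
  assumes P: "P \<in> sets borel" and p: "1 \<le> p"
  shows "\<exists>K>0. \<forall>h A. A \<ge> 0 \<longrightarrow> (\<forall>I. h I \<in> borel_measurable borel) \<longrightarrow>
    form_le p (\<lambda>i. s $ i - real_of_int (c $ i)) P q h A \<longrightarrow>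
    wform_norm q p s P (fmult (mono_pow c) h) \<le> ennreal (K * A)"
proof -
  let ?F = "{I::'n set. card I = q}"
  let ?\<sigma> = "\<lambda>i. s $ i - real_of_int (c $ i)"
  have fF: "finite ?F" by simp
  obtain K where K: "K > 0" "\<And>(f :: 'n set \<Rightarrow> complex^'n::{finite,linorder} \<Rightarrow> ennreal) A. A \<ge> 0 \<Longrightarrow> (\<forall>i\<in>?F. f i \<in> borel_measurable lborel \<and> Lp_le p lborel (f i) A) \<Longrightarrow>
    Lp_le p lborel (\<lambda>x. \<Sum>i\<in>?F. f i x) (K * A)"
    using Lp_le_sum[OF p fF, of "lborel :: (complex^'n::{finite,linorder}) measure"] by blast
  show ?thesis
  proof (intro exI[of _ K] conjI allI impI K(1))
    fix h :: "'n form" and A :: real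
    assume A: "0 \<le> A" and h: "\<forall>I. h I \<in> borel_measurable borel" and fl: "form_le p ?\<sigma> P q h A"
    have [measurable]: "h I \<in> borel_measurable borel" for I using h by blast
    have KA: "K * A \<ge> 0" using K(1) A by simp
    let ?u = "fmult (mono_pow c) h"
    let ?L = "\<lambda>z. L2_set (\<lambda>I. cmod (fmult (abs_pow (- s)) ?u I z)) ?F"
    have Lb [measurable]: "?L \<in> borel_measurable borel"
      unfolding L2_set_def fmult_def by measurable
    have [measurable]: "P \<in> sets borel" by (rule P)
    let ?t = "\<lambda>I z. ennreal (indicator P z * weight ?\<sigma> z * cmod (h I z))"
    have S: "Lp_le p lborel (\<lambda>z. \<Sum>I\<in>?F. ?t I z) (K * A)"
      by (rule K(2)[OF A]) (use fl in \<open>auto simp: form_le_def\<close>)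
    have "Lp_le p lborel (\<lambda>z. ennreal (norm (?L z)) * indicator P z) (1 * (K * A))"
    proof (rule Lp_le_mono[OF p _ KA _ _ S])
      show "AE z in lborel. ennreal (norm (?L z)) * indicator P z \<le> ennreal 1 * (\<Sum>I\<in>?F. ?t I z)"
        using AE_all_components_nonzero
      proof eventually_elim
        case (elim z)
        show ?case
        proof (cases "z \<in> P")
          case True
          have "?L z \<le> (\<Sum>I\<in>?F. cmod (fmult (abs_pow (- s)) ?u I z))" by (rule L2_set_le_sum) simp
          also have "\<dots> = (\<Sum>I\<in>?F. indicator P z * weight ?\<sigma> z * cmod (h I z))"
            using True elim norm_abs_pow_mono_pow[of z s c] by (simp add: fmult_def)
          finally have "ennreal (norm (?L z)) \<le> ennreal (\<Sum>I\<in>?F. indicator P z * weight ?\<sigma> z * cmod (h I z))"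
            by (intro ennreal_leI) (simp add: L2_set_nonneg)
          also have "\<dots> = (\<Sum>I\<in>?F. ?t I z)" by (rule sum_ennreal[symmetric]) (simp add: weight_nonneg)
          finally show ?thesis using True by simp
        qed simp
      qed
    qed auto
    then have "Lp_le p (lebesgue_on P) (\<lambda>z. ennreal (norm (?L z))) (K * A)"
      by (subst Lp_le_lebesgue_on[OF P p KA]) simp
    then show "wform_norm q p s P ?u \<le> ennreal (K * A)"
      unfolding wform_norm_def by (subst Lp_norm_le_iff[OF p KA borel_measurable_lebesgue_on[OF Lb]])
  qed
qed

text \<open>Writing \<open>z\<^sup>-\<^sup>b = z\<^sup>m z\<^sup>-\<^sup>c\<close> with \<open>m = c - b \<ge> 0\<close>, the equation with twist \<open>b\<close> is the
equation d-bar \<open>h = g\<close> multiplied by the holomorphic monomial \<open>z\<^sup>m\<close>.\<close>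

lemma has_dbar_c_of_weak_dbar:
  fixes b c :: "int^'n::{finite,linorder}" and h g \<omega> :: "'n form"
  assumes P: "P \<in> sets borel" "Q \<in> sets borel" "Q \<subseteq> P" and bc: "\<And>i. b $ i \<le> c $ i"
    and h: "\<And>I. h I \<in> borel_measurable borel" "\<And>I. card I = q \<Longrightarrow> loc_int Q (h I)"
    and g: "\<And>I. g I \<in> borel_measurable borel" "\<And>I. card I = Suc q \<Longrightarrow> loc_int Q (g I)"
    and \<omega>: "\<And>I. card I = Suc q \<Longrightarrow> \<omega> I \<in> borel_measurable (lebesgue_on P)"
      "\<And>I. card I = Suc q \<Longrightarrow> AE z in lborel. z \<in> P \<longrightarrow> mono_pow (- c) z * \<omega> I z = g I z"
    and d: "weak_dbar Q q h g"
  shows "has_dbar_c Q b q (fmult (mono_pow c) h) \<omega>"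
proof -
  define m where "m = c - b"
  have m: "0 \<le> m $ i" for i using bc[of i] by (simp add: m_def)
  have mc: "continuous_on UNIV (mono_pow m)" by (rule Ck_continuous[OF mono_pow_holomorphic(1)[OF m]])
  let ?u = "fmult (mono_pow c) h"
  note [measurable] = h(1) g(1)
  have um: "?u I \<in> borel_measurable borel" for I unfolding fmult_def by measurable
  have \<omega>Q: "card I = Suc q \<Longrightarrow> \<omega> I \<in> borel_measurable (lebesgue_on Q)" for I
    using \<omega>(1) P(3) by (rule measurable_restrict_mono)
  let ?g0 = "fmult (mono_pow (- b)) \<omega>"
  have "has_dbar Q q (fmult (mono_pow (- b)) ?u) ?g0 \<longleftrightarrow>
    (\<forall>I. card I = q \<longrightarrow> loc_int Q (fmult (mono_pow m) h I)) \<and>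
    (\<forall>I. card I = Suc q \<longrightarrow> loc_int Q (fmult (mono_pow m) g I)) \<and> weak_dbar Q q (fmult (mono_pow m) h) (fmult (mono_pow m) g)"
  proof (rule has_dbar_iff_weak_dbar[OF P(2)])
    show "fmult (mono_pow (- b)) ?u I \<in> borel_measurable (lebesgue_on Q)" for I
      unfolding fmult_def by (rule borel_measurable_lebesgue_on) measurable
    show "fmult (mono_pow m) h I \<in> borel_measurable borel" "fmult (mono_pow m) g I \<in> borel_measurable borel" for I
      unfolding fmult_def by measurable
    show "AE z in lborel. z \<in> Q \<longrightarrow> fmult (mono_pow (- b)) ?u I z = fmult (mono_pow m) h I z" for I
      using AE_all_components_nonzero
    proof eventually_elim
      case (elim z)
      then have "mono_pow m z = mono_pow (- b) z * mono_pow c z"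
        by (subst mono_pow_add[symmetric]) (auto simp: m_def)
      then show ?case by (simp add: fmult_def)
    qed
    show "?g0 I \<in> borel_measurable (lebesgue_on Q)" if "card I = Suc q" for I
      unfolding fmult_def by (intro borel_measurable_times borel_measurable_lebesgue_on[OF mono_pow_measurable] \<omega>Q[OF that])
    show "AE z in lborel. z \<in> Q \<longrightarrow> ?g0 I z = fmult (mono_pow m) g I z" if I: "card I = Suc q" for I
      using AE_all_components_nonzero \<omega>(2)[OF I]
    proof eventually_elim
      case (elim z)
      show ?case
      proof
        assume "z \<in> Q"
        then have gz: "g I z = mono_pow (- c) z * \<omega> I z" using elim(2) P(3) by auto
        have "mono_pow (- b) z = mono_pow m z * mono_pow (- c) z"
          using elim(1) by (subst mono_pow_add[symmetric]) (auto simp: m_def)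
        then show "?g0 I z = fmult (mono_pow m) g I z" by (simp add: fmult_def gz)
      qed
    qed
  qed
  moreover have "\<forall>I. card I = q \<longrightarrow> loc_int Q (fmult (mono_pow m) h I)" "\<forall>I. card I = Suc q \<longrightarrow> loc_int Q (fmult (mono_pow m) g I)"
    unfolding fmult_def using loc_int_mult_continuous[OF _ mc] h g by blast+
  ultimately have hd: "has_dbar Q q (fmult (mono_pow (- b)) ?u) ?g0"
    using weak_dbar_mono_pow[OF m d] by blast
  have "form_ae_eq (Suc q) Q \<omega> (fmult (mono_pow b) ?g0)"
    unfolding form_ae_eq_def AE_lebesgue_on_iff[OF P(2)]
  proof (intro allI impI)
    fix I :: "'n set"
    show "AE z in lborel. z \<in> Q \<longrightarrow> \<omega> I z = fmult (mono_pow b) ?g0 I z"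
      using AE_all_components_nonzero
    proof eventually_elim
      case (elim z)
      then have "mono_pow b z * mono_pow (- b) z = 1"
        by (subst mono_pow_add[symmetric]) auto
      then show ?case by (simp add: fmult_def mult.assoc[symmetric])
    qed
  qed
  moreover have "measurable_form q Q ?u"
    unfolding measurable_form_def by (intro allI impI borel_measurable_lebesgue_on um)
  ultimately show ?thesis unfolding has_dbar_c_def using hd by blast
qed

text \<open>The coordinate \<open>j\<close> is treated first, with a change of exponent from \<open>s j\<close> to \<open>s' j\<close>; the
remaining coordinates are treated with unchanged exponents. The operator on forms is conjugation of
the resulting solution operator by multiplication with \<open>z\<^sup>c\<close>.\<close>

lemma weighted_solution_operator:
  fixes D G :: "'n::{finite,linorder} \<Rightarrow> complex set" and s s' :: "real^'n::{finite,linorder}" and b c :: "int^'n::{finite,linorder}"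
  assumes p: "1 \<le> p" and D: "\<And>i. open (D i)" and G: "\<And>i. open (G i)"
    and GD: "\<And>i. compact (closure (G i))" "\<And>i. closure (G i) \<subseteq> D i"
    and B: "B > 0" "\<And>i w. w \<in> D i \<Longrightarrow> cmod w \<le> B"
    and adm: "\<And>i. i \<noteq> j \<Longrightarrow> admissible p (s $ i - real_of_int (c $ i)) (s $ i - real_of_int (c $ i))"
      "admissible p (s $ j - real_of_int (c $ j)) (s' $ j - real_of_int (c $ j))" "\<And>i. i \<noteq> j \<Longrightarrow> s' $ i = s $ i"
    and bc: "\<And>i. b $ i \<le> c $ i"
  shows "\<exists>J :: 'n form \<Rightarrow> 'n form.
      (\<forall>\<omega> \<in> wform_Lp (Suc q) p s (product_set D) \<inter> ker_dbar_c (product_set D) c (Suc q). J \<omega> \<in> wform_Lp q p s' (product_set D)) \<and>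
      (\<forall>\<omega> \<in> wform_Lp (Suc q) p s (product_set D) \<inter> ker_dbar_c (product_set D) c (Suc q).
       \<forall>\<eta> \<in> wform_Lp (Suc q) p s (product_set D) \<inter> ker_dbar_c (product_set D) c (Suc q).
         \<forall>a b. form_ae_eq q (product_set D) (J (lincomb a \<omega> b \<eta>)) (lincomb a (J \<omega>) b (J \<eta>))) \<and>
      (\<exists>C::real. \<forall>\<omega> \<in> wform_Lp (Suc q) p s (product_set D) \<inter> ker_dbar_c (product_set D) c (Suc q).
         wform_norm q p s' (product_set D) (J \<omega>) \<le> ennreal C * wform_norm (Suc q) p s (product_set D) \<omega>) \<and>
      (\<forall>\<omega> \<in> wform_Lp (Suc q) p s (product_set D) \<inter> ker_dbar_c (product_set D) c (Suc q).
         has_dbar_c (product_set G) c q (J \<omega>) \<omega> \<and> has_dbar_c (product_set G) b q (J \<omega>) \<omega>)"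
proof -
  let ?P = "product_set D" and ?Q = "product_set G"
  let ?X = "wform_Lp (Suc q) p s ?P \<inter> ker_dbar_c ?P c (Suc q)"
  let ?\<sigma> = "\<lambda>i. s $ i - real_of_int (c $ i)" and ?\<sigma>' = "\<lambda>i. s' $ i - real_of_int (c $ i)"
  have Pb: "?P \<in> sets borel" "?Q \<in> sets borel" by (intro borel_open open_product_set D G)+
  have QP: "?Q \<subseteq> ?P"
  proof (rule product_set_mono)
    show "G i \<subseteq> D i" for i using GD(2)[of i] closure_subset[of "G i"] by blast
  qed
  define \<tau> where "\<tau> = ?\<sigma>' j"
  have \<sigma>': "?\<sigma>(j := \<tau>) = ?\<sigma>'" using adm(3) by (auto simp: \<tau>_def fun_eq_iff)
  have "\<exists>H C. C > 0 \<and> solution_operator p D G (UNIV - {j}) q ?\<sigma>' ?\<sigma>' H C"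
  proof (rule solution_operator_exists[where D=D and G=G and B=B])
    show "admissible p (?\<sigma>' i) (?\<sigma>' i)" if "i \<in> UNIV - {j}" for i
      using adm(1,3)[of i] that by simp
  qed (use p D GD B in auto)
  then obtain H' C3 where H': "C3 > 0" "solution_operator p D G (UNIV - {j}) q ?\<sigma>' ?\<sigma>' H' C3" by blast
  have "\<exists>H C. C > 0 \<and> solution_operator p D G (insert j (UNIV - {j})) q ?\<sigma> (?\<sigma>(j := \<tau>)) H C"
  proof (rule solution_operator_insert[where D=D and G=G and B=B and S="UNIV - {j}" and \<sigma>="?\<sigma>" and \<tau>=\<tau> and H'=H' and ?C3.0=C3])
    show "admissible p (?\<sigma> j) \<tau>" using adm(2) by (simp add: \<tau>_def)
    show "solution_operator p D G (UNIV - {j}) q (?\<sigma>(j := \<tau>)) (?\<sigma>(j := \<tau>)) H' C3" unfolding \<sigma>' by (rule H'(2))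
  qed (use p D GD B H'(1) in auto)
  moreover have "insert j (UNIV - {j}) = UNIV" by auto
  ultimately obtain H C where H: "C > 0" "solution_operator p D G UNIV q ?\<sigma> ?\<sigma>' H C" unfolding \<sigma>' by auto
  define g where "g \<omega> = borel_version ?P (Suc q) (fmult (mono_pow (- c)) \<omega>)" for \<omega>
  define J where "J \<omega> = fmult (mono_pow c) (H (g \<omega>))" for \<omega>
  have fm: "measurable_form (Suc q) ?P (fmult (mono_pow (- c)) \<omega>)" if "measurable_form (Suc q) ?P \<omega>" for \<omega>
    using that unfolding measurable_form_def fmult_def
    by (auto intro!: borel_measurable_times borel_measurable_lebesgue_on[OF mono_pow_measurable])
  have gb: "g \<omega> I \<in> borel_measurable borel" "card I = Suc q \<Longrightarrow> AE z in lborel. z \<in> ?P \<longrightarrow> mono_pow (- c) z * \<omega> I z = g \<omega> I z"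
    if "measurable_form (Suc q) ?P \<omega>" for \<omega> I
    using borel_version[OF Pb(1) fm[OF that], of I] unfolding g_def by (simp_all add: fmult_def)
  have Xm: "\<omega> \<in> ?X \<Longrightarrow> measurable_form (Suc q) ?P \<omega>" for \<omega> by (simp add: wform_Lp_def)
  define A where "A \<omega> = enn2real (wform_norm (Suc q) p s ?P \<omega>)" for \<omega>
  have A0: "A \<omega> \<ge> 0" for \<omega> by (simp add: A_def)
  have An: "wform_norm (Suc q) p s ?P \<omega> = ennreal (A \<omega>)" if "\<omega> \<in> ?X" for \<omega>
    using that by (simp add: A_def wform_Lp_def less_top)
  have cd: "closed_data p ?\<sigma> D G UNIV q (g \<omega>) (A \<omega>)" if "\<omega> \<in> ?X" for \<omega>
    unfolding g_def by (rule closed_data_borel_version[OF Pb(1) p _ _ A0]) (use that An[OF that] in auto)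
  have Hm: "H (g \<omega>) I \<in> borel_measurable borel" if "measurable_form (Suc q) ?P \<omega>" for \<omega> I
    using H(2) gb(1)[OF that] unfolding solution_operator_def by blast
  have Hs: "form_le p ?\<sigma>' ?P q (H (g \<omega>)) (C * A \<omega>)" "\<And>I. card I = q \<Longrightarrow> loc_int ?Q (H (g \<omega>) I)" "weak_dbar ?Q q (H (g \<omega>)) (g \<omega>)"
    if "\<omega> \<in> ?X" for \<omega>
    using H(2) A0[of \<omega>] cd[OF that] unfolding solution_operator_def by blast+
  obtain K where K: "K > 0" "\<And>h A. A \<ge> 0 \<Longrightarrow> (\<forall>I. h I \<in> borel_measurable borel) \<Longrightarrow>
    form_le p ?\<sigma>' ?P q h A \<Longrightarrow> wform_norm q p s' ?P (fmult (mono_pow c) h) \<le> ennreal (K * A)"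
    using wform_norm_le_of_form_le[OF Pb(1) p, of s' c q] by blast
  have nb: "wform_norm q p s' ?P (J \<omega>) \<le> ennreal (K * C) * wform_norm (Suc q) p s ?P \<omega>" if "\<omega> \<in> ?X" for \<omega>
  proof -
    have "wform_norm q p s' ?P (J \<omega>) \<le> ennreal (K * (C * A \<omega>))"
      unfolding J_def by (rule K(2)) (use H(1) A0 Hm[OF Xm[OF that]] Hs(1)[OF that] in auto)
    also have "\<dots> = ennreal (K * C) * wform_norm (Suc q) p s ?P \<omega>"
      unfolding An[OF that] using K(1) H(1) A0[of \<omega>] by (simp add: ennreal_mult[symmetric] mult.assoc)
    finally show ?thesis .
  qed
  show ?thesis
  proof (intro exI[of _ J] conjI ballI allI)
    fix \<omega> assume \<omega>: "\<omega> \<in> ?X"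
    note [measurable] = Hm[OF Xm[OF \<omega>]]
    have "wform_norm q p s' ?P (J \<omega>) < \<infinity>"
      using nb[OF \<omega>] unfolding An[OF \<omega>] by (rule le_less_trans) (simp add: ennreal_mult_less_top)
    moreover have "measurable_form q ?P (J \<omega>)" "measurable_form q ?P (fmult (abs_pow (- s')) (J \<omega>))"
      unfolding measurable_form_def J_def fmult_def
      by (intro allI impI borel_measurable_lebesgue_on; measurable)+
    ultimately show "J \<omega> \<in> wform_Lp q p s' ?P" by (simp add: wform_Lp_def)
    have lg: "card I = Suc q \<Longrightarrow> loc_int ?Q (g \<omega> I)" for I
      using cd[OF \<omega>] QP unfolding closed_data_def mixed_product_def by (auto intro: loc_int_mono)
    have \<omega>m: "card I = Suc q \<Longrightarrow> \<omega> I \<in> borel_measurable (lebesgue_on ?P)" for I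
      using Xm[OF \<omega>] by (simp add: measurable_form_def)
    have hd: "has_dbar_c ?Q b' q (J \<omega>) \<omega>" if "\<And>i. b' $ i \<le> c $ i" for b'
      unfolding J_def
      by (rule has_dbar_c_of_weak_dbar[OF Pb QP that Hm[OF Xm[OF \<omega>]] Hs(2)[OF \<omega>] gb(1)[OF Xm[OF \<omega>]] lg \<omega>m gb(2)[OF Xm[OF \<omega>]] Hs(3)[OF \<omega>]])
    show "has_dbar_c ?Q c q (J \<omega>) \<omega>" by (rule hd) simp
    show "has_dbar_c ?Q b q (J \<omega>) \<omega>" by (rule hd) (rule bc)
  next
    fix \<omega> \<eta> :: "'n form" and a b :: complex assume \<omega>: "\<omega> \<in> ?X" and \<eta>: "\<eta> \<in> ?X"
    have lm: "measurable_form (Suc q) ?P (lincomb a \<omega> b \<eta>)"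
      using Xm[OF \<omega>] Xm[OF \<eta>] unfolding measurable_form_def lincomb_def by (auto intro!: borel_measurable_add borel_measurable_times)
    have "ae_lincomb ?P (Suc q) (g (lincomb a \<omega> b \<eta>)) a (g \<omega>) b (g \<eta>)"
      unfolding ae_lincomb_def
    proof (intro allI impI)
      fix I :: "'n set" assume I: "card I = Suc q"
      show "AE z in lborel. z \<in> ?P \<longrightarrow> g (lincomb a \<omega> b \<eta>) I z = a * g \<omega> I z + b * g \<eta> I z"
        using gb(2)[OF lm I] gb(2)[OF Xm[OF \<omega>] I] gb(2)[OF Xm[OF \<eta>] I]
      proof eventually_elim
        case (elim z)
        then show ?case by (auto simp: lincomb_def algebra_simps)
      qed
    qed
    then have "ae_lincomb ?P q (H (g (lincomb a \<omega> b \<eta>))) a (H (g \<omega>)) b (H (g \<eta>))"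
      using H(2) A0[of \<omega>] A0[of \<eta>] cd[OF \<omega>] cd[OF \<eta>] gb(1)[OF lm] unfolding solution_operator_def by blast
    then show "form_ae_eq q ?P (J (lincomb a \<omega> b \<eta>)) (lincomb a (J \<omega>) b (J \<eta>))"
      unfolding form_ae_eq_def ae_lincomb_def AE_lebesgue_on_iff[OF Pb(1)]
    proof (intro allI impI)
      fix I :: "'n set"
      assume a: "\<forall>I. card I = q \<longrightarrow> (AE z in lborel. z \<in> ?P \<longrightarrow> H (g (lincomb a \<omega> b \<eta>)) I z = a * H (g \<omega>) I z + b * H (g \<eta>) I z)"
        and I: "card I = q"
      from a I have "AE z in lborel. z \<in> ?P \<longrightarrow> H (g (lincomb a \<omega> b \<eta>)) I z = a * H (g \<omega>) I z + b * H (g \<eta>) I z" by blast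
      then show "AE z in lborel. z \<in> ?P \<longrightarrow> J (lincomb a \<omega> b \<eta>) I z = lincomb a (J \<omega>) b (J \<eta>) I z"
        by eventually_elim (auto simp: J_def fmult_def lincomb_def algebra_simps)
    qed
  next
    show "\<exists>C::real. \<forall>\<omega>\<in>?X. wform_norm q p s' ?P (J \<omega>) \<le> ennreal C * wform_norm (Suc q) p s ?P \<omega>"
      using nb by blast
  qed
qed

theorem theorem4p4:
  fixes D G :: "'n::{finite,linorder} \<Rightarrow> complex set"
    and P Q :: "(complex^'n::{finite,linorder}) set"
    and q :: nat and p :: ennreal
    and s s_plus :: "real^'n::{finite,linorder}" and c ktilde :: "int^'n::{finite,linorder}"
  assumes "\<And>j. planar_domain (D j)" and "P = product_set D" and "bounded P"
    and "\<And>j. planar_domain (G j)" and "Q = product_set G" and "bounded Q"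
    and "rel_compact_in Q P" and "rel_compact_in P UNIV"
    and "1 \<le> q" and "q \<le> CARD('n)" and "1 \<le> p"
    and "ktilde = (\<chi> j. mod_dbar_weight p (s $ j))"
    and "(c = (\<chi> j. dbar_weight p (s $ j)) \<and>
            (\<exists>\<epsilon>>0. s_plus = (\<chi> j. if j = Max UNIV then s $ j + 1 - \<epsilon> else s $ j)))
         \<or> (c = ktilde \<and> s_plus = s)"
  shows "\<exists>J :: 'n form \<Rightarrow> 'n form.
      (\<forall>\<omega> \<in> wform_Lp q p s P \<inter> ker_dbar_c P c q. J \<omega> \<in> wform_Lp (q - 1) p s_plus P) \<and>
      (\<forall>\<omega> \<in> wform_Lp q p s P \<inter> ker_dbar_c P c q. \<forall>\<eta> \<in> wform_Lp q p s P \<inter> ker_dbar_c P c q.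
         \<forall>a b. form_ae_eq (q - 1) P (J (lincomb a \<omega> b \<eta>)) (lincomb a (J \<omega>) b (J \<eta>))) \<and>
      (\<exists>C::real. \<forall>\<omega> \<in> wform_Lp q p s P \<inter> ker_dbar_c P c q.
         wform_norm (q - 1) p s_plus P (J \<omega>) \<le> ennreal C * wform_norm q p s P \<omega>) \<and>
      (\<forall>\<omega> \<in> wform_Lp q p s P \<inter> ker_dbar_c P c q.
         has_dbar_c Q c (q - 1) (J \<omega>) \<omega> \<and> has_dbar_c Q ktilde (q - 1) (J \<omega>) \<omega>)"
proof -
  obtain q' where q: "q = Suc q'" using assms(9) by (cases q) auto
  have D: "open (D i)" "D i \<noteq> {}" and G: "open (G i)" "G i \<noteq> {}" for i
    using assms(1)[of i] assms(4)[of i] by (auto simp: planar_domain_def)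
  have rc: "rel_compact_in (product_set G) (product_set D)" using assms(2,5,7) by simp
  note GD = closure_factor_subset[OF G(2) rc]
  define d where "d i = (SOME x. x \<in> D i)" for i
  have d: "d i \<in> D i" for i unfolding d_def using D(2) by (simp add: some_in_eq)
  obtain B where B: "B > 0" "\<And>z. z \<in> P \<Longrightarrow> norm z \<le> B" using assms(3) unfolding bounded_pos by blast
  have BD: "cmod w \<le> B" if "w \<in> D i" for i w
  proof -
    let ?z = "(\<chi> k. if k = i then w else d k) :: complex^'n::{finite,linorder}"
    have "?z \<in> P" using d that by (simp add: assms(2) product_set_def)
    then have "norm ?z \<le> B" by (rule B(2))
    then show ?thesis using Finite_Cartesian_Product.norm_nth_le[of ?z i] by simp
  qed
  have p: "1 \<le> p" by (rule assms(11))
  let ?j = "Max (UNIV :: 'n set)"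
  have adm: "(\<forall>i. i \<noteq> ?j \<longrightarrow> admissible p (s $ i - real_of_int (c $ i)) (s $ i - real_of_int (c $ i))) \<and>
    admissible p (s $ ?j - real_of_int (c $ ?j)) (s_plus $ ?j - real_of_int (c $ ?j)) \<and>
    (\<forall>i. i \<noteq> ?j \<longrightarrow> s_plus $ i = s $ i) \<and> (\<forall>i. ktilde $ i \<le> c $ i)"
    using assms(13)
  proof (elim disjE conjE exE)
    fix \<epsilon> :: real
    assume c: "c = (\<chi> j. dbar_weight p (s $ j))" and \<epsilon>: "0 < \<epsilon>"
      and sp: "s_plus = (\<chi> j. if j = Max UNIV then s $ j + 1 - \<epsilon> else s $ j)"
    have ad: "admissible p (s $ i - real_of_int (c $ i)) (s $ i - real_of_int (c $ i) + 1 - e)" if "e > 0" for i e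
      unfolding c using admissible_dbar[OF p dbar_weight_bounds[OF p] that] by simp
    \<comment> \<open>In the last coordinate the full gain \<open>1 - \<epsilon>\<close> is used; in the others \<open>\<epsilon> = 1\<close> leaves the exponent unchanged.\<close>
    have gain: "s_plus $ ?j - real_of_int (c $ ?j) = s $ ?j - real_of_int (c $ ?j) + 1 - \<epsilon>" by (simp add: sp)
    show ?thesis
    proof (intro conjI allI impI)
      show "admissible p (s $ i - real_of_int (c $ i)) (s $ i - real_of_int (c $ i))" for i using ad[of 1 i] by simp
      show "admissible p (s $ ?j - real_of_int (c $ ?j)) (s_plus $ ?j - real_of_int (c $ ?j))"
        unfolding gain by (rule ad[OF \<epsilon>])
      show "i \<noteq> ?j \<Longrightarrow> s_plus $ i = s $ i" for i by (simp add: sp)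
      show "ktilde $ i \<le> c $ i" for i using mod_le_dbar_weight[OF p] by (simp add: c assms(12))
    qed
  next
    assume c: "c = ktilde" "s_plus = s"
    have "admissible p (s $ i - real_of_int (c $ i)) (s $ i - real_of_int (c $ i))" for i
      unfolding c assms(12) using admissible_mod[OF p mod_dbar_weight_bounds[OF p]] by simp
    then show ?thesis using c by simp
  qed
  show ?thesis
    unfolding q assms(2,5) diff_Suc_1
    by (rule weighted_solution_operator[where D=D and G=G and B=B and j="?j"])
       (use p D(1) G(1) GD B(1) BD adm in auto)
qed

end
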